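(* Let $w_0\in Y$ satisfy $|w_0|\le1$ on $\overline\Omega$, i.e. $\hat K^0(w_0)\in L^1(\Omega)$. Then there exist an optimal control $u^\circ=[u_1^\circ,\dots,u_n^\circ]\in\mathbb{X}$ of $(\mathrm{OP})^{(0,0)}$, together with the solution $w^\circ=[w_1^\circ,\dots,w_n^\circ]$ to $(\mathrm{AC})^{(0,0)}$ for the forcing term $u^\circ$ and initial data $w_0$, and moreover there exist $p^\circ=[p_1^\circ,\dots,p_n^\circ]\in\mathbb{X}$ and $\zeta^\circ=[\zeta_1^\circ,\dots,\zeta_n^\circ]\in\mathbb{Y}^*$ such that: $$M_u(p_i^\circ+u_i^\circ)=0 \text{ in } X,\quad i=1,\dots,n;\qquad p^\circ\in\mathbb{Y}\subset[C(\overline\Omega)]^n;$$ and $$\frac1\tau(p_i^\circ-p_{i+1}^\circ,\varphi)_X+\nu^2\langle Fp_i^\circ,\varphi\rangle_Y-\nu^2(p_i^\circ,\varphi)_X+(g'(w_i^\circ)p_i^\circ,\varphi)_X+\langle\zeta_i^\circ,\varphi\rangle_Y=\big(M_w(w_i^\circ-w_i^{\mathrm{ad}}),\varphi\big)_X$$ for all $\varphi\in Y$ and $i=n,\dots,3,2,1$, subject to $p_{n+1}^\circ=0$ in $X$. Moreover, for every $\gamma_0\in C^1(\mathbb{R})\cap W^{1,\infty}(\mathbb{R})$ with $\gamma_0(0)=\gamma_0'(0)=0$, $$\gamma_0(\partial_xw_i^\circ)\Big(\frac1\tau(p_i^\circ-p_{i+1}^\circ)-\nu^2\partial_x^2p_i^\circ+g'(w_i^\circ)p_i^\circ-M_w(w_i^\circ-w_i^{\mathrm{ad}})\Big)=0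 \text{ in } X,\quad i=n,\dots,3,2,1,$$ and therefore $$\frac1\tau(p_i^\circ-p_{i+1}^\circ)-\nu^2\partial_x^2p_i^\circ+g'(w_i^\circ)p_i^\circ=M_w(w_i^\circ-w_i^{\mathrm{ad}}) \ \text{ a.e. in } \{\partial_xw_i^\circ\neq0\},\quad i=n,\dots,3,2,1.$$
   Context: Let $0<L,T<\infty$, $\Omega := (-L,L)$, $X := L^2(\Omega)$, $Y := H^1(\Omega)\ (\subset C(\overline\Omega))$, $n\in\mathbb{N}$, $\mathbb{X} := [X]^n$, $\mathbb{Y} := [Y]^n$, $\mathbb{Y}^*=[Y^*]^n$; $\partial_x$ is the distributional derivative. $\langle\cdot,\cdot\rangle_Y$ is the duality pairing between $Y$ and $Y^*$, and $F:Y\to Y^*$ is the duality map $\langle F\varphi,\psi\rangle_Y:=(\varphi,\psi)_Y$, where $(\varphi,\psi)_Y=(\varphi,\psi)_X+(\partial_x\varphi,\partial_x\psi)_X$. $\nu>0$, $M_u\ge 0$, $M_w\ge 0$ are fixed constants, and $w^{\mathrm{ad}}=[w_1^{\mathrm{ad}},\dots,w_n^{\mathrm{ad}}]\in\mathbb{X}$ is a fixed target profile. Mosco convergence: for proper l.s.c. convex functions $\psi_n,\psi$ on a Hilbert space $H$, $\psi_n \to \psi$ in the sense of Mosco iff (M1) $\liminf_n \psi_n(w_n) \ge \psi(w)$ whenever $w_n \to w$ weakly in $H$; (M2) for every $w \in D(\psi)$ there are $w_n \to w$ in $H$ with $\psi_n(w_n) \to \psi(w)$. For a family with a continuous parameter,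 convergence is meant along every sequence of parameters converging to the given limit. Standing assumption on approximations $f^\varepsilon$: $f^0(r) := |r|$; $\{f^\varepsilon\}_{\varepsilon\in(0,1]} \subset C^2(\mathbb{R})$ are convex functions with $f^\varepsilon(0)=0$, $f^\varepsilon \ge 0$ on $\mathbb{R}$; for every $\varepsilon_0 \in [0,1]$, as $\varepsilon \to \varepsilon_0$, $f^\varepsilon(r) \to f^{\varepsilon_0}(r)$ for every $r\in\mathbb{R}$ and $f^\varepsilon \to f^{\varepsilon_0}$ on $\mathbb{R}$ in the sense of Mosco; there is $C_0>0$ independent of $\varepsilon$ with $|(f^\varepsilon)'(r)| \le C_0(1+|r|)$ for all $r \in \mathbb{R}$, $\varepsilon\in(0,1]$; and for every $\lambda>0$, $(f^\varepsilon)'' \to 0$ uniformly on $\{|r| \ge \lambda\}$ as $\varepsilon \to 0$. Here $\partial f^0(r) = \{r/|r|\}$ if $r\neq 0$, $\partial f^0(0)=[-1,1]$. Assumption on $g$: $g\in C^1(\mathbb{R})$, there is $C_g>0$ such that $r\mapsto g(r)+C_g r$ is monotone (nondecreasing), and $g$ has a nonnegative primitive $0\le G\in C^2(\mathbb{R})$, $G'=g$. Standing assumption on approximations $K^\delta$: $\hat K^0 := I_{[-1,1]}$ (equal to $0$ on $[-1,1]$ and $+\infty$ elsewhere) and $K^0 := \partial I_{[-1,1]}$ (set-valued subdifferential). $\{\hat K^\delta\}_{\delta\in(0,1]} \subset C^2(\mathbb{R})$ and $\{K^\delta\}_{\delta\in(0,1]} \subset C^1(\mathbb{R})$ satisfy: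 $K^\delta = (\hat K^\delta)'$ and $\hat K^\delta \equiv 0$ on $[-1,1]$ for all $\delta\in(0,1]$; for each $\delta\in(0,1]$ there is $C_K^\delta>0$ with $0 \le (K^\delta)' \le C_K^\delta$ on $\mathbb{R}$; for every $\delta_0\in[0,1]$, $\hat K^\delta \to \hat K^{\delta_0}$ on $\mathbb{R}$ in the sense of Mosco as $\delta\to\delta_0$, and if $\delta_0 \in (0,1]$ also $\hat K^\delta \to \hat K^{\delta_0}$ in $C_{\mathrm{loc}}(\mathbb{R})$. Time step: $\tau := T/n$ with $0<\tau<\tau^* := \frac{1}{8(C_g+1)}$. Functional: $\Psi^{(0,0)}(z) := \int_\Omega |\partial_x z|\,dx + \frac{\nu^2}{2}\int_\Omega |\partial_x z|^2\,dx + \int_\Omega I_{[-1,1]}(z)\,dx$ if $z\in Y$, and $:=\infty$ if $z\in X\setminus Y$; its effective domain is $D(\Psi^{(0,0)})=\{z\in Y: |z|\le1 \text{ on }\overline\Omega\}$. State-system $(\mathrm{AC})^{(0,0)}$ for forcing $u\in\mathbb{X}$ and initial value $w_0$: find $w=[w_1,\dots,w_n]$ with $$\frac1\tau(w_i-w_{i-1}) - \partial_x\big(\partial f^0(\partial_x w_i)+\nu^2\partial_x w_i\big) + \partial I_{[-1,1]}(w_i) + g(w_i) \ni M_u u_i \text{ in } \Omega,\quad \partial_x w_i(\pm L)=0,\quad i=1,\dots,n.$$ Being a solution means: $w_i\in D(\Psi^{(0,0)})$ and, for all $z\in D(\Psi^{(0,0)})$ and $i=1,\dots,n$, $$\frac1\tau(w_i-w_{i-1},w_i-z)_X+(g(w_i)-M_uu_i,w_i-z)_X+\Psi^{(0,0)}(w_i)-\Psi^{(0,0)}(z)\le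 0.$$ A unique solution exists; it belongs to $[H^2(\Omega)]^n$ (so $w_i\in C^1(\overline\Omega)$) and $\partial_xw_i(\pm L)=0$. Optimal control problem $(\mathrm{OP})^{(0,0)}$: find $u^*\in\mathbb{X}$ (an optimal control) minimizing over $\mathbb{X}$ the cost $\mathcal{J}^{(0,0)}(u) := \frac{M_w}{2}|w-w^{\mathrm{ad}}|_{\mathbb{X}}^2+\frac{M_u}{2}|u|_{\mathbb{X}}^2$, where $w$ is the solution to $(\mathrm{AC})^{(0,0)}$ for the forcing term $u$ and initial data $w_0$. Meaning of the products: $\partial_x^2p_i^\circ$ is a distributional second derivative of $p_i^\circ\in Y$; the product $\gamma_0(\partial_xw_i^\circ)\,\partial_x^2p_i^\circ$ is the element of $Y^*$ given by $\varphi\mapsto-\int_\Omega\partial_xp_i^\circ\,\partial_x\big(\gamma_0(\partial_xw_i^\circ)\varphi\big)\,dx$, and the identity "in $X$" includes the assertion that this product is (represented by) an element of $X$. The last identity is an equality a.e. in the open set $\{\partial_xw_i^\circ\ne0\}\cap\Omega$, on which the distribution $\partial_x^2p_i^\circ$ is a locally square-integrable function. *)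

theory Defs
  imports "HOL-Analysis.Analysis"
begin

definition Ck :: "nat \<Rightarrow> (real \<Rightarrow> real) \<Rightarrow> bool" where
  "Ck k f \<longleftrightarrow> (\<forall>j<k. \<forall>x. (deriv ^^ j) f differentiable (at x)) \<and> continuous_on UNIV ((deriv ^^ k) f)"

definition test_functions :: "real set \<Rightarrow> (real \<Rightarrow> real) set" where
  "test_functions U =
     {\<phi>. (\<forall>k. Ck k \<phi>) \<and> compact (closure {x. \<phi> x \<noteq> 0}) \<and> closure {x. \<phi> x \<noteq> 0} \<subseteq> U}"

text \<open>
  Elements of \<open>L\<^sup>2\<close> and \<open>H\<^sup>1\<close> are represented by functions on the real line whose values outside
  the domain are irrelevant; equality in these spaces is equality almost everywhere in the domain.
\<close>

definition L2 :: "real set \<Rightarrow> (real \<Rightarrow> real) set" where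
  "L2 U = {f. f \<in> borel_measurable (lebesgue_on U) \<and> integrable (lebesgue_on U) (\<lambda>x. (f x)\<^sup>2)}"

definition L2_loc :: "real set \<Rightarrow> (real \<Rightarrow> real) set" where
  "L2_loc U = {f. \<forall>K. compact K \<longrightarrow> K \<subseteq> U \<longrightarrow> f \<in> L2 K}"

definition ip_L2 :: "real set \<Rightarrow> (real \<Rightarrow> real) \<Rightarrow> (real \<Rightarrow> real) \<Rightarrow> real" where
  "ip_L2 U f h = (LINT x|lebesgue_on U. f x * h x)"

definition weak_deriv :: "real set \<Rightarrow> (real \<Rightarrow> real) \<Rightarrow> (real \<Rightarrow> real) \<Rightarrow> bool" where
  "weak_deriv U f v \<longleftrightarrow>
     (\<forall>\<phi>\<in>test_functions U.
        (LINT x|lebesgue_on U. f x * deriv \<phi> x) = - (LINT x|lebesgue_on U. v x * \<phi> x))"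

definition H1 :: "real set \<Rightarrow> (real \<Rightarrow> real) set" where
  "H1 U = {f \<in> L2 U. \<exists>v \<in> L2 U. weak_deriv U f v}"

text \<open>A representative of the distributional derivative; it is determined up to null sets.\<close>

definition dx :: "real set \<Rightarrow> (real \<Rightarrow> real) \<Rightarrow> (real \<Rightarrow> real)" where
  "dx U f = (SOME v. v \<in> L2 U \<and> weak_deriv U f v)"

text \<open>The continuous representative, for functions that have one (in particular for \<open>H\<^sup>1\<close> on a
  bounded interval); for an open domain it is uniquely determined on the closure.\<close>

definition cont_rep :: "real set \<Rightarrow> (real \<Rightarrow> real) \<Rightarrow> (real \<Rightarrow> real)" where
  "cont_rep U f = (SOME h. continuous_on (closure U) h \<and> (AE x in lebesgue_on U. h x = f x))"

definition H2 :: "real set \<Rightarrow> (real \<Rightarrow> real) set" where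
  "H2 U = {f \<in> H1 U. dx U f \<in> H1 U}"

definition ip_H1 :: "real set \<Rightarrow> (real \<Rightarrow> real) \<Rightarrow> (real \<Rightarrow> real) \<Rightarrow> real" where
  "ip_H1 U f h = ip_L2 U f h + ip_L2 U (dx U f) (dx U h)"

text \<open>Linearity together with the bound forces the value to depend only on the class modulo
  null sets.\<close>

definition H1_dual :: "real set \<Rightarrow> ((real \<Rightarrow> real) \<Rightarrow> real) set" where
  "H1_dual U = {\<zeta>.
     (\<forall>\<phi>\<in>H1 U. \<forall>\<psi>\<in>H1 U. \<zeta> (\<lambda>x. \<phi> x + \<psi> x) = \<zeta> \<phi> + \<zeta> \<psi>) \<and>
     (\<forall>c. \<forall>\<phi>\<in>H1 U. \<zeta> (\<lambda>x. c * \<phi> x) = c * \<zeta> \<phi>) \<and>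
     (\<exists>C. \<forall>\<phi>\<in>H1 U. \<bar>\<zeta> \<phi>\<bar> \<le> C * sqrt (ip_H1 U \<phi> \<phi>))}"

definition duality_map :: "real set \<Rightarrow> (real \<Rightarrow> real) \<Rightarrow> ((real \<Rightarrow> real) \<Rightarrow> real)" where
  "duality_map U \<phi> = (\<lambda>\<psi>. ip_H1 U \<phi> \<psi>)"

definition represented_by :: "real set \<Rightarrow> ((real \<Rightarrow> real) \<Rightarrow> real) \<Rightarrow> (real \<Rightarrow> real) \<Rightarrow> bool" where
  "represented_by U \<xi> h \<longleftrightarrow> h \<in> L2 U \<and> (\<forall>\<phi>\<in>H1 U. \<xi> \<phi> = ip_L2 U h \<phi>)"

text \<open>The product of \<open>a\<close> with the second distributional derivative of \<open>p\<close>, as a functional on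
  \<open>H\<^sup>1\<close>. It is meaningful when \<open>a\<close> is a multiplier of \<open>H\<^sup>1\<close>.\<close>

definition H1_multiplier :: "real set \<Rightarrow> (real \<Rightarrow> real) \<Rightarrow> bool" where
  "H1_multiplier U a \<longleftrightarrow> (\<forall>\<phi>\<in>H1 U. (\<lambda>x. a x * \<phi> x) \<in> H1 U)"

definition times_dxx :: "real set \<Rightarrow> (real \<Rightarrow> real) \<Rightarrow> (real \<Rightarrow> real) \<Rightarrow> ((real \<Rightarrow> real) \<Rightarrow> real)" where
  "times_dxx U a p = (\<lambda>\<phi>. - ip_L2 U (dx U p) (dx U (\<lambda>x. a x * \<phi> x)))"

definition mosco :: "(nat \<Rightarrow> 'a::real_inner \<Rightarrow> ereal) \<Rightarrow> ('a \<Rightarrow> ereal) \<Rightarrow> bool" where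
  "mosco \<psi>s \<psi> \<longleftrightarrow>
     (\<forall>ws w. (\<forall>y. (\<lambda>k. ws k \<bullet> y) \<longlonglongrightarrow> w \<bullet> y) \<longrightarrow> \<psi> w \<le> liminf (\<lambda>k. \<psi>s k (ws k))) \<and>
     (\<forall>w. \<psi> w < \<infinity> \<longrightarrow> (\<exists>ws. ws \<longlonglongrightarrow> w \<and> (\<lambda>k. \<psi>s k (ws k)) \<longlonglongrightarrow> \<psi> w))"

text \<open>Mosco convergence of a family with parameters in \<open>[0,1]\<close>, as the parameter tends to \<open>e0\<close>.\<close>

definition mosco_family :: "(real \<Rightarrow> 'a::real_inner \<Rightarrow> ereal) \<Rightarrow> real \<Rightarrow> bool" where
  "mosco_family F e0 \<longleftrightarrow>
     (\<forall>s :: nat \<Rightarrow> real. (\<forall>k. s k \<in> {0..1}) \<longrightarrow> s \<longlonglongrightarrow> e0 \<longrightarrow> mosco (\<lambda>k. F (s k)) (F e0))"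

definition f_approximation :: "(real \<Rightarrow> real \<Rightarrow> real) \<Rightarrow> bool" where
  "f_approximation f \<longleftrightarrow>
     (\<forall>r. f 0 r = \<bar>r\<bar>) \<and>
     (\<forall>\<epsilon>\<in>{0<..1}. Ck 2 (f \<epsilon>) \<and> convex_on UNIV (f \<epsilon>) \<and> f \<epsilon> 0 = 0 \<and> (\<forall>r. 0 \<le> f \<epsilon> r)) \<and>
     (\<forall>\<epsilon>0\<in>{0..1}. (\<forall>r. ((\<lambda>\<epsilon>. f \<epsilon> r) \<longlongrightarrow> f \<epsilon>0 r) (at \<epsilon>0 within {0..1})) \<and>
                   mosco_family (\<lambda>\<epsilon> r. ereal (f \<epsilon> r)) \<epsilon>0) \<and>
     (\<exists>C0>0. \<forall>\<epsilon>\<in>{0<..1}. \<forall>r. \<bar>deriv (f \<epsilon>) r\<bar> \<le> C0 * (1 + \<bar>r\<bar>)) \<and>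
     (\<forall>l>0. uniform_limit {r. l \<le> \<bar>r\<bar>} (\<lambda>\<epsilon>. (deriv ^^ 2) (f \<epsilon>)) (\<lambda>r. 0) (at_right 0))"

definition indicator_functional :: "real \<Rightarrow> ennreal" where
  "indicator_functional r = (if r \<in> {-1..1} then 0 else \<infinity>)"

text \<open>\<open>Khat\<close> and \<open>K\<close> are only used for parameters in \<open>(0,1]\<close>; the value of the extended family
  at the parameter \<open>0\<close> is the indicator functional.\<close>

definition K_approximation :: "(real \<Rightarrow> real \<Rightarrow> real) \<Rightarrow> (real \<Rightarrow> real \<Rightarrow> real) \<Rightarrow> bool" where
  "K_approximation Khat K \<longleftrightarrow>
     (\<forall>\<delta>\<in>{0<..1}. Ck 2 (Khat \<delta>) \<and> Ck 1 (K \<delta>) \<and>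
        (\<forall>r. (Khat \<delta> has_real_derivative K \<delta> r) (at r)) \<and>
        (\<forall>r\<in>{-1..1}. Khat \<delta> r = 0) \<and>
        (\<exists>C>0. \<forall>r. 0 \<le> deriv (K \<delta>) r \<and> deriv (K \<delta>) r \<le> C)) \<and>
     (\<forall>\<delta>0\<in>{0..1}. mosco_family
        (\<lambda>\<delta> r. if \<delta> = 0 then enn2ereal (indicator_functional r) else ereal (Khat \<delta> r)) \<delta>0) \<and>
     (\<forall>\<delta>0\<in>{0<..1}. \<forall>S. compact S \<longrightarrow> uniform_limit S Khat (Khat \<delta>0) (at \<delta>0 within {0<..1}))"

definition Psi :: "real set \<Rightarrow> real \<Rightarrow> (real \<Rightarrow> real) \<Rightarrow> ennreal" where
  "Psi \<Omega> \<nu> z =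
     (if z \<in> H1 \<Omega> then
        ennreal ((LINT x|lebesgue_on \<Omega>. \<bar>dx \<Omega> z x\<bar>) + \<nu>\<^sup>2 / 2 * (LINT x|lebesgue_on \<Omega>. \<bar>dx \<Omega> z x\<bar>\<^sup>2))
        + (\<integral>\<^sup>+x. indicator_functional (z x) \<partial>lebesgue_on \<Omega>)
      else \<infinity>)"

definition dom_Psi :: "real set \<Rightarrow> real \<Rightarrow> (real \<Rightarrow> real) set" where
  "dom_Psi \<Omega> \<nu> = {z \<in> L2 \<Omega>. Psi \<Omega> \<nu> z < \<infinity>}"

text \<open>A vector \<open>[v\<^sub>1, \<dots>, v\<^sub>n]\<close> is a sequence \<open>v\<close> of which only the indices \<open>1, \<dots>, n\<close> matter, except
  that the entry \<open>0\<close> of a state carries the initial datum.\<close>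

definition state_solution ::
  "real set \<Rightarrow> nat \<Rightarrow> real \<Rightarrow> real \<Rightarrow> real \<Rightarrow> (real \<Rightarrow> real) \<Rightarrow> (real \<Rightarrow> real)
     \<Rightarrow> (nat \<Rightarrow> real \<Rightarrow> real) \<Rightarrow> (nat \<Rightarrow> real \<Rightarrow> real) \<Rightarrow> bool" where
  "state_solution \<Omega> n \<tau> \<nu> Mu g w0 u w \<longleftrightarrow>
     w 0 = w0 \<and>
     (\<forall>i\<in>{1..n}. w i \<in> dom_Psi \<Omega> \<nu> \<and>
        (\<forall>z\<in>dom_Psi \<Omega> \<nu>.
           1 / \<tau> * ip_L2 \<Omega> (\<lambda>x. w i x - w (i - 1) x) (\<lambda>x. w i x - z x)
           + ip_L2 \<Omega> (\<lambda>x. g (w i x) - Mu * u i x) (\<lambda>x. w i x - z x)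
           + enn2real (Psi \<Omega> \<nu> (w i)) - enn2real (Psi \<Omega> \<nu> z) \<le> 0))"

text \<open>The solution of the state system is unique up to null sets, so the choice is immaterial.\<close>

definition cost ::
  "real set \<Rightarrow> nat \<Rightarrow> real \<Rightarrow> real \<Rightarrow> real \<Rightarrow> real \<Rightarrow> (real \<Rightarrow> real) \<Rightarrow> (nat \<Rightarrow> real \<Rightarrow> real) \<Rightarrow> (real \<Rightarrow> real)
     \<Rightarrow> (nat \<Rightarrow> real \<Rightarrow> real) \<Rightarrow> real" where
  "cost \<Omega> n \<tau> \<nu> Mu Mw g wad w0 u =
     (let w = (SOME w. state_solution \<Omega> n \<tau> \<nu> Mu g w0 u w) in
        Mw / 2 * (\<Sum>i=1..n. ip_L2 \<Omega> (\<lambda>x. w i x - wad i x) (\<lambda>x. w i x - wad i x))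
        + Mu / 2 * (\<Sum>i=1..n. ip_L2 \<Omega> (u i) (u i)))"

definition optimal_control ::
  "real set \<Rightarrow> nat \<Rightarrow> real \<Rightarrow> real \<Rightarrow> real \<Rightarrow> real \<Rightarrow> (real \<Rightarrow> real) \<Rightarrow> (nat \<Rightarrow> real \<Rightarrow> real) \<Rightarrow> (real \<Rightarrow> real)
     \<Rightarrow> (nat \<Rightarrow> real \<Rightarrow> real) \<Rightarrow> bool" where
  "optimal_control \<Omega> n \<tau> \<nu> Mu Mw g wad w0 u \<longleftrightarrow>
     (\<forall>i\<in>{1..n}. u i \<in> L2 \<Omega>) \<and>
     (\<forall>v. (\<forall>i\<in>{1..n}. v i \<in> L2 \<Omega>) \<longrightarrow>
        cost \<Omega> n \<tau> \<nu> Mu Mw g wad w0 u \<le> cost \<Omega> n \<tau> \<nu> Mu Mw g wad w0 v)"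

end

theory Submission
  imports Defs "HOL-Complex_Analysis.Great_Picard"
begin

text \<open>
  In one space dimension the inclusion \<open>\<sigma> \<in> \<partial>|\<cdot>|(w') + \<nu>\<^sup>2 w'\<close> can be solved for \<open>w'\<close>: it means
  \<open>w' = soft \<nu> \<sigma>\<close>, where \<open>soft \<nu>\<close> is soft thresholding at level \<open>1\<close> followed by division by \<open>\<nu>\<^sup>2\<close>.
  So the singular, set-valued equation for \<open>w\<close> becomes a first order system for the pair of state
  and flux with Lipschitz right-hand side,
  \<open>w' = S \<sigma>\<close> and \<open>\<sigma>' = h w + \<xi> - w\<^sub>i\<^sub>-\<^sub>1/\<tau> - e\<close>, with \<open>\<sigma> = 0\<close> at both ends, \<open>S = soft \<nu>\<close>,
  \<open>h r = r/\<tau> + g r\<close>, the obstacle reaction \<open>\<xi> \<in> \<partial>I(w)\<close> and the forcing \<open>e = M\<^sub>u u\<close>. For approximation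
  purposes \<open>S\<close> is replaced by a continuously differentiable nondecreasing function and \<open>\<xi>\<close> by a
  penalty \<open>K w\<close>, with one parameter \<open>\<epsilon>\<close> for both.

  The regularised problem is to minimise the tracking functional over all triples of forcing, state
  and flux that satisfy the system. The forcing is explicit in the other two, so every perturbation
  of one flux by a function vanishing at the ends, together with a shift of the left end value of
  that state, produces again an admissible triple. The Euler-Lagrange equations can
  therefore be read off without linearising a control-to-state map (\<open>minimality_variation\<close>,
  \<open>adjoint_exists\<close>): \<open>P' = S'(\<sigma>) R\<close> and \<open>R' = (h' + K') P - P\<^sub>i\<^sub>+\<^sub>1/\<tau> - M\<^sub>w (w - w\<^sup>a\<^sup>d)\<close>
  with \<open>R = 0\<close> at both ends, where \<open>P\<close> is a negative multiple of the forcing. Testing the second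
  equation with \<open>P\<close> bounds \<open>P\<close> and \<open>P'\<close> independently of \<open>\<epsilon>\<close>, because \<open>h'\<close> is bounded below by
  a positive constant when \<open>\<tau>\<close> is small and \<open>S'\<close>, \<open>K'\<close> are nonnegative (\<open>adjoint_energy\<close>). The same
  argument with zero weight on the state gives \<open>P = 0\<close>, which says that every prescribed forcing has
  a state (\<open>flux_system_exists\<close>).

  The states are bounded by testing the flux equation with \<open>w\<close> and with \<open>K w\<close>, so that subsequences
  of states, fluxes and adjoint states converge uniformly as \<open>\<epsilon> \<rightarrow> 0\<close> (\<open>flux_system_compact\<close>,
  \<open>limit_feasible\<close>, \<open>optimality_limit\<close>). The weight of the forcing is \<open>1/\<mu>\<close> with \<open>\<mu> = M\<^sub>u + \<epsilon>\<close>; in the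
  limit the forcing is \<open>- M\<^sub>u P\<close>, so \<open>u = - P\<close> is a control for it, and the comparison of minimal
  values passes to the limit also when \<open>M\<^sub>u = 0\<close>. A limit triple solves the variational
  inequality because \<open>soft \<nu>\<close> inverts the subdifferential (\<open>soft_subgradient\<close>), and the solution of
  that inequality is unique, so \<open>u\<close> is optimal.

  Where \<open>|\<sigma>| > 1\<close> one has \<open>w' \<noteq> 0\<close>, hence \<open>|w| < 1\<close>, since an interior contact point with the obstacle is an
  extremum of \<open>w\<close> (\<open>saturated_flux\<close>). There the penalty vanishes and \<open>S' = 1/\<nu>\<^sup>2\<close> for small \<open>\<epsilon>\<close>, and the
  adjoint system passes to the limit as a linear second order equation (\<open>local_adjoint_limit\<close>). The
  product \<open>\<gamma>\<^sub>0(w') \<phi>\<close> equals \<open>(\<gamma>\<^sub>0 \<circ> soft \<nu>)(\<sigma>) \<phi>\<close>, where \<open>\<gamma>\<^sub>0 \<circ> soft \<nu>\<close> is continuously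
  differentiable as \<open>\<gamma>\<^sub>0\<close> is flat at \<open>0\<close>; it is a limit of functions supported where
  \<open>|\<sigma>| \<ge> c\<close> with \<open>c > 1\<close>, so the local equation applies to it (\<open>multiplier_identity\<close>). Finally \<open>\<zeta>\<close> is
  the residual of the global adjoint equation.
\<close>

section \<open>Real sequences and functions of one variable\<close>

lemma subsequence_principle:
  fixes X :: "nat \<Rightarrow> real"
  assumes bd: "\<And>k. \<bar>X k\<bar> \<le> C" and lim: "\<And>r l. strict_mono r \<Longrightarrow> (\<lambda>k. X (r k)) \<longlonglongrightarrow> l \<Longrightarrow> l = L"
  shows "X \<longlonglongrightarrow> L"
proof (rule ccontr)
  assume "\<not> X \<longlonglongrightarrow> L"
  then obtain e where e: "e > 0" "\<And>N. \<exists>n\<ge>N. e \<le> \<bar>X n - L\<bar>"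
    unfolding LIMSEQ_iff real_norm_def by (metis not_less)
  then have inf: "infinite {n. e \<le> \<bar>X n - L\<bar>}" by (auto simp: infinite_nat_iff_unbounded_le)
  define r where "r = enumerate {n. e \<le> \<bar>X n - L\<bar>}"
  have r: "strict_mono r" unfolding r_def using inf by (rule strict_mono_enumerate)
  have rX: "e \<le> \<bar>X (r k) - L\<bar>" for k unfolding r_def using enumerate_in_set[OF inf, of k] by simp
  have "bounded (range (\<lambda>k. X (r k)))" using bd by (auto simp: bounded_iff)
  then obtain l s where s: "strict_mono s" "((\<lambda>k. X (r k)) \<circ> s) \<longlonglongrightarrow> l"
    using bounded_imp_convergent_subsequence by blast
  have "l = L" by (rule lim[of "r \<circ> s"]) (use s r in \<open>auto simp: o_def strict_mono_def\<close>)
  moreover have "(\<lambda>k. \<bar>X (r (s k)) - L\<bar>) \<longlonglongrightarrow> \<bar>l - L\<bar>" using s(2) by (intro tendsto_intros) (simp add: o_def)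
  then have "e \<le> \<bar>l - L\<bar>" using rX by (intro LIMSEQ_le_const) auto
  ultimately show False using e(1) by simp
qed

text \<open>Serves to extract one subsequence for all time levels, one level after the other: what is arranged for a
  level survives the passage to further subsequences.\<close>

lemma finite_subseq:
  fixes P :: "nat \<Rightarrow> (nat \<Rightarrow> nat) \<Rightarrow> bool"
  assumes ex: "\<And>i (r::nat\<Rightarrow>nat). i \<in> {1..N} \<Longrightarrow> strict_mono r \<Longrightarrow> \<exists>s::nat\<Rightarrow>nat. strict_mono s \<and> P i (\<lambda>k. r (s k))"
    and cl: "\<And>i (r::nat\<Rightarrow>nat) (s::nat\<Rightarrow>nat). P i r \<Longrightarrow> strict_mono s \<Longrightarrow> P i (\<lambda>k. r (s k))"
  shows "\<exists>r::nat\<Rightarrow>nat. strict_mono r \<and> (\<forall>i\<in>{1..N}. P i r)"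
  using ex
proof (induction N)
  case 0
  then show ?case by (auto intro!: exI[of _ id] simp: strict_mono_def)
next
  case (Suc N)
  then obtain r where r: "strict_mono r" "\<forall>i\<in>{1..N}. P i r" by force
  obtain s where s: "strict_mono s" "P (Suc N) (\<lambda>k. r (s k))" using Suc.prems[of "Suc N" r] r by auto
  have "strict_mono (\<lambda>k. r (s k))" using r(1) s(1) by (simp add: strict_mono_def)
  moreover have "P i (\<lambda>k. r (s k))" if "i \<in> {1..Suc N}" for i
    using that s cl[OF _ s(1)] r(2) by (cases "i = Suc N") auto
  ultimately show ?case by blast
qed

lemma has_deriv_cont: "(\<And>r. (f has_real_derivative f' r) (at r)) \<Longrightarrow> continuous_on UNIV f"
  by (meson DERIV_isCont continuous_at_imp_continuous_on)

lemma deriv_bounds: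
  fixes f f' :: "real \<Rightarrow> real"
  assumes d: "\<And>r. (f has_real_derivative f' r) (at r)" and l: "\<And>r. l \<le> f' r" and "x \<le> y"
  shows "l * (y - x) \<le> f y - f x"
proof (cases "x < y")
  case True
  obtain z where "f y - f x = (y - x) * f' z" using MVT2[OF True, of f f'] d by blast
  then show ?thesis using l[of z] True by (simp add: mult.commute mult_left_mono)
qed (use assms in auto)

lemma deriv_bounds_upper:
  fixes f f' :: "real \<Rightarrow> real"
  assumes d: "\<And>r. (f has_real_derivative f' r) (at r)" and l: "\<And>r. f' r \<le> l" and "x \<le> y"
  shows "f y - f x \<le> l * (y - x)"
proof (cases "x < y")
  case True
  obtain z where "f y - f x = (y - x) * f' z" using MVT2[OF True, of f f'] d by blast
  then show ?thesis using l[of z] True by (simp add: mult.commute mult_left_mono)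
qed (use assms in auto)

lemma deriv_lip:
  fixes f f' :: "real \<Rightarrow> real"
  assumes d: "\<And>r. (f has_real_derivative f' r) (at r)" and l: "\<And>r. 0 \<le> f' r" "\<And>r. f' r \<le> l"
  shows "\<bar>f y - f x\<bar> \<le> l * \<bar>y - x\<bar>"
proof (cases "x \<le> y")
  case True
  show ?thesis using deriv_bounds[OF d l(1) True] deriv_bounds_upper[OF d l(2) True] True by simp
next
  case False
  then have F: "y \<le> x" by simp
  show ?thesis using deriv_bounds[OF d l(1) F] deriv_bounds_upper[OF d l(2) F] F by (simp add: algebra_simps)
qed

lemma deriv_sign:
  fixes f f' :: "real \<Rightarrow> real"
  assumes d: "\<And>r. (f has_real_derivative f' r) (at r)" and l: "\<And>r. l \<le> f' r"
  shows "l * (r * r) \<le> (f r - f 0) * r"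
proof (cases "0 \<le> r")
  case True
  show ?thesis using mult_right_mono[OF deriv_bounds[OF d l True] True] by (simp add: mult_ac)
next
  case False
  then have F: "r \<le> 0" by simp
  then have "(f 0 - f r) * r \<le> l * (0 - r) * r" using mult_right_mono_neg[OF deriv_bounds[OF d l F] F] by simp
  then show ?thesis by (simp add: algebra_simps)
qed

text \<open>The increment is \<open>t k\<close> times a convergent sequence, not a fixed multiple of \<open>t k\<close>; this is the form in
  which a state reacts to a perturbation of its flux.\<close>

lemma diff_quotient_limit:
  fixes F :: "real \<Rightarrow> real"
  assumes F: "(F has_real_derivative F') (at y)" and t: "t \<longlonglongrightarrow> 0" "\<And>k. t k \<noteq> 0"
    and d: "\<delta> \<longlonglongrightarrow> d"
  shows "(\<lambda>k::nat. (F (y + t k * \<delta> k) - F y) / t k) \<longlonglongrightarrow> F' * d"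
proof -
  define q where "q u = (if u = 0 then F' else (F (y + u) - F y) / u)" for u
  have "(\<lambda>u. (F (y + u) - F y) / u) \<midarrow>0\<rightarrow> F'" using F by (simp add: DERIV_def)
  then have "isCont q 0" unfolding isCont_def
    using LIM_equal[of 0 q "\<lambda>u. (F (y + u) - F y) / u" F'] by (simp add: q_def)
  moreover have "(\<lambda>k. t k * \<delta> k) \<longlonglongrightarrow> 0" using tendsto_mult[OF t(1) d] by simp
  ultimately have "(\<lambda>k. q (t k * \<delta> k)) \<longlonglongrightarrow> q 0" by (rule isCont_tendsto_compose)
  then have "(\<lambda>k. q (t k * \<delta> k) * \<delta> k) \<longlonglongrightarrow> q 0 * d" using d by (intro tendsto_intros)
  moreover have "q (t k * \<delta> k) * \<delta> k = (F (y + t k * \<delta> k) - F y) / t k" for k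
    using t(2)[of k] by (auto simp: q_def)
  ultimately show ?thesis by (simp add: q_def)
qed

section \<open>Square-integrable functions on a bounded interval\<close>

locale segment = fixes a b :: real assumes ab: "a < b"
begin

abbreviation M :: "real measure" where "M \<equiv> lebesgue_on {a<..<b}"

abbreviation LL :: "(real \<Rightarrow> real) set" where "LL \<equiv> L2 {a<..<b}"

abbreviation IP :: "(real \<Rightarrow> real) \<Rightarrow> (real \<Rightarrow> real) \<Rightarrow> real" where "IP \<equiv> ip_L2 {a<..<b}"

definition nrm :: "(real \<Rightarrow> real) \<Rightarrow> real" where "nrm f = sqrt (IP f f)"

lemma finite_M: "finite_measure M"
  by (rule finite_measure_lebesgue_on) simp

lemma measure_M: "measure M (space M) = b - a"
  using ab by (simp add: measure_restrict_space)

lemma LL_meas: "f \<in> LL \<Longrightarrow> f \<in> borel_measurable M"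
  by (simp add: L2_def)

lemma LL_sq: "f \<in> LL \<Longrightarrow> integrable M (\<lambda>x. f x * f x)"
  by (simp add: L2_def power2_eq_square)

lemma LL_I: "f \<in> borel_measurable M \<Longrightarrow> integrable M (\<lambda>x. f x * f x) \<Longrightarrow> f \<in> LL"
  by (simp add: L2_def power2_eq_square)

lemma LL_mult_integrable [simp, intro]:
  assumes "f \<in> LL" "g \<in> LL" shows "integrable M (\<lambda>x. f x * g x)"
proof (rule Bochner_Integration.integrable_bound)
  show "integrable M (\<lambda>x. f x * f x + g x * g x)" using assms by (intro Bochner_Integration.integrable_add LL_sq)
  show "(\<lambda>x. f x * g x) \<in> borel_measurable M"
    using assms by (intro borel_measurable_times LL_meas)
  have "\<bar>x * y\<bar> \<le> x * x + y * y" for x y :: real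
  proof -
    have "0 \<le> (\<bar>x\<bar> - \<bar>y\<bar>)\<^sup>2" "0 \<le> \<bar>x\<bar> * \<bar>y\<bar>" by simp_all
    moreover have "(\<bar>x\<bar> - \<bar>y\<bar>)\<^sup>2 = x * x + y * y - 2 * (\<bar>x\<bar> * \<bar>y\<bar>)"
      by (simp add: power2_diff power2_eq_square[symmetric])
    ultimately show ?thesis by (simp only: abs_mult)
  qed
  then show "AE x in M. norm (f x * g x) \<le> norm (f x * f x + g x * g x)" by auto
qed

lemma LL_add [simp, intro]: assumes "f \<in> LL" "g \<in> LL" shows "(\<lambda>x. f x + g x) \<in> LL"
proof (rule LL_I)
  show "(\<lambda>x. f x + g x) \<in> borel_measurable M" using assms by (intro borel_measurable_add LL_meas)
  have "integrable M (\<lambda>x. f x * f x + 2 * (f x * g x) + g x * g x)"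
    using assms by (intro Bochner_Integration.integrable_add integrable_mult_right) auto
  then show "integrable M (\<lambda>x. (f x + g x) * (f x + g x))" by (simp add: algebra_simps)
qed

lemma LL_scale [simp, intro]: assumes "f \<in> LL" shows "(\<lambda>x. c * f x) \<in> LL"
proof (rule LL_I)
  show "(\<lambda>x. c * f x) \<in> borel_measurable M" using LL_meas[OF assms] by simp
  have "integrable M (\<lambda>x. (c * c) * (f x * f x))" using assms by (intro integrable_mult_right) auto
  then show "integrable M (\<lambda>x. c * f x * (c * f x))" by (simp add: mult_ac)
qed

lemma LL_minus [simp, intro]: assumes "f \<in> LL" shows "(\<lambda>x. - f x) \<in> LL"
  using LL_scale[OF assms, of "-1"] by simp

lemma LL_diff [simp, intro]: assumes "f \<in> LL" "g \<in> LL" shows "(\<lambda>x. f x - g x) \<in> LL"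
  using LL_add[OF assms(1) LL_minus[OF assms(2)]] by simp

lemma LL_divide [simp, intro]: assumes "f \<in> LL" shows "(\<lambda>x. f x / c) \<in> LL"
  using LL_scale[OF assms, of "inverse c"] by (simp add: divide_inverse mult.commute)

lemma LL_abs [simp, intro]: assumes "f \<in> LL" shows "(\<lambda>x. \<bar>f x\<bar>) \<in> LL"
  using LL_meas[OF assms] LL_sq[OF assms] by (intro LL_I) auto

lemma LL_bounded_mult:
  assumes f: "f \<in> LL" and m: "h \<in> borel_measurable M" and bd: "\<And>x. x \<in> {a<..<b} \<Longrightarrow> \<bar>h x\<bar> \<le> C"
  shows "(\<lambda>x. h x * f x) \<in> LL"
proof (rule LL_I)
  show "(\<lambda>x. h x * f x) \<in> borel_measurable M" using LL_meas[OF f] m by simp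
  then have m2: "(\<lambda>x. h x * f x * (h x * f x)) \<in> borel_measurable M" by simp
  show "integrable M (\<lambda>x. h x * f x * (h x * f x))"
  proof (rule Bochner_Integration.integrable_bound[OF _ m2])
    show "integrable M (\<lambda>x. (C * C) * (f x * f x))" using f by (intro integrable_mult_right) auto
    show "AE x in M. norm (h x * f x * (h x * f x)) \<le> norm ((C * C) * (f x * f x))"
    proof (rule AE_I2)
      fix x assume "x \<in> space M"
      then have h: "\<bar>h x\<bar> \<le> C" using bd by simp
      have "h x * h x \<le> C * C" using mult_mono[OF h h] h by (simp add: abs_mult_self_eq)
      then show "norm (h x * f x * (h x * f x)) \<le> norm ((C * C) * (f x * f x))"
        using mult_right_mono[of "h x * h x" "C*C" "f x * f x"] by (simp add: abs_mult mult_ac)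
    qed
  qed
qed

lemma cont_meas: "continuous_on {a..b} f \<Longrightarrow> f \<in> borel_measurable M"
  by (rule continuous_imp_measurable_on_sets_lebesgue)
    (auto elim: continuous_on_subset)

lemma cont_bound: fixes f :: "real \<Rightarrow> real"
  assumes "continuous_on {a..b} f" obtains C where "\<And>x. x \<in> {a..b} \<Longrightarrow> \<bar>f x\<bar> \<le> C" "0 \<le> C"
proof -
  have "bounded (f ` {a..b})" using assms compact_continuous_image compact_imp_bounded by blast
  then obtain C where C: "\<forall>x\<in>{a..b}. \<bar>f x\<bar> \<le> C" by (auto simp: bounded_iff)
  then have "0 \<le> C" using ab by (smt (verit, best) atLeastAtMost_iff)
  then show ?thesis using that C by blast
qed

lemma LL_const [simp, intro]: "(\<lambda>x. c) \<in> LL"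
  using finite_measure.integrable_const[OF finite_M] by (intro LL_I) auto

lemma LL_cont_mult: assumes "continuous_on {a..b} h" "f \<in> LL" shows "(\<lambda>x. h x * f x) \<in> LL"
proof -
  obtain C where "\<And>x. x \<in> {a..b} \<Longrightarrow> \<bar>h x\<bar> \<le> C" using cont_bound[OF assms(1)] by blast
  then show ?thesis by (intro LL_bounded_mult[OF assms(2) cont_meas[OF assms(1)], of C]) auto
qed

lemma LL_cont: assumes "continuous_on {a..b} f" shows "f \<in> LL"
  using LL_cont_mult[OF assms LL_const[of 1]] by simp

lemma LL_indicator [simp, intro]: assumes "S \<in> sets lebesgue" shows "(indicator S :: real \<Rightarrow> real) \<in> LL"
proof -
  have "(indicator S :: real \<Rightarrow> real) \<in> borel_measurable M"
    using assms by (intro measurable_restrict_space1) auto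
  then have "(\<lambda>x. indicator S x * 1 :: real) \<in> LL"
    by (rule LL_bounded_mult[OF LL_const, where C = 1]) (auto simp: indicator_def)
  then show ?thesis by simp
qed

lemma LL_AE:
  assumes "f \<in> LL" "AE x in M. g x = f x" "g \<in> borel_measurable M" shows "g \<in> LL"
proof (rule LL_I[OF assms(3)])
  have m: "(\<lambda>x. g x * g x) \<in> borel_measurable M" using assms(3) by simp
  have "AE x in M. f x * f x = g x * g x" using assms(2) by (rule eventually_mono) auto
  then show "integrable M (\<lambda>x. g x * g x)"
    using Bochner_Integration.integrable_cong_AE[of "\<lambda>x. f x * f x" M "\<lambda>x. g x * g x"] m LL_sq[OF assms(1)] LL_meas[OF assms(1)]
    by auto
qed

text \<open>Holds because the Lebesgue measure is complete.\<close>

lemma meas_AE: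
  fixes f g :: "real \<Rightarrow> real"
  assumes "f \<in> borel_measurable M" "AE x in M. g x = f x" shows "g \<in> borel_measurable M"
proof (rule measurableI)
  have "AE x in lebesgue. x \<in> {a<..<b} \<longrightarrow> g x = f x"
    using assms(2) by (subst (asm) AE_restrict_space_iff) (auto)
  then obtain N where N: "N \<in> null_sets lebesgue" "{x. \<not> (x \<in> {a<..<b} \<longrightarrow> g x = f x)} \<subseteq> N"
    by (auto simp: eventually_ae_filter)
  then have ng: "negligible N" by (simp add: negligible_iff_null_sets)
  fix A :: "real set" assume A: "A \<in> sets borel"
  have "f -` A \<inter> space M \<in> sets M" using assms(1) A by (rule measurable_sets)
  then have 1: "f -` A \<inter> {a<..<b} \<in> sets lebesgue" by (simp add: sets_restrict_space_iff)
  have "g -` A \<inter> {a<..<b} \<in> sets lebesgue"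
    by (rule sets_negligible_symdiff[OF 1]) (rule negligible_subset[OF ng], use N in auto)
  then show "g -` A \<inter> space M \<in> sets M" by (simp add: sets_restrict_space_iff)
qed simp

lemma LL_AE': assumes "f \<in> LL" "AE x in M. g x = f x" shows "g \<in> LL"
  using LL_AE[OF assms meas_AE[OF LL_meas[OF assms(1)] assms(2)]] .

lemma IP_commute: "IP f g = IP g f" by (simp add: ip_L2_def mult.commute)

lemma IP_add_left: "f \<in> LL \<Longrightarrow> g \<in> LL \<Longrightarrow> h \<in> LL \<Longrightarrow> IP (\<lambda>x. f x + g x) h = IP f h + IP g h"
  unfolding ip_L2_def by (simp add: distrib_right)

lemma IP_diff_left: "f \<in> LL \<Longrightarrow> g \<in> LL \<Longrightarrow> h \<in> LL \<Longrightarrow> IP (\<lambda>x. f x - g x) h = IP f h - IP g h"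
  unfolding ip_L2_def by (simp add: left_diff_distrib)

lemma IP_scale_left: "IP (\<lambda>x. c * f x) h = c * IP f h"
  unfolding ip_L2_def by (simp add: mult.assoc)

lemma IP_minus_left: "IP (\<lambda>x. - f x) h = - IP f h"
  using IP_scale_left[of "-1"] by simp

lemma IP_divide_left: "IP (\<lambda>x. f x / c) h = IP f h / c"
  using IP_scale_left[of "inverse c" f h] by (simp add: divide_inverse mult.commute)

lemma IP_zero_left: "IP (\<lambda>x. 0) h = 0" by (simp add: ip_L2_def)

lemma IP_add_right: "f \<in> LL \<Longrightarrow> g \<in> LL \<Longrightarrow> h \<in> LL \<Longrightarrow> IP h (\<lambda>x. f x + g x) = IP h f + IP h g"
  using IP_add_left[of f g h] by (simp only: IP_commute)

lemma IP_diff_right: "f \<in> LL \<Longrightarrow> g \<in> LL \<Longrightarrow> h \<in> LL \<Longrightarrow> IP h (\<lambda>x. f x - g x) = IP h f - IP h g"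
  using IP_diff_left[of f g h] by (simp only: IP_commute)

lemma IP_scale_right: "IP h (\<lambda>x. c * f x) = c * IP h f"
  using IP_scale_left[of c f h] by (simp only: IP_commute)

lemma IP_minus_right: "IP h (\<lambda>x. - f x) = - IP h f"
  using IP_minus_left[of f h] by (simp only: IP_commute)

lemma IP_divide_right: "IP h (\<lambda>x. f x / c) = IP h f / c"
  using IP_divide_left[of f c h] by (simp only: IP_commute)

lemma IP_zero_right: "IP h (\<lambda>x. 0) = 0" by (simp add: ip_L2_def)

lemmas IP_simps = IP_add_left IP_diff_left IP_scale_left IP_minus_left IP_divide_left IP_zero_left
  IP_add_right IP_diff_right IP_scale_right IP_minus_right IP_divide_right IP_zero_right

lemma IP_cong_AE:
  assumes "f \<in> LL" "g \<in> LL" "AE x in M. f' x = f x" "AE x in M. g' x = g x"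
  shows "IP f' g' = IP f g"
proof -
  have "f' \<in> LL" "g' \<in> LL" using LL_AE' assms by auto
  then have m: "(\<lambda>x. f' x * g' x) \<in> borel_measurable M" "(\<lambda>x. f x * g x) \<in> borel_measurable M"
    using assms LL_meas by simp_all
  show ?thesis unfolding ip_L2_def using assms(3,4)
    by (intro integral_cong_AE m) (auto elim: eventually_elim2)
qed

lemma IP_cong: "(\<And>x. x \<in> {a<..<b} \<Longrightarrow> f' x * g' x = f x * g x) \<Longrightarrow> IP f' g' = IP f g"
  unfolding ip_L2_def by (rule Bochner_Integration.integral_cong) auto

lemma IP_mono:
  assumes "f \<in> LL" "g \<in> LL" "f' \<in> LL" "g' \<in> LL" "\<And>x. x \<in> {a<..<b} \<Longrightarrow> f x * g x \<le> f' x * g' x"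
  shows "IP f g \<le> IP f' g'"
  unfolding ip_L2_def using assms by (intro integral_mono) auto

lemma IP_self_nonneg [simp]: "0 \<le> IP f f"
  unfolding ip_L2_def by simp

lemma IP_self_0: assumes "f \<in> LL" "IP f f = 0" shows "AE x in M. f x = 0"
proof -
  have "AE x in M. f x * f x = 0"
    using assms integral_nonneg_eq_0_iff_AE[of M "\<lambda>x. f x * f x"] by (auto simp: ip_L2_def)
  then show ?thesis by simp
qed

lemma nrm_nonneg [simp]: "0 \<le> nrm f" by (simp add: nrm_def)

lemma nrm_sq: "nrm f ^ 2 = IP f f" by (simp add: nrm_def)

lemma nrm_sq': "nrm f * nrm f = IP f f" using nrm_sq[of f] by (simp add: power2_eq_square)

lemma Cauchy_Schwarz: assumes f: "f \<in> LL" and g: "g \<in> LL" shows "\<bar>IP f g\<bar> \<le> nrm f * nrm g"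
proof (cases "IP g g = 0")
  case True
  then have "AE x in M. g x = (\<lambda>x. 0) x" using IP_self_0[OF g] by simp
  then have "IP f g = IP f (\<lambda>x. 0)" using f by (intro IP_cong_AE) auto
  then show ?thesis by (simp add: IP_simps)
next
  case False
  then have pos: "IP g g > 0" using IP_self_nonneg[of g] by linarith
  define c where "c = IP f g / IP g g"
  have "0 \<le> IP (\<lambda>x. f x - c * g x) (\<lambda>x. f x - c * g x)" by simp
  also have "\<dots> = IP f f - 2 * c * IP f g + c * c * IP g g"
    using f g by (simp add: IP_simps IP_commute[of g f] algebra_simps)
  also have "\<dots> = IP f f - IP f g ^ 2 / IP g g"
    using pos by (simp add: c_def power2_eq_square field_simps)
  finally have "IP f g ^ 2 \<le> IP f f * IP g g" using pos by (simp add: field_simps)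
  then have "sqrt (IP f g ^ 2) \<le> sqrt (IP f f * IP g g)" by (rule real_sqrt_le_mono)
  then show ?thesis by (simp add: nrm_def real_sqrt_mult)
qed

lemma nrm_triangle: assumes f: "f \<in> LL" and g: "g \<in> LL" shows "nrm (\<lambda>x. f x + g x) \<le> nrm f + nrm g"
proof (rule power2_le_imp_le)
  have "nrm (\<lambda>x. f x + g x) ^ 2 = IP f f + 2 * IP f g + IP g g"
    using f g by (simp add: nrm_sq IP_simps IP_commute[of g f])
  also have "\<dots> \<le> nrm f ^ 2 + 2 * (nrm f * nrm g) + nrm g ^ 2"
    using Cauchy_Schwarz[OF f g] by (simp add: nrm_sq)
  also have "\<dots> = (nrm f + nrm g) ^ 2" by (simp add: power2_sum)
  finally show "nrm (\<lambda>x. f x + g x) ^ 2 \<le> (nrm f + nrm g) ^ 2" .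
qed simp

lemma nrm_scale: "nrm (\<lambda>x. c * f x) = \<bar>c\<bar> * nrm f"
proof -
  have "IP (\<lambda>x. c * f x) (\<lambda>x. c * f x) = c^2 * IP f f" by (simp add: IP_simps power2_eq_square)
  then show ?thesis by (simp add: nrm_def real_sqrt_mult)
qed

lemma nrm_minus: "nrm (\<lambda>x. - f x) = nrm f" using nrm_scale[of "-1" f] by simp

lemma nrm_diff_triangle: assumes f: "f \<in> LL" and g: "g \<in> LL" shows "nrm (\<lambda>x. f x - g x) \<le> nrm f + nrm g"
  using nrm_triangle[OF f LL_minus[OF g]] nrm_minus by simp

lemma nrm_mono: assumes "f \<in> LL" "g \<in> LL" "\<And>x. x \<in> {a<..<b} \<Longrightarrow> \<bar>f x\<bar> \<le> \<bar>g x\<bar>" shows "nrm f \<le> nrm g"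
  unfolding nrm_def
proof (intro real_sqrt_le_mono IP_mono)
  fix x assume "x \<in> {a<..<b}"
  then have "f x ^ 2 \<le> g x ^ 2" using assms(3) by (simp add: abs_le_square_iff)
  then show "f x * f x \<le> g x * g x" by (simp add: power2_eq_square)
qed (use assms in auto)

lemma nrm_const: "nrm (\<lambda>x. c) = \<bar>c\<bar> * sqrt (b - a)"
proof -
  have "IP (\<lambda>x. c) (\<lambda>x. c) = c^2 * (b - a)" using measure_M by (simp add: ip_L2_def power2_eq_square)
  then show ?thesis by (simp add: nrm_def real_sqrt_mult)
qed

section \<open>Square-integrable functions are determined by their primitives\<close>

lemma LL_integrable: "f \<in> LL \<Longrightarrow> integrable M f"
  using LL_mult_integrable[of f "\<lambda>x. 1"] by simp

lemma LL_abs_integrable: "f \<in> LL \<Longrightarrow> f absolutely_integrable_on {a..b}"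
  using LL_integrable[of f] unfolding absolutely_integrable_on_Icc_iff_Ioo
  by (simp add: set_integrable_def integrable_restrict_space)

lemma LL_integrable_on: "f \<in> LL \<Longrightarrow> {x..y} \<subseteq> {a..b} \<Longrightarrow> f integrable_on {x..y}"
  using LL_abs_integrable absolutely_integrable_on_def integrable_on_subinterval by blast

lemma LINT_M: "f \<in> LL \<Longrightarrow> integral\<^sup>L M f = integral {a..b} f"
  by (simp add: lebesgue_integral_eq_integral LL_integrable integral_open_interval_real)

lemma LL_primitive:
  assumes f: "f \<in> LL" and "a \<le> x" "x \<le> y" "y \<le> b"
  shows "integral {x..y} f = IP f (indicator {x..y})"
proof -
  have "(\<lambda>t. indicator {x..y} t * f t) \<in> LL"
  proof (rule LL_bounded_mult[OF f, of _ 1])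
    show "indicat_real {x..y} \<in> borel_measurable M" by (rule LL_meas) simp
  qed (auto simp: indicator_def)
  then have "IP f (indicator {x..y}) = integral {a..b} (\<lambda>t. indicator {x..y} t * f t)"
    unfolding ip_L2_def by (simp add: LINT_M[symmetric] mult.commute)
  also have "\<dots> = integral {a..b} (\<lambda>t. if t \<in> {x..y} then f t else 0)"
    by (rule integral_cong) auto
  also have "\<dots> = integral ({x..y} \<inter> {a..b}) f"
    using integral_restrict_Int[of "{a..b}" "{x..y}" f] by (simp add: Int_commute)
  also have "{x..y} \<inter> {a..b} = {x..y}" using assms by auto
  finally show ?thesis by simp
qed

lemma LL_primitive_bound:
  assumes f: "f \<in> LL" and "a \<le> x" "x \<le> y" "y \<le> b"
  shows "\<bar>integral {x..y} f\<bar> \<le> nrm f * sqrt (y - x)"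
proof -
  have "IP (indicator {x..y}) (indicator {x..y}) = integral {x..y} (indicator {x..y} :: real \<Rightarrow> real)"
    using LL_primitive[OF LL_indicator, of "{x..y}" x y] assms by simp
  also have "\<dots> = integral {x..y} (\<lambda>t. 1)" by (rule integral_cong) auto
  also have "\<dots> = y - x" using assms by simp
  finally have "nrm (indicator {x..y}) = sqrt (y - x)" by (simp add: nrm_def)
  then show ?thesis using Cauchy_Schwarz[OF f LL_indicator, of "{x..y}"] LL_primitive[OF assms] by simp
qed

lemma LL_primitive_split:
  assumes f: "f \<in> LL" and "a \<le> x" "x \<le> y" "y \<le> b"
  shows "integral {a..y} f = integral {a..x} f + integral {x..y} f"
  using Henstock_Kurzweil_Integration.integral_combine[of a x y f] LL_integrable_on[OF f, of a y] assms by auto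

lemma LL_primitive_cong_AE:
  assumes f: "f \<in> LL" and ae: "AE x in M. g x = f x" and "a \<le> x" "x \<le> y" "y \<le> b"
  shows "integral {x..y} g = integral {x..y} f"
  using LL_primitive[OF LL_AE'[OF f ae]] LL_primitive[OF f] assms IP_cong_AE[OF f LL_indicator ae, of "{x..y}" "indicator {x..y}"]
  by auto

lemma IP_tendsto_dominated:
  assumes "\<And>k. f k \<in> LL" "f0 \<in> borel_measurable M" "g \<in> LL" "h \<in> LL"
    and lim: "\<And>x. x \<in> {a<..<b} \<Longrightarrow> (\<lambda>k. f k x) \<longlonglongrightarrow> f0 x"
    and bd: "\<And>k x. x \<in> {a<..<b} \<Longrightarrow> \<bar>f k x\<bar> \<le> h x"
  shows "(\<lambda>k. IP (f k) g) \<longlonglongrightarrow> IP f0 g"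
  unfolding ip_L2_def
proof (rule integral_dominated_convergence)
  show "(\<lambda>x. f0 x * g x) \<in> borel_measurable M" using assms(2) LL_meas[OF assms(3)] by simp
  show "(\<lambda>x. f k x * g x) \<in> borel_measurable M" for k
    using LL_meas[OF assms(1)] LL_meas[OF assms(3)] by simp
  show "integrable M (\<lambda>x. \<bar>h x * g x\<bar>)"
    using LL_mult_integrable[OF assms(4,3)] by (rule integrable_abs)
  show "AE x in M. (\<lambda>k. f k x * g x) \<longlonglongrightarrow> f0 x * g x" using lim by (intro AE_I2 tendsto_intros) auto
  show "AE x in M. norm (f k x * g x) \<le> \<bar>h x * g x\<bar>" for k
  proof (rule AE_I2)
    fix x assume "x \<in> space M"
    then have "\<bar>f k x\<bar> \<le> \<bar>h x\<bar>" using bd[of x k] by simp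
    then show "norm (f k x * g x) \<le> \<bar>h x * g x\<bar>" by (simp add: abs_mult mult_right_mono)
  qed
qed

text \<open>It suffices to test with the sets where a Borel version of \<open>v\<close> is positive or negative.\<close>

lemma IP_indicator_zero_AE:
  assumes v: "v \<in> LL" and z: "\<And>A. A \<in> sets borel \<Longrightarrow> IP v (indicator A) = 0"
  shows "AE x in M. v x = 0"
proof -
  have "(\<lambda>x. if x \<in> {a<..<b} then v x else 0) \<in> borel_measurable lebesgue"
    using LL_meas[OF v] by (subst borel_measurable_if) auto
  then obtain v' where v': "v' \<in> borel_measurable lborel"
    "AE x in lborel. (if x \<in> {a<..<b} then v x else 0) = v' x"
    using completion_ex_borel_measurable_real by blast
  then have "AE x in lebesgue. (if x \<in> {a<..<b} then v x else 0) = v' x" by (simp add: AE_completion)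
  then have ae: "AE x in M. v x = v' x"
    by (subst AE_restrict_space_iff) (auto elim: eventually_mono)
  have z': "AE x in M. v x * indicator A x = 0"
    if A: "A \<in> sets borel" and sg: "(\<forall>x\<in>A. 0 \<le> v' x) \<or> (\<forall>x\<in>A. v' x \<le> 0)" for A
  proof -
    have A': "A \<in> sets lebesgue" using A by simp
    obtain s :: real where s: "s \<noteq> 0" "\<And>x. x \<in> A \<Longrightarrow> 0 \<le> s * v' x"
      using sg by (metis mult_1 mult_minus1 neg_0_le_iff_le one_neq_zero zero_neq_neg_one)
    have int: "integrable M (\<lambda>x. s * (v x * indicator A x))"
      using LL_mult_integrable[OF v LL_indicator[OF A']] by (intro integrable_mult_right)
    have "AE x in M. 0 \<le> s * (v x * indicator A x)"
      using ae by (rule eventually_mono) (auto simp: indicator_def s)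
    moreover have "integral\<^sup>L M (\<lambda>x. s * (v x * indicator A x)) = 0" using z[OF A] by (simp add: ip_L2_def)
    ultimately have "AE x in M. s * (v x * indicator A x) = 0"
      using integral_nonneg_eq_0_iff_AE[OF int] by simp
    then show ?thesis using s(1) by simp
  qed
  have s1: "{x. 0 < v' x} \<in> sets borel" using v'(1)
    unfolding borel_measurable_iff_greater by (simp add: sets_lborel space_lborel)
  have s2: "{x. v' x < 0} \<in> sets borel" using v'(1)
    unfolding borel_measurable_iff_less by (simp add: sets_lborel space_lborel)
  have "AE x in M. v x * indicator {x. 0 < v' x} x = 0" by (rule z'[OF s1]) auto
  moreover have "AE x in M. v x * indicator {x. v' x < 0} x = 0" by (rule z'[OF s2]) auto
  ultimately show ?thesis using ae by eventually_elim (auto simp: indicator_def split: if_splits)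
qed

text \<open>The Borel sets whose indicator is orthogonal to \<open>v\<close> form a Dynkin system, which contains the
  half-lines by hypothesis.\<close>

lemma primitive_zero_imp_AE_zero:
  assumes v: "v \<in> LL" and z: "\<And>x. x \<in> {a..b} \<Longrightarrow> integral {a..x} v = 0"
  shows "AE x in M. v x = 0"
proof (rule IP_indicator_zero_AE[OF v])
  have total: "IP v (\<lambda>x. 1) = 0"
    using LINT_M[OF v] z[of b] ab by (simp add: ip_L2_def)
  fix A :: "real set" assume "A \<in> sets borel"
  then have A: "A \<in> sigma_sets UNIV (range (\<lambda>a::real. {..a}))" by (simp add: borel_eq_atMost)
  have "Int_stable (range (\<lambda>a::real. {..a}))" by (auto simp: Int_stable_def)
  moreover have "range (\<lambda>a::real. {..a}) \<subseteq> Pow UNIV" by simp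
  ultimately show "IP v (indicator A) = 0" using A
  proof (induction A rule: sigma_sets_induct_disjoint)
    case (basic A)
    then obtain c where A: "A = {..c}" by auto
    have "integral {a..min b (max a c)} v = 0" using ab by (intro z) auto
    then have "IP v (indicator {a..min b (max a c)}) = 0"
      using LL_primitive[OF v, of a "min b (max a c)"] ab by auto
    moreover have "IP v (indicator A) = IP v (indicator {a..min b (max a c)})" if "a \<le> c"
      using that by (intro IP_cong) (auto simp: A indicator_def)
    moreover have "IP v (indicator A) = IP v (\<lambda>x. 0)" if "c < a"
      using that by (intro IP_cong) (auto simp: A indicator_def)
    ultimately show ?case by (cases "a \<le> c") (auto simp: IP_simps)
  next
    case empty
    then show ?case using IP_simps by simp
  next
    case (compl A)
    then have "A \<in> sets borel" by (simp add: borel_eq_atMost)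
    then have A: "A \<in> sets lebesgue" by simp
    have "IP v (indicator (UNIV - A)) = IP v (\<lambda>x. 1 - indicator A x)"
      by (intro IP_cong) (auto simp: indicator_def)
    also have "\<dots> = 0" using IP_diff_right[OF LL_const[of 1] LL_indicator[OF A] v] total compl by simp
    finally show ?case .
  next
    case (union A)
    have Al: "A i \<in> sets lebesgue" for i
    proof -
      have "A i \<in> sigma_sets UNIV (range (\<lambda>a::real. {..a}))" using union by auto
      then have "A i \<in> sets borel" by (simp add: borel_eq_atMost)
      then show ?thesis by simp
    qed
    have "IP (\<lambda>x. \<Sum>i<k. indicator (A i) x) v = 0" for k
    proof (induction k)
      case (Suc k)
      have L: "(\<lambda>x. \<Sum>i<k. indicator (A i) x :: real) \<in> LL" for k
        by (induction k) (auto simp: Al)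
      show ?case using IP_add_left[OF L[of k] LL_indicator[OF Al[of k]] v] Suc union(3)[of k]
        by (simp add: IP_commute)
    qed (simp add: IP_simps)
    moreover have "(\<lambda>k. IP (\<lambda>x. \<Sum>i<k. indicator (A i) x) v) \<longlonglongrightarrow> IP (indicator (\<Union>i. A i)) v"
    proof (rule IP_tendsto_dominated[OF _ _ v LL_const[of 1]])
      show "(\<lambda>x. \<Sum>i<k. indicator (A i) x :: real) \<in> LL" for k
        by (induction k) (auto simp: Al)
      show "indicat_real (\<Union> (range A)) \<in> borel_measurable M"
        using Al by (intro LL_meas LL_indicator) auto
      have s: "(\<lambda>i. indicator (A i) x :: real) sums indicator (\<Union>i. A i) x" for x
      proof (cases "\<exists>i. x \<in> A i")
        case True
        then obtain i where i: "x \<in> A i" by auto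
        have "indicator (A j) x = (if j = i then 1 else 0::real)" for j
          using i union(1) by (auto simp: disjoint_family_on_def indicator_def)
        then show ?thesis using i sums_single[of i "\<lambda>_. 1::real"] by (auto simp: indicator_def)
      next
        case False
        then show ?thesis by (auto simp: indicator_def)
      qed
      then show "(\<lambda>k. \<Sum>i<k. indicator (A i) x :: real) \<longlonglongrightarrow> indicator (\<Union> (range A)) x" for x
        by (simp add: sums_def)
      show "\<bar>\<Sum>i<k. indicator (A i) x :: real\<bar> \<le> 1" for k x
      proof -
        have "(\<Sum>i<k. indicator (A i) x :: real) \<le> (\<Sum>i. indicator (A i) x)"
          using s[of x] by (intro sum_le_suminf) (auto simp: summable_def)
        also have "\<dots> = indicator (\<Union> (range A)) x" using sums_unique[OF s[of x]] by simp
        also have "\<dots> \<le> (1::real)" by (simp add: indicator_def)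
        finally show ?thesis by (simp add: sum_nonneg)
      qed
    qed
    ultimately show ?case by (simp add: IP_commute LIMSEQ_const_iff)
  qed
qed

lemma primitive_eq_imp_AE_eq:
  assumes v: "v \<in> LL" "w \<in> LL" and z: "\<And>x. x \<in> {a..b} \<Longrightarrow> integral {a..x} v = integral {a..x} w"
  shows "AE x in M. v x = w x"
proof -
  have "AE x in M. v x - w x = 0"
    using v z by (intro primitive_zero_imp_AE_zero LL_diff)
      (auto simp: Henstock_Kurzweil_Integration.integral_diff LL_integrable_on)
  then show ?thesis by simp
qed

section \<open>Absolutely continuous functions with square-integrable derivative\<close>

text \<open>These are the continuous representatives of \<open>H\<^sup>1\<close> functions. The derivative is an argument of its
  own because it is known only almost everywhere and because weak limits of derivatives have to be
  named.\<close>

definition AC :: "(real \<Rightarrow> real) \<Rightarrow> (real \<Rightarrow> real) \<Rightarrow> bool" where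
  "AC f v \<longleftrightarrow> v \<in> LL \<and> (\<forall>x\<in>{a..b}. integral {a..x} v = f x - f a)"

lemma AC_LL: "AC f v \<Longrightarrow> v \<in> LL" by (simp add: AC_def)

lemma AC_diff_eq:
  assumes "AC f v" "a \<le> x" "x \<le> y" "y \<le> b" shows "f y - f x = integral {x..y} v"
  using assms LL_primitive_split[of v x y] by (simp add: AC_def)

text \<open>Hoelder continuity with exponent \<open>1/2\<close>: the Cauchy-Schwarz inequality against an indicator. It supplies
  the equicontinuity for the compactness theorem below.\<close>

lemma AC_holder:
  assumes "AC f v" "x \<in> {a..b}" "y \<in> {a..b}" shows "\<bar>f y - f x\<bar> \<le> nrm v * sqrt \<bar>y - x\<bar>"
proof (cases "x \<le> y")
  case True
  then show ?thesis using AC_diff_eq[of f v x y] LL_primitive_bound[of v x y] assms AC_LL by auto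
next
  case False
  then show ?thesis using AC_diff_eq[of f v y x] LL_primitive_bound[of v y x] assms AC_LL by auto
qed

lemma AC_bound: assumes "AC f v" "x \<in> {a..b}" shows "\<bar>f x\<bar> \<le> \<bar>f a\<bar> + nrm v * sqrt (b - a)"
proof -
  have "\<bar>f x - f a\<bar> \<le> nrm v * sqrt \<bar>x - a\<bar>" using assms ab by (intro AC_holder) auto
  also have "\<dots> \<le> nrm v * sqrt (b - a)" using assms by (intro mult_left_mono) auto
  finally show ?thesis by simp
qed

lemma AC_prim: "v \<in> LL \<Longrightarrow> AC (\<lambda>x. c + integral {a..x} v) v"
  by (simp add: AC_def)

lemma AC_cont: assumes "AC f v" shows "continuous_on {a..b} f"
proof -
  have "continuous_on {a..b} (\<lambda>x. f a + integral {a..x} v)"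
    using LL_integrable_on[OF AC_LL[OF assms], of a b]
    by (intro continuous_intros indefinite_integral_continuous_1) auto
  then show ?thesis
    by (rule continuous_on_eq) (use assms in \<open>simp add: AC_def\<close>)
qed

lemma AC_fLL: "AC f v \<Longrightarrow> f \<in> LL" using AC_cont LL_cont by blast

lemma cont_comp: "continuous_on UNIV \<kappa> \<Longrightarrow> continuous_on {a..b} f \<Longrightarrow> continuous_on {a..b} (\<lambda>x. \<kappa> (f x :: real) :: real)"
  by (rule continuous_on_compose2[of UNIV]) auto

lemma AC_comp_LL: "continuous_on UNIV \<kappa> \<Longrightarrow> AC f v \<Longrightarrow> (\<lambda>x. \<kappa> (f x :: real) :: real) \<in> LL"
  by (rule LL_cont, rule cont_comp, assumption, erule AC_cont)

text \<open>Comparison of \<open>f\<close> with the constant \<open>f a\<close>: bounds for \<open>f\<close> and its derivative in the mean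
  bound the values.\<close>

lemma AC_left_bound: assumes f: "AC f v" shows "\<bar>f a\<bar> \<le> nrm f / sqrt (b - a) + nrm v * sqrt (b - a)"
proof -
  have sq: "0 < sqrt (b - a)" using ab by simp
  have fL: "f \<in> LL" by (rule AC_fLL[OF f])
  have "\<bar>f a\<bar> * sqrt (b - a) = nrm (\<lambda>x. f x + (f a - f x))" by (simp add: nrm_const)
  also have "\<dots> \<le> nrm f + nrm (\<lambda>x. f a - f x)" using fL by (intro nrm_triangle) auto
  also have "nrm (\<lambda>x. f a - f x) \<le> nrm (\<lambda>x. nrm v * sqrt (b - a))"
  proof (rule nrm_mono)
    fix x assume x: "x \<in> {a<..<b}"
    have "\<bar>f a - f x\<bar> \<le> nrm v * sqrt \<bar>a - x\<bar>" using x ab by (intro AC_holder[OF f]) auto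
    also have "\<dots> \<le> nrm v * sqrt (b - a)" using x by (intro mult_left_mono) auto
    finally show "\<bar>f a - f x\<bar> \<le> \<bar>nrm v * sqrt (b - a)\<bar>" by simp
  qed (use fL in auto)
  also have "\<dots> = nrm v * sqrt (b - a) * sqrt (b - a)" unfolding nrm_const using sq by simp
  finally show ?thesis using sq by (simp add: field_simps)
qed

lemma AC_cong:
  assumes "AC f v" "\<And>x. x \<in> {a..b} \<Longrightarrow> g x = f x" "AE x in M. w x = v x" shows "AC g w"
  using assms LL_AE'[of v w] LL_primitive_cong_AE[of v w a] ab unfolding AC_def by auto

lemma AC_cong': 
  assumes "AC f v" "\<And>x. x \<in> {a..b} \<Longrightarrow> g x = f x" "\<And>x. x \<in> {a<..<b} \<Longrightarrow> w x = v x" shows "AC g w"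
  using assms(1,2) by (rule AC_cong) (use assms(3) in auto)

lemma AC_unique: assumes "AC f v" "AC g w" "\<And>x. x \<in> {a..b} \<Longrightarrow> f x = g x" shows "AE x in M. v x = w x"
proof (rule primitive_eq_imp_AE_eq)
  fix x assume x: "x \<in> {a..b}"
  show "integral {a..x} v = integral {a..x} w"
    using assms(1,2) assms(3)[OF x] assms(3)[of a] x ab unfolding AC_def by auto
qed (use assms AC_LL in auto)

lemma AC_add: assumes "AC f v" "AC g w" shows "AC (\<lambda>x. f x + g x) (\<lambda>x. v x + w x)"
  using assms unfolding AC_def
  by (auto simp: Henstock_Kurzweil_Integration.integral_add LL_integrable_on)

lemma AC_scale: assumes "AC f v" shows "AC (\<lambda>x. c * f x) (\<lambda>x. c * v x)"
  using assms unfolding AC_def by (auto simp: right_diff_distrib)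

lemma AC_const: "AC (\<lambda>x. c) (\<lambda>x. 0)" by (simp add: AC_def)

lemma AC_minus: assumes "AC f v" shows "AC (\<lambda>x. - f x) (\<lambda>x. - v x)"
  using AC_scale[OF assms, of "-1"] by simp

lemma AC_diff: assumes "AC f v" "AC g w" shows "AC (\<lambda>x. f x - g x) (\<lambda>x. v x - w x)"
  using AC_add[OF assms(1) AC_minus[OF assms(2)]] by simp

lemma AC_C1:
  assumes d: "\<And>x. x \<in> {a..b} \<Longrightarrow> (f has_real_derivative v x) (at x)" and c: "continuous_on {a..b} v"
  shows "AC f v"
  unfolding AC_def
proof (intro conjI ballI)
  show "v \<in> LL" using c by (rule LL_cont)
  fix x assume x: "x \<in> {a..b}"
  have "(v has_integral (f x - f a)) {a..x}"
  proof (rule fundamental_theorem_of_calculus)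
    fix t assume "t \<in> {a..x}"
    then have "(f has_real_derivative v t) (at t)" using x by (intro d) auto
    then show "(f has_vector_derivative v t) (at t within {a..x})"
      by (rule has_vector_derivative_at_within[OF has_real_derivative_iff_has_vector_derivative[THEN iffD1]])
  qed (use x in auto)
  then show "integral {a..x} v = f x - f a" by (simp add: integral_unique)
qed

text \<open>On a short interval the mean value theorem gives \<open>\<kappa> (f y) - \<kappa> (f x) = \<kappa>' (f t) * (f y - f x)\<close>, and
  uniform continuity of \<open>\<kappa>' \<circ> f\<close> compares this with the integral of \<open>(\<kappa>' \<circ> f) * v\<close> up to \<open>e\<close> times the
  integral of \<open>\<bar>v\<bar>\<close>. These errors add up along a subdivision, so the difference \<open>D\<close> of the two sides
  varies by at most a multiple of \<open>e\<close>, for every \<open>e\<close>.\<close>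

lemma AC_chain:
  assumes f: "AC f v" and k: "\<And>r. (\<kappa> has_real_derivative \<kappa>' r) (at r)" and c: "continuous_on UNIV \<kappa>'"
  shows "AC (\<lambda>x. \<kappa> (f x)) (\<lambda>x. \<kappa>' (f x) * v x)"
proof -
  have v: "v \<in> LL" using f by (rule AC_LL)
  have fc: "continuous_on {a..b} f" using f by (rule AC_cont)
  have kc: "continuous_on {a..b} (\<lambda>x. \<kappa>' (f x))"
    using continuous_on_compose2[OF c fc] by simp
  have w: "(\<lambda>x. \<kappa>' (f x) * v x) \<in> LL" using kc v by (rule LL_cont_mult)
  have vabs: "(\<lambda>x. \<bar>v x\<bar>) integrable_on {x..y}" if "{x..y} \<subseteq> {a..b}" for x y
    using LL_abs_integrable[OF v] that absolutely_integrable_on_subinterval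
    by (force simp: absolutely_integrable_on_def)
  define D where "D x = \<kappa> (f x) - integral {a..x} (\<lambda>x. \<kappa>' (f x) * v x)" for x
  have est: "\<bar>D y - D x\<bar> \<le> e * integral {x..y} (\<lambda>t. \<bar>v t\<bar>)" if e: "e > 0" and xy0: "a \<le> x" "x \<le> y" "y \<le> b" for e x y
  proof -
    have "uniformly_continuous_on {a..b} (\<lambda>x. \<kappa>' (f x))"
      using kc compact_Icc by (rule compact_uniformly_continuous)
    then obtain d where d: "d > 0" "\<And>s t. s \<in> {a..b} \<Longrightarrow> t \<in> {a..b} \<Longrightarrow> \<bar>s - t\<bar> < d \<Longrightarrow> \<bar>\<kappa>' (f s) - \<kappa>' (f t)\<bar> < e"
      using e unfolding uniformly_continuous_on_def dist_real_def by meson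
    have loc: "\<bar>D y - D x\<bar> \<le> e * integral {x..y} (\<lambda>t. \<bar>v t\<bar>)" if xy: "a \<le> x" "x \<le> y" "y \<le> b" "y - x < d" for x y
    proof -
      obtain t where t: "t \<in> {x..y}" "\<kappa> (f y) - \<kappa> (f x) = \<kappa>' (f t) * (f y - f x)"
      proof (cases "f x = f y")
        case True
        then show ?thesis using that[of x] xy by auto
      next
        case False
        define l u where "l = min (f x) (f y)" and "u = max (f x) (f y)"
        have "l < u" using False by (auto simp: l_def u_def)
        then obtain z where z: "l < z" "z < u" "\<kappa> u - \<kappa> l = (u - l) * \<kappa>' z"
          using MVT2[of l u \<kappa> \<kappa>'] k by blast
        have "is_interval (f ` {x..y})"
          using continuous_on_subset[OF fc, of "{x..y}"] xy
          by (auto intro!: connected_continuous_image simp: is_interval_connected_1)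
        moreover have "l \<in> f ` {x..y}" "u \<in> f ` {x..y}" using xy by (auto simp: l_def u_def min_def max_def)
        ultimately have "z \<in> f ` {x..y}" using z by (meson mem_is_interval_1_I less_imp_le)
        then obtain t where "t \<in> {x..y}" "f t = z" by auto
        moreover have "\<kappa> (f y) - \<kappa> (f x) = \<kappa>' z * (f y - f x)"
          using z(3) by (cases "f x \<le> f y") (auto simp: l_def u_def algebra_simps)
        ultimately show ?thesis using that by blast
      qed
      have i1: "(\<lambda>s. \<kappa>' (f t) * v s) integrable_on {x..y}"
        using LL_integrable_on[OF v, of x y] xy by (intro integrable_on_mult_right) auto
      have i2: "(\<lambda>s. \<kappa>' (f s) * v s) integrable_on {x..y}"
        using LL_integrable_on[OF w, of x y] xy by auto
      have "D y - D x = \<kappa>' (f t) * integral {x..y} v - integral {x..y} (\<lambda>s. \<kappa>' (f s) * v s)"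
        using t(2) LL_primitive_split[OF w xy(1-3)] AC_diff_eq[OF f xy(1-3)] by (simp add: D_def)
      also have "\<dots> = integral {x..y} (\<lambda>s. \<kappa>' (f t) * v s - \<kappa>' (f s) * v s)"
        using i1 i2 by (simp add: Henstock_Kurzweil_Integration.integral_diff)
      finally have eq: "D y - D x = integral {x..y} (\<lambda>s. \<kappa>' (f t) * v s - \<kappa>' (f s) * v s)" .
      have "norm (integral {x..y} (\<lambda>s. \<kappa>' (f t) * v s - \<kappa>' (f s) * v s)) \<le> integral {x..y} (\<lambda>s. e * \<bar>v s\<bar>)"
      proof (rule integral_norm_bound_integral)
        show "(\<lambda>s. \<kappa>' (f t) * v s - \<kappa>' (f s) * v s) integrable_on {x..y}"
          using i1 i2 by (rule integrable_diff)
        show "(\<lambda>s. e * \<bar>v s\<bar>) integrable_on {x..y}"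
          using vabs[of x y] xy by (intro integrable_on_mult_right) auto
        fix s assume s: "s \<in> {x..y}"
        have "\<bar>t - s\<bar> < d" using s t xy by auto
        then have "\<bar>\<kappa>' (f t) - \<kappa>' (f s)\<bar> \<le> e" using d(2)[of t s] s t xy by auto
        then show "norm (\<kappa>' (f t) * v s - \<kappa>' (f s) * v s) \<le> e * \<bar>v s\<bar>"
          by (simp add: abs_mult mult_right_mono flip: left_diff_distrib)
      qed
      then show ?thesis using eq by simp
    qed
    \<comment> \<open>Bolzano induction removes the restriction to short intervals.\<close>
    have "x \<le> y \<Longrightarrow> a \<le> x \<and> y \<le> b \<longrightarrow> \<bar>D y - D x\<bar> \<le> e * integral {x..y} (\<lambda>t. \<bar>v t\<bar>)"
    proof (induction x y rule: Bolzano)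
      case (trans x y z)
      show ?case
      proof
        assume "a \<le> x \<and> z \<le> b"
        with trans have "\<bar>D y - D x\<bar> \<le> e * integral {x..y} (\<lambda>t. \<bar>v t\<bar>)" "\<bar>D z - D y\<bar> \<le> e * integral {y..z} (\<lambda>t. \<bar>v t\<bar>)"
          "integral {x..z} (\<lambda>t. \<bar>v t\<bar>) = integral {x..y} (\<lambda>t. \<bar>v t\<bar>) + integral {y..z} (\<lambda>t. \<bar>v t\<bar>)"
          using Henstock_Kurzweil_Integration.integral_combine[of x y z "\<lambda>t. \<bar>v t\<bar>"] vabs[of x z] by auto
        then show "\<bar>D z - D x\<bar> \<le> e * integral {x..z} (\<lambda>t. \<bar>v t\<bar>)" by (simp add: distrib_left)
      qed
    next
      case (local z)
      show ?case using loc d(1) by (intro exI[of _ d]) auto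
    qed
    then show ?thesis using xy0 by simp
  qed
  have const: "D x = D a" if "x \<in> {a..b}" for x
  proof -
    define I where "I = integral {a..x} (\<lambda>t. \<bar>v t\<bar>)"
    have I: "0 \<le> I" unfolding I_def using vabs that by (intro Henstock_Kurzweil_Integration.integral_nonneg) auto
    have "\<bar>D x - D a\<bar> \<le> 0 + e" if "e > 0" for e
    proof -
      have "\<bar>D x - D a\<bar> \<le> e / (I + 1) * I" unfolding I_def[symmetric] 
        using est[of "e / (I + 1)" a x] \<open>e > 0\<close> I \<open>x \<in> {a..b}\<close> by (simp add: I_def)
      also have "\<dots> \<le> e" using I \<open>e > 0\<close> by (simp add: field_simps)
      finally show ?thesis by simp
    qed
    then have "\<bar>D x - D a\<bar> \<le> 0" by (rule field_le_epsilon)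
    then show ?thesis by simp
  qed
  show ?thesis unfolding AC_def
  proof (intro conjI w ballI)
    fix x assume "x \<in> {a..b}"
    from const[OF this] show "integral {a..x} (\<lambda>x. \<kappa>' (f x) * v x) = \<kappa> (f x) - \<kappa> (f a)"
      by (simp add: D_def)
  qed
qed

text \<open>Polarisation of the chain rule for squares.\<close>

lemma AC_mult:
  assumes f: "AC f v" and g: "AC g w"
  shows "AC (\<lambda>x. f x * g x) (\<lambda>x. f x * w x + v x * g x)"
proof -
  have sq: "AC (\<lambda>x. h x * h x) (\<lambda>x. 2 * h x * z x)" if "AC h z" for h z
    by (rule AC_chain[OF that, of "\<lambda>r. r * r" "\<lambda>r. 2 * r"]) (auto intro!: derivative_eq_intros continuous_intros)
  have "AC (\<lambda>x. (1/4) * ((f x + g x) * (f x + g x) - (f x - g x) * (f x - g x)))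
      (\<lambda>x. (1/4) * (2 * (f x + g x) * (v x + w x) - 2 * (f x - g x) * (v x - w x)))"
    using f g by (intro AC_scale AC_diff sq AC_add)
  then show ?thesis by (rule AC_cong') (auto simp: algebra_simps)
qed

lemma AC_by_parts:
  assumes f: "AC f v" and g: "AC g w"
  shows "IP f w + IP v g = f b * g b - f a * g a"
proof -
  have m: "AC (\<lambda>x. f x * g x) (\<lambda>x. f x * w x + v x * g x)" using f g by (rule AC_mult)
  have "IP f w + IP v g = integral\<^sup>L M (\<lambda>x. f x * w x + v x * g x)"
    unfolding ip_L2_def using AC_fLL[OF f] AC_fLL[OF g] AC_LL[OF f] AC_LL[OF g] by simp
  also have "\<dots> = integral {a..b} (\<lambda>x. f x * w x + v x * g x)"
    using AC_LL[OF m] by (rule LINT_M)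
  also have "\<dots> = f b * g b - f a * g a" using AC_diff_eq[OF m, of a b] ab by simp
  finally show ?thesis .
qed

section \<open>Completeness and weak compactness\<close>

text \<open>A Cauchy sequence in the mean square is Cauchy in the mean, so a subsequence converges almost
  everywhere; Fatou's lemma then gives convergence to its limit in the mean square.\<close>

lemma LL_complete:
  assumes f: "\<And>k::nat. f k \<in> LL"
    and cau: "\<And>e. e > 0 \<Longrightarrow> \<exists>N. \<forall>i\<ge>N. \<forall>j\<ge>N. nrm (\<lambda>x. f i x - f j x) < e"
  obtains g where "g \<in> LL" "(\<lambda>k. nrm (\<lambda>x. f k x - g x)) \<longlonglongrightarrow> 0"
proof -
  have [measurable]: "f k \<in> borel_measurable M" for k using f LL_meas by blast
  have l1: "integral\<^sup>L M (\<lambda>x. norm (h x)) \<le> nrm h * sqrt (b - a)" if h: "h \<in> LL" for h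
  proof -
    have ha: "(\<lambda>x. \<bar>h x\<bar>) \<in> LL"
      using LL_meas[OF h] LL_sq[OF h] by (intro LL_I) auto
    have "integral\<^sup>L M (\<lambda>x. norm (h x)) = IP (\<lambda>x. \<bar>h x\<bar>) (\<lambda>x. 1)" by (simp add: ip_L2_def)
    also have "\<dots> \<le> nrm (\<lambda>x. \<bar>h x\<bar>) * nrm (\<lambda>x. 1)" using Cauchy_Schwarz[OF ha LL_const[of 1]] by simp
    also have "nrm (\<lambda>x. \<bar>h x\<bar>) = nrm h" by (simp add: nrm_def ip_L2_def)
    finally show ?thesis using ab by (simp add: nrm_const)
  qed
  have L1: "\<exists>N. \<forall>i\<ge>N. \<forall>j\<ge>N. LINT x|M. norm (f i x - f j x) < e" if "e > 0" for e
  proof -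
    have "e / (sqrt (b - a) + 1) > 0" using that ab by (simp add: add_nonneg_pos)
    then obtain N where N: "\<And>i j. i \<ge> N \<Longrightarrow> j \<ge> N \<Longrightarrow> nrm (\<lambda>x. f i x - f j x) < e / (sqrt (b - a) + 1)"
      using cau by meson
    have "LINT x|M. norm (f i x - f j x) < e" if "i \<ge> N" "j \<ge> N" for i j
    proof -
      have p: "0 < sqrt (b - a) + 1" using ab by (simp add: add_nonneg_pos)
      have "LINT x|M. norm (f i x - f j x) \<le> nrm (\<lambda>x. f i x - f j x) * sqrt (b - a)"
        using f by (intro l1) auto
      also have "\<dots> \<le> nrm (\<lambda>x. f i x - f j x) * (sqrt (b - a) + 1)" by (intro mult_left_mono) auto
      also have "\<dots> < e / (sqrt (b - a) + 1) * (sqrt (b - a) + 1)"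
        using N[OF that] p by (intro mult_strict_right_mono)
      also have "\<dots> = e" using p by simp
      finally show ?thesis .
    qed
    then show ?thesis by blast
  qed
  obtain r where r: "strict_mono r" "AE x in M. Cauchy (\<lambda>i. f (r i) x)"
  proof (rule cauchy_L1_AE_cauchy_subseq[of M f])
    show "integrable M (f n)" for n using f by (rule LL_integrable)
    show "\<exists>N. \<forall>i\<ge>N. \<forall>j\<ge>N. LINT x|M. norm (f i x - f j x) < e" if "e > 0" for e using L1[OF that] .
  qed (rule that)
  define g where "g x = lim (\<lambda>i. f (r i) x)" for x
  have gm [measurable]: "g \<in> borel_measurable M" unfolding g_def by measurable
  have conv: "AE x in M. (\<lambda>i. f (r i) x) \<longlonglongrightarrow> g x"
    using r(2) by (rule eventually_mono) (simp add: g_def Cauchy_convergent_iff convergent_LIMSEQ_iff)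
  have key: "(\<lambda>x. f k x - g x) \<in> LL \<and> nrm (\<lambda>x. f k x - g x) \<le> e"
    if e: "e > 0" and kN: "\<And>j. j \<ge> N \<Longrightarrow> nrm (\<lambda>x. f k x - f j x) < e" for e k N
  proof -
    have "(\<integral>\<^sup>+x. ennreal ((f k x - g x) * (f k x - g x)) \<partial>M)
        = (\<integral>\<^sup>+x. liminf (\<lambda>i. ennreal ((f k x - f (r i) x) * (f k x - f (r i) x))) \<partial>M)"
    proof (rule nn_integral_cong_AE, use conv in eventually_elim)
      case (elim x)
      then have "(\<lambda>i. ennreal ((f k x - f (r i) x) * (f k x - f (r i) x))) \<longlonglongrightarrow> ennreal ((f k x - g x) * (f k x - g x))"
        by (intro tendsto_ennrealI tendsto_intros)
      then show ?case by (intro lim_imp_Liminf[symmetric]) auto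
    qed
    also have "\<dots> \<le> liminf (\<lambda>i. \<integral>\<^sup>+x. ennreal ((f k x - f (r i) x) * (f k x - f (r i) x)) \<partial>M)"
      by (rule nn_integral_liminf) measurable
    also have "\<dots> \<le> liminf (\<lambda>i. ennreal (e * e))"
    proof (rule Liminf_mono, rule eventually_sequentiallyI[of N])
      fix i assume "N \<le> i"
      then have "N \<le> r i" using seq_suble[OF r(1), of i] by simp
      then have lt: "nrm (\<lambda>x. f k x - f (r i) x) < e" by (rule kN)
      have "(\<integral>\<^sup>+x. ennreal ((f k x - f (r i) x) * (f k x - f (r i) x)) \<partial>M)
          = ennreal (IP (\<lambda>x. f k x - f (r i) x) (\<lambda>x. f k x - f (r i) x))"
        unfolding ip_L2_def using f by (intro nn_integral_eq_integral) auto
      also have "\<dots> \<le> ennreal (e * e)"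
        unfolding nrm_sq'[symmetric] using lt e by (intro ennreal_leI mult_mono) auto
      finally show "(\<integral>\<^sup>+x. ennreal ((f k x - f (r i) x) * (f k x - f (r i) x)) \<partial>M) \<le> ennreal (e * e)" .
    qed
    also have "\<dots> = ennreal (e * e)" by (simp add: Liminf_const)
    finally have le: "(\<integral>\<^sup>+x. ennreal ((f k x - g x) * (f k x - g x)) \<partial>M) \<le> ennreal (e * e)" .
    have int: "integrable M (\<lambda>x. (f k x - g x) * (f k x - g x))"
    proof (rule integrableI_nonneg)
      show "(\<integral>\<^sup>+x. ennreal ((f k x - g x) * (f k x - g x)) \<partial>M) < \<infinity>"
        using le by (rule order_le_less_trans) (simp add: ennreal_mult_less_top)
    qed auto
    have L: "(\<lambda>x. f k x - g x) \<in> LL" by (rule LL_I[OF _ int]) measurable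
    have "ennreal (IP (\<lambda>x. f k x - g x) (\<lambda>x. f k x - g x)) \<le> ennreal (e * e)"
      using le nn_integral_eq_integral[OF int] by (simp add: ip_L2_def)
    then have "IP (\<lambda>x. f k x - g x) (\<lambda>x. f k x - g x) \<le> e * e" using e by (simp add: ennreal_le_iff)
    then have "sqrt (IP (\<lambda>x. f k x - g x) (\<lambda>x. f k x - g x)) \<le> sqrt (e * e)" by (rule real_sqrt_le_mono)
    then have "nrm (\<lambda>x. f k x - g x) \<le> e" using e by (simp add: nrm_def)
    with L show ?thesis by simp
  qed
  have "g \<in> LL"
  proof -
    obtain N where "\<And>i j. i \<ge> N \<Longrightarrow> j \<ge> N \<Longrightarrow> nrm (\<lambda>x. f i x - f j x) < 1" using cau[of 1] by auto
    then have "(\<lambda>x. f N x - g x) \<in> LL" using key[of 1 N N] by auto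
    then show ?thesis using LL_diff[OF f[of N]] by fastforce
  qed
  moreover have "(\<lambda>k. nrm (\<lambda>x. f k x - g x)) \<longlonglongrightarrow> 0"
  proof (rule LIMSEQ_I)
    fix e :: real assume e: "e > 0"
    then obtain N where N: "\<And>i j. i \<ge> N \<Longrightarrow> j \<ge> N \<Longrightarrow> nrm (\<lambda>x. f i x - f j x) < e / 2" using cau[of "e/2"] by auto
    have "norm (nrm (\<lambda>x. f k x - g x) - 0) < e" if "k \<ge> N" for k
      using key[of "e/2" N k] N that e by fastforce
    then show "\<exists>N. \<forall>k\<ge>N. norm (nrm (\<lambda>x. f k x - g x) - 0) < e" by blast
  qed
  ultimately show ?thesis using that by blast
qed

lemma parallelogram:
  assumes "f \<in> LL" "g \<in> LL"
  shows "IP (\<lambda>x. f x - g x) (\<lambda>x. f x - g x) = 2 * IP f f + 2 * IP g g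
    - 4 * IP (\<lambda>x. (1/2) * (f x + g x)) (\<lambda>x. (1/2) * (f x + g x))"
  using assms by (simp add: IP_simps IP_commute[of g f] algebra_simps)

lemma nrm_le_iff: "0 \<le> C \<Longrightarrow> nrm f \<le> C \<longleftrightarrow> IP f f \<le> C * C"
  by (metis nrm_sq' nrm_nonneg mult_mono' power2_eq_square power2_le_imp_le)

text \<open>The functions of norm at most \<open>C\<close> whose primitive and whose pairing with \<open>g\<close> are \<open>d\<close>-close to the
  prescribed limits form a convex set \<open>A d\<close>, nonempty for \<open>d > 0\<close>. By the parallelogram identity,
  almost minimal elements of \<open>A (1 / (k + 1))\<close> form a Cauchy sequence, and its limit satisfies both
  limit conditions exactly.\<close>

lemma weak_limit_against:
  assumes u: "\<And>k. u k \<in> LL" and C: "\<And>k. nrm (u k) \<le> C"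
    and g: "g \<in> LL" and l: "(\<lambda>k. IP (u k) g) \<longlonglongrightarrow> l"
    and U: "uniform_limit {a..b} (\<lambda>k x. integral {a..x} (u k)) U sequentially"
  shows "\<exists>v\<in>LL. (\<forall>x\<in>{a..b}. integral {a..x} v = U x) \<and> IP v g = l \<and> nrm v \<le> C"
proof -
  have C0: "0 \<le> C" using C[of 0] nrm_nonneg[of "u 0"] by linarith
  define A where "A d = {f \<in> LL. nrm f \<le> C \<and> \<bar>IP f g - l\<bar> \<le> d \<and> (\<forall>x\<in>{a..b}. \<bar>integral {a..x} f - U x\<bar> \<le> d)}" for d
  have ne: "A d \<noteq> {}" if "d > 0" for d
  proof -
    have "eventually (\<lambda>k. \<bar>IP (u k) g - l\<bar> < d) sequentially"
      using l \<open>d > 0\<close> by (auto simp: tendsto_iff dist_real_def)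
    moreover have "eventually (\<lambda>k. \<forall>x\<in>{a..b}. \<bar>integral {a..x} (u k) - U x\<bar> < d) sequentially"
      using U \<open>d > 0\<close> by (auto simp: uniform_limit_iff dist_real_def)
    ultimately have "eventually (\<lambda>k. u k \<in> A d) sequentially"
      by eventually_elim (use u C in \<open>force simp: A_def\<close>)
    then show ?thesis by (auto simp: eventually_sequentially)
  qed
  have mono: "A d \<subseteq> A d'" if "d \<le> d'" for d d' using that unfolding A_def by force
  have conv: "(\<lambda>x. (1/2) * (f x + h x)) \<in> A d" if "f \<in> A d" "h \<in> A d" for f h d
  proof -
    have fh: "f \<in> LL" "h \<in> LL" using that by (auto simp: A_def)
    have "nrm (\<lambda>x. (1/2) * (f x + h x)) \<le> C"
      using nrm_triangle[OF fh] that unfolding nrm_scale by (auto simp: A_def)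
    moreover have eq: "IP (\<lambda>x. (1/2) * (f x + h x)) g - l = ((IP f g - l) + (IP h g - l)) / 2"
      using fh g by (simp add: IP_simps field_simps)
    have "\<bar>IP f g - l\<bar> \<le> d" "\<bar>IP h g - l\<bar> \<le> d" using that by (auto simp: A_def)
    then have "\<bar>IP (\<lambda>x. (1/2) * (f x + h x)) g - l\<bar> \<le> d" unfolding eq by (auto simp: abs_le_iff)
    moreover have "\<bar>integral {a..x} (\<lambda>x. (1/2) * (f x + h x)) - U x\<bar> \<le> d" if x: "x \<in> {a..b}" for x
    proof -
      have "integral {a..x} (\<lambda>x. (1/2) * (f x + h x)) = (1/2) * (integral {a..x} f + integral {a..x} h)"
        unfolding integral_mult_right using fh x by (simp add: Henstock_Kurzweil_Integration.integral_add LL_integrable_on)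
      then have "integral {a..x} (\<lambda>x. (1/2) * (f x + h x)) - U x = ((integral {a..x} f - U x) + (integral {a..x} h - U x)) / 2"
        by (simp add: field_simps)
      moreover have "\<bar>integral {a..x} f - U x\<bar> \<le> d" "\<bar>integral {a..x} h - U x\<bar> \<le> d"
        using x \<open>f \<in> A d\<close> \<open>h \<in> A d\<close> by (auto simp: A_def)
      ultimately show ?thesis by (simp only: abs_le_iff) argo
    qed
    ultimately show ?thesis using fh by (auto simp: A_def)
  qed
  define d where "d k = 1 / real (Suc k)" for k
  have d0: "d k > 0" for k by (simp add: d_def)
  have dmono: "d j \<le> d k" if "k \<le> j" for j k using that by (simp add: d_def frac_le)
  have dlim: "d \<longlonglongrightarrow> 0" unfolding d_def using LIMSEQ_inverse_real_of_nat by (simp add: inverse_eq_divide)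
  \<comment> \<open>The infimum \<open>s k\<close> increases with \<open>k\<close> and is bounded by \<open>C * C\<close>, hence it converges.\<close>
  define s where "s k = Inf ((\<lambda>f. IP f f) ` A (d k))" for k
  have bdd: "bdd_below ((\<lambda>f. IP f f) ` A e)" for e by (rule bdd_belowI[of _ 0]) auto
  have s_le: "s k \<le> IP f f" if "f \<in> A (d k)" for f k
    unfolding s_def using that bdd by (intro cInf_lower) auto
  have s_mono: "s k \<le> s j" if "k \<le> j" for k j
    unfolding s_def using that ne d0 mono[OF dmono] bdd by (intro cInf_superset_mono image_mono) auto
  have s_bd: "s k \<le> C * C" for k
  proof -
    obtain f where f: "f \<in> A (d k)" using ne[OF d0] by blast
    then have "IP f f \<le> C * C" using nrm_le_iff[OF C0, of f] by (simp add: A_def)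
    then show ?thesis using s_le[OF f] by simp
  qed
  have "convergent s"
  proof -
    have "incseq s" "\<forall>i. s i \<le> C * C" using s_mono s_bd by (auto simp: incseq_def)
    then obtain L where "s \<longlonglongrightarrow> L" using incseq_convergent by blast
    then show ?thesis by (auto simp: convergent_def)
  qed
  then have sC: "Cauchy s" by (simp add: Cauchy_convergent_iff)
  have "\<exists>f. f \<in> A (d k) \<and> IP f f < s k + d k" for k
  proof -
    have "Inf ((\<lambda>f. IP f f) ` A (d k)) < s k + d k" unfolding s_def using d0[of k] by simp
    then show ?thesis using cInf_lessD[of "(\<lambda>f. IP f f) ` A (d k)"] ne[OF d0] by auto
  qed
  then obtain f where f: "\<And>k. f k \<in> A (d k)" "\<And>k. IP (f k) (f k) < s k + d k" by metis
  have fL: "f k \<in> LL" for k using f(1)[of k] by (simp add: A_def)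
  have est: "IP (\<lambda>x. f j x - f k x) (\<lambda>x. f j x - f k x) \<le> 2 * (s j - s k) + 4 * d k" if "k \<le> j" for j k
  proof -
    have "s k \<le> IP (\<lambda>x. (1/2) * (f j x + f k x)) (\<lambda>x. (1/2) * (f j x + f k x))"
      using f(1) mono[OF dmono[OF that]] by (intro s_le conv) auto
    then show ?thesis using parallelogram[OF fL[of j] fL[of k]] f(2)[of j] f(2)[of k] dmono[OF that] by simp
  qed
  obtain v where v: "v \<in> LL" "(\<lambda>k. nrm (\<lambda>x. f k x - v x)) \<longlonglongrightarrow> 0"
  proof (rule LL_complete[of f, OF fL])
    fix e :: real assume e: "e > 0"
    then have e2: "e * e / 8 > 0" by simp
    then have "eventually (\<lambda>k. d k < e * e / 8) sequentially"
      using dlim by (rule order_tendstoD(2)[rotated])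
    moreover obtain N1 where N1: "\<And>i j. i \<ge> N1 \<Longrightarrow> j \<ge> N1 \<Longrightarrow> \<bar>s i - s j\<bar> < e * e / 8"
      using sC e2 unfolding Cauchy_def dist_real_def by meson
    ultimately obtain N where N: "\<And>k. k \<ge> N \<Longrightarrow> d k < e * e / 8" "N \<ge> N1"
      unfolding eventually_sequentially by (metis max.bounded_iff max.cobounded2)
    have *: "nrm (\<lambda>x. f j x - f k x) < e" if "N \<le> k" "k \<le> j" for j k
    proof -
      have aux: "I < p" if "I \<le> 2 * x + 4 * y" "y < p / 8" "\<bar>x\<bar> < p / 8" "0 < p / 8" for I x y p :: real
        using that by linarith
      have "\<bar>s j - s k\<bar> < e * e / 8" using N(2) that by (intro N1) auto
      from aux[OF est[OF that(2)] N(1)[OF that(1)] this e2]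
      have "IP (\<lambda>x. f j x - f k x) (\<lambda>x. f j x - f k x) < e * e" .
      then have "sqrt (IP (\<lambda>x. f j x - f k x) (\<lambda>x. f j x - f k x)) < sqrt (e * e)" by (rule real_sqrt_less_mono)
      then show ?thesis using e by (simp add: nrm_def)
    qed
    have sym: "nrm (\<lambda>x. f i x - f j x) = nrm (\<lambda>x. f j x - f i x)" for i j
      using nrm_minus[of "\<lambda>x. f i x - f j x"] by simp
    show "\<exists>N. \<forall>i\<ge>N. \<forall>j\<ge>N. nrm (\<lambda>x. f i x - f j x) < e"
    proof (intro exI[of _ N] allI impI)
      fix i j assume "N \<le> i" "N \<le> j"
      then show "nrm (\<lambda>x. f i x - f j x) < e" using *[of i j] *[of j i] sym[of i j] by (cases "i \<le> j") auto
    qed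
  qed auto
  have fAk: "nrm (f k) \<le> C" "\<bar>IP (f k) g - l\<bar> \<le> d k" "\<And>x. x \<in> {a..b} \<Longrightarrow> \<bar>integral {a..x} (f k) - U x\<bar> \<le> d k" for k
    using f(1)[of k] by (auto simp: A_def)
  have IPlim: "(\<lambda>k. IP (f k) h) \<longlonglongrightarrow> IP v h" if h: "h \<in> LL" for h
  proof -
    have "(\<lambda>k. nrm (\<lambda>x. f k x - v x) * nrm h) \<longlonglongrightarrow> 0" using tendsto_mult_left_zero[OF v(2)] .
    moreover have "norm (IP (f k) h - IP v h) \<le> nrm (\<lambda>x. f k x - v x) * nrm h" for k
      using Cauchy_Schwarz[OF LL_diff[OF fL[of k] v(1)] h] IP_diff_left[OF fL[of k] v(1) h] by simp
    ultimately have "(\<lambda>k. IP (f k) h - IP v h) \<longlonglongrightarrow> 0"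
      using Lim_null_comparison[OF always_eventually, of "\<lambda>k. IP (f k) h - IP v h" "\<lambda>k. nrm (\<lambda>x. f k x - v x) * nrm h" sequentially] by simp
    then show ?thesis by (simp add: LIM_zero_iff)
  qed
  have toU: "X \<longlonglongrightarrow> y" if "\<And>k. \<bar>X k - y\<bar> \<le> d k" for X :: "nat \<Rightarrow> real" and y
  proof -
    have "(\<lambda>k. X k - y) \<longlonglongrightarrow> 0"
      by (rule Lim_null_comparison[OF always_eventually dlim]) (simp add: that)
    then show ?thesis by (simp add: LIM_zero_iff)
  qed
  have "(\<lambda>k. IP (f k) g) \<longlonglongrightarrow> l" by (rule toU) (rule fAk(2))
  from LIMSEQ_unique[OF IPlim[OF g] this] have "IP v g = l" .
  moreover have "integral {a..x} v = U x" if x: "x \<in> {a..b}" for x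
  proof -
    have "(\<lambda>k. IP (f k) (indicator {a..x})) \<longlonglongrightarrow> U x"
    proof (rule toU)
      show "\<bar>IP (f k) (indicator {a..x}) - U x\<bar> \<le> d k" for k
        using fAk(3)[OF x, of k] LL_primitive[OF fL, of a x k] x by auto
    qed
    moreover have "(\<lambda>k. IP (f k) (indicator {a..x})) \<longlonglongrightarrow> IP v (indicator {a..x})"
      by (rule IPlim) simp
    ultimately have "IP v (indicator {a..x}) = U x" using LIMSEQ_unique by blast
    then show ?thesis using LL_primitive[OF v(1), of a x] x by auto
  qed
  moreover have "nrm v \<le> C"
  proof -
    have "(\<lambda>k. C + nrm (\<lambda>x. f k x - v x)) \<longlonglongrightarrow> C + 0" using v(2) by (intro tendsto_intros)
    moreover have "nrm v \<le> C + nrm (\<lambda>x. f k x - v x)" for k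
      using nrm_diff_triangle[OF fL[of k] LL_diff[OF fL[of k] v(1)]] fAk(1)[of k] by simp
    ultimately show ?thesis using LIMSEQ_le_const[of "\<lambda>k. C + nrm (\<lambda>x. f k x - v x)" C "nrm v"] by simp
  qed
  ultimately show ?thesis using v(1) by blast
qed

definition weak_conv :: "(nat \<Rightarrow> real \<Rightarrow> real) \<Rightarrow> (real \<Rightarrow> real) \<Rightarrow> bool" where
  "weak_conv u v \<longleftrightarrow> (\<forall>k. u k \<in> LL) \<and> v \<in> LL \<and> (\<forall>g\<in>LL. (\<lambda>k. IP (u k) g) \<longlonglongrightarrow> IP v g)"

lemma weak_convD: "weak_conv u v \<Longrightarrow> g \<in> LL \<Longrightarrow> (\<lambda>k. IP (u k) g) \<longlonglongrightarrow> IP v g"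
  by (simp add: weak_conv_def)

lemma weak_conv_LL: "weak_conv u v \<Longrightarrow> u k \<in> LL" "weak_conv u v \<Longrightarrow> v \<in> LL"
  by (simp_all add: weak_conv_def)

lemma weak_conv_subseq: "weak_conv u v \<Longrightarrow> strict_mono r \<Longrightarrow> weak_conv (\<lambda>k. u (r k)) v"
  unfolding weak_conv_def using LIMSEQ_subseq_LIMSEQ by (fastforce simp: o_def)

lemma weak_conv_add: "weak_conv u v \<Longrightarrow> weak_conv u' v' \<Longrightarrow> weak_conv (\<lambda>k x. u k x + u' k x) (\<lambda>x. v x + v' x)"
  unfolding weak_conv_def by (auto simp: IP_simps intro!: tendsto_intros)

lemma weak_conv_diff: "weak_conv u v \<Longrightarrow> weak_conv u' v' \<Longrightarrow> weak_conv (\<lambda>k x. u k x - u' k x) (\<lambda>x. v x - v' x)"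
  unfolding weak_conv_def by (auto simp: IP_simps intro!: tendsto_intros)

lemma weak_conv_scale: "weak_conv u v \<Longrightarrow> weak_conv (\<lambda>k x. c * u k x) (\<lambda>x. c * v x)"
  unfolding weak_conv_def by (auto simp: IP_simps intro!: tendsto_intros)

lemma weak_conv_const: "v \<in> LL \<Longrightarrow> weak_conv (\<lambda>k. v) v"
  unfolding weak_conv_def by auto

lemma weak_conv_unique:
  assumes "weak_conv u v" "weak_conv u v'" shows "AE x in M. v x = v' x"
proof -
  have L: "v \<in> LL" "v' \<in> LL" using assms weak_conv_LL by auto
  have "IP v g = IP v' g" if "g \<in> LL" for g
    using LIMSEQ_unique[OF weak_convD[OF assms(1) that] weak_convD[OF assms(2) that]] .
  then have "IP (\<lambda>x. v x - v' x) (\<lambda>x. v x - v' x) = 0"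
    using L by (simp add: IP_diff_left)
  from IP_self_0[OF LL_diff[OF L] this] show ?thesis by simp
qed

text \<open>Any cluster value of the pairings with \<open>g\<close> is the pairing with some function whose primitive is \<open>U\<close>;
  since the primitive determines that function, there is only one such value.\<close>

lemma weak_limit:
  assumes u: "\<And>k. u k \<in> LL" and C: "\<And>k. nrm (u k) \<le> C"
    and U: "uniform_limit {a..b} (\<lambda>k x. integral {a..x} (u k)) U sequentially"
  shows "\<exists>v. weak_conv u v \<and> (\<forall>x\<in>{a..b}. integral {a..x} v = U x) \<and> nrm v \<le> C"
proof -
  have "(\<lambda>k. IP (u k) (\<lambda>x. 0)) \<longlonglongrightarrow> 0" by (simp add: IP_simps)
  from weak_limit_against[OF u C LL_const this U]
  obtain v where v: "v \<in> LL" "\<And>x. x \<in> {a..b} \<Longrightarrow> integral {a..x} v = U x" "nrm v \<le> C" by blast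
  have "(\<lambda>k. IP (u k) g) \<longlonglongrightarrow> IP v g" if g: "g \<in> LL" for g
  proof (rule subsequence_principle)
    show "\<bar>IP (u k) g\<bar> \<le> C * nrm g" for k
      using Cauchy_Schwarz[OF u g, of k] mult_right_mono[OF C[of k] nrm_nonneg[of g]] by linarith
    fix r l assume r: "strict_mono r" "(\<lambda>k. IP (u (r k)) g) \<longlonglongrightarrow> l"
    have "uniform_limit {a..b} (\<lambda>k x. integral {a..x} (u (r k))) U sequentially"
      using filterlim_compose[OF U filterlim_subseq[OF r(1)]] by (simp add: o_def)
    from weak_limit_against[of "\<lambda>k. u (r k)", OF u C g r(2) this]
    obtain v' where v': "v' \<in> LL" "\<And>x. x \<in> {a..b} \<Longrightarrow> integral {a..x} v' = U x" "IP v' g = l" by blast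
    have "AE x in M. v' x = v x" using v v' by (intro primitive_eq_imp_AE_eq) auto
    then have "IP v' g = IP v g" using v(1) g by (intro IP_cong_AE) auto
    then show "l = IP v g" using v' by simp
  qed
  then show ?thesis using u v unfolding weak_conv_def by blast
qed

text \<open>Arzela-Ascoli for the functions, and \<open>weak_limit\<close> for their derivatives, whose primitives converge.\<close>

lemma AC_compact:
  fixes f v :: "nat \<Rightarrow> real \<Rightarrow> real"
  assumes f: "\<And>k. AC (f k) (v k)" and C: "\<And>k. nrm (v k) \<le> C" and C0: "\<And>k. \<bar>f k a\<bar> \<le> C0"
  shows "\<exists>r f0 v0. strict_mono r \<and> AC f0 v0 \<and> uniform_limit {a..b} (\<lambda>k. f (r k)) f0 sequentially
    \<and> weak_conv (\<lambda>k. v (r k)) v0 \<and> nrm v0 \<le> C"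
proof -
  have Cn: "0 \<le> C" using C[of 0] nrm_nonneg[of "v 0"] by linarith
  obtain f0 r where r: "continuous_on {a..b} f0" "strict_mono (r :: nat \<Rightarrow> nat)"
    "\<And>e. 0 < e \<Longrightarrow> \<exists>N. \<forall>n x. n \<ge> N \<and> x \<in> {a..b} \<longrightarrow> norm (f (r n) x - f0 x) < e"
  proof (rule Arzela_Ascoli[of "{a..b}" f "C0 + C * sqrt (b - a)"])
    show "compact {a..b}" by simp
    fix n x assume x: "x \<in> {a..b}"
    have "nrm (v n) * sqrt (b - a) \<le> C * sqrt (b - a)" using C ab by (intro mult_right_mono) auto
    then show "norm (f n x) \<le> C0 + C * sqrt (b - a)" using AC_bound[OF f x, of n] C0[of n] by simp
  next
    fix x e :: real assume x: "x \<in> {a..b}" and e: "0 < e"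
    define d where "d = (e / (C + 1))\<^sup>2"
    have d: "d > 0" using e Cn by (simp add: d_def)
    have "norm (f n x - f n y) < e" if "y \<in> {a..b}" "norm (x - y) < d" for n y
    proof -
      have "sqrt \<bar>x - y\<bar> < sqrt d" using that by simp
      also have "sqrt d = e / (C + 1)" using e Cn by (simp add: d_def)
      finally have s: "sqrt \<bar>x - y\<bar> < e / (C + 1)" .
      have "\<bar>f n x - f n y\<bar> \<le> nrm (v n) * sqrt \<bar>x - y\<bar>" using AC_holder[OF f that(1) x] .
      also have "\<dots> \<le> C * sqrt \<bar>x - y\<bar>" using C by (intro mult_right_mono) auto
      also have "\<dots> \<le> C * (e / (C + 1))" using s Cn by (intro mult_left_mono) auto
      also have "\<dots> < e" using e Cn by (simp add: field_simps)
      finally show ?thesis by simp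
    qed
    with d show "\<exists>d>0. \<forall>n y. y \<in> {a..b} \<and> norm (x - y) < d \<longrightarrow> norm (f n x - f n y) < e" by blast
  qed (rule that)
  have ul: "uniform_limit {a..b} (\<lambda>k. f (r k)) f0 sequentially"
    unfolding uniform_limit_sequentially_iff dist_norm using r(3) by blast
  have fa: "(\<lambda>k. f (r k) a) \<longlonglongrightarrow> f0 a" using tendsto_uniform_limitI[OF ul, of a] ab by simp
  have "uniform_limit {a..b} (\<lambda>k x. f (r k) x - f (r k) a) (\<lambda>x. f0 x - f0 a) sequentially"
  proof (rule uniform_limit_minus[OF ul])
    show "uniform_limit {a..b} (\<lambda>k x. f (r k) a) (\<lambda>x. f0 a) sequentially"
      using fa by (auto simp: uniform_limit_iff tendsto_iff)
  qed
  then have "uniform_limit {a..b} (\<lambda>k x. integral {a..x} (v (r k))) (\<lambda>x. f0 x - f0 a) sequentially"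
    by (rule uniform_limit_cong'[THEN iffD1, rotated 2]) (use f in \<open>auto simp: AC_def\<close>)
  from weak_limit[OF _ C this] obtain v0 where v0: "weak_conv (\<lambda>k. v (r k)) v0"
    "\<And>x. x \<in> {a..b} \<Longrightarrow> integral {a..x} v0 = f0 x - f0 a" "nrm v0 \<le> C"
    using AC_LL[OF f] by blast
  have "AC f0 v0" using v0 unfolding AC_def weak_conv_def by auto
  with r(2) ul v0 show ?thesis by blast
qed

lemma weak_compact:
  fixes u :: "nat \<Rightarrow> real \<Rightarrow> real"
  assumes u: "\<And>k. u k \<in> LL" and C: "\<And>k. nrm (u k) \<le> C"
  shows "\<exists>r v. strict_mono r \<and> weak_conv (\<lambda>k. u (r k)) v \<and> nrm v \<le> C"
  using AC_compact[of "\<lambda>k x. 0 + integral {a..x} (u k)" u C 0] AC_prim[OF u, of 0] C by auto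

lemma AC_limit:
  fixes f v :: "nat \<Rightarrow> real \<Rightarrow> real"
  assumes f: "\<And>k. AC (f k) (v k)" and lim: "\<And>x. x \<in> {a..b} \<Longrightarrow> (\<lambda>k. f k x) \<longlonglongrightarrow> f0 x" and w: "weak_conv v v0"
  shows "AC f0 v0"
  unfolding AC_def
proof (intro conjI ballI)
  show v0: "v0 \<in> LL" using w by (simp add: weak_conv_def)
  fix x assume x: "x \<in> {a..b}"
  have "(\<lambda>k. IP (v k) (indicator {a..x})) \<longlonglongrightarrow> IP v0 (indicator {a..x})" by (rule weak_convD[OF w]) simp
  then have "(\<lambda>k. f k x - f k a) \<longlonglongrightarrow> integral {a..x} v0"
    using LL_primitive[OF v0, of a x] LL_primitive[OF AC_LL[OF f], of a x] AC_diff_eq[OF f, of a x] x by simp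
  moreover have "(\<lambda>k. f k x - f k a) \<longlonglongrightarrow> f0 x - f0 a" using x ab by (intro tendsto_diff lim) auto
  ultimately show "integral {a..x} v0 = f0 x - f0 a" by (rule LIMSEQ_unique)
qed

section \<open>Uniform and bounded pointwise convergence\<close>

definition unif_conv :: "(nat \<Rightarrow> real \<Rightarrow> real) \<Rightarrow> (real \<Rightarrow> real) \<Rightarrow> bool" where
  "unif_conv f f0 \<longleftrightarrow> (\<forall>k. continuous_on {a..b} (f k)) \<and> uniform_limit {a..b} f f0 sequentially"

lemma unif_conv_cont: "unif_conv f f0 \<Longrightarrow> continuous_on {a..b} f0" "unif_conv f f0 \<Longrightarrow> continuous_on {a..b} (f k)"
  unfolding unif_conv_def by (auto intro!: uniform_limit_theorem[where F = sequentially and f = f and l = f0])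

lemma unif_conv_pointwise: "unif_conv f f0 \<Longrightarrow> x \<in> {a..b} \<Longrightarrow> (\<lambda>k. f k x) \<longlonglongrightarrow> f0 x"
  unfolding unif_conv_def by (elim conjE) (rule tendsto_uniform_limitI)

lemma unif_conv_subseq: assumes "unif_conv f f0" "strict_mono r" shows "unif_conv (\<lambda>k. f (r k)) f0"
proof -
  have "uniform_limit {a..b} f f0 sequentially" using assms(1) by (simp add: unif_conv_def)
  from filterlim_compose[OF this filterlim_subseq[OF assms(2)]] show ?thesis
    using assms(1) by (simp add: unif_conv_def)
qed

lemma unif_conv_const: "continuous_on {a..b} f \<Longrightarrow> unif_conv (\<lambda>k. f) f"
  unfolding unif_conv_def uniform_limit_iff by simp

lemma unif_conv_bounded:
  assumes "unif_conv f f0"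
  obtains B where "0 \<le> B" "\<And>k x. x \<in> {a..b} \<Longrightarrow> \<bar>f k x\<bar> \<le> B" "\<And>x. x \<in> {a..b} \<Longrightarrow> \<bar>f0 x\<bar> \<le> B"
proof -
  obtain B0 where B0: "\<And>x. x \<in> {a..b} \<Longrightarrow> \<bar>f0 x\<bar> \<le> B0" "0 \<le> B0" using cont_bound[OF unif_conv_cont(1)[OF assms]] by metis
  have "\<exists>B. \<forall>x\<in>{a..b}. \<bar>f k x\<bar> \<le> B" for k using cont_bound[OF unif_conv_cont(2)[OF assms], of k] by metis
  then obtain Bk where Bk: "\<And>k x. x \<in> {a..b} \<Longrightarrow> \<bar>f k x\<bar> \<le> Bk k" by metis
  have "eventually (\<lambda>k. \<forall>x\<in>{a..b}. \<bar>f k x - f0 x\<bar> < 1) sequentially"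
    using assms unfolding unif_conv_def uniform_limit_iff dist_real_def by auto
  then obtain N where N: "\<And>k x. k \<ge> N \<Longrightarrow> x \<in> {a..b} \<Longrightarrow> \<bar>f k x - f0 x\<bar> < 1"
    unfolding eventually_sequentially by blast
  define B where "B = B0 + 1 + (\<Sum>k<N. \<bar>Bk k\<bar>)"
  have "\<bar>f k x\<bar> \<le> B" if x: "x \<in> {a..b}" for k x
  proof (cases "k < N")
    case True
    have "\<bar>Bk k\<bar> \<le> (\<Sum>k<N. \<bar>Bk k\<bar>)" using True by (intro member_le_sum) auto
    then show ?thesis using Bk[OF x, of k] B0(2) by (simp add: B_def)
  next
    case False
    have "0 \<le> (\<Sum>k<N. \<bar>Bk k\<bar>)" by (intro sum_nonneg) auto
    then show ?thesis using N[of k x] B0(1)[OF x] False x unfolding B_def by linarith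
  qed
  moreover have "0 \<le> B" "\<And>x. x \<in> {a..b} \<Longrightarrow> \<bar>f0 x\<bar> \<le> B"
    using B0 sum_nonneg[of "{..<N}" "\<lambda>k. \<bar>Bk k\<bar>"] by (auto simp: B_def add_increasing2)
  ultimately show ?thesis using that by blast
qed

lemma unif_conv_diff: "unif_conv f f0 \<Longrightarrow> unif_conv g g0 \<Longrightarrow> unif_conv (\<lambda>k x. f k x - g k x) (\<lambda>x. f0 x - g0 x)"
  unfolding unif_conv_def by (auto intro!: continuous_intros uniform_limit_intros)

lemma unif_conv_mult:
  assumes f: "unif_conv f f0" and g: "unif_conv g g0" shows "unif_conv (\<lambda>k x. f k x * g k x) (\<lambda>x. f0 x * g0 x)"
proof -
  have "bounded (f0 ` {a..b})" "bounded (g0 ` {a..b})"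
    using unif_conv_cont(1)[OF f] unif_conv_cont(1)[OF g] compact_continuous_image compact_imp_bounded by blast+
  then show ?thesis using f g unfolding unif_conv_def by (auto intro!: continuous_intros uniform_lim_mult)
qed

lemma unif_conv_comp:
  assumes f: "unif_conv f f0" and c: "continuous_on UNIV \<kappa>" shows "unif_conv (\<lambda>k x. \<kappa> (f k x)) (\<lambda>x. \<kappa> (f0 x :: real) :: real)"
proof -
  obtain B where B: "\<And>k x. x \<in> {a..b} \<Longrightarrow> \<bar>f k x\<bar> \<le> B" "\<And>x. x \<in> {a..b} \<Longrightarrow> \<bar>f0 x\<bar> \<le> B" using unif_conv_bounded[OF f] by metis
  have "uniformly_continuous_on {-B..B} \<kappa>"
    using continuous_on_subset[OF c] by (intro compact_uniformly_continuous) auto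
  moreover have "uniform_limit {a..b} f f0 sequentially" using f by (simp add: unif_conv_def)
  moreover have "eventually (\<lambda>k. \<forall>x\<in>{a..b}. f k x \<in> {-B..B}) sequentially"
  proof (intro always_eventually allI ballI)
    fix k x assume "x \<in> {a..b}"
    from B(1)[OF this, of k] show "f k x \<in> {-B..B}" by auto
  qed
  ultimately have "uniform_limit {a..b} (\<lambda>k x. \<kappa> (f k x)) (\<lambda>x. \<kappa> (f0 x)) sequentially"
    using uniform_limit_compose_uniformly_continuous_on[where g = f and g' = f0 and B = "{-B..B}" and f = \<kappa>] closed_atLeastAtMost
    by blast
  moreover have "continuous_on {a..b} (\<lambda>x. \<kappa> (f k x))" for k
    using continuous_on_compose2[OF c unif_conv_cont(2)[OF f]] by simp
  ultimately show ?thesis by (simp add: unif_conv_def)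
qed

text \<open>Used for the regularisations of soft thresholding, which converge uniformly on the whole line.\<close>

lemma unif_conv_comp_seq:
  assumes f: "unif_conv f f0" and c: "continuous_on UNIV \<kappa>0" "\<And>k. continuous_on UNIV (\<kappa> k)"
    and u: "uniform_limit UNIV \<kappa> \<kappa>0 sequentially"
  shows "unif_conv (\<lambda>k x. \<kappa> k (f k x)) (\<lambda>x. \<kappa>0 (f0 x :: real) :: real)"
proof -
  have "uniform_limit {a..b} (\<lambda>k x. \<kappa> k (f k x)) (\<lambda>x. \<kappa>0 (f0 x)) sequentially"
  proof (rule uniform_limitI)
    fix e :: real assume e: "e > 0"
    have "eventually (\<lambda>k. \<forall>x\<in>{a..b}. dist (\<kappa>0 (f k x)) (\<kappa>0 (f0 x)) < e/2) sequentially"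
      using unif_conv_comp[OF f c(1)] e unfolding unif_conv_def by (auto dest: uniform_limitD[of _ _ _ _ "e/2"])
    moreover have "eventually (\<lambda>k. \<forall>y\<in>UNIV. dist (\<kappa> k y) (\<kappa>0 y) < e/2) sequentially"
      using u e by (intro uniform_limitD) auto
    ultimately show "eventually (\<lambda>k. \<forall>x\<in>{a..b}. dist (\<kappa> k (f k x)) (\<kappa>0 (f0 x)) < e) sequentially"
    proof eventually_elim
      case (elim k)
      show ?case
      proof
        fix x assume "x \<in> {a..b}"
        then have "dist (\<kappa>0 (f k x)) (\<kappa>0 (f0 x)) < e/2" "dist (\<kappa> k (f k x)) (\<kappa>0 (f k x)) < e/2" using elim by auto
        then show "dist (\<kappa> k (f k x)) (\<kappa>0 (f0 x)) < e" unfolding dist_real_def by linarith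
      qed
    qed
  qed
  moreover have "continuous_on {a..b} (\<lambda>x. \<kappa> k (f k x))" for k
    using continuous_on_compose2[OF c(2) unif_conv_cont(2)[OF f]] by simp
  ultimately show ?thesis by (simp add: unif_conv_def)
qed

lemma unif_conv_weak_conv: assumes f: "unif_conv f f0" shows "weak_conv f f0"
proof -
  obtain B where B: "\<And>k x. x \<in> {a..b} \<Longrightarrow> \<bar>f k x\<bar> \<le> B" using unif_conv_bounded[OF f] by metis
  show ?thesis unfolding weak_conv_def
  proof (intro conjI allI ballI)
    fix g assume g: "g \<in> LL"
    show "(\<lambda>k. IP (f k) g) \<longlonglongrightarrow> IP f0 g"
    proof (rule IP_tendsto_dominated[of f f0 g "\<lambda>_. B"])
      fix x assume "x \<in> {a<..<b}"
      then show "(\<lambda>k. f k x) \<longlonglongrightarrow> f0 x" by (intro unif_conv_pointwise[OF f]) auto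
    qed (use g B in \<open>auto intro: unif_conv_cont[OF f] LL_cont cont_meas\<close>)
  qed (auto intro: unif_conv_cont[OF f] LL_cont)
qed

lemma unif_conv_IP: assumes f: "unif_conv f f0" and g: "unif_conv g g0" shows "(\<lambda>k. IP (f k) (g k)) \<longlonglongrightarrow> IP f0 g0"
  using weak_convD[OF unif_conv_weak_conv[OF unif_conv_mult[OF f g]] LL_const[of 1]] by (simp add: ip_L2_def)

text \<open>A weakly convergent factor needs its bound \<open>C\<close> to absorb the error of the uniformly convergent one.\<close>

lemma weak_conv_unif_conv_IP:
  assumes u: "weak_conv u v" and C: "\<And>k. nrm (u k) \<le> C" and f: "unif_conv f f0"
  shows "(\<lambda>k. IP (u k) (f k)) \<longlonglongrightarrow> IP v f0"
proof -
  have fL: "f k \<in> LL" "f0 \<in> LL" for k using unif_conv_cont[OF f] LL_cont by auto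
  have d: "unif_conv (\<lambda>k x. f k x - f0 x) (\<lambda>x. f0 x - f0 x)" by (intro unif_conv_diff f unif_conv_const unif_conv_cont(1)[OF f])
  have "(\<lambda>k. IP (\<lambda>x. f k x - f0 x) (\<lambda>x. f k x - f0 x)) \<longlonglongrightarrow> 0" using unif_conv_IP[OF d d] by (simp add: IP_simps)
  then have "(\<lambda>k. nrm (\<lambda>x. f k x - f0 x)) \<longlonglongrightarrow> 0" unfolding nrm_def using tendsto_real_sqrt by fastforce
  then have lim: "(\<lambda>k. C * nrm (\<lambda>x. f k x - f0 x)) \<longlonglongrightarrow> 0" using tendsto_mult_left[of _ 0 _ C] by simp
  have "norm (IP (u k) (\<lambda>x. f k x - f0 x)) \<le> C * nrm (\<lambda>x. f k x - f0 x)" for k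
    using Cauchy_Schwarz[OF weak_conv_LL(1)[OF u, of k] LL_diff[OF fL(1)[of k] fL(2)]] mult_right_mono[OF C[of k] nrm_nonneg[of "\<lambda>x. f k x - f0 x"]]
    by (simp only: real_norm_def)
  then have "(\<lambda>k. IP (u k) (\<lambda>x. f k x - f0 x)) \<longlonglongrightarrow> 0"
    using Lim_null_comparison[OF always_eventually lim, of "\<lambda>k. IP (u k) (\<lambda>x. f k x - f0 x)"] by blast
  from tendsto_add[OF this weak_convD[OF u fL(2)]] show ?thesis
    using fL weak_conv_LL(1)[OF u] by (simp add: IP_diff_right)
qed

lemma cont_IP_zero: assumes c: "continuous_on {a..b} f" and z: "IP f f = 0" and x: "x \<in> {a..b}" shows "f x = 0"
proof -
  have c2: "continuous_on {a..b} (\<lambda>x. f x * f x)" using c by (intro continuous_intros)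
  have "integral {a..b} (\<lambda>x. f x * f x) = 0" using z LINT_M[OF LL_cont[OF c2]] by (simp add: ip_L2_def)
  then have "\<forall>x\<in>{a..b}. f x * f x = 0" using integral_eq_0_iff[of a b "\<lambda>x. f x * f x"] c2 ab by auto
  then show ?thesis using x by auto
qed

text \<open>Difference quotients of states converge in this sense, by dominated convergence.\<close>

definition bounded_pointwise :: "(nat \<Rightarrow> real \<Rightarrow> real) \<Rightarrow> (real \<Rightarrow> real) \<Rightarrow> bool" where
  "bounded_pointwise f f0 \<longleftrightarrow> (\<forall>k. continuous_on {a..b} (f k)) \<and> continuous_on {a..b} f0 \<and>
     (\<forall>x\<in>{a..b}. (\<lambda>k. f k x) \<longlonglongrightarrow> f0 x) \<and> (\<exists>B. \<forall>k. \<forall>x\<in>{a..b}. \<bar>f k x\<bar> \<le> B)"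

lemma bounded_pointwise_weak_conv: assumes f: "bounded_pointwise f f0" shows "weak_conv f f0" "\<exists>C. \<forall>k. nrm (f k) \<le> C"
proof -
  obtain B where B: "\<And>k x. x \<in> {a..b} \<Longrightarrow> \<bar>f k x\<bar> \<le> B" using f unfolding bounded_pointwise_def by blast
  have L: "f k \<in> LL" "f0 \<in> LL" for k using f LL_cont unfolding bounded_pointwise_def by auto
  show "weak_conv f f0" unfolding weak_conv_def
  proof (intro conjI allI ballI L)
    fix g assume g: "g \<in> LL"
    show "(\<lambda>k. IP (f k) g) \<longlonglongrightarrow> IP f0 g"
    proof (rule IP_tendsto_dominated[of f f0 g "\<lambda>_. B"])
      show "(\<lambda>k. f k x) \<longlonglongrightarrow> f0 x" if "x \<in> {a<..<b}" for x using f that unfolding bounded_pointwise_def by auto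
    qed (use g B L LL_meas in auto)
  qed
  have "nrm (f k) \<le> nrm (\<lambda>x. B)" for k
  proof (rule nrm_mono[OF L(1) LL_const])
    fix x assume "x \<in> {a<..<b}"
    then show "\<bar>f k x\<bar> \<le> \<bar>B\<bar>" using B[of x k] by auto
  qed
  then show "\<exists>C. \<forall>k. nrm (f k) \<le> C" by blast
qed

text \<open>The derivative of a quadratic functional along directions that converge only weakly; the remainder
  is \<open>t k\<close> times a bounded quantity.\<close>

lemma quad_limit:
  assumes f: "f \<in> LL" and q: "weak_conv q q0" and C: "\<exists>C. \<forall>k. nrm (q k) \<le> C" and t: "t \<longlonglongrightarrow> 0" "\<And>k. t k \<noteq> 0"
  shows "(\<lambda>k. (IP (\<lambda>x. f x + t k * q k x) (\<lambda>x. f x + t k * q k x) - IP f f) / t k) \<longlonglongrightarrow> 2 * IP q0 f"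
proof -
  obtain C where C: "\<And>k. nrm (q k) \<le> C" using assms(3) by blast
  have qL: "q k \<in> LL" for k using weak_conv_LL[OF q] by auto
  have "(IP (\<lambda>x. f x + t k * q k x) (\<lambda>x. f x + t k * q k x) - IP f f) / t k = 2 * IP (q k) f + t k * IP (q k) (q k)" for k
  proof -
    have "IP (\<lambda>x. f x + t k * q k x) (\<lambda>x. f x + t k * q k x) - IP f f = t k * (2 * IP (q k) f + t k * IP (q k) (q k))"
      using f qL by (simp add: IP_simps IP_commute[of f "q k"] algebra_simps)
    then show ?thesis using t(2)[of k] by simp
  qed
  moreover have "(\<lambda>k. 2 * IP (q k) f + t k * IP (q k) (q k)) \<longlonglongrightarrow> 2 * IP q0 f + 0"
  proof (intro tendsto_add tendsto_mult_left weak_convD[OF q f])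
    have "(\<lambda>k. \<bar>t k\<bar> * (C * C)) \<longlonglongrightarrow> \<bar>0\<bar> * (C * C)" using t(1) by (intro tendsto_intros)
    moreover have "norm (t k * IP (q k) (q k)) \<le> \<bar>t k\<bar> * (C * C)" for k
      using C[of k] nrm_le_iff[of C "q k"] nrm_nonneg[of "q k"] by (auto simp: abs_mult intro!: mult_left_mono)
    ultimately show "(\<lambda>k. t k * IP (q k) (q k)) \<longlonglongrightarrow> 0"
      using Lim_null_comparison[OF always_eventually, of "\<lambda>k. t k * IP (q k) (q k)" "\<lambda>k. \<bar>t k\<bar> * (C * C)" sequentially] by simp
  qed
  ultimately show ?thesis by simp
qed

end

section \<open>The time-discrete system in flux form\<close>

text \<open>In the application \<open>h r\<close> is \<open>r / \<tau> + g r\<close> for \<open>\<bar>r\<bar> \<le> 1\<close>, continued with bounded slope, and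
  \<open>m = 1 / \<tau> - C\<^sub>g\<close>. The constant \<open>\<Lambda>\<close>
  bounds the slope of all functions \<open>S\<close> that express \<open>w'\<close> through the flux; for soft thresholding it is
  \<open>1 / \<nu>\<^sup>2\<close>.\<close>

locale evolution = segment +
  fixes h h' :: "real \<Rightarrow> real" and m M1 \<Lambda> \<tau> :: real and n :: nat and w0 :: "real \<Rightarrow> real"
  assumes h_deriv: "\<And>r. (h has_real_derivative h' r) (at r)"
    and h'_cont: "continuous_on UNIV h'"
    and m_le: "\<And>r. m \<le> h' r" and le_M1: "\<And>r. h' r \<le> M1"
    and m_pos: "0 < m" and tau_pos: "0 < \<tau>" and Lam_nonneg: "0 \<le> \<Lambda>"
    and w0_cont: "continuous_on {a..b} w0"
begin

text \<open>Admissible smooth replacements \<open>S\<close> of soft thresholding and \<open>K\<close> of the subdifferential of the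
  obstacle. The slope of \<open>S\<close> is bounded uniformly, that of \<open>K\<close> is not: \<open>K\<close> is to become vertical.\<close>

definition regularisation :: "(real \<Rightarrow> real) \<Rightarrow> (real \<Rightarrow> real) \<Rightarrow> (real \<Rightarrow> real) \<Rightarrow> (real \<Rightarrow> real) \<Rightarrow> bool" where
  "regularisation S S' K K' \<longleftrightarrow>
     (\<forall>r. (S has_real_derivative S' r) (at r)) \<and> continuous_on UNIV S' \<and> (\<forall>r. 0 \<le> S' r \<and> S' r \<le> \<Lambda>) \<and> S 0 = 0 \<and>
     (\<forall>r. (K has_real_derivative K' r) (at r)) \<and> continuous_on UNIV K' \<and> (\<forall>r. 0 \<le> K' r) \<and> K 0 = 0"

text \<open>The reaction \<open>\<xi>\<close> of the obstacle is kept as a separate unknown, so that the regularised systems,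
  where \<open>\<xi> = K w\<close>, and the limit system, where it is only a weak limit, are instances of one definition. The
  forcing is called \<open>e\<close>.\<close>

definition flux_system :: "(real \<Rightarrow> real) \<Rightarrow> (nat \<Rightarrow> real \<Rightarrow> real) \<Rightarrow> (nat \<Rightarrow> real \<Rightarrow> real)
    \<Rightarrow> (nat \<Rightarrow> real \<Rightarrow> real) \<Rightarrow> (nat \<Rightarrow> real \<Rightarrow> real) \<Rightarrow> bool" where
  "flux_system S e \<xi> w \<sigma> \<longleftrightarrow> w 0 = w0 \<and>
     (\<forall>i\<in>{1..n}. e i \<in> LL \<and> \<xi> i \<in> LL \<and> AC (w i) (\<lambda>x. S (\<sigma> i x)) \<and>
        AC (\<sigma> i) (\<lambda>x. h (w i x) + \<xi> i x - w (i - 1) x / \<tau> - e i x) \<and> \<sigma> i a = 0 \<and> \<sigma> i b = 0)"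

lemma h_cont: "continuous_on UNIV h"
  by (rule has_deriv_cont) (rule h_deriv)

lemma regularisationD:
  assumes "regularisation S S' K K'"
  shows "(S has_real_derivative S' r) (at r)" "continuous_on UNIV S'" "0 \<le> S' r" "S' r \<le> \<Lambda>" "S 0 = 0"
    "(K has_real_derivative K' r) (at r)" "continuous_on UNIV K'" "0 \<le> K' r" "K 0 = 0"
    "continuous_on UNIV S" "continuous_on UNIV K"
    "\<bar>S x - S y\<bar> \<le> \<Lambda> * \<bar>x - y\<bar>" "\<bar>S r\<bar> \<le> \<Lambda> * \<bar>r\<bar>" "0 \<le> S r * r" "0 \<le> K r * r"
proof -
  note d = assms[unfolded regularisation_def]
  show "(S has_real_derivative S' r) (at r)" "continuous_on UNIV S'" "0 \<le> S' r" "S' r \<le> \<Lambda>" and S0: "S 0 = 0"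
    and "(K has_real_derivative K' r) (at r)" "continuous_on UNIV K'" "0 \<le> K' r" and K0: "K 0 = 0" using d by auto
  show "continuous_on UNIV S" by (rule has_deriv_cont[of S S']) (use d in blast)
  show "continuous_on UNIV K" by (rule has_deriv_cont[of K K']) (use d in blast)
  have l: "\<bar>S x - S y\<bar> \<le> \<Lambda> * \<bar>x - y\<bar>" for x y using deriv_lip[of S S' \<Lambda> x y] d by blast
  then show "\<bar>S x - S y\<bar> \<le> \<Lambda> * \<bar>x - y\<bar>" .
  show "\<bar>S r\<bar> \<le> \<Lambda> * \<bar>r\<bar>" using l[of r 0] S0 by simp
  show "0 \<le> S r * r" using deriv_sign[of S S' 0 r] d S0 by auto
  show "0 \<le> K r * r" using deriv_sign[of K K' 0 r] d K0 by auto
qed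

text \<open>All bounds depend on the forcing \<open>d\<close> through its norm only and are independent of \<open>S\<close> and \<open>K\<close>.
  The boundary values of \<open>\<sigma>\<close> remove the boundary terms; \<open>S \<sigma> * \<sigma> \<ge> 0\<close>, \<open>K w * w \<ge> 0\<close> and
  \<open>K' \<ge> 0\<close> remove the remaining terms of unknown size.\<close>

lemma step_bounds:
  "\<exists>C. \<forall>S S' K K' d w \<sigma>. regularisation S S' K K' \<longrightarrow> d \<in> LL \<longrightarrow> nrm d \<le> D \<longrightarrow> AC w (\<lambda>x. S (\<sigma> x)) \<longrightarrow>
     AC \<sigma> (\<lambda>x. h (w x) + K (w x) - d x) \<longrightarrow> \<sigma> a = 0 \<longrightarrow> \<sigma> b = 0 \<longrightarrow>
     nrm w \<le> C \<and> nrm (\<lambda>x. K (w x)) \<le> C \<and> nrm (\<lambda>x. h (w x) + K (w x) - d x) \<le> C \<and> nrm (\<lambda>x. S (\<sigma> x)) \<le> C \<and> \<bar>w a\<bar> \<le> C"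
proof -
  define hc where "hc = \<bar>h 0\<bar> * sqrt (b - a)"
  define Bw where "Bw = (D + hc) / m"
  define BK where "BK = D + (hc + M1 * Bw)"
  define Bs where "Bs = BK + BK"
  define BS where "BS = \<Lambda> * (Bs * sqrt (b - a)) * sqrt (b - a)"
  define Ba where "Ba = Bw / sqrt (b - a) + BS * sqrt (b - a)"
  define C where "C = max (max Bw BK) (max (max Bs BS) Ba)"
  have sq: "0 < sqrt (b - a)" using ab by simp
  have "nrm w \<le> Bw \<and> nrm (\<lambda>x. K (w x)) \<le> BK \<and> nrm (\<lambda>x. h (w x) + K (w x) - d x) \<le> Bs \<and> nrm (\<lambda>x. S (\<sigma> x)) \<le> BS \<and> \<bar>w a\<bar> \<le> Ba"
    if R: "regularisation S S' K K'" and d: "d \<in> LL" "nrm d \<le> D" and w: "AC w (\<lambda>x. S (\<sigma> x))"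
      and s: "AC \<sigma> (\<lambda>x. h (w x) + K (w x) - d x)" and bc: "\<sigma> a = 0" "\<sigma> b = 0" for S S' K K' d w \<sigma>
  proof -
    note r = regularisationD[OF R]
    have L: "w \<in> LL" "\<sigma> \<in> LL" "(\<lambda>x. S (\<sigma> x)) \<in> LL" "(\<lambda>x. K (w x)) \<in> LL" "(\<lambda>x. h (w x)) \<in> LL"
      using AC_fLL[OF w] AC_fLL[OF s] AC_LL[OF w] AC_comp_LL[OF r(11) w] AC_comp_LL[OF h_cont w] by auto
    have Dn: "0 \<le> D" using d(2) nrm_nonneg[of d] by linarith
    have hcn: "nrm (\<lambda>x. h 0) = hc" by (simp add: nrm_const hc_def)
    \<comment> \<open>Testing the flux equation with \<open>w\<close>: the flux term and the penalty term have a sign.\<close>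
    have "IP \<sigma> (\<lambda>x. S (\<sigma> x)) + IP (\<lambda>x. h (w x) + K (w x) - d x) w = 0"
      using AC_by_parts[OF s w] bc by simp
    moreover have "0 \<le> IP \<sigma> (\<lambda>x. S (\<sigma> x))"
      unfolding ip_L2_def using r(14) by (intro integral_nonneg_AE AE_I2) (simp add: mult.commute)
    ultimately have t: "IP (\<lambda>x. h (w x)) w + IP (\<lambda>x. K (w x)) w \<le> IP d w"
      using L d by (simp add: IP_simps)
    have "m * IP w w \<le> IP (\<lambda>x. h (w x) - h 0) w"
    proof -
      have "m * IP w w = IP (\<lambda>x. m * w x) w" by (simp add: IP_simps)
      also have "\<dots> \<le> IP (\<lambda>x. h (w x) - h 0) w"
        using L deriv_sign[OF h_deriv m_le] by (intro IP_mono) (auto simp: mult.assoc)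
      finally show ?thesis .
    qed
    moreover have "0 \<le> IP (\<lambda>x. K (w x)) w"
      unfolding ip_L2_def using r(15) by (intro integral_nonneg_AE AE_I2) simp
    ultimately have "m * IP w w \<le> IP (\<lambda>x. d x - h 0) w" using t L d by (simp add: IP_simps)
    also have "\<dots> \<le> nrm (\<lambda>x. d x - h 0) * nrm w" using Cauchy_Schwarz[of "\<lambda>x. d x - h 0" w] L d by auto
    also have "\<dots> \<le> (D + hc) * nrm w"
      using nrm_diff_triangle[OF d(1) LL_const[of "h 0"]] hcn d(2) by (intro mult_right_mono) auto
    finally have "(m * nrm w) * nrm w \<le> (D + hc) * nrm w" by (simp add: nrm_sq'[symmetric] mult.assoc)
    moreover have "0 \<le> D + hc" using Dn sq by (simp add: hc_def)
    ultimately have "m * nrm w \<le> D + hc"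
      by (cases "nrm w = 0") (auto simp: mult_le_cancel_right order.strict_iff_order)
    then have 1: "nrm w \<le> Bw" using m_pos by (simp add: Bw_def field_simps)
    have M1: "0 \<le> M1" using m_le[of 0] le_M1[of 0] m_pos by simp
    have "nrm (\<lambda>x. h (w x)) \<le> nrm (\<lambda>x. \<bar>h 0\<bar> + M1 * \<bar>w x\<bar>)"
    proof (rule nrm_mono[OF L(5)])
      show "(\<lambda>x. \<bar>h 0\<bar> + M1 * \<bar>w x\<bar>) \<in> LL"
        using AC_cont[OF w] by (intro LL_cont continuous_intros)
      fix x assume "x \<in> {a<..<b}"
      have "\<bar>h (w x) - h 0\<bar> \<le> M1 * \<bar>w x - 0\<bar>"
        by (rule deriv_lip[OF h_deriv]) (use m_le le_M1 m_pos in \<open>auto intro: order_trans less_imp_le\<close>)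
      then show "\<bar>h (w x)\<bar> \<le> \<bar>\<bar>h 0\<bar> + M1 * \<bar>w x\<bar>\<bar>" by simp
    qed
    also have "\<dots> \<le> nrm (\<lambda>x. \<bar>h 0\<bar>) + nrm (\<lambda>x. M1 * \<bar>w x\<bar>)"
      using AC_cont[OF w] by (intro nrm_triangle LL_cont continuous_intros)
    also have "nrm (\<lambda>x. M1 * \<bar>w x\<bar>) = M1 * nrm w" unfolding nrm_scale using M1 by (simp add: nrm_def ip_L2_def)
    also have "\<dots> \<le> M1 * Bw" using 1 M1 by (intro mult_left_mono)
    finally have hn: "nrm (\<lambda>x. h (w x)) \<le> hc + M1 * Bw" by (simp add: nrm_const hc_def)
    \<comment> \<open>Testing with \<open>K w\<close>, whose derivative \<open>K' w * S \<sigma>\<close> has the sign of \<open>\<sigma>\<close>: this bounds the penalty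
      independently of the steepness of \<open>K\<close>.\<close>
    have Kw: "AC (\<lambda>x. K (w x)) (\<lambda>x. K' (w x) * S (\<sigma> x))"
      by (rule AC_chain[OF w]) (rule r)+
    have "IP \<sigma> (\<lambda>x. K' (w x) * S (\<sigma> x)) + IP (\<lambda>x. h (w x) + K (w x) - d x) (\<lambda>x. K (w x)) = 0"
      using AC_by_parts[OF s Kw] bc by simp
    moreover have "0 \<le> \<sigma> x * (K' (w x) * S (\<sigma> x))" for x
      using mult_nonneg_nonneg[OF r(8)[of "w x"] r(14)[of "\<sigma> x"]] by (simp add: mult_ac)
    then have "0 \<le> IP \<sigma> (\<lambda>x. K' (w x) * S (\<sigma> x))"
      unfolding ip_L2_def by (intro integral_nonneg_AE AE_I2)
    ultimately have "IP (\<lambda>x. K (w x)) (\<lambda>x. K (w x)) \<le> IP (\<lambda>x. d x - h (w x)) (\<lambda>x. K (w x))"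
      using L d by (simp add: IP_simps)
    also have "\<dots> \<le> nrm (\<lambda>x. d x - h (w x)) * nrm (\<lambda>x. K (w x))"
      using Cauchy_Schwarz[of "\<lambda>x. d x - h (w x)" "\<lambda>x. K (w x)"] L d by auto
    finally have "nrm (\<lambda>x. K (w x)) * nrm (\<lambda>x. K (w x)) \<le> nrm (\<lambda>x. d x - h (w x)) * nrm (\<lambda>x. K (w x))"
      by (simp add: nrm_sq')
    then have "nrm (\<lambda>x. K (w x)) \<le> nrm (\<lambda>x. d x - h (w x))"
      by (cases "nrm (\<lambda>x. K (w x)) = 0") (auto simp: mult_le_cancel_right order.strict_iff_order)
    moreover have dh: "nrm (\<lambda>x. d x - h (w x)) \<le> BK"
      using nrm_diff_triangle[OF d(1) L(5)] hn d(2) by (simp add: BK_def)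
    ultimately have 2: "nrm (\<lambda>x. K (w x)) \<le> BK" by simp
    have "nrm (\<lambda>x. K (w x) - (d x - h (w x))) \<le> nrm (\<lambda>x. K (w x)) + nrm (\<lambda>x. d x - h (w x))"
      using L d by (intro nrm_diff_triangle) auto
    moreover have "(\<lambda>x. K (w x) - (d x - h (w x))) = (\<lambda>x. h (w x) + K (w x) - d x)" by (simp add: algebra_simps)
    ultimately have 3: "nrm (\<lambda>x. h (w x) + K (w x) - d x) \<le> Bs" using 2 dh by (simp add: Bs_def)
    have Sb: "\<bar>S (\<sigma> x)\<bar> \<le> \<Lambda> * (Bs * sqrt (b - a))" if "x \<in> {a..b}" for x
    proof -
      have "\<bar>\<sigma> x\<bar> \<le> nrm (\<lambda>x. h (w x) + K (w x) - d x) * sqrt (b - a)" using AC_bound[OF s that] bc by simp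
      also have "\<dots> \<le> Bs * sqrt (b - a)" using 3 sq by (intro mult_right_mono) auto
      finally have "\<Lambda> * \<bar>\<sigma> x\<bar> \<le> \<Lambda> * (Bs * sqrt (b - a))" using Lam_nonneg by (intro mult_left_mono)
      then show ?thesis using r(13)[of "\<sigma> x"] by simp
    qed
    have Sn: "0 \<le> \<Lambda> * (Bs * sqrt (b - a))" using Sb[of a] ab by (smt (verit) atLeastAtMost_iff abs_ge_zero)
    have "nrm (\<lambda>x. S (\<sigma> x)) \<le> nrm (\<lambda>x. \<Lambda> * (Bs * sqrt (b - a)))"
    proof (rule nrm_mono[OF L(3) LL_const])
      fix x assume "x \<in> {a<..<b}"
      then have "\<bar>S (\<sigma> x)\<bar> \<le> \<Lambda> * (Bs * sqrt (b - a))" by (intro Sb) auto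
      then show "\<bar>S (\<sigma> x)\<bar> \<le> \<bar>\<Lambda> * (Bs * sqrt (b - a))\<bar>" by simp
    qed
    also have "\<dots> = BS" unfolding nrm_const BS_def using Sn by simp
    finally have 4: "nrm (\<lambda>x. S (\<sigma> x)) \<le> BS" .
    have "nrm w / sqrt (b - a) \<le> Bw / sqrt (b - a)" "nrm (\<lambda>x. S (\<sigma> x)) * sqrt (b - a) \<le> BS * sqrt (b - a)"
      using 1 4 sq by (simp_all add: divide_right_mono mult_right_mono)
    then have 5: "\<bar>w a\<bar> \<le> Ba" unfolding Ba_def using AC_left_bound[OF w] by linarith
    show ?thesis using 1 2 3 4 5 by blast
  qed
  then have "\<forall>S S' K K' d w \<sigma>. regularisation S S' K K' \<longrightarrow> d \<in> LL \<longrightarrow> nrm d \<le> D \<longrightarrow> AC w (\<lambda>x. S (\<sigma> x)) \<longrightarrow>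
     AC \<sigma> (\<lambda>x. h (w x) + K (w x) - d x) \<longrightarrow> \<sigma> a = 0 \<longrightarrow> \<sigma> b = 0 \<longrightarrow>
     nrm w \<le> C \<and> nrm (\<lambda>x. K (w x)) \<le> C \<and> nrm (\<lambda>x. h (w x) + K (w x) - d x) \<le> C \<and> nrm (\<lambda>x. S (\<sigma> x)) \<le> C \<and> \<bar>w a\<bar> \<le> C"
    unfolding C_def by (intro allI impI) (simp only: le_max_iff_disj, blast)
  then show ?thesis by blast
qed

lemma flux_systemD:
  assumes "flux_system S e \<xi> w \<sigma>" "i \<in> {1..n}"
  shows "e i \<in> LL" "\<xi> i \<in> LL" "AC (w i) (\<lambda>x. S (\<sigma> i x))"
    "AC (\<sigma> i) (\<lambda>x. h (w i x) + \<xi> i x - w (i - 1) x / \<tau> - e i x)" "\<sigma> i a = 0" "\<sigma> i b = 0"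
  using assms unfolding flux_system_def by auto

lemma flux_system_w0: "flux_system S e \<xi> w \<sigma> \<Longrightarrow> w 0 = w0" by (simp add: flux_system_def)

lemma flux_system_w_cont: "flux_system S e \<xi> w \<sigma> \<Longrightarrow> i \<le> n \<Longrightarrow> continuous_on {a..b} (w i)"
  using AC_cont[OF flux_systemD(3)] w0_cont by (cases i) (auto simp: flux_system_def)

lemma flux_system_bounds:
  assumes R: "\<And>k::nat. regularisation (S k) (S' k) (K k) (K' k)"
    and sy: "\<And>k. flux_system (S k) (e k) (\<lambda>i x. K k (w k i x)) (w k) (\<sigma> k)"
    and E: "\<And>k i. i \<in> {1..n} \<Longrightarrow> nrm (e k i) \<le> E"
  shows "i \<le> n \<Longrightarrow> \<exists>C. \<forall>k. nrm (w k i) \<le> C \<and> (1 \<le> i \<longrightarrow> nrm (\<lambda>x. K k (w k i x)) \<le> C \<and>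
     nrm (\<lambda>x. h (w k i x) + K k (w k i x) - w k (i - 1) x / \<tau> - e k i x) \<le> C \<and> nrm (\<lambda>x. S k (\<sigma> k i x)) \<le> C \<and> \<bar>w k i a\<bar> \<le> C)"
proof (induction i)
  case 0
  then show ?case using flux_system_w0[OF sy] by (intro exI[of _ "nrm w0"]) auto
next
  case (Suc i)
  then obtain C0 where C0: "\<And>k. nrm (w k i) \<le> C0" by auto
  have i: "Suc i \<in> {1..n}" using Suc by auto
  from step_bounds[of "C0 / \<tau> + E"]
  obtain C where C: "\<And>S S' K K' d w \<sigma>. regularisation S S' K K' \<Longrightarrow> d \<in> LL \<Longrightarrow> nrm d \<le> C0 / \<tau> + E \<Longrightarrow> AC w (\<lambda>x. S (\<sigma> x)) \<Longrightarrow>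
     AC \<sigma> (\<lambda>x. h (w x) + K (w x) - d x) \<Longrightarrow> \<sigma> a = 0 \<Longrightarrow> \<sigma> b = 0 \<Longrightarrow>
     nrm w \<le> C \<and> nrm (\<lambda>x. K (w x)) \<le> C \<and> nrm (\<lambda>x. h (w x) + K (w x) - d x) \<le> C \<and> nrm (\<lambda>x. S (\<sigma> x)) \<le> C \<and> \<bar>w a\<bar> \<le> C"
    by blast
  have "nrm (w k (Suc i)) \<le> C \<and> nrm (\<lambda>x. K k (w k (Suc i) x)) \<le> C \<and>
     nrm (\<lambda>x. h (w k (Suc i) x) + K k (w k (Suc i) x) - (w k i x / \<tau> + e k (Suc i) x)) \<le> C \<and>
     nrm (\<lambda>x. S k (\<sigma> k (Suc i) x)) \<le> C \<and> \<bar>w k (Suc i) a\<bar> \<le> C" for k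
  proof (rule C[OF R])
    note s = flux_systemD[OF sy i, of k]
    have wl: "w k i \<in> LL" using flux_system_w_cont[OF sy, of i] Suc.prems by (intro LL_cont) auto
    show "(\<lambda>x. w k i x / \<tau> + e k (Suc i) x) \<in> LL" using wl s by auto
    have "nrm (\<lambda>x. w k i x / \<tau>) = nrm (w k i) / \<tau>"
      using nrm_scale[of "1/\<tau>" "w k i"] tau_pos by simp
    also have "\<dots> \<le> C0 / \<tau>" using C0 tau_pos by (intro divide_right_mono) auto
    finally show "nrm (\<lambda>x. w k i x / \<tau> + e k (Suc i) x) \<le> C0 / \<tau> + E"
      using nrm_triangle[OF LL_divide[OF wl] s(1), of \<tau>] E[OF i, of k] by linarith
    show "AC (w k (Suc i)) (\<lambda>x. S k (\<sigma> k (Suc i) x))" using s by simp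
    show "AC (\<sigma> k (Suc i)) (\<lambda>x. h (w k (Suc i) x) + K k (w k (Suc i) x) - (w k i x / \<tau> + e k (Suc i) x))"
      using s(4) by (simp add: diff_diff_eq)
    show "\<sigma> k (Suc i) a = 0" "\<sigma> k (Suc i) b = 0" using s by auto
  qed
  then show ?case by (intro exI[of _ C]) (simp add: diff_diff_eq)
qed

text \<open>The bounds of \<open>step_bounds\<close> make states and fluxes relatively compact in the uniform norm. The system is linear
  in the quantities that converge only weakly, namely \<open>e\<close> and \<open>K w\<close>, so it passes to the limit.\<close>

lemma flux_system_compact:
  assumes R: "\<And>k::nat. regularisation (S k) (S' k) (K k) (K' k)"
    and sy: "\<And>k. flux_system (S k) (e k) (\<lambda>i x. K k (w k i x)) (w k) (\<sigma> k)"
    and E: "\<And>k i. i \<in> {1..n} \<Longrightarrow> nrm (e k i) \<le> E"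
    and S0: "uniform_limit UNIV S S0 sequentially" "continuous_on UNIV S0"
  shows "\<exists>(r::nat\<Rightarrow>nat) e0 \<xi> wl \<sigma>l. strict_mono r \<and> flux_system S0 e0 \<xi> wl \<sigma>l \<and>
     (\<forall>i\<in>{1..n}. weak_conv (\<lambda>k. e (r k) i) (e0 i) \<and> weak_conv (\<lambda>k x. K (r k) (w (r k) i x)) (\<xi> i) \<and>
        unif_conv (\<lambda>k. w (r k) i) (wl i) \<and> unif_conv (\<lambda>k. \<sigma> (r k) i) (\<sigma>l i))"
proof -
  define P where "P i r \<longleftrightarrow> (\<exists>e0 \<xi> wl \<sigma>l. weak_conv (\<lambda>k. e (r k) i) e0 \<and> weak_conv (\<lambda>k x. K (r k) (w (r k) i x)) \<xi> \<and>
        unif_conv (\<lambda>k. w (r k) i) wl \<and> unif_conv (\<lambda>k. \<sigma> (r k) i) \<sigma>l)" for i and r :: "nat \<Rightarrow> nat"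
  have "\<exists>r. strict_mono r \<and> (\<forall>i\<in>{1..n}. P i r)"
  proof (rule finite_subseq)
    fix i and r s :: "nat \<Rightarrow> nat" assume "P i r" "strict_mono s"
    then show "P i (\<lambda>k. r (s k))" unfolding P_def
      using weak_conv_subseq[OF _ \<open>strict_mono s\<close>] unif_conv_subseq[OF _ \<open>strict_mono s\<close>] by fast
  next
    fix i and r :: "nat \<Rightarrow> nat" assume i: "i \<in> {1..n}" and r: "strict_mono r"
    note s = flux_systemD[OF sy i]
    have "i \<le> n" "1 \<le> i" using i by auto
    then obtain C where C: "\<And>k. nrm (\<lambda>x. K k (w k i x)) \<le> C"
      "\<And>k. nrm (\<lambda>x. h (w k i x) + K k (w k i x) - w k (i - 1) x / \<tau> - e k i x) \<le> C"
      "\<And>k. nrm (\<lambda>x. S k (\<sigma> k i x)) \<le> C" "\<And>k. \<bar>w k i a\<bar> \<le> C"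
      using flux_system_bounds[of S S' K K' e w \<sigma> E i, OF R sy E] by blast
    obtain s1 e0 where s1: "strict_mono s1" "weak_conv (\<lambda>k. e (r (s1 k)) i) e0"
      using weak_compact[of "\<lambda>k. e (r k) i" E] s(1) E[OF i] by blast
    obtain s2 \<xi> where s2: "strict_mono s2" "weak_conv (\<lambda>k x. K (r (s1 (s2 k))) (w (r (s1 (s2 k))) i x)) \<xi>"
      using weak_compact[of "\<lambda>k x. K (r (s1 k)) (w (r (s1 k)) i x)" C] s(2) C(1) by blast
    obtain s3 wl where s3: "strict_mono s3" "uniform_limit {a..b} (\<lambda>k. w (r (s1 (s2 (s3 k)))) i) wl sequentially"
      using AC_compact[of "\<lambda>k. w (r (s1 (s2 k))) i" "\<lambda>k x. S (r (s1 (s2 k))) (\<sigma> (r (s1 (s2 k))) i x)" C C] s(3) C(3,4) by blast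
    have \<sigma>a: "\<bar>\<sigma> k i a\<bar> \<le> 0" for k using s(5) by simp
    obtain s4 \<sigma>l where s4: "strict_mono s4" "uniform_limit {a..b} (\<lambda>k. \<sigma> (r (s1 (s2 (s3 (s4 k))))) i) \<sigma>l sequentially"
      using AC_compact[of "\<lambda>k. \<sigma> (r (s1 (s2 (s3 k)))) i" _ C 0, OF s(4) C(2) \<sigma>a] by blast
    have u1: "unif_conv (\<lambda>k. w (r (s1 (s2 (s3 k)))) i) wl" using s3(2) AC_cont[OF s(3)] by (simp add: unif_conv_def)
    have u2: "unif_conv (\<lambda>k. \<sigma> (r (s1 (s2 (s3 (s4 k))))) i) \<sigma>l" using s4(2) AC_cont[OF s(4)] by (simp add: unif_conv_def)
    have "P i (\<lambda>k. r (s1 (s2 (s3 (s4 k)))))" unfolding P_def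
      using weak_conv_subseq[OF weak_conv_subseq[OF weak_conv_subseq[OF s1(2) s2(1)] s3(1)] s4(1)]
        weak_conv_subseq[OF weak_conv_subseq[OF s2(2) s3(1)] s4(1)] unif_conv_subseq[OF u1 s4(1)] u2 by blast
    moreover have "strict_mono (\<lambda>k. s1 (s2 (s3 (s4 k))))" using s1(1) s2(1) s3(1) s4(1) by (simp add: strict_mono_def)
    ultimately show "\<exists>s. strict_mono s \<and> P i (\<lambda>k. r (s k))" by blast
  qed
  then obtain r where r: "strict_mono r" "\<And>i. i \<in> {1..n} \<Longrightarrow> P i r" by blast
  have "\<forall>i\<in>{1..n}. \<exists>e0. weak_conv (\<lambda>k. e (r k) i) e0" "\<forall>i\<in>{1..n}. \<exists>\<xi>. weak_conv (\<lambda>k x. K (r k) (w (r k) i x)) \<xi>"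
    "\<forall>i\<in>{1..n}. \<exists>wl. unif_conv (\<lambda>k. w (r k) i) wl" "\<forall>i\<in>{1..n}. \<exists>\<sigma>l. unif_conv (\<lambda>k. \<sigma> (r k) i) \<sigma>l"
    using r(2) unfolding P_def by blast+
  from this[THEN bchoice] obtain e0 \<xi> wl0 \<sigma>l where lim0: "\<And>i. i \<in> {1..n} \<Longrightarrow> weak_conv (\<lambda>k. e (r k) i) (e0 i)"
    "\<And>i. i \<in> {1..n} \<Longrightarrow> weak_conv (\<lambda>k x. K (r k) (w (r k) i x)) (\<xi> i)"
    "\<And>i. i \<in> {1..n} \<Longrightarrow> unif_conv (\<lambda>k. w (r k) i) (wl0 i)" "\<And>i. i \<in> {1..n} \<Longrightarrow> unif_conv (\<lambda>k. \<sigma> (r k) i) (\<sigma>l i)"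
    by blast
  define wl where "wl i = (if i = 0 then w0 else wl0 i)" for i
  have wl: "unif_conv (\<lambda>k. w (r k) i) (wl i)" if "i \<le> n" for i
  proof (cases "i = 0")
    case True
    have eq: "w k i = w0" for k using flux_system_w0[OF sy] True by simp
    show ?thesis unfolding eq using unif_conv_const[OF w0_cont] by (simp add: wl_def True)
  next
    case False
    then show ?thesis using lim0(3)[of i] that by (simp add: wl_def)
  qed
  have Sr: "uniform_limit UNIV (\<lambda>k. S (r k)) S0 sequentially"
    using filterlim_compose[OF S0(1) filterlim_subseq[OF r(1)]] .
  have "flux_system S0 e0 \<xi> wl \<sigma>l" unfolding flux_system_def
  proof (intro conjI ballI)
    show "wl 0 = w0" by (simp add: wl_def)
    fix i assume i: "i \<in> {1..n}"
    then have il: "i \<le> n" "i - 1 \<le> n" by auto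
    note s = flux_systemD[OF sy i]
    show "e0 i \<in> LL" "\<xi> i \<in> LL" using lim0(1,2)[OF i] weak_conv_LL by blast+
    have "unif_conv (\<lambda>k x. S (r k) (\<sigma> (r k) i x)) (\<lambda>x. S0 (\<sigma>l i x))"
      by (rule unif_conv_comp_seq[OF lim0(4)[OF i] S0(2) _ Sr]) (rule regularisationD(10)[OF R])
    from AC_limit[OF s(3) unif_conv_pointwise[OF wl[OF il(1)]] unif_conv_weak_conv[OF this]]
    show "AC (wl i) (\<lambda>x. S0 (\<sigma>l i x))" .
    have "weak_conv (\<lambda>k x. h (w (r k) i x) + K (r k) (w (r k) i x) - (1/\<tau>) * w (r k) (i - 1) x - e (r k) i x)
       (\<lambda>x. h (wl i x) + \<xi> i x - (1/\<tau>) * wl (i - 1) x - e0 i x)"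
      by (intro weak_conv_diff weak_conv_add weak_conv_scale lim0(1)[OF i] lim0(2)[OF i]
          unif_conv_weak_conv[OF unif_conv_comp[OF wl[OF il(1)] h_cont]] unif_conv_weak_conv[OF wl[OF il(2)]])
    then have "weak_conv (\<lambda>k x. h (w (r k) i x) + K (r k) (w (r k) i x) - w (r k) (i - 1) x / \<tau> - e (r k) i x)
       (\<lambda>x. h (wl i x) + \<xi> i x - wl (i - 1) x / \<tau> - e0 i x)" by simp
    from AC_limit[OF s(4) unif_conv_pointwise[OF lim0(4)[OF i]] this]
    show "AC (\<sigma>l i) (\<lambda>x. h (wl i x) + \<xi> i x - wl (i - 1) x / \<tau> - e0 i x)" .
    have "(\<lambda>k. \<sigma> (r k) i a) \<longlonglongrightarrow> \<sigma>l i a" "(\<lambda>k. \<sigma> (r k) i b) \<longlonglongrightarrow> \<sigma>l i b"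
      using unif_conv_pointwise[OF lim0(4)[OF i]] ab by auto
    then show "\<sigma>l i a = 0" "\<sigma>l i b = 0" using s(5,6) by (simp_all add: LIMSEQ_const_iff)
  qed
  moreover have "\<forall>i\<in>{1..n}. weak_conv (\<lambda>k. e (r k) i) (e0 i) \<and> weak_conv (\<lambda>k x. K (r k) (w (r k) i x)) (\<xi> i) \<and>
        unif_conv (\<lambda>k. w (r k) i) (wl i) \<and> unif_conv (\<lambda>k. \<sigma> (r k) i) (\<sigma>l i)"
    using lim0 wl by auto
  ultimately show ?thesis using r(1) by blast
qed

section \<open>Minimisers of the regularised tracking problem\<close>

definition tracking :: "real \<Rightarrow> real \<Rightarrow> (nat \<Rightarrow> real \<Rightarrow> real) \<Rightarrow> (nat \<Rightarrow> real \<Rightarrow> real) \<Rightarrow> (nat \<Rightarrow> real \<Rightarrow> real) \<Rightarrow> (nat \<Rightarrow> real \<Rightarrow> real) \<Rightarrow> real" where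
  "tracking A B z v e w = A / 2 * (\<Sum>i=1..n. IP (\<lambda>x. w i x - z i x) (\<lambda>x. w i x - z i x))
     + B / 2 * (\<Sum>i=1..n. IP (\<lambda>x. e i x - v i x) (\<lambda>x. e i x - v i x))"

text \<open>The competitors are all solutions of the system rather than all forcings. Since \<open>e\<close> is determined by
  \<open>w\<close> and \<open>\<sigma>\<close>, no solvability for a given forcing is presupposed.\<close>

definition minimal where
  "minimal S K A B z v e w \<longleftrightarrow>
     (\<forall>e' w' \<sigma>'. flux_system S e' (\<lambda>i x. K (w' i x)) w' \<sigma>' \<longrightarrow> tracking A B z v e w \<le> tracking A B z v e' w')"

lemma tracking_nonneg: "0 \<le> A \<Longrightarrow> 0 \<le> B \<Longrightarrow> 0 \<le> tracking A B z v e w"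
  unfolding tracking_def by (intro add_nonneg_nonneg mult_nonneg_nonneg sum_nonneg) auto

lemma tracking_control_bound:
  assumes "0 \<le> A" "0 < B" "i \<in> {1..n}" "v i \<in> LL" "e i \<in> LL" "tracking A B z v e w \<le> c"
  shows "nrm (e i) \<le> sqrt (2 * c / B) + nrm (v i)"
proof -
  have "IP (\<lambda>x. e i x - v i x) (\<lambda>x. e i x - v i x) \<le> (\<Sum>i=1..n. IP (\<lambda>x. e i x - v i x) (\<lambda>x. e i x - v i x))"
    using assms(3) by (intro member_le_sum) auto
  moreover have "0 \<le> A / 2 * (\<Sum>i=1..n. IP (\<lambda>x. w i x - z i x) (\<lambda>x. w i x - z i x))"
    using assms(1) by (intro mult_nonneg_nonneg sum_nonneg) auto
  then have "B / 2 * (\<Sum>i=1..n. IP (\<lambda>x. e i x - v i x) (\<lambda>x. e i x - v i x)) \<le> c"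
    using assms(6) unfolding tracking_def by linarith
  then have "(\<Sum>i=1..n. IP (\<lambda>x. e i x - v i x) (\<lambda>x. e i x - v i x)) \<le> 2 * c / B"
    using assms(2) by (simp add: field_simps)
  ultimately have "IP (\<lambda>x. e i x - v i x) (\<lambda>x. e i x - v i x) \<le> 2 * c / B" by linarith
  then have "nrm (\<lambda>x. e i x - v i x) \<le> sqrt (2 * c / B)" unfolding nrm_def by (rule real_sqrt_le_mono)
  moreover have "nrm (\<lambda>x. (e i x - v i x) + v i x) \<le> nrm (\<lambda>x. e i x - v i x) + nrm (v i)"
    using assms(4,5) by (intro nrm_triangle) auto
  ultimately show ?thesis by simp
qed

lemma flux_system_cong_AE:
  assumes s: "flux_system S e \<xi> w \<sigma>"
    and ae: "\<And>i. i \<in> {1..n} \<Longrightarrow> AE x in M. \<xi>' i x = \<xi> i x" "\<And>i. i \<in> {1..n} \<Longrightarrow> AE x in M. e' i x = e i x"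
  shows "flux_system S e' \<xi>' w \<sigma>"
  unfolding flux_system_def
proof (intro conjI ballI)
  show "w 0 = w0" using s by (rule flux_system_w0)
  fix i assume i: "i \<in> {1..n}"
  note d = flux_systemD[OF s i]
  show "e' i \<in> LL" "\<xi>' i \<in> LL" using LL_AE'[OF d(1) ae(2)[OF i]] LL_AE'[OF d(2) ae(1)[OF i]] .
  show "AC (w i) (\<lambda>x. S (\<sigma> i x))" "\<sigma> i a = 0" "\<sigma> i b = 0" using d by auto
  show "AC (\<sigma> i) (\<lambda>x. h (w i x) + \<xi>' i x - w (i - 1) x / \<tau> - e' i x)"
  proof (rule AC_cong[OF d(4)])
    show "AE x in M. h (w i x) + \<xi>' i x - w (i - 1) x / \<tau> - e' i x = h (w i x) + \<xi> i x - w (i - 1) x / \<tau> - e i x"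
      using ae(1)[OF i] ae(2)[OF i] by eventually_elim simp
  qed simp
qed

text \<open>The zero state and the zero flux, with the forcing that this choice dictates.\<close>

lemma trivial_flux_system:
  assumes R: "regularisation S S' K K'"
  shows "\<exists>e w \<sigma>. flux_system S e (\<lambda>i x. K (w i x)) w \<sigma>"
proof -
  note r = regularisationD[OF R]
  define w where "w i = (if i = 0 then w0 else (\<lambda>x. 0))" for i :: nat
  define e where "e i = (\<lambda>x. h 0 - w (i - 1) x / \<tau>)" for i
  have wL: "w i \<in> LL" for i using LL_cont[OF w0_cont] by (auto simp: w_def)
  have "flux_system S e (\<lambda>i x. K (w i x)) w (\<lambda>i x. 0)"
    unfolding flux_system_def
  proof (intro conjI ballI)
    fix i assume i: "i \<in> {1..n}"
    show "e i \<in> LL" unfolding e_def using wL by auto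
    have wi: "w i = (\<lambda>x. 0)" using i by (simp add: w_def)
    show "(\<lambda>x. K (w i x)) \<in> LL" by (simp add: wi r)
    show "AC (w i) (\<lambda>x. S 0)" by (simp add: wi r AC_const)
    show "AC (\<lambda>x. 0) (\<lambda>x. h (w i x) + K (w i x) - w (i - 1) x / \<tau> - e i x)"
      by (simp add: wi r e_def AC_const)
  qed (auto simp: w_def)
  then show ?thesis by blast
qed

text \<open>The direct method. The state term converges along a minimising sequence; the forcing converges weakly
  only, and its term is bounded from below by its tangent at the limit.\<close>

lemma minimiser_exists:
  assumes R: "regularisation S S' K K'" and A: "0 \<le> A" and B: "0 < B"
    and z0: "\<forall>i\<in>{1..n}. z i \<in> LL" and v0: "\<forall>i\<in>{1..n}. v i \<in> LL"
  shows "\<exists>e w \<sigma>. flux_system S e (\<lambda>i x. K (w i x)) w \<sigma> \<and> minimal S K A B z v e w"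
proof -
  have z: "z i \<in> LL" and v: "v i \<in> LL" if "i \<in> {1..n}" for i using z0 v0 that by auto
  note r = regularisationD[OF R]
  define V where "V = {tracking A B z v e w | e w \<sigma>. flux_system S e (\<lambda>i x. K (w i x)) w \<sigma>}"
  have ne: "V \<noteq> {}" using trivial_flux_system[OF R] by (auto simp: V_def)
  have bdd: "bdd_below V" by (rule bdd_belowI[of _ 0]) (use tracking_nonneg A B in \<open>auto simp: V_def less_imp_le\<close>)
  define I where "I = Inf V"
  have "\<exists>e w \<sigma>. flux_system S e (\<lambda>i x. K (w i x)) w \<sigma> \<and> tracking A B z v e w < I + 1 / real (Suc k)" for k
  proof -
    have "Inf V < I + 1 / real (Suc k)" by (simp add: I_def)
    then obtain y where "y \<in> V" "y < I + 1 / real (Suc k)" using cInf_lessD[OF ne] by blast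
    then show ?thesis unfolding V_def by blast
  qed
  then obtain e w \<sigma> where s: "\<And>k. flux_system S (e k) (\<lambda>i x. K (w k i x)) (w k) (\<sigma> k)"
    and Jk: "\<And>k. tracking A B z v (e k) (w k) < I + 1 / real (Suc k)" by metis
  define E where "E = sqrt (2 * (I + 1) / B) + (\<Sum>i=1..n. nrm (v i))"
  have E: "nrm (e k i) \<le> E" if i: "i \<in> {1..n}" for k i
  proof -
    have "1 / real (Suc k) \<le> 1" by simp
    then have "tracking A B z v (e k) (w k) \<le> I + 1" using Jk[of k] by linarith
    from tracking_control_bound[of A B i v "e k" z "w k", OF A B i v[OF i] flux_systemD(1)[OF s i] this]
    have "nrm (e k i) \<le> sqrt (2 * (I + 1) / B) + nrm (v i)" .
    moreover have "nrm (v i) \<le> (\<Sum>i=1..n. nrm (v i))" using i by (intro member_le_sum) auto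
    ultimately show ?thesis by (simp add: E_def)
  qed
  obtain r0 e0 \<xi> wl \<sigma>l where r0: "strict_mono (r0::nat\<Rightarrow>nat)" and sl: "flux_system S e0 \<xi> wl \<sigma>l"
    and lim: "\<forall>i\<in>{1..n}. weak_conv (\<lambda>k. e (r0 k) i) (e0 i) \<and> weak_conv (\<lambda>k x. K (w (r0 k) i x)) (\<xi> i) \<and>
        unif_conv (\<lambda>k. w (r0 k) i) (wl i) \<and> unif_conv (\<lambda>k. \<sigma> (r0 k) i) (\<sigma>l i)"
    using flux_system_compact[of "\<lambda>k. S" "\<lambda>k. S'" "\<lambda>k. K" "\<lambda>k. K'" e w \<sigma> E S, OF R s E uniform_limit_const r(10)] by blast
  have s0: "flux_system S e0 (\<lambda>i x. K (wl i x)) wl \<sigma>l"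
  proof (rule flux_system_cong_AE[OF sl])
    fix i assume i: "i \<in> {1..n}"
    have "unif_conv (\<lambda>k x. K (w (r0 k) i x)) (\<lambda>x. K (wl i x))"
      by (rule unif_conv_comp[OF _ r(11)]) (use lim i in blast)
    from weak_conv_unique[OF unif_conv_weak_conv[OF this]] lim i show "AE x in M. K (wl i x) = \<xi> i x" by blast
  qed auto
  have "tracking A B z v e0 wl \<le> I"
  proof (rule LIMSEQ_le)
    have "(\<lambda>k. 1 / real (Suc (r0 k))) \<longlonglongrightarrow> 0"
      using LIMSEQ_subseq_LIMSEQ[OF LIMSEQ_inverse_real_of_nat r0] by (simp add: o_def inverse_eq_divide)
    from tendsto_add[OF tendsto_const[of I] this]
    show "(\<lambda>k. I + 1 / real (Suc (r0 k))) \<longlonglongrightarrow> I" by simp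
    \<comment> \<open>\<open>Q\<close> replaces the squares of the forcing by their tangents at the limit; it is a lower bound that is weakly continuous.\<close>
    define Q where "Q k = A / 2 * (\<Sum>i=1..n. IP (\<lambda>x. w (r0 k) i x - z i x) (\<lambda>x. w (r0 k) i x - z i x))
      + B / 2 * (\<Sum>i=1..n. 2 * IP (\<lambda>x. e (r0 k) i x - v i x) (\<lambda>x. e0 i x - v i x) - IP (\<lambda>x. e0 i x - v i x) (\<lambda>x. e0 i x - v i x))" for k
    have lw: "(\<lambda>k. IP (\<lambda>x. w (r0 k) i x - z i x) (\<lambda>x. w (r0 k) i x - z i x)) \<longlonglongrightarrow> IP (\<lambda>x. wl i x - z i x) (\<lambda>x. wl i x - z i x)"
      if i: "i \<in> {1..n}" for i
    proof -
      have u: "unif_conv (\<lambda>k. w (r0 k) i) (wl i)" using lim i by blast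
      have L: "w k i \<in> LL" "wl i \<in> LL" for k using AC_fLL flux_systemD(3)[OF s i] flux_systemD(3)[OF s0 i] by auto
      have "(\<lambda>k. IP (w (r0 k) i) (w (r0 k) i) - 2 * IP (w (r0 k) i) (z i) + IP (z i) (z i))
         \<longlonglongrightarrow> IP (wl i) (wl i) - 2 * IP (wl i) (z i) + IP (z i) (z i)"
        by (intro tendsto_add tendsto_diff tendsto_mult_left tendsto_const unif_conv_IP[OF u u] weak_convD[OF unif_conv_weak_conv[OF u] z[OF i]])
      then show ?thesis using L z[OF i] by (simp add: IP_simps IP_commute[of "z i" "wl i"] IP_commute[of "z i" "w (r0 _) i"] algebra_simps)
    qed
    have le: "(\<lambda>k. 2 * IP (\<lambda>x. e (r0 k) i x - v i x) (\<lambda>x. e0 i x - v i x) - IP (\<lambda>x. e0 i x - v i x) (\<lambda>x. e0 i x - v i x))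
      \<longlonglongrightarrow> IP (\<lambda>x. e0 i x - v i x) (\<lambda>x. e0 i x - v i x)" if i: "i \<in> {1..n}" for i
    proof -
      have "weak_conv (\<lambda>k x. e (r0 k) i x - v i x) (\<lambda>x. e0 i x - v i x)"
        using lim i by (intro weak_conv_diff weak_conv_const v) auto
      from weak_convD[OF this] have "(\<lambda>k. IP (\<lambda>x. e (r0 k) i x - v i x) (\<lambda>x. e0 i x - v i x)) \<longlonglongrightarrow> IP (\<lambda>x. e0 i x - v i x) (\<lambda>x. e0 i x - v i x)"
        using flux_systemD(1)[OF s0 i] v[OF i] by auto
      then have "(\<lambda>k. 2 * IP (\<lambda>x. e (r0 k) i x - v i x) (\<lambda>x. e0 i x - v i x) - IP (\<lambda>x. e0 i x - v i x) (\<lambda>x. e0 i x - v i x))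
       \<longlonglongrightarrow> 2 * IP (\<lambda>x. e0 i x - v i x) (\<lambda>x. e0 i x - v i x) - IP (\<lambda>x. e0 i x - v i x) (\<lambda>x. e0 i x - v i x)"
        by (intro tendsto_intros)
      then show ?thesis by simp
    qed
    show "Q \<longlonglongrightarrow> tracking A B z v e0 wl" unfolding Q_def tracking_def
      by (intro tendsto_intros lw le)
    have "Q k \<le> I + 1 / real (Suc (r0 k))" for k
    proof -
      have "2 * IP f g - IP g g \<le> IP f f" if "f \<in> LL" "g \<in> LL" for f g
        using IP_self_nonneg[of "\<lambda>x. f x - g x"] that by (simp add: IP_simps IP_commute[of g f])
      then have "Q k \<le> tracking A B z v (e (r0 k)) (w (r0 k))"
        unfolding Q_def tracking_def using B v flux_systemD(1)[OF s] flux_systemD(1)[OF s0]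
        by (intro add_left_mono mult_left_mono sum_mono) auto
      then show ?thesis using Jk[of "r0 k"] by simp
    qed
    then show "\<exists>N. \<forall>k\<ge>N. Q k \<le> I + 1 / real (Suc (r0 k))" by blast
  qed
  moreover have "I \<le> tracking A B z v e' w'" if "flux_system S e' (\<lambda>i x. K (w' i x)) w' \<sigma>'" for e' w' \<sigma>'
    unfolding I_def using that by (intro cInf_lower bdd) (auto simp: V_def)
  ultimately have "minimal S K A B z v e0 wl" unfolding minimal_def using order_trans by blast
  with s0 show ?thesis by blast
qed

section \<open>Euler-Lagrange equations and the adjoint system\<close>

text \<open>Perturb the flux of level \<open>j\<close> by \<open>t * \<eta>\<close> and the left end value of \<open>w j\<close> by \<open>t * \<theta>\<close>. The state \<open>w j\<close> is
  then the primitive of \<open>S (\<sigma> + t * \<eta>)\<close>, and the forcing is adapted at the levels \<open>j\<close> and \<open>Suc j\<close>, the only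
  flux equations in which \<open>w j\<close> occurs, so the perturbed triple still solves the system. The
  derivative of the state is \<open>\<omega>\<close>.\<close>

lemma minimality_variation:
  assumes R: "regularisation S S' K K'"
    and s: "flux_system S e (\<lambda>i x. K (w i x)) w \<sigma>"
    and min: "minimal S K A B z v e w"
    and z: "\<forall>i\<in>{1..n}. z i \<in> LL" and v: "\<forall>i\<in>{1..n}. v i \<in> LL"
    and j: "j \<in> {1..n}" and eta: "AC \<eta> \<eta>'" "\<eta> a = 0" "\<eta> b = 0"
    and om: "\<And>x. \<omega> x = \<theta> + integral {a..x} (\<lambda>y. S' (\<sigma> j y) * \<eta> y)"
  shows "0 \<le> A * IP \<omega> (\<lambda>x. w j x - z j x)
     + B * IP (\<lambda>x. (h' (w j x) + K' (w j x)) * \<omega> x - \<eta>' x) (\<lambda>x. e j x - v j x)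
     - (if j < n then B / \<tau> * IP \<omega> (\<lambda>x. e (Suc j) x - v (Suc j) x) else 0)"
proof -
  note r = regularisationD[OF R] and sj = flux_systemD[OF s j]
  define t where "t k = 1 / real (Suc k)" for k
  have t0: "t k \<noteq> 0" "0 < t k" "t k \<le> 1" for k by (auto simp: t_def)
  have tl: "t \<longlonglongrightarrow> 0" unfolding t_def using LIMSEQ_inverse_real_of_nat by (simp add: inverse_eq_divide)
  define q where "q k y = (S (\<sigma> j y + t k * \<eta> y) - S (\<sigma> j y)) / t k" for k y
  define \<delta> where "\<delta> k x = \<theta> + integral {a..x} (q k)" for k x
  have c\<sigma>: "continuous_on {a..b} (\<sigma> j)" and c\<eta>: "continuous_on {a..b} \<eta>" and cw: "continuous_on {a..b} (w j)"
    using AC_cont sj eta by auto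
  have S'L: "(\<lambda>y. S' (\<sigma> j y) * \<eta> y) \<in> LL"
    by (intro LL_cont continuous_on_mult cont_comp[OF r(2)] c\<sigma> c\<eta>)
  have om': "\<omega> = (\<lambda>x. \<theta> + integral {a..x} (\<lambda>y. S' (\<sigma> j y) * \<eta> y))" using om by blast
  have AC\<omega>: "AC \<omega> (\<lambda>y. S' (\<sigma> j y) * \<eta> y)" unfolding om' by (rule AC_prim[OF S'L])
  have qL: "q k \<in> LL" for k unfolding q_def
    by (intro LL_divide LL_diff LL_cont cont_comp[OF r(10)] continuous_on_add continuous_on_mult continuous_on_const c\<sigma> c\<eta>)
  have AC\<delta>: "AC (\<delta> k) (q k)" for k unfolding \<delta>_def by (rule AC_prim[OF qL])
  have HL: "(\<lambda>y. \<Lambda> * \<bar>\<eta> y\<bar>) \<in> LL" using c\<eta> by (intro LL_cont continuous_intros)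
  have qb: "\<bar>q k y\<bar> \<le> \<Lambda> * \<bar>\<eta> y\<bar>" for k y
  proof -
    have "\<bar>S (\<sigma> j y + t k * \<eta> y) - S (\<sigma> j y)\<bar> \<le> \<Lambda> * (t k * \<bar>\<eta> y\<bar>)"
      using r(12)[of "\<sigma> j y + t k * \<eta> y" "\<sigma> j y"] t0(2)[of k] by (simp add: abs_mult)
    then show ?thesis using t0(2)[of k] unfolding q_def by (simp add: field_simps)
  qed
  have ql: "(\<lambda>k. q k y) \<longlonglongrightarrow> S' (\<sigma> j y) * \<eta> y" for y
    unfolding q_def by (rule diff_quotient_limit[OF r(1) tl t0(1) tendsto_const])
  have b\<delta>: "bounded_pointwise \<delta> \<omega>" unfolding bounded_pointwise_def
  proof (intro conjI allI ballI)
    show "continuous_on {a..b} (\<delta> k)" "continuous_on {a..b} \<omega>" for k using AC_cont AC\<delta> AC\<omega> by auto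
    fix x assume x: "x \<in> {a..b}"
    have "(\<lambda>k. IP (q k) (indicator {a..x})) \<longlonglongrightarrow> IP (\<lambda>y. S' (\<sigma> j y) * \<eta> y) (indicator {a..x})"
      by (rule IP_tendsto_dominated[OF qL LL_meas[OF S'L] LL_indicator HL ql qb]) simp
    then have "(\<lambda>k. integral {a..x} (q k)) \<longlonglongrightarrow> integral {a..x} (\<lambda>y. S' (\<sigma> j y) * \<eta> y)"
      using x by (simp add: LL_primitive[OF qL] LL_primitive[OF S'L])
    then show "(\<lambda>k. \<delta> k x) \<longlonglongrightarrow> \<omega> x" unfolding \<delta>_def om by (intro tendsto_intros)
  next
    have "\<bar>\<delta> k x\<bar> \<le> \<bar>\<theta>\<bar> + nrm (\<lambda>y. \<Lambda> * \<bar>\<eta> y\<bar>) * sqrt (b - a)" if x: "x \<in> {a..b}" for k x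
    proof -
      have "nrm (q k) \<le> nrm (\<lambda>y. \<Lambda> * \<bar>\<eta> y\<bar>)"
        using qb Lam_nonneg by (intro nrm_mono qL HL) (simp add: abs_mult)
      then have "nrm (q k) * sqrt (b - a) \<le> nrm (\<lambda>y. \<Lambda> * \<bar>\<eta> y\<bar>) * sqrt (b - a)" using ab by (intro mult_right_mono) auto
      moreover have "\<delta> k a = \<theta>" by (simp add: \<delta>_def)
      ultimately show ?thesis using AC_bound[OF AC\<delta> x, of k] by simp
    qed
    then show "\<exists>B. \<forall>k. \<forall>x\<in>{a..b}. \<bar>\<delta> k x\<bar> \<le> B" by blast
  qed
  define F where "F y = h y + K y" for y
  have F: "(F has_real_derivative (h' y + K' y)) (at y)" for y
    unfolding F_def by (intro derivative_intros h_deriv r)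
  have F'c: "continuous_on UNIV (\<lambda>y. h' y + K' y)" by (intro continuous_on_add h'_cont r)
  have Fc: "continuous_on UNIV F" by (rule has_deriv_cont) (rule F)
  define \<phi> where "\<phi> k x = (F (w j x + t k * \<delta> k x) - F (w j x)) / t k" for k x
  have cd: "continuous_on {a..b} (\<delta> k)" "continuous_on {a..b} \<omega>" for k using b\<delta> unfolding bounded_pointwise_def by auto
  have b\<phi>: "bounded_pointwise \<phi> (\<lambda>x. (h' (w j x) + K' (w j x)) * \<omega> x)" unfolding bounded_pointwise_def
  proof (intro conjI allI ballI)
    show "continuous_on {a..b} (\<phi> k)" for k unfolding \<phi>_def using t0
      by (intro continuous_on_divide continuous_on_diff cont_comp[OF Fc] continuous_on_add continuous_on_mult continuous_on_const cd cw) auto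
    show "continuous_on {a..b} (\<lambda>x. (h' (w j x) + K' (w j x)) * \<omega> x)"
      by (intro continuous_on_mult continuous_on_add cont_comp[OF h'_cont] cont_comp[OF r(7)] cd cw)
    fix x assume x: "x \<in> {a..b}"
    then have "(\<lambda>k. \<delta> k x) \<longlonglongrightarrow> \<omega> x" using b\<delta> unfolding bounded_pointwise_def by blast
    then show "(\<lambda>k. \<phi> k x) \<longlonglongrightarrow> (h' (w j x) + K' (w j x)) * \<omega> x"
      unfolding \<phi>_def by (rule diff_quotient_limit[OF F tl t0(1)])
  next
    obtain Bd where Bd: "\<And>k x. x \<in> {a..b} \<Longrightarrow> \<bar>\<delta> k x\<bar> \<le> Bd" using b\<delta> unfolding bounded_pointwise_def by blast
    obtain Bw where Bw: "\<And>x. x \<in> {a..b} \<Longrightarrow> \<bar>w j x\<bar> \<le> Bw" using cont_bound[OF cw] by blast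
    define Cc where "Cc = Bw + Bd"
    have "bounded ((\<lambda>y. h' y + K' y) ` {-Cc..Cc})"
      using continuous_on_subset[OF F'c, of "{-Cc..Cc}"] by (intro compact_imp_bounded compact_continuous_image) auto
    then obtain L where "\<forall>y\<in>{-Cc..Cc}. \<bar>h' y + K' y\<bar> \<le> L" by (auto simp: bounded_iff)
    then have L: "\<And>y. y \<in> {-Cc..Cc} \<Longrightarrow> \<bar>h' y + K' y\<bar> \<le> L" by blast
    have "\<bar>\<phi> k x\<bar> \<le> L * Bd" if x: "x \<in> {a..b}" for k x
    proof -
      have Bd0: "0 \<le> Bd" using Bd[OF x, of k] by linarith
      have td: "\<bar>t k * \<delta> k x\<bar> \<le> t k * Bd" using Bd[OF x, of k] t0(2)[of k] by (simp add: abs_mult)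
      have "t k * Bd \<le> Bd" using t0(2,3)[of k] Bd0 by (intro mult_left_le_one_le) auto
      with td Bw[OF x] have in1: "w j x + t k * \<delta> k x \<in> {-Cc..Cc}" "w j x \<in> {-Cc..Cc}"
        using Bd0 by (auto simp: Cc_def abs_le_iff)
      have "norm (F (w j x + t k * \<delta> k x) - F (w j x)) \<le> L * norm ((w j x + t k * \<delta> k x) - w j x)"
        by (rule field_differentiable_bound[of "{-Cc..Cc}" F "\<lambda>y. h' y + K' y"])
          (use F L in1 in \<open>auto intro: has_field_derivative_at_within\<close>)
      also have "\<dots> \<le> L * (t k * Bd)" using td L[OF in1(2)] by (intro mult_left_mono) auto
      finally have "\<bar>F (w j x + t k * \<delta> k x) - F (w j x)\<bar> \<le> L * Bd * t k" by (simp add: mult_ac)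
      then show ?thesis using t0(2)[of k] unfolding \<phi>_def by (simp add: field_simps)
    qed
    then show "\<exists>B. \<forall>k. \<forall>x\<in>{a..b}. \<bar>\<phi> k x\<bar> \<le> B" by blast
  qed
  \<comment> \<open>Increments of states and forcings divided by \<open>t k\<close>, and their limits \<open>dw\<close> and \<open>de\<close>.\<close>
  define qw where "qw k i = (if i = j then \<delta> k else (\<lambda>x. 0))" for k i
  define qe where "qe k i = (if i = j then (\<lambda>x. \<phi> k x - \<eta>' x) else if i = Suc j then (\<lambda>x. (- 1 / \<tau>) * \<delta> k x) else (\<lambda>x. 0))" for k i
  define dw where "dw i = (if i = j then \<omega> else (\<lambda>x. 0))" for i
  define de where "de i = (if i = j then (\<lambda>x. (h' (w j x) + K' (w j x)) * \<omega> x - \<eta>' x) else if i = Suc j then (\<lambda>x. (- 1 / \<tau>) * \<omega> x) else (\<lambda>x. 0))" for i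
  have \<eta>'L: "\<eta>' \<in> LL" using eta AC_LL by blast
  have qw_lim: "weak_conv (\<lambda>k. qw k i) (dw i)" "\<exists>C. \<forall>k. nrm (qw k i) \<le> C" for i
    using bounded_pointwise_weak_conv[OF b\<delta>] weak_conv_const[OF LL_const[of 0]] by (auto simp: qw_def dw_def)
  have qe_lim: "weak_conv (\<lambda>k. qe k i) (de i)" for i
    using weak_conv_diff[OF bounded_pointwise_weak_conv(1)[OF b\<phi>] weak_conv_const[OF \<eta>'L]] weak_conv_scale[OF bounded_pointwise_weak_conv(1)[OF b\<delta>], of "- 1/\<tau>"]
      weak_conv_const[OF LL_const[of 0]] by (auto simp: qe_def de_def)
  have qe_bd: "\<exists>C. \<forall>k. nrm (qe k i) \<le> C" for i
  proof -
    obtain C1 where C1: "\<And>k. nrm (\<phi> k) \<le> C1" using bounded_pointwise_weak_conv(2)[OF b\<phi>] by blast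
    obtain C2 where C2: "\<And>k. nrm (\<delta> k) \<le> C2" using bounded_pointwise_weak_conv(2)[OF b\<delta>] by blast
    have "nrm (\<lambda>x. \<phi> k x - \<eta>' x) \<le> C1 + nrm \<eta>'" for k
      using nrm_diff_triangle[OF weak_conv_LL(1)[OF bounded_pointwise_weak_conv(1)[OF b\<phi>], of k] \<eta>'L] C1[of k] by linarith
    moreover have "nrm (\<lambda>x. (- 1 / \<tau>) * \<delta> k x) \<le> \<bar>- 1 / \<tau>\<bar> * C2" for k
      unfolding nrm_scale using C2 by (intro mult_left_mono) auto
    ultimately show ?thesis unfolding qe_def by (cases "i = j"; cases "i = Suc j") auto
  qed
  define wt where "wt k i x = w i x + t k * qw k i x" for k i x
  define et where "et k i x = e i x + t k * qe k i x" for k i x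
  define st where "st k i = (if i = j then (\<lambda>x. \<sigma> j x + t k * \<eta> x) else \<sigma> i)" for k i
  have sysk: "flux_system S (et k) (\<lambda>i x. K (wt k i x)) (wt k) (st k)" for k
    unfolding flux_system_def
  proof (intro conjI ballI)
    show "wt k 0 = w0" using flux_system_w0[OF s] j by (auto simp: wt_def qw_def)
    fix i assume i: "i \<in> {1..n}"
    note si = flux_systemD[OF s i]
    show "et k i \<in> LL" unfolding et_def using si(1) weak_conv_LL(1)[OF qe_lim, of k i] by auto
    show wi: "AC (wt k i) (\<lambda>x. S (st k i x))"
    proof (cases "i = j")
      case True
      have "AC (\<lambda>x. w j x + t k * \<delta> k x) (\<lambda>x. S (\<sigma> j x) + t k * q k x)"
        by (rule AC_add[OF sj(3) AC_scale[OF AC\<delta>]])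
      then show ?thesis by (rule AC_cong') (use t0 in \<open>auto simp: wt_def qw_def st_def q_def True\<close>)
    next
      case False
      then have "wt k i = w i" by (intro ext) (simp add: wt_def qw_def)
      then show ?thesis using si(3) False by (simp add: st_def)
    qed
    show "(\<lambda>x. K (wt k i x)) \<in> LL" using r(11) wi by (rule AC_comp_LL)
    show "st k i a = 0" "st k i b = 0" using si(5,6) sj(5,6) eta by (auto simp: st_def)
    show "AC (st k i) (\<lambda>x. h (wt k i x) + K (wt k i x) - wt k (i - 1) x / \<tau> - et k i x)"
    proof (cases "i = j")
      case True
      then have ne: "i - 1 \<noteq> j" using i by auto
      have "AC (\<lambda>x. \<sigma> j x + t k * \<eta> x) (\<lambda>x. (h (w j x) + K (w j x) - w (j - 1) x / \<tau> - e j x) + t k * \<eta>' x)"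
        by (rule AC_add[OF sj(4) AC_scale[OF eta(1)]])
      then show ?thesis
      proof (rule AC_cong')
        fix x
        have "t k * \<phi> k x = F (w j x + t k * \<delta> k x) - F (w j x)" using t0 by (simp add: \<phi>_def)
        then show "h (wt k i x) + K (wt k i x) - wt k (i - 1) x / \<tau> - et k i x
            = (h (w j x) + K (w j x) - w (j - 1) x / \<tau> - e j x) + t k * \<eta>' x"
          using ne by (simp add: wt_def et_def qw_def qe_def True F_def right_diff_distrib)
      qed (simp add: st_def True)
    next
      case False
      show ?thesis
      proof (cases "i = Suc j")
        case True
        show ?thesis using si(4)
        proof (rule AC_cong')
          fix x show "h (wt k i x) + K (wt k i x) - wt k (i - 1) x / \<tau> - et k i x
            = h (w i x) + K (w i x) - w (i - 1) x / \<tau> - e i x"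
            by (simp add: wt_def et_def qw_def qe_def True add_divide_distrib)
        qed (simp add: st_def True)
      next
        case False
        with \<open>i \<noteq> j\<close> have "i - 1 \<noteq> j" using i by auto
        then show ?thesis using si(4) \<open>i \<noteq> j\<close> False by (simp add: wt_def et_def qw_def qe_def st_def)
      qed
    qed
  qed
  have wL: "w i \<in> LL" if "i \<in> {1..n}" for i using AC_fLL[OF flux_systemD(3)[OF s that]] .
  have "(\<lambda>k. A / 2 * (\<Sum>i=1..n. (IP (\<lambda>x. (w i x - z i x) + t k * qw k i x) (\<lambda>x. (w i x - z i x) + t k * qw k i x)
        - IP (\<lambda>x. w i x - z i x) (\<lambda>x. w i x - z i x)) / t k)
      + B / 2 * (\<Sum>i=1..n. (IP (\<lambda>x. (e i x - v i x) + t k * qe k i x) (\<lambda>x. (e i x - v i x) + t k * qe k i x)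
        - IP (\<lambda>x. e i x - v i x) (\<lambda>x. e i x - v i x)) / t k))
    \<longlonglongrightarrow> A / 2 * (\<Sum>i=1..n. 2 * IP (dw i) (\<lambda>x. w i x - z i x)) + B / 2 * (\<Sum>i=1..n. 2 * IP (de i) (\<lambda>x. e i x - v i x))"
    (is "?Q \<longlonglongrightarrow> ?D")
    by (intro tendsto_add tendsto_mult_left tendsto_sum quad_limit LL_diff wL z[rule_format] v[rule_format] flux_systemD(1)[OF s] qw_lim qe_lim qe_bd tl t0(1))
  moreover have "0 \<le> ?Q k" for k
  proof -
    have "tracking A B z v e w \<le> tracking A B z v (et k) (wt k)" using min sysk unfolding minimal_def by blast
    then have "0 \<le> (tracking A B z v (et k) (wt k) - tracking A B z v e w) / t k" using t0(2)[of k] by simp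
    also have "\<dots> = ?Q k"
    proof -
      have alg: "(A / 2 * x1 + B / 2 * y1 - (A / 2 * x0 + B / 2 * y0)) / s = A / 2 * ((x1 - x0) / s) + B / 2 * ((y1 - y0) / s)"
        for x1 x0 y1 y0 s :: real by (simp add: diff_divide_distrib add_divide_distrib right_diff_distrib)
      show ?thesis unfolding tracking_def wt_def et_def alg
        by (simp only: sum_subtractf sum_divide_distrib[symmetric] diff_add_eq)
    qed
    finally show ?thesis .
  qed
  ultimately have "0 \<le> ?D" by (intro LIMSEQ_le_const) auto
  also have "(\<Sum>i=1..n. 2 * IP (dw i) (\<lambda>x. w i x - z i x)) = (\<Sum>i=1..n. if i = j then 2 * IP \<omega> (\<lambda>x. w j x - z j x) else 0)"
    by (intro sum.cong) (auto simp: dw_def IP_simps)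
  also have "\<dots> = 2 * IP \<omega> (\<lambda>x. w j x - z j x)" using j by simp
  also have "(\<Sum>i=1..n. 2 * IP (de i) (\<lambda>x. e i x - v i x)) =
      (\<Sum>i=1..n. (if i = j then 2 * IP (\<lambda>x. (h' (w j x) + K' (w j x)) * \<omega> x - \<eta>' x) (\<lambda>x. e j x - v j x) else 0)
        + (if i = Suc j then 2 * ((- 1 / \<tau>) * IP \<omega> (\<lambda>x. e (Suc j) x - v (Suc j) x)) else 0))"
    by (intro sum.cong) (auto simp: de_def IP_simps)
  also have "\<dots> = 2 * IP (\<lambda>x. (h' (w j x) + K' (w j x)) * \<omega> x - \<eta>' x) (\<lambda>x. e j x - v j x)
      + (if Suc j \<in> {1..n} then 2 * ((- 1 / \<tau>) * IP \<omega> (\<lambda>x. e (Suc j) x - v (Suc j) x)) else 0)"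
    unfolding sum.distrib using j by (simp add: sum.delta)
  finally show ?thesis by (simp add: Suc_le_eq algebra_simps split: if_splits)
qed

text \<open>Changing the sign of the direction turns the inequality into an equation. With constant \<open>\<omega>\<close> it
  shows that \<open>R\<close>, the primitive of the adjoint right-hand side \<open>G\<close>, vanishes at \<open>b\<close>; with \<open>\<omega> a = 0\<close> and
  integration by parts it shows that \<open>p - Q\<close>, where \<open>Q' = S' \<sigma> * R\<close>, is orthogonal to the derivatives of all
  functions vanishing at the ends, hence constant.\<close>

lemma adjoint_exists:
  assumes R: "regularisation S S' K K'"
    and s: "flux_system S e (\<lambda>i x. K (w i x)) w \<sigma>"
    and min: "minimal S K A B z v e w"
    and z: "\<forall>i\<in>{1..n}. z i \<in> LL" and v: "\<forall>i\<in>{1..n}. v i \<in> LL"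
    and j: "j \<in> {1..n}" and p: "\<And>i x. p i x = (if i \<in> {1..n} then - B * (e i x - v i x) else 0)"
  shows "\<exists>P R. AC P (\<lambda>x. S' (\<sigma> j x) * R x) \<and> (AE x in M. P x = p j x) \<and> R a = 0 \<and> R b = 0 \<and>
     AC R (\<lambda>x. (h' (w j x) + K' (w j x)) * p j x - p (Suc j) x / \<tau> - A * (w j x - z j x))"
proof -
  note r = regularisationD[OF R] and sj = flux_systemD[OF s j]
  have pL: "p i \<in> LL" for i
  proof -
    have "(\<lambda>x. if i \<in> {1..n} then - B * (e i x - v i x) else 0) \<in> LL"
    proof (cases "i \<in> {1..n}")
      case True
      from LL_scale[OF LL_diff[OF flux_systemD(1)[OF s True] v[rule_format, OF True]], of "-B"] show ?thesis using True by simp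
    qed auto
    moreover have "p i = (\<lambda>x. if i \<in> {1..n} then - B * (e i x - v i x) else 0)" using p by blast
    ultimately show ?thesis by simp
  qed
  have c\<sigma>: "continuous_on {a..b} (\<sigma> j)" and cw: "continuous_on {a..b} (w j)"
    using AC_cont sj by auto
  have wzL: "(\<lambda>x. w j x - z j x) \<in> LL" using LL_cont[OF cw] z[rule_format, OF j] by auto
  have Fc: "continuous_on {a..b} (\<lambda>x. h' (w j x) + K' (w j x))"
    by (intro continuous_on_add cont_comp[OF h'_cont] cont_comp[OF r(7)] cw)
  define G where "G x = (h' (w j x) + K' (w j x)) * p j x - p (Suc j) x / \<tau> - A * (w j x - z j x)" for x
  have FpL: "(\<lambda>x. (h' (w j x) + K' (w j x)) * p j x) \<in> LL" by (rule LL_cont_mult[OF Fc pL])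
  have GL: "G \<in> LL" unfolding G_def by (intro LL_diff FpL LL_divide LL_scale pL wzL)
  have S'L: "(\<lambda>y. S' (\<sigma> j y) * \<eta> y) \<in> LL" if "\<eta> \<in> LL" for \<eta>
    by (rule LL_cont_mult[OF cont_comp[OF r(2) c\<sigma>] that])
  have ineq: "0 \<le> - IP \<omega> G + IP \<eta>' (p j)"
    if eta: "AC \<eta> \<eta>'" "\<eta> a = 0" "\<eta> b = 0" and om: "\<And>x. \<omega> x = \<theta> + integral {a..x} (\<lambda>y. S' (\<sigma> j y) * \<eta> y)" for \<eta> \<eta>' \<omega> \<theta>
  proof -
    have om': "\<omega> = (\<lambda>x. \<theta> + integral {a..x} (\<lambda>y. S' (\<sigma> j y) * \<eta> y))" using om by blast
    have AC\<omega>: "AC \<omega> (\<lambda>y. S' (\<sigma> j y) * \<eta> y)" unfolding om' by (rule AC_prim[OF S'L[OF AC_fLL[OF eta(1)]]])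
    have \<omega>L: "\<omega> \<in> LL" and c\<omega>: "continuous_on {a..b} \<omega>" and \<eta>'L: "\<eta>' \<in> LL"
      using AC_fLL[OF AC\<omega>] AC_cont[OF AC\<omega>] AC_LL[OF eta(1)] .
    have F\<omega>L: "(\<lambda>x. (h' (w j x) + K' (w j x)) * \<omega> x) \<in> LL" by (rule LL_cont_mult[OF Fc \<omega>L])
    have "B * IP (\<lambda>x. (h' (w j x) + K' (w j x)) * \<omega> x - \<eta>' x) (\<lambda>x. e j x - v j x)
       = IP (\<lambda>x. (h' (w j x) + K' (w j x)) * \<omega> x - \<eta>' x) (\<lambda>x. - p j x)"
      unfolding p using j by (simp flip: IP_scale_right)
    also have "\<dots> = - IP (\<lambda>x. (h' (w j x) + K' (w j x)) * \<omega> x) (p j) + IP \<eta>' (p j)"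
      using F\<omega>L \<eta>'L pL by (simp add: IP_simps)
    also have "IP (\<lambda>x. (h' (w j x) + K' (w j x)) * \<omega> x) (p j) = IP \<omega> (\<lambda>x. (h' (w j x) + K' (w j x)) * p j x)"
      by (rule IP_cong) (simp add: mult_ac)
    finally have 1: "B * IP (\<lambda>x. (h' (w j x) + K' (w j x)) * \<omega> x - \<eta>' x) (\<lambda>x. e j x - v j x)
       = - IP \<omega> (\<lambda>x. (h' (w j x) + K' (w j x)) * p j x) + IP \<eta>' (p j)" .
    have 2: "(if j < n then B / \<tau> * IP \<omega> (\<lambda>x. e (Suc j) x - v (Suc j) x) else 0) = - IP \<omega> (\<lambda>x. p (Suc j) x / \<tau>)"
    proof (cases "j < n")
      case True
      then have "p (Suc j) = (\<lambda>x. - B * (e (Suc j) x - v (Suc j) x))" using p by (intro ext) auto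
      then have "IP \<omega> (\<lambda>x. p (Suc j) x / \<tau>) = - B * IP \<omega> (\<lambda>x. e (Suc j) x - v (Suc j) x) / \<tau>"
        by (simp only: IP_divide_right IP_scale_right)
      then show ?thesis using True by simp
    next
      case False
      then have "p (Suc j) = (\<lambda>x. 0)" using p by auto
      then show ?thesis using False by (simp add: IP_simps)
    qed
    have "IP \<omega> G = IP \<omega> (\<lambda>x. (h' (w j x) + K' (w j x)) * p j x) - IP \<omega> (\<lambda>x. p (Suc j) x / \<tau>) - A * IP \<omega> (\<lambda>x. w j x - z j x)"
      unfolding G_def by (simp only: IP_diff_right[OF LL_diff[OF FpL LL_divide[OF pL]] LL_scale[OF wzL] \<omega>L]
          IP_diff_right[OF FpL LL_divide[OF pL] \<omega>L] IP_scale_right)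
    then show ?thesis using minimality_variation[OF R s min z v j eta om] 1 2 by linarith
  qed
  have eq: "IP \<omega> G = IP \<eta>' (p j)"
    if eta: "AC \<eta> \<eta>'" "\<eta> a = 0" "\<eta> b = 0" and om: "\<And>x. \<omega> x = \<theta> + integral {a..x} (\<lambda>y. S' (\<sigma> j y) * \<eta> y)" for \<eta> \<eta>' \<omega> \<theta>
  proof -
    have "0 \<le> - IP (\<lambda>x. - \<omega> x) G + IP (\<lambda>x. - \<eta>' x) (p j)"
      by (rule ineq[OF AC_minus[OF eta(1)], of _ "- \<theta>"]) (use eta om in simp_all)
    then show ?thesis using ineq[OF eta om] by (simp add: IP_simps)
  qed
  define Rr where "Rr x = 0 + integral {a..x} G" for x
  have ACR: "AC Rr G" unfolding Rr_def by (rule AC_prim[OF GL])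
  have Ra: "Rr a = 0" by (simp add: Rr_def)
  have "IP (\<lambda>x. 1) G = IP (\<lambda>x. 0) (p j)"
    by (rule eq[OF AC_const, of 0 _ 1]) simp_all
  then have Rb: "Rr b = 0" using LINT_M[OF GL] by (simp add: Rr_def IP_simps ip_L2_def)
  define Q where "Q x = 0 + integral {a..x} (\<lambda>y. S' (\<sigma> j y) * Rr y)" for x
  have QL': "(\<lambda>y. S' (\<sigma> j y) * Rr y) \<in> LL" by (rule S'L[OF AC_fLL[OF ACR]])
  have ACQ: "AC Q (\<lambda>y. S' (\<sigma> j y) * Rr y)" unfolding Q_def by (rule AC_prim[OF QL'])
  have QL: "Q \<in> LL" using ACQ by (rule AC_fLL)
  have weak: "IP \<eta>' (\<lambda>x. p j x - Q x) = 0" if eta: "AC \<eta> \<eta>'" "\<eta> a = 0" "\<eta> b = 0" for \<eta> \<eta>'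
  proof -
    define \<omega> where "\<omega> x = 0 + integral {a..x} (\<lambda>y. S' (\<sigma> j y) * \<eta> y)" for x
    have AC\<omega>: "AC \<omega> (\<lambda>y. S' (\<sigma> j y) * \<eta> y)" unfolding \<omega>_def by (rule AC_prim[OF S'L[OF AC_fLL[OF eta(1)]]])
    have "IP \<omega> G = IP \<eta>' (p j)" by (rule eq[OF eta \<omega>_def])
    moreover have "IP \<omega> G + IP (\<lambda>y. S' (\<sigma> j y) * \<eta> y) Rr = 0" using AC_by_parts[OF AC\<omega> ACR] Ra Rb by simp
    moreover have "IP \<eta> (\<lambda>y. S' (\<sigma> j y) * Rr y) + IP \<eta>' Q = 0" using AC_by_parts[OF eta(1) ACQ] eta by simp
    moreover have "IP \<eta> (\<lambda>y. S' (\<sigma> j y) * Rr y) = IP (\<lambda>y. S' (\<sigma> j y) * \<eta> y) Rr" by (rule IP_cong) simp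
    ultimately show ?thesis using IP_diff_right[OF pL[of j] QL AC_LL[OF eta(1)]] by linarith
  qed
  \<comment> \<open>Test with \<open>\<eta>\<close> whose derivative is \<open>p j - Q\<close> minus its mean; then \<open>\<eta>\<close> vanishes at both ends.\<close>
  define c where "c = IP (\<lambda>x. 1) (\<lambda>x. p j x - Q x) / (b - a)"
  define \<eta>' where "\<eta>' x = p j x - Q x - c" for x
  have \<eta>'L: "\<eta>' \<in> LL" unfolding \<eta>'_def by (intro LL_diff pL QL LL_const)
  have one: "IP (\<lambda>x. 1) (\<lambda>x. 1) = b - a" using measure_M by (simp add: ip_L2_def)
  have mean: "IP (\<lambda>x. 1) \<eta>' = 0"
  proof -
    have "IP (\<lambda>x. 1) \<eta>' = IP (\<lambda>x. 1) (\<lambda>x. p j x - Q x) - IP (\<lambda>x. 1) (\<lambda>x. c * 1)"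
      unfolding \<eta>'_def using IP_diff_right[OF LL_diff[OF pL QL] LL_const[of c] LL_const[of 1]] by simp
    also have "IP (\<lambda>x. 1) (\<lambda>x. c * 1) = c * (b - a)" by (simp only: IP_scale_right one)
    finally show ?thesis using ab by (simp add: c_def)
  qed
  have eta: "AC (\<lambda>x. 0 + integral {a..x} \<eta>') \<eta>'" by (rule AC_prim[OF \<eta>'L])
  have "integral {a..b} \<eta>' = 0" using mean LINT_M[OF \<eta>'L] by (simp add: ip_L2_def)
  then have "IP \<eta>' (\<lambda>x. p j x - Q x) = 0" by (intro weak[OF eta]) auto
  moreover have "IP \<eta>' \<eta>' = IP \<eta>' (\<lambda>x. p j x - Q x) - IP \<eta>' (\<lambda>x. c * 1)"
    using IP_diff_right[OF LL_diff[OF pL QL] LL_const[of c] \<eta>'L, of j] by (simp add: \<eta>'_def[abs_def])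
  moreover have "IP \<eta>' (\<lambda>x. c * 1) = 0" using mean by (simp only: IP_scale_right IP_commute[of \<eta>'])
  ultimately have "IP \<eta>' \<eta>' = 0" by simp
  from IP_self_0[OF \<eta>'L this] have ae: "AE x in M. c + Q x = p j x"
    by (rule eventually_mono) (simp add: \<eta>'_def)
  have "AC (\<lambda>x. c + Q x) (\<lambda>x. S' (\<sigma> j x) * Rr x)" using AC_add[OF AC_const ACQ] by simp
  then show ?thesis using ae Ra Rb ACR unfolding G_def by blast
qed

definition adjoint_system :: "(real \<Rightarrow> real) \<Rightarrow> (real \<Rightarrow> real) \<Rightarrow> real \<Rightarrow> (nat \<Rightarrow> real \<Rightarrow> real)
    \<Rightarrow> (nat \<Rightarrow> real \<Rightarrow> real) \<Rightarrow> (nat \<Rightarrow> real \<Rightarrow> real) \<Rightarrow> (nat \<Rightarrow> real \<Rightarrow> real) \<Rightarrow> (nat \<Rightarrow> real \<Rightarrow> real) \<Rightarrow> bool" where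
  "adjoint_system S' K' A z w \<sigma> P R \<longleftrightarrow> P (Suc n) = (\<lambda>x. 0) \<and>
     (\<forall>j\<in>{1..n}. AC (P j) (\<lambda>x. S' (\<sigma> j x) * R j x) \<and> R j a = 0 \<and> R j b = 0 \<and>
        AC (R j) (\<lambda>x. (h' (w j x) + K' (w j x)) * P j x - P (Suc j) x / \<tau> - A * (w j x - z j x)))"

lemma optimality_system:
  assumes R: "regularisation S S' K K'"
    and s: "flux_system S e (\<lambda>i x. K (w i x)) w \<sigma>"
    and min: "minimal S K A B z v e w"
    and z: "\<forall>i\<in>{1..n}. z i \<in> LL" and v: "\<forall>i\<in>{1..n}. v i \<in> LL"
  shows "\<exists>P R. adjoint_system S' K' A z w \<sigma> P R \<and> (\<forall>j\<in>{1..n}. AE x in M. P j x = - B * (e j x - v j x))"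
proof -
  define p where "p i x = (if i \<in> {1..n} then - B * (e i x - v i x) else 0)" for i x
  have "\<forall>j\<in>{1..n}. \<exists>P R. AC P (\<lambda>x. S' (\<sigma> j x) * R x) \<and> (AE x in M. P x = p j x) \<and> R a = 0 \<and> R b = 0 \<and>
     AC R (\<lambda>x. (h' (w j x) + K' (w j x)) * p j x - p (Suc j) x / \<tau> - A * (w j x - z j x))"
    using adjoint_exists[OF R s min z v _ p_def] by blast
  from this[THEN bchoice] obtain P where "\<forall>j\<in>{1..n}. \<exists>R. AC (P j) (\<lambda>x. S' (\<sigma> j x) * R x) \<and> (AE x in M. P j x = p j x) \<and> R a = 0 \<and> R b = 0 \<and>
     AC R (\<lambda>x. (h' (w j x) + K' (w j x)) * p j x - p (Suc j) x / \<tau> - A * (w j x - z j x))" by blast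
  from this[THEN bchoice] obtain R where PR: "\<And>j. j \<in> {1..n} \<Longrightarrow> AC (P j) (\<lambda>x. S' (\<sigma> j x) * R j x)"
     "\<And>j. j \<in> {1..n} \<Longrightarrow> AE x in M. P j x = p j x" "\<And>j. j \<in> {1..n} \<Longrightarrow> R j a = 0" "\<And>j. j \<in> {1..n} \<Longrightarrow> R j b = 0"
     "\<And>j. j \<in> {1..n} \<Longrightarrow> AC (R j) (\<lambda>x. (h' (w j x) + K' (w j x)) * p j x - p (Suc j) x / \<tau> - A * (w j x - z j x))" by blast
  define P' where "P' j = (if j = Suc n then (\<lambda>x. 0) else P j)" for j
  have ae: "AE x in M. P' j x = p j x" if "j \<in> {1..Suc n}" for j
    using that PR(2)[of j] by (cases "j = Suc n") (auto simp: P'_def p_def)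
  have "adjoint_system S' K' A z w \<sigma> P' R"
    unfolding adjoint_system_def
  proof (intro conjI ballI)
    fix j assume j: "j \<in> {1..n}"
    then show "AC (P' j) (\<lambda>x. S' (\<sigma> j x) * R j x)" "R j a = 0" "R j b = 0" using PR by (auto simp: P'_def)
    show "AC (R j) (\<lambda>x. (h' (w j x) + K' (w j x)) * P' j x - P' (Suc j) x / \<tau> - A * (w j x - z j x))"
    proof (rule AC_cong[OF PR(5)[OF j]])
      have "AE x in M. P' j x = p j x" "AE x in M. P' (Suc j) x = p (Suc j) x" using j by (auto intro: ae)
      then show "AE x in M. (h' (w j x) + K' (w j x)) * P' j x - P' (Suc j) x / \<tau> - A * (w j x - z j x) =
          (h' (w j x) + K' (w j x)) * p j x - p (Suc j) x / \<tau> - A * (w j x - z j x)" by eventually_elim simp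
    qed simp
  qed (simp add: P'_def)
  moreover have "AE x in M. P' j x = - B * (e j x - v j x)" if "j \<in> {1..n}" for j
    using ae[of j] that by (auto simp: p_def)
  ultimately show ?thesis by blast
qed

text \<open>Testing the equation of \<open>R\<close> with \<open>P\<close> gives \<open>\<integral> (h' + K') P\<^sup>2 + \<integral> S' \<sigma> * R\<^sup>2 = \<integral> P * (P\<^sub>j\<^sub>+\<^sub>1 / \<tau> + A * (w - z))\<close>.
  Both terms on the left are nonnegative; the first controls \<open>P\<close>, the second
  controls \<open>P' = S' \<sigma> * R\<close> because \<open>(S')\<^sup>2 \<le> \<Lambda> * S'\<close>.\<close>

lemma adjoint_energy:
  assumes R: "regularisation S S' K K'" and ad: "adjoint_system S' K' A z w \<sigma> P R" and j: "j \<in> {1..n}"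
    and wc: "continuous_on {a..b} (w j)" and \<sigma>c: "continuous_on {a..b} (\<sigma> j)" and z: "z j \<in> LL"
    and A: "0 \<le> A" and E: "nrm (w j) + nrm (z j) \<le> E" and D: "nrm (P (Suc j)) \<le> D"
  shows "nrm (P j) \<le> (D / \<tau> + A * E) / m"
    "nrm (\<lambda>x. S' (\<sigma> j x) * R j x) \<le> sqrt (\<Lambda> * ((D / \<tau> + A * E) / m * (D / \<tau> + A * E)))"
proof -
  note r = regularisationD[OF R]
  have d: "AC (P j) (\<lambda>x. S' (\<sigma> j x) * R j x)" "R j a = 0" "R j b = 0"
    "AC (R j) (\<lambda>x. (h' (w j x) + K' (w j x)) * P j x - P (Suc j) x / \<tau> - A * (w j x - z j x))"
    using ad j unfolding adjoint_system_def by auto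
  have PL: "P j \<in> LL" using AC_fLL d(1) by blast
  have PSL: "P (Suc j) \<in> LL"
  proof (cases "j = n")
    case True
    then show ?thesis using ad unfolding adjoint_system_def by simp
  next
    case False
    then have "Suc j \<in> {1..n}" using j by auto
    then show ?thesis using ad AC_fLL unfolding adjoint_system_def by blast
  qed
  have wL: "(\<lambda>x. w j x - z j x) \<in> LL" using LL_cont[OF wc] z by auto
  have RL: "R j \<in> LL" using AC_fLL d(4) by blast
  have Fc: "continuous_on {a..b} (\<lambda>x. h' (w j x) + K' (w j x))"
    by (intro continuous_on_add cont_comp[OF h'_cont] cont_comp[OF r(7)] wc)
  have FPL: "(\<lambda>x. (h' (w j x) + K' (w j x)) * P j x) \<in> LL" by (rule LL_cont_mult[OF Fc PL])
  have SRL: "(\<lambda>x. S' (\<sigma> j x) * R j x) \<in> LL" using AC_LL[OF d(1)] .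
  define c where "c = D / \<tau> + A * E"
  have D0: "0 \<le> D" using D nrm_nonneg[of "P (Suc j)"] by linarith
  have E0: "0 \<le> E" using E nrm_nonneg[of "w j"] nrm_nonneg[of "z j"] by linarith
  have c0: "0 \<le> c" using D0 E0 A tau_pos by (simp add: c_def)
  have "IP (P j) (\<lambda>x. (h' (w j x) + K' (w j x)) * P j x - P (Suc j) x / \<tau> - A * (w j x - z j x)) +
      IP (\<lambda>x. S' (\<sigma> j x) * R j x) (R j) = 0" using AC_by_parts[OF d(1) d(4)] d(2,3) by simp
  then have id: "IP (P j) (\<lambda>x. (h' (w j x) + K' (w j x)) * P j x) + IP (\<lambda>x. S' (\<sigma> j x) * R j x) (R j)
     = IP (P j) (P (Suc j)) / \<tau> + A * IP (P j) (\<lambda>x. w j x - z j x)"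
    unfolding IP_diff_right[OF LL_diff[OF FPL LL_divide[OF PSL]] LL_scale[OF wL] PL]
      IP_diff_right[OF FPL LL_divide[OF PSL] PL] IP_scale_right IP_divide_right by linarith
  have "IP (P j) (P (Suc j)) / \<tau> \<le> nrm (P j) * D / \<tau>"
    using Cauchy_Schwarz[OF PL PSL] mult_left_mono[OF D nrm_nonneg[of "P j"]] tau_pos by (intro divide_right_mono) auto
  moreover have "A * IP (P j) (\<lambda>x. w j x - z j x) \<le> A * (nrm (P j) * E)"
  proof (intro mult_left_mono A)
    have "nrm (\<lambda>x. w j x - z j x) \<le> E" using nrm_diff_triangle[OF LL_cont[OF wc] z] E by linarith
    then have "nrm (P j) * nrm (\<lambda>x. w j x - z j x) \<le> nrm (P j) * E" by (intro mult_left_mono) auto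
    then show "IP (P j) (\<lambda>x. w j x - z j x) \<le> nrm (P j) * E" using Cauchy_Schwarz[OF PL wL] by linarith
  qed
  ultimately have rhs: "IP (P j) (P (Suc j)) / \<tau> + A * IP (P j) (\<lambda>x. w j x - z j x) \<le> nrm (P j) * c"
    by (simp add: c_def algebra_simps)
  have SR0: "0 \<le> IP (\<lambda>x. S' (\<sigma> j x) * R j x) (R j)"
    unfolding ip_L2_def using r(3) by (intro integral_nonneg_AE AE_I2) (simp add: mult.assoc)
  have lower: "m * IP (P j) (P j) \<le> IP (P j) (\<lambda>x. (h' (w j x) + K' (w j x)) * P j x)"
  proof -
    have "m * IP (P j) (P j) = IP (P j) (\<lambda>x. m * P j x)" by (simp add: IP_simps)
    also have "\<dots> \<le> IP (P j) (\<lambda>x. (h' (w j x) + K' (w j x)) * P j x)"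
    proof (rule IP_mono[OF PL LL_scale[OF PL] PL FPL])
      fix x
      have "m \<le> h' (w j x) + K' (w j x)" using m_le[of "w j x"] r(8)[of "w j x"] by linarith
      then have "m * (P j x * P j x) \<le> (h' (w j x) + K' (w j x)) * (P j x * P j x)" by (intro mult_right_mono) auto
      then show "P j x * (m * P j x) \<le> P j x * ((h' (w j x) + K' (w j x)) * P j x)" by (simp add: mult_ac)
    qed
    finally show ?thesis .
  qed
  have "(m * nrm (P j)) * nrm (P j) \<le> c * nrm (P j)"
    using lower id rhs SR0 by (simp add: mult.assoc nrm_sq' mult.commute[of c])
  then have "m * nrm (P j) \<le> c"
    using c0 by (cases "nrm (P j) = 0") (auto simp: mult_le_cancel_right order.strict_iff_order)
  then have P: "nrm (P j) \<le> c / m" using m_pos by (simp add: field_simps)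
  then show "nrm (P j) \<le> (D / \<tau> + A * E) / m" by (simp add: c_def)
  have "IP (\<lambda>x. S' (\<sigma> j x) * R j x) (\<lambda>x. S' (\<sigma> j x) * R j x) \<le> IP (\<lambda>x. S' (\<sigma> j x) * R j x) (\<lambda>x. \<Lambda> * R j x)"
  proof (rule IP_mono[OF SRL SRL SRL LL_scale[OF RL]])
    fix x
    have "S' (\<sigma> j x) * (S' (\<sigma> j x) * (R j x * R j x)) \<le> S' (\<sigma> j x) * (\<Lambda> * (R j x * R j x))"
      using r(3,4) by (intro mult_left_mono mult_right_mono) auto
    then show "S' (\<sigma> j x) * R j x * (S' (\<sigma> j x) * R j x) \<le> S' (\<sigma> j x) * R j x * (\<Lambda> * R j x)" by (simp add: mult_ac)
  qed
  also have "\<dots> = \<Lambda> * IP (\<lambda>x. S' (\<sigma> j x) * R j x) (R j)" by (simp add: IP_simps)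
  also have "\<dots> \<le> \<Lambda> * (nrm (P j) * c)"
  proof (rule mult_left_mono[OF _ Lam_nonneg])
    have "0 \<le> m * IP (P j) (P j)" using m_pos by simp
    then show "IP (\<lambda>x. S' (\<sigma> j x) * R j x) (R j) \<le> nrm (P j) * c" using id rhs lower by linarith
  qed
  also have "\<dots> \<le> \<Lambda> * (c / m * c)" using P c0 Lam_nonneg by (intro mult_left_mono mult_right_mono) auto
  finally show "nrm (\<lambda>x. S' (\<sigma> j x) * R j x) \<le> sqrt (\<Lambda> * ((D / \<tau> + A * E) / m * (D / \<tau> + A * E)))"
    unfolding c_def nrm_def[of "\<lambda>x. S' (\<sigma> j x) * R j x"] by (rule real_sqrt_le_mono)
qed

text \<open>Minimise the distance of the forcing to \<open>v\<close>, ignoring the state. The adjoint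
  state is then driven by its successor alone, so it vanishes level by level from the last one down; as it
  is \<open>v - e\<close>, the minimiser has forcing \<open>v\<close>.\<close>

lemma flux_system_exists:
  assumes R: "regularisation S S' K K'" and v: "\<forall>i\<in>{1..n}. v i \<in> LL"
  shows "\<exists>w \<sigma>. flux_system S v (\<lambda>i x. K (w i x)) w \<sigma>"
proof -
  have z: "\<forall>i\<in>{1..n}. (\<lambda>x. 0) \<in> LL" by simp
  obtain e w \<sigma> where s: "flux_system S e (\<lambda>i x. K (w i x)) w \<sigma>" and min: "minimal S K 0 1 (\<lambda>i x. 0) v e w"
    using minimiser_exists[OF R order_refl zero_less_one z v] by blast
  obtain P Rr where ad: "adjoint_system S' K' 0 (\<lambda>i x. 0) w \<sigma> P Rr" and Pe: "\<forall>j\<in>{1..n}. AE x in M. P j x = - 1 * (e j x - v j x)"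
    using optimality_system[OF R s min z v] by blast
  have P0: "nrm (P (Suc n - k)) = 0" if "k \<le> n" for k
    using that
  proof (induction k)
    case 0
    then show ?case using ad by (simp add: adjoint_system_def nrm_const)
  next
    case (Suc k)
    define j where "j = n - k"
    have j: "j \<in> {1..n}" "Suc j = Suc n - k" using Suc.prems by (auto simp: j_def)
    have "nrm (P j) \<le> (0 / \<tau> + 0 * (nrm (w j) + nrm (\<lambda>x::real. 0))) / m"
      by (rule adjoint_energy(1)[OF R ad j(1) AC_cont[OF flux_systemD(3)[OF s j(1)]] AC_cont[OF flux_systemD(4)[OF s j(1)]] LL_const])
        (use Suc j in auto)
    then have "nrm (P j) = 0" using nrm_nonneg[of "P j"] by simp
    moreover have "Suc n - Suc k = j" by (simp add: j_def)
    ultimately show ?case by simp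
  qed
  have ev: "AE x in M. v i x = e i x" if i: "i \<in> {1..n}" for i
  proof -
    have "nrm (P (Suc n - (Suc n - i))) = 0" using i by (intro P0) auto
    then have "IP (P i) (P i) = 0" using i by (simp add: nrm_def)
    moreover have "P i \<in> LL" using ad i AC_fLL unfolding adjoint_system_def by blast
    ultimately have "AE x in M. P i x = 0" by (intro IP_self_0)
    moreover have "AE x in M. P i x = - 1 * (e i x - v i x)" using Pe i by blast
    ultimately show ?thesis by eventually_elim simp
  qed
  have "flux_system S v (\<lambda>i x. K (w i x)) w \<sigma>" by (rule flux_system_cong_AE[OF s _ ev]) auto
  then show ?thesis by blast
qed

end

section \<open>Soft thresholding and its regularisation\<close>

text \<open>The inverse of the set-valued map \<open>r \<mapsto> \<partial>|\<cdot>|(r) + \<nu>\<^sup>2 r\<close>.\<close>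

definition soft :: "real \<Rightarrow> real \<Rightarrow> real" where
  "soft \<nu> r = (max (r - 1) 0 - max (- r - 1) 0) / \<nu>\<^sup>2"

text \<open>A continuously differentiable positive part: constant on the left of \<open>0\<close>, of slope \<open>1\<close> on the right
  of \<open>\<epsilon>\<close>, with linear interpolation of the slope in between.\<close>

definition ramp :: "real \<Rightarrow> real \<Rightarrow> real" where
  "ramp \<epsilon> t = ((max t 0)\<^sup>2 - (max (t - \<epsilon>) 0)\<^sup>2) / (2 * \<epsilon>)"

definition ramp' :: "real \<Rightarrow> real \<Rightarrow> real" where
  "ramp' \<epsilon> t = (max t 0 - max (t - \<epsilon>) 0) / \<epsilon>"

definition soft_reg :: "real \<Rightarrow> real \<Rightarrow> real \<Rightarrow> real" where
  "soft_reg \<nu> \<epsilon> r = (ramp \<epsilon> (r - 1) - ramp \<epsilon> (- r - 1)) / \<nu>\<^sup>2"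

definition soft_reg' :: "real \<Rightarrow> real \<Rightarrow> real \<Rightarrow> real" where
  "soft_reg' \<nu> \<epsilon> r = (ramp' \<epsilon> (r - 1) + ramp' \<epsilon> (- r - 1)) / \<nu>\<^sup>2"

text \<open>A continuously differentiable, nondecreasing function that vanishes exactly on the admissible
  interval; the penalty is a large multiple of it.\<close>

definition excess :: "real \<Rightarrow> real" where
  "excess r = (max (r - 1) 0)\<^sup>2 - (max (- r - 1) 0)\<^sup>2"

definition penalty :: "real \<Rightarrow> real \<Rightarrow> real" where
  "penalty \<epsilon> r = excess r / \<epsilon>"

definition penalty' :: "real \<Rightarrow> real \<Rightarrow> real" where
  "penalty' \<epsilon> r = 2 * (max (r - 1) 0 + max (- r - 1) 0) / \<epsilon>"

lemma pos_part_square_deriv: "((\<lambda>t::real. (max t 0)\<^sup>2) has_real_derivative 2 * max t 0) (at t)"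
proof -
  consider "0 < t" | "t < 0" | "t = 0" by linarith
  then show ?thesis
  proof cases
    case 1
    have "((\<lambda>t::real. t\<^sup>2) has_real_derivative 2 * max t 0) (at t)"
      using 1 by (auto intro!: derivative_eq_intros)
    then show ?thesis
      by (rule has_field_derivative_transform_within_open[of _ _ _ "{0<..}"]) (use 1 in auto)
  next
    case 2
    have "((\<lambda>t::real. 0) has_real_derivative 2 * max t 0) (at t)"
      using 2 by (auto intro!: derivative_eq_intros)
    then show ?thesis
      by (rule has_field_derivative_transform_within_open[of _ _ _ "{..<0}"]) (use 2 in auto)
  next
    case 3
    have "(\<lambda>u::real. (max u 0)\<^sup>2 / u) \<midarrow>0\<rightarrow> 0"
    proof (rule Lim_null_comparison)
      show "\<forall>\<^sub>F u in at 0. norm ((max u 0)\<^sup>2 / u) \<le> \<bar>u::real\<bar>"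
        by (rule always_eventually) (auto simp: max_def power2_eq_square)
      show "(\<lambda>u::real. \<bar>u\<bar>) \<midarrow>0\<rightarrow> 0" using tendsto_rabs[OF tendsto_ident_at, of 0 UNIV] by simp
    qed
    then show ?thesis using 3 by (simp add: DERIV_def)
  qed
qed

lemma pos_part_square_deriv':
  assumes "(f has_real_derivative d) (at t)"
  shows "((\<lambda>t::real. (max (f t) 0)\<^sup>2) has_real_derivative 2 * max (f t) 0 * d) (at t)"
  using DERIV_chain2[OF pos_part_square_deriv assms] .

lemma ramp_deriv: "0 < \<epsilon> \<Longrightarrow> (ramp \<epsilon> has_real_derivative ramp' \<epsilon> t) (at t)"
  unfolding ramp_def[abs_def] ramp'_def
  by (rule DERIV_cdivide[THEN DERIV_cong], rule DERIV_diff, rule pos_part_square_deriv, rule pos_part_square_deriv'[where d = 1])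
    (auto intro!: derivative_eq_intros simp: field_simps)

lemma ramp'_bounds: assumes "0 < \<epsilon>" shows "0 \<le> ramp' \<epsilon> t" "ramp' \<epsilon> t \<le> 1"
  "t \<le> 0 \<Longrightarrow> ramp' \<epsilon> t = 0" "\<epsilon> \<le> t \<Longrightarrow> ramp' \<epsilon> t = 1"
  using assms by (auto simp: ramp'_def max_def field_simps)

lemma ramp_approx: assumes "0 < \<epsilon>" shows "\<bar>ramp \<epsilon> t - max t 0\<bar> \<le> \<epsilon>"
proof -
  consider "t \<le> 0" | "0 < t" "t \<le> \<epsilon>" | "\<epsilon> < t" by linarith
  then show ?thesis
  proof cases
    case 1
    then show ?thesis using assms by (simp add: ramp_def max_def)
  next
    case 2
    have "t\<^sup>2 / (2 * \<epsilon>) \<le> t" using 2 assms by (simp add: field_simps power2_eq_square)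
    moreover have "0 \<le> t\<^sup>2 / (2 * \<epsilon>)" using assms by simp
    moreover have "ramp \<epsilon> t = t\<^sup>2 / (2 * \<epsilon>)" "max t 0 = t" using 2 by (auto simp: ramp_def max_def)
    ultimately show ?thesis using 2 by linarith
  next
    case 3
    have "ramp \<epsilon> t = t - \<epsilon> / 2" using 3 assms by (simp add: ramp_def max_def field_simps power2_eq_square)
    then show ?thesis using 3 assms by simp
  qed
qed

lemma soft_reg_approx: assumes "0 < \<epsilon>" "0 < \<nu>" shows "\<bar>soft_reg \<nu> \<epsilon> r - soft \<nu> r\<bar> \<le> 2 * \<epsilon> / \<nu>\<^sup>2"
proof -
  have "soft_reg \<nu> \<epsilon> r - soft \<nu> r = ((ramp \<epsilon> (r - 1) - max (r - 1) 0) - (ramp \<epsilon> (- r - 1) - max (- r - 1) 0)) / \<nu>\<^sup>2"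
    unfolding soft_reg_def soft_def by (simp only: diff_divide_distrib[symmetric]) (simp add: algebra_simps)
  moreover have "\<bar>(ramp \<epsilon> (r - 1) - max (r - 1) 0) - (ramp \<epsilon> (- r - 1) - max (- r - 1) 0)\<bar> \<le> 2 * \<epsilon>"
    using ramp_approx[OF assms(1), of "r - 1"] ramp_approx[OF assms(1), of "- r - 1"] by linarith
  ultimately show ?thesis using assms(2) by (simp add: divide_right_mono)
qed

lemma soft_reg'_outside: "0 < \<epsilon> \<Longrightarrow> 1 + \<epsilon> \<le> \<bar>r\<bar> \<Longrightarrow> soft_reg' \<nu> \<epsilon> r = 1 / \<nu>\<^sup>2"
  by (cases "0 \<le> r") (simp_all add: soft_reg'_def ramp'_bounds)

lemma soft_cont: "continuous_on UNIV (soft \<nu>)"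
  unfolding soft_def[abs_def] by (cases "\<nu> = 0") (auto intro!: continuous_intros)

lemma soft_zero_iff: "0 < \<nu> \<Longrightarrow> soft \<nu> r = 0 \<longleftrightarrow> \<bar>r\<bar> \<le> 1"
  by (auto simp: soft_def max_def)

lemma excess_deriv: "(excess has_real_derivative 2 * (max (r - 1) 0 + max (- r - 1) 0)) (at r)"
  unfolding excess_def[abs_def]
  by (rule DERIV_diff[THEN DERIV_cong], rule pos_part_square_deriv'[where d = 1], (auto intro!: derivative_eq_intros)[1],
      rule pos_part_square_deriv'[where d = "-1"]) (auto intro!: derivative_eq_intros)

lemma excess_zero: "excess r = 0 \<longleftrightarrow> \<bar>r\<bar> \<le> 1"
  by (auto simp: excess_def max_def)

lemma excess_sign: "\<bar>z\<bar> \<le> 1 \<Longrightarrow> excess r * (z - r) \<le> 0"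
  by (auto simp: excess_def max_def mult_nonneg_nonpos mult_nonpos_nonneg)

text \<open>Thresholding at a variable level \<open>c\<close>. Levels \<open>c > 1\<close> give functions of the flux that vanish on a neighbourhood
  of the set where \<open>\<bar>\<sigma>\<bar> \<le> 1\<close>.\<close>

definition softc :: "real \<Rightarrow> real \<Rightarrow> real \<Rightarrow> real" where
  "softc \<nu> c r = (max (r - c) 0 - max (- r - c) 0) / \<nu>\<^sup>2"

lemma softc_cont: "0 < \<nu> \<Longrightarrow> continuous_on UNIV (softc \<nu> c)"
  unfolding softc_def[abs_def] by (auto intro!: continuous_intros)

lemma softc_lip: assumes "0 < \<nu>" "0 \<le> c" shows "\<bar>softc \<nu> c x - softc \<nu> c y\<bar> \<le> \<bar>x - y\<bar> / \<nu>\<^sup>2"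
proof -
  have "softc \<nu> c x - softc \<nu> c y = ((max (x - c) 0 - max (- x - c) 0) - (max (y - c) 0 - max (- y - c) 0)) / \<nu>\<^sup>2"
    by (simp add: softc_def diff_divide_distrib)
  moreover have "\<bar>(max (x - c) 0 - max (- x - c) 0) - (max (y - c) 0 - max (- y - c) 0)\<bar> \<le> \<bar>x - y\<bar>" using assms(2) by linarith
  ultimately show ?thesis using assms(1) by (simp add: divide_right_mono)
qed

lemma softc_inside: "0 \<le> c \<Longrightarrow> \<bar>r\<bar> \<le> c \<Longrightarrow> softc \<nu> c r = 0"
  by (auto simp: softc_def)

text \<open>At the corners of the thresholding function, and on the interval between them, the
  derivative vanishes because \<open>\<gamma>\<close> is flat at \<open>0\<close> and \<open>softc \<nu> c\<close> is Lipschitz.\<close>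

lemma flat_comp_soft_deriv:
  assumes nu: "0 < \<nu>" and c: "0 \<le> c" and G: "\<And>r. (\<gamma> has_real_derivative \<gamma>' r) (at r)" and z: "\<gamma> 0 = 0" "\<gamma>' 0 = 0"
  shows "((\<lambda>r. \<gamma> (softc \<nu> c r)) has_real_derivative \<gamma>' (softc \<nu> c r) / \<nu>\<^sup>2) (at r)"
proof -
  consider "c < r" | "r < - c" | "\<bar>r\<bar> \<le> c" by linarith
  then show ?thesis
  proof cases
    case 1
    have "((\<lambda>r. \<gamma> ((r - c) / \<nu>\<^sup>2)) has_real_derivative \<gamma>' ((r - c) / \<nu>\<^sup>2) * (1 / \<nu>\<^sup>2)) (at r)"
      by (rule DERIV_chain2[OF G], rule DERIV_cong[OF DERIV_cdivide[OF DERIV_diff[OF DERIV_ident DERIV_const]]]) simp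
    then have "((\<lambda>r. \<gamma> ((r - c) / \<nu>\<^sup>2)) has_real_derivative \<gamma>' (softc \<nu> c r) / \<nu>\<^sup>2) (at r)" using 1 c by (simp add: softc_def max_def)
    then show ?thesis
      by (rule has_field_derivative_transform_within_open[of _ _ _ "{c<..}"]) (use 1 c in \<open>auto simp: softc_def max_def\<close>)
  next
    case 2
    have "((\<lambda>r. \<gamma> ((r + c) / \<nu>\<^sup>2)) has_real_derivative \<gamma>' ((r + c) / \<nu>\<^sup>2) * (1 / \<nu>\<^sup>2)) (at r)"
      by (rule DERIV_chain2[OF G], rule DERIV_cong[OF DERIV_cdivide[OF DERIV_add[OF DERIV_ident DERIV_const]]]) simp
    then have "((\<lambda>r. \<gamma> ((r + c) / \<nu>\<^sup>2)) has_real_derivative \<gamma>' (softc \<nu> c r) / \<nu>\<^sup>2) (at r)" using 2 c by (simp add: softc_def max_def add.commute)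
    then show ?thesis
      by (rule has_field_derivative_transform_within_open[of _ _ _ "{..<-c}"]) (use 2 c in \<open>auto simp: softc_def max_def add.commute\<close>)
  next
    case 3
    have s0: "softc \<nu> c r = 0" by (rule softc_inside[OF c 3])
    obtain g where g: "\<And>z. \<gamma> z - \<gamma> 0 = g z * (z - 0)" "isCont g 0" "g 0 = 0"
      using G[of 0] z unfolding CARAT_DERIV by auto
    define q where "q y = (if y = r then 0 else g (softc \<nu> c y) * softc \<nu> c y / (y - r))" for y
    have "((\<lambda>y. \<bar>g (softc \<nu> c y)\<bar> / \<nu>\<^sup>2) \<longlongrightarrow> \<bar>g (softc \<nu> c r)\<bar> / \<nu>\<^sup>2) (at r)"
    proof (intro tendsto_divide tendsto_rabs tendsto_const)
      have "isCont (softc \<nu> c) r" using softc_cont[OF nu] by (simp add: continuous_on_eq_continuous_at)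
      then have "isCont (\<lambda>y. g (softc \<nu> c y)) r" using g(2) s0 isCont_o2[of r "softc \<nu> c" g] by simp
      then show "((\<lambda>y. g (softc \<nu> c y)) \<longlongrightarrow> g (softc \<nu> c r)) (at r)" by (simp add: isCont_def)
    qed (use nu in simp)
    then have l: "((\<lambda>y. \<bar>g (softc \<nu> c y)\<bar> / \<nu>\<^sup>2) \<longlongrightarrow> 0) (at r)" using s0 g(3) by simp
    have "norm (q y) \<le> \<bar>g (softc \<nu> c y)\<bar> / \<nu>\<^sup>2" for y
    proof (cases "y = r")
      case False
      have "\<bar>softc \<nu> c y\<bar> / \<bar>y - r\<bar> \<le> 1 / \<nu>\<^sup>2"
        using softc_lip[OF nu c, of y r] s0 False nu by (simp add: field_simps)
      then have "\<bar>g (softc \<nu> c y)\<bar> * (\<bar>softc \<nu> c y\<bar> / \<bar>y - r\<bar>) \<le> \<bar>g (softc \<nu> c y)\<bar> * (1 / \<nu>\<^sup>2)" by (intro mult_left_mono) auto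
      then show ?thesis using False by (simp add: q_def abs_mult abs_divide)
    qed (simp add: q_def)
    then have "(q \<longlongrightarrow> 0) (at r)" using Lim_null_comparison[OF always_eventually l, of q] by blast
    then have "isCont q r" by (simp add: isCont_def q_def)
    moreover have "\<gamma> (softc \<nu> c y) - \<gamma> (softc \<nu> c r) = q y * (y - r)" for y
      using g(1)[of "softc \<nu> c y"] s0 z by (auto simp: q_def)
    ultimately have "((\<lambda>r. \<gamma> (softc \<nu> c r)) has_real_derivative q r) (at r)" unfolding CARAT_DERIV by blast
    then show ?thesis using s0 z by (simp add: q_def)
  qed
qed

lemma soft_softc: "soft \<nu> = softc \<nu> 1" by (simp add: soft_def softc_def fun_eq_iff)

text \<open>With \<open>t = soft \<nu> s\<close> one has \<open>s = y + \<nu>\<^sup>2 * t\<close>, where \<open>\<bar>y\<bar> \<le> 1\<close> and \<open>y * t = \<bar>t\<bar>\<close>, that is,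
  \<open>y \<in> \<partial>|\<cdot>|(t)\<close>.\<close>

lemma soft_subgradient: assumes "0 < \<nu>"
  shows "s * (q - soft \<nu> s) \<le> (\<bar>q\<bar> + \<nu>\<^sup>2 / 2 * \<bar>q\<bar>\<^sup>2) - (\<bar>soft \<nu> s\<bar> + \<nu>\<^sup>2 / 2 * \<bar>soft \<nu> s\<bar>\<^sup>2)"
proof -
  define t where "t = soft \<nu> s"
  have nu: "0 < \<nu>\<^sup>2" using assms by simp
  have sq: "\<nu>\<^sup>2 * t * (q - t) \<le> \<nu>\<^sup>2 / 2 * q\<^sup>2 - \<nu>\<^sup>2 / 2 * t\<^sup>2"
  proof -
    have "0 \<le> \<nu>\<^sup>2 / 2 * (q - t)\<^sup>2" using nu by simp
    also have "\<dots> = (\<nu>\<^sup>2 / 2 * q\<^sup>2 - \<nu>\<^sup>2 / 2 * t\<^sup>2) - \<nu>\<^sup>2 * t * (q - t)" by (simp add: power2_eq_square algebra_simps)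
    finally show ?thesis by simp
  qed
  define y where "y = s - \<nu>\<^sup>2 * t"
  have s: "s = y + \<nu>\<^sup>2 * t" by (simp add: y_def)
  have nt: "\<nu>\<^sup>2 * t = max (s - 1) 0 - max (- s - 1) 0" using nu by (simp add: t_def soft_def)
  have y1: "\<bar>y\<bar> \<le> 1" unfolding y_def nt by linarith
  have yt: "y * t = \<bar>t\<bar>"
  proof -
    consider "\<bar>s\<bar> \<le> 1" | "1 < s" | "s < - 1" by linarith
    then show ?thesis
    proof cases
      case 1
      then have "t = 0" using soft_zero_iff[OF assms] by (simp add: t_def)
      then show ?thesis by simp
    next
      case 2
      then have "y = 1" "0 \<le> t" using nu by (auto simp: y_def nt t_def soft_def)
      then show ?thesis by simp
    next
      case 3
      then have "y = - 1" by (auto simp: y_def nt)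
      moreover have "t \<le> 0" unfolding t_def soft_def using 3 nu by (intro divide_nonpos_pos) auto
      ultimately have "y = - 1" "t \<le> 0" by auto
      then show ?thesis by simp
    qed
  qed
  have "\<bar>y * q\<bar> \<le> 1 * \<bar>q\<bar>" unfolding abs_mult using y1 by (intro mult_right_mono) auto
  then have "y * q \<le> \<bar>q\<bar>" by linarith
  then have "s * (q - t) \<le> (\<bar>q\<bar> - \<bar>t\<bar>) + \<nu>\<^sup>2 * t * (q - t)" unfolding s using yt by (simp add: algebra_simps)
  then show ?thesis using sq unfolding t_def[symmetric] by simp
qed

section \<open>Passage to the limit in the optimality system\<close>

locale tv_evolution = evolution +
  fixes \<nu> :: real
  assumes nu_pos: "0 < \<nu>" and Lam: "\<Lambda> = 1 / \<nu>\<^sup>2"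
begin

lemma soft_reg_regularisation: assumes "0 < \<epsilon>" shows "regularisation (soft_reg \<nu> \<epsilon>) (soft_reg' \<nu> \<epsilon>) (penalty \<epsilon>) (penalty' \<epsilon>)"
  unfolding regularisation_def
proof (intro conjI allI)
  fix r
  show "(soft_reg \<nu> \<epsilon> has_real_derivative soft_reg' \<nu> \<epsilon> r) (at r)"
    unfolding soft_reg_def[abs_def] soft_reg'_def using nu_pos
    by (auto intro!: derivative_eq_intros DERIV_chain2[OF ramp_deriv[OF assms]] simp: field_simps)
  show "(penalty \<epsilon> has_real_derivative penalty' \<epsilon> r) (at r)"
    unfolding penalty_def[abs_def] penalty'_def using DERIV_cdivide[OF excess_deriv] by simp
  show "0 \<le> soft_reg' \<nu> \<epsilon> r" using ramp'_bounds[OF assms] by (simp add: soft_reg'_def)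
  show "soft_reg' \<nu> \<epsilon> r \<le> \<Lambda>"
    using ramp'_bounds[OF assms, of "r - 1"] ramp'_bounds[OF assms, of "- r - 1"] nu_pos
    by (cases "0 \<le> r") (auto simp: soft_reg'_def Lam intro!: divide_right_mono)
  show "0 \<le> penalty' \<epsilon> r" using assms by (simp add: penalty'_def)
next
  show "continuous_on UNIV (soft_reg' \<nu> \<epsilon>)" "continuous_on UNIV (penalty' \<epsilon>)"
    unfolding soft_reg'_def[abs_def] penalty'_def[abs_def] ramp'_def using nu_pos assms
    by (auto intro!: continuous_intros)
  show "soft_reg \<nu> \<epsilon> 0 = 0" "penalty \<epsilon> 0 = 0" by (simp_all add: soft_reg_def penalty_def excess_def)
qed

lemma soft_reg_uniform:
  assumes "\<And>k. 0 < \<epsilon> k" "\<epsilon> \<longlonglongrightarrow> 0"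
  shows "uniform_limit UNIV (\<lambda>k::nat. soft_reg \<nu> (\<epsilon> k)) (soft \<nu>) sequentially"
proof (rule uniform_limitI)
  fix e :: real assume e: "0 < e"
  have "(\<lambda>k. 2 * \<epsilon> k / \<nu>\<^sup>2) \<longlonglongrightarrow> 2 * 0 / \<nu>\<^sup>2" using assms(2) nu_pos by (intro tendsto_intros) auto
  then have "\<forall>\<^sub>F k in sequentially. 2 * \<epsilon> k / \<nu>\<^sup>2 < e" using e by (intro order_tendstoD(2)) auto
  then show "\<forall>\<^sub>F k in sequentially. \<forall>x\<in>UNIV. dist (soft_reg \<nu> (\<epsilon> k) x) (soft \<nu> x) < e"
  proof eventually_elim
    case (elim k)
    then show ?case using soft_reg_approx[OF assms(1) nu_pos, of k] by (auto simp: dist_real_def intro: order_le_less_trans)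
  qed
qed

text \<open>The limit system. The last condition says \<open>\<xi> \<in> \<partial>I(w)\<close> for the indicator functional of the
  obstacle, tested with all admissible square-integrable functions.\<close>

definition feasible :: "(nat \<Rightarrow> real \<Rightarrow> real) \<Rightarrow> (nat \<Rightarrow> real \<Rightarrow> real) \<Rightarrow> (nat \<Rightarrow> real \<Rightarrow> real) \<Rightarrow> (nat \<Rightarrow> real \<Rightarrow> real) \<Rightarrow> bool" where
  "feasible e \<xi> w \<sigma> \<longleftrightarrow> flux_system (soft \<nu>) e \<xi> w \<sigma> \<and>
     (\<forall>i\<in>{1..n}. (\<forall>x\<in>{a..b}. \<bar>w i x\<bar> \<le> 1) \<and>
       (\<forall>z\<in>LL. (AE x in M. \<bar>z x\<bar> \<le> 1) \<longrightarrow> IP (\<xi> i) (\<lambda>x. z x - w i x) \<le> 0))"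

text \<open>The penalties stay bounded in the mean square while they are the excess divided by \<open>\<epsilon>\<close>, so the excess
  vanishes in the limit. The sign condition on the reaction holds for the penalties and is preserved because
  the states converge uniformly.\<close>

lemma limit_feasible:
  assumes eps: "\<And>k::nat. 0 < \<epsilon> k" "\<epsilon> \<longlonglongrightarrow> 0"
    and sy: "\<And>k. flux_system (soft_reg \<nu> (\<epsilon> k)) (e k) (\<lambda>i x. penalty (\<epsilon> k) (w k i x)) (w k) (\<sigma> k)"
    and E: "\<And>k i. i \<in> {1..n} \<Longrightarrow> nrm (e k i) \<le> E"
  shows "\<exists>(r::nat\<Rightarrow>nat) e0 \<xi> wl \<sigma>l. strict_mono r \<and> feasible e0 \<xi> wl \<sigma>l \<and>
     (\<forall>i\<in>{1..n}. weak_conv (\<lambda>k. e (r k) i) (e0 i) \<and> unif_conv (\<lambda>k. w (r k) i) (wl i) \<and> unif_conv (\<lambda>k. \<sigma> (r k) i) (\<sigma>l i))"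
proof -
  note R = soft_reg_regularisation[OF eps(1)]
  obtain r e0 \<xi> wl \<sigma>l where r: "strict_mono (r::nat\<Rightarrow>nat)" and sl: "flux_system (soft \<nu>) e0 \<xi> wl \<sigma>l"
    and lim: "\<forall>i\<in>{1..n}. weak_conv (\<lambda>k. e (r k) i) (e0 i) \<and> weak_conv (\<lambda>k x. penalty (\<epsilon> (r k)) (w (r k) i x)) (\<xi> i) \<and>
        unif_conv (\<lambda>k. w (r k) i) (wl i) \<and> unif_conv (\<lambda>k. \<sigma> (r k) i) (\<sigma>l i)"
    using flux_system_compact[OF R sy E soft_reg_uniform[OF eps] soft_cont] by blast
  have "feasible e0 \<xi> wl \<sigma>l" unfolding feasible_def
  proof (intro conjI sl ballI impI)
    fix i assume i: "i \<in> {1..n}"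
    then have "i \<le> n" "1 \<le> i" by auto
    then obtain C where C: "\<And>k. nrm (\<lambda>x. penalty (\<epsilon> k) (w k i x)) \<le> C"
      using flux_system_bounds[of "\<lambda>k. soft_reg \<nu> (\<epsilon> k)" "\<lambda>k. soft_reg' \<nu> (\<epsilon> k)" "\<lambda>k. penalty (\<epsilon> k)" "\<lambda>k. penalty' (\<epsilon> k)" e w \<sigma> E i,
          OF R sy E] by blast
    have u: "unif_conv (\<lambda>k. w (r k) i) (wl i)" and kx: "weak_conv (\<lambda>k x. penalty (\<epsilon> (r k)) (w (r k) i x)) (\<xi> i)" using lim i by auto
    have excess_c: "continuous_on UNIV excess" by (rule has_deriv_cont) (rule excess_deriv)
    have ue: "unif_conv (\<lambda>k x. excess (w (r k) i x)) (\<lambda>x. excess (wl i x))" by (rule unif_conv_comp[OF u excess_c])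
    have er: "(\<lambda>k. \<epsilon> (r k)) \<longlonglongrightarrow> 0" using LIMSEQ_subseq_LIMSEQ[OF eps(2) r] by (simp add: o_def)
    have "IP (\<lambda>x. excess (w (r k) i x)) (\<lambda>x. excess (w (r k) i x)) \<le> \<epsilon> (r k) * \<epsilon> (r k) * (C * C)" for k
    proof -
      have "(\<lambda>x. excess (w (r k) i x)) = (\<lambda>x. \<epsilon> (r k) * penalty (\<epsilon> (r k)) (w (r k) i x))"
        using eps(1)[of "r k"] by (simp add: penalty_def)
      then have "IP (\<lambda>x. excess (w (r k) i x)) (\<lambda>x. excess (w (r k) i x))
        = \<epsilon> (r k) * (\<epsilon> (r k) * IP (\<lambda>x. penalty (\<epsilon> (r k)) (w (r k) i x)) (\<lambda>x. penalty (\<epsilon> (r k)) (w (r k) i x)))"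
        by (simp only: IP_scale_left IP_scale_right)
      also have "\<dots> \<le> \<epsilon> (r k) * (\<epsilon> (r k) * (C * C))"
        using C[of "r k"] eps(1)[of "r k"] order_trans[OF nrm_nonneg C[of "r k"]]
        unfolding nrm_sq'[symmetric] by (intro mult_left_mono mult_mono) auto
      finally show ?thesis by (simp add: mult.assoc)
    qed
    moreover have "(\<lambda>k. \<epsilon> (r k) * \<epsilon> (r k) * (C * C)) \<longlonglongrightarrow> 0 * 0 * (C * C)" using er by (intro tendsto_intros)
    ultimately have "IP (\<lambda>x. excess (wl i x)) (\<lambda>x. excess (wl i x)) \<le> 0 * 0 * (C * C)"
      using LIMSEQ_le[OF unif_conv_IP[OF ue ue]] by blast
    then have z0: "IP (\<lambda>x. excess (wl i x)) (\<lambda>x. excess (wl i x)) = 0"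
      using IP_self_nonneg[of "\<lambda>x. excess (wl i x)"] by linarith
    show "\<bar>wl i x\<bar> \<le> 1" if "x \<in> {a..b}" for x
      using cont_IP_zero[OF unif_conv_cont(1)[OF ue] z0 that] excess_zero by blast
    fix z assume z: "z \<in> LL" "AE x in M. \<bar>z x\<bar> \<le> 1"
    have wL: "w k i \<in> LL" "wl i \<in> LL" for k using AC_fLL flux_systemD(3)[OF sy i] flux_systemD(3)[OF sl i] by auto
    have KL: "(\<lambda>x. penalty (\<epsilon> k) (w k i x)) \<in> LL" for k using flux_systemD(2)[OF sy i] .
    have "IP (\<lambda>x. penalty (\<epsilon> k) (w k i x)) (\<lambda>x. z x - w k i x) \<le> 0" for k
    proof -
      have "AE x in M. penalty (\<epsilon> k) (w k i x) * (z x - w k i x) \<le> 0"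
        using z(2)
      proof eventually_elim
        case (elim x)
        from excess_sign[OF this, of "w k i x"] eps(1)[of k] show ?case
          by (simp add: penalty_def divide_nonpos_pos)
      qed
      then have "0 \<le> integral\<^sup>L M (\<lambda>x. - (penalty (\<epsilon> k) (w k i x) * (z x - w k i x)))" by (intro integral_nonneg_AE) auto
      then show ?thesis by (simp add: ip_L2_def)
    qed
    moreover have "(\<lambda>k. IP (\<lambda>x. penalty (\<epsilon> (r k)) (w (r k) i x)) (\<lambda>x. z x - w (r k) i x)) \<longlonglongrightarrow> IP (\<xi> i) (\<lambda>x. z x - wl i x)"
      using tendsto_diff[OF weak_convD[OF kx z(1)] weak_conv_unif_conv_IP[OF kx C u]] z(1) wL KL flux_systemD(2)[OF sl i]
      by (simp add: IP_diff_right)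
    ultimately show "IP (\<xi> i) (\<lambda>x. z x - wl i x) \<le> 0"
      by (intro LIMSEQ_le_const2) auto
  qed
  then show ?thesis using r lim by blast
qed

text \<open>The regularisations satisfy the chain rule with uniformly bounded derivatives.\<close>

lemma soft_AC:
  assumes s: "AC \<sigma> v" shows "\<exists>v'. AC (\<lambda>x. soft \<nu> (\<sigma> x)) v'"
proof -
  define \<epsilon> where "\<epsilon> k = 1 / real (Suc k)" for k
  have eps: "\<And>k. 0 < \<epsilon> k" "\<epsilon> \<longlonglongrightarrow> 0"
    unfolding \<epsilon>_def using LIMSEQ_inverse_real_of_nat by (auto simp: inverse_eq_divide)
  note rg = regularisationD[OF soft_reg_regularisation[OF eps(1)]]
  have A: "AC (\<lambda>x. soft_reg \<nu> (\<epsilon> k) (\<sigma> x)) (\<lambda>x. soft_reg' \<nu> (\<epsilon> k) (\<sigma> x) * v x)" for k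
    by (rule AC_chain[OF s]) (rule rg)+
  have v: "v \<in> LL" using s by (rule AC_LL)
  have "nrm (\<lambda>x. soft_reg' \<nu> (\<epsilon> k) (\<sigma> x) * v x) \<le> nrm (\<lambda>x. \<Lambda> * v x)" for k
    using rg(3,4) Lam_nonneg by (intro nrm_mono AC_LL[OF A] LL_scale v) (auto simp: abs_mult intro!: mult_right_mono)
  moreover have "\<bar>soft_reg \<nu> (\<epsilon> k) (\<sigma> a)\<bar> \<le> \<Lambda> * \<bar>\<sigma> a\<bar>" for k by (rule rg)
  ultimately obtain r f0 v0 where r: "strict_mono (r::nat\<Rightarrow>nat)" "AC f0 v0"
    "uniform_limit {a..b} (\<lambda>k x. soft_reg \<nu> (\<epsilon> (r k)) (\<sigma> x)) f0 sequentially"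
    using AC_compact[of "\<lambda>k x. soft_reg \<nu> (\<epsilon> k) (\<sigma> x)" "\<lambda>k x. soft_reg' \<nu> (\<epsilon> k) (\<sigma> x) * v x"
        "nrm (\<lambda>x. \<Lambda> * v x)" "\<Lambda> * \<bar>\<sigma> a\<bar>", OF A] by blast
  have "f0 x = soft \<nu> (\<sigma> x)" if x: "x \<in> {a..b}" for x
  proof -
    have "(\<lambda>k. soft_reg \<nu> (\<epsilon> (r k)) (\<sigma> x)) \<longlonglongrightarrow> f0 x" using tendsto_uniform_limitI[OF r(3) x] .
    moreover have "(\<lambda>k. soft_reg \<nu> (\<epsilon> k) (\<sigma> x)) \<longlonglongrightarrow> soft \<nu> (\<sigma> x)"
      using tendsto_uniform_limitI[OF soft_reg_uniform[OF eps], of "\<sigma> x"] by simp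
    from LIMSEQ_subseq_LIMSEQ[OF this r(1)] have "(\<lambda>k. soft_reg \<nu> (\<epsilon> (r k)) (\<sigma> x)) \<longlonglongrightarrow> soft \<nu> (\<sigma> x)" by (simp add: o_def)
    ultimately show ?thesis by (rule LIMSEQ_unique)
  qed
  then have "AC (\<lambda>x. soft \<nu> (\<sigma> x)) v0" using r(2) by (intro AC_cong'[OF r(2)]) auto
  then show ?thesis by blast
qed

text \<open>A point where \<open>\<bar>w\<bar> = 1\<close> is an extremum of \<open>w\<close>. It is an interior point if \<open>\<bar>\<sigma>\<bar> > 1\<close> there, because the flux
  vanishes at the ends. So \<open>w' = soft \<nu> \<sigma>\<close> would vanish there.\<close>

lemma saturated_flux:
  assumes w: "AC w (\<lambda>x. soft \<nu> (\<sigma> x))" and s: "continuous_on {a..b} \<sigma>" "\<sigma> a = 0" "\<sigma> b = 0"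
    and le: "\<And>x. x \<in> {a..b} \<Longrightarrow> \<bar>w x\<bar> \<le> 1" and x: "x \<in> {a..b}" "1 < \<bar>\<sigma> x\<bar>"
  shows "\<bar>w x\<bar> < 1"
proof (rule ccontr)
  assume "\<not> \<bar>w x\<bar> < 1"
  then have wx: "\<bar>w x\<bar> = 1" using le[OF x(1)] by simp
  have x': "x \<in> {a<..<b}" using x s(2,3) by (cases "x = a"; cases "x = b") auto
  \<comment> \<open>The derivative of \<open>w\<close> is continuous, hence classical.\<close>
  have c: "continuous_on {a..b} (\<lambda>x. soft \<nu> (\<sigma> x))" by (rule cont_comp[OF soft_cont s(1)])
  have "((\<lambda>y. integral {a..y} (\<lambda>x. soft \<nu> (\<sigma> x))) has_real_derivative soft \<nu> (\<sigma> x)) (at x within {a..b})"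
    using integral_has_real_derivative[OF c x(1)] .
  then have "((\<lambda>y. integral {a..y} (\<lambda>x. soft \<nu> (\<sigma> x))) has_real_derivative soft \<nu> (\<sigma> x)) (at x)"
    using x' at_within_Icc_at[of a x b] by simp
  then have "((\<lambda>y. w a + integral {a..y} (\<lambda>x. soft \<nu> (\<sigma> x))) has_real_derivative soft \<nu> (\<sigma> x)) (at x)"
    by (auto intro!: derivative_eq_intros)
  then have dw: "(w has_real_derivative soft \<nu> (\<sigma> x)) (at x)"
    by (rule has_field_derivative_transform_within_open[of _ _ _ "{a<..<b}"]) (use x' w in \<open>auto simp: AC_def\<close>)
  define d where "d = min (x - a) (b - x)"
  have d: "0 < d" "\<And>y. \<bar>x - y\<bar> < d \<Longrightarrow> y \<in> {a..b}" using x' by (auto simp: d_def)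
  have "soft \<nu> (\<sigma> x) = 0"
  proof (cases "w x = 1")
    case True
    have "\<forall>y. \<bar>x - y\<bar> < d \<longrightarrow> w y \<le> w x" using le d(2) True by (auto simp: abs_le_iff)
    then show ?thesis using DERIV_local_max[OF dw d(1)] by simp
  next
    case False
    then have "w x = - 1" using wx by auto
    then have "\<forall>y. \<bar>x - y\<bar> < d \<longrightarrow> w x \<le> w y" using le d(2) by (force simp: abs_le_iff)
    then show ?thesis using DERIV_local_min[OF dw d(1)] by simp
  qed
  then show False using soft_zero_iff[OF nu_pos] x(2) by auto
qed

text \<open>On the compact set where \<open>\<bar>\<sigma>1\<bar> \<ge> 1 + d\<close> the limit state keeps a positive distance to the obstacle. By uniform
  convergence the approximate states eventually satisfy \<open>\<bar>w\<bar> < 1\<close> and the approximate fluxes leave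
  the smoothed corner there, so the penalty term drops out and \<open>S'\<close> equals \<open>1 / \<nu>\<^sup>2\<close>. Eliminating
  \<open>R\<close> by parts leaves an equation for \<open>P\<close> that passes to the limit.\<close>

lemma local_adjoint_limit:
  assumes eps: "\<And>k::nat. 0 < \<epsilon> k" "\<epsilon> \<longlonglongrightarrow> 0" and i: "i \<in> {1..n}"
    and ad: "\<And>k. adjoint_system (soft_reg' \<nu> (\<epsilon> k)) (penalty' (\<epsilon> k)) A z (w k) (\<sigma> k) (P k) (R k)"
    and u: "unif_conv (\<lambda>k. w k i) w1" "unif_conv (\<lambda>k. \<sigma> k i) \<sigma>1" "unif_conv (\<lambda>k. P k i) P1" "unif_conv (\<lambda>k. P k (Suc i)) P2"
    and dP: "weak_conv (\<lambda>k x. soft_reg' \<nu> (\<epsilon> k) (\<sigma> k i x) * R k i x) Q" and z: "z i \<in> LL"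
    and w1: "AC w1 (\<lambda>x. soft \<nu> (\<sigma>1 x))" "\<sigma>1 a = 0" "\<sigma>1 b = 0" "\<And>x. x \<in> {a..b} \<Longrightarrow> \<bar>w1 x\<bar> \<le> 1"
    and al: "AC \<alpha> \<alpha>'" and d: "0 < d"
    and van: "\<And>x. x \<in> {a..b} \<Longrightarrow> \<bar>\<sigma>1 x\<bar> \<le> 1 + d \<Longrightarrow> \<alpha> x = 0 \<and> \<alpha>' x = 0"
  shows "IP Q \<alpha>' = - IP (\<lambda>x. (h' (w1 x) * P1 x - P2 x / \<tau> - A * (w1 x - z i x)) / \<nu>\<^sup>2) \<alpha>"
proof -
  define D where "D = {x \<in> {a..b}. 1 + d \<le> \<bar>\<sigma>1 x\<bar>}"
  have c1: "continuous_on {a..b} \<sigma>1" "continuous_on {a..b} w1" using u unif_conv_cont by auto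
  have al_out: "\<alpha> x = 0" "\<alpha>' x = 0" if "x \<in> {a..b}" "x \<notin> D" for x
    using van[OF that(1)] that by (auto simp: D_def)
  have bc: "\<alpha> a = 0" "\<alpha> b = 0" using van[of a] van[of b] w1 d ab by auto
  have aL: "\<alpha> \<in> LL" "\<alpha>' \<in> LL" using al AC_fLL AC_LL by auto
  have "D = {a..b} \<inter> (\<lambda>x. \<bar>\<sigma>1 x\<bar>) -` {1 + d..}" by (auto simp: D_def)
  moreover have "closed ({a..b} \<inter> (\<lambda>x. \<bar>\<sigma>1 x\<bar>) -` {1 + d..})"
    using c1 by (intro continuous_closed_preimage continuous_intros) auto
  ultimately have cD: "compact D" using compact_Int_closed[of "{a..b}" D] by (simp add: Int_absorb1 D_def subset_eq)
  obtain c where c: "0 < c" "\<And>x. x \<in> D \<Longrightarrow> \<bar>w1 x\<bar> \<le> 1 - c"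
  proof (cases "D = {}")
    case True
    then show ?thesis using that[of 1] by simp
  next
    case False
    have "D \<subseteq> {a..b}" by (auto simp: D_def)
    then have "continuous_on D (\<lambda>x. \<bar>w1 x\<bar>)" using continuous_on_subset[OF c1(2)] by (intro continuous_on_rabs)
    then obtain x0 where x0: "x0 \<in> D" "\<And>x. x \<in> D \<Longrightarrow> \<bar>w1 x\<bar> \<le> \<bar>w1 x0\<bar>"
      using continuous_attains_sup[OF cD False] by blast
    have "\<bar>w1 x0\<bar> < 1" using x0(1) d by (intro saturated_flux[OF w1(1) c1(1) w1(2-4)]) (auto simp: D_def)
    then show ?thesis using that[of "1 - \<bar>w1 x0\<bar>"] x0 by auto
  qed
  have "\<forall>\<^sub>F k in sequentially. \<forall>x\<in>{a..b}. dist (\<sigma> k i x) (\<sigma>1 x) < d / 2"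
    using u(2) d unfolding unif_conv_def by (intro uniform_limitD) auto
  moreover have "\<forall>\<^sub>F k in sequentially. \<forall>x\<in>{a..b}. dist (w k i x) (w1 x) < c"
    using u(1) c(1) unfolding unif_conv_def by (intro uniform_limitD) auto
  moreover have "\<forall>\<^sub>F k in sequentially. \<epsilon> k < d / 2" using eps(2) d by (intro order_tendstoD(2)) auto
  ultimately have ev: "\<forall>\<^sub>F k in sequentially. IP (\<lambda>x. soft_reg' \<nu> (\<epsilon> k) (\<sigma> k i x) * R k i x) \<alpha>'
     = (- 1 / \<nu>\<^sup>2) * IP (\<lambda>x. h' (w k i x) * P k i x - (1 / \<tau>) * P k (Suc i) x - A * (w k i x - z i x)) \<alpha>"
  proof eventually_elim
    case (elim k)
    have on: "soft_reg' \<nu> (\<epsilon> k) (\<sigma> k i x) = 1 / \<nu>\<^sup>2" "penalty' (\<epsilon> k) (w k i x) = 0" if x: "x \<in> D" for x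
    proof -
      have x': "x \<in> {a..b}" "1 + d \<le> \<bar>\<sigma>1 x\<bar>" using x by (auto simp: D_def)
      then have "\<bar>\<sigma> k i x - \<sigma>1 x\<bar> < d / 2" "\<bar>w k i x - w1 x\<bar> < c" using elim by (auto simp: dist_real_def)
      then have "1 + \<epsilon> k \<le> \<bar>\<sigma> k i x\<bar>" "\<bar>w k i x\<bar> \<le> 1" using x'(2) c(2)[OF x] elim(3) by linarith+
      then show "soft_reg' \<nu> (\<epsilon> k) (\<sigma> k i x) = 1 / \<nu>\<^sup>2" "penalty' (\<epsilon> k) (w k i x) = 0"
        using soft_reg'_outside[OF eps(1)] by (auto simp: penalty'_def)
    qed
    have R: "AC (R k i) (\<lambda>x. (h' (w k i x) + penalty' (\<epsilon> k) (w k i x)) * P k i x - P k (Suc i) x / \<tau> - A * (w k i x - z i x))"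
      using ad i unfolding adjoint_system_def by blast
    have "IP (\<lambda>x. soft_reg' \<nu> (\<epsilon> k) (\<sigma> k i x) * R k i x) \<alpha>' = IP (\<lambda>x. (1 / \<nu>\<^sup>2) * R k i x) \<alpha>'"
    proof (rule IP_cong)
      fix x assume "x \<in> {a<..<b}"
      then show "soft_reg' \<nu> (\<epsilon> k) (\<sigma> k i x) * R k i x * \<alpha>' x = 1 / \<nu>\<^sup>2 * R k i x * \<alpha>' x"
        using on(1)[of x] al_out(2)[of x] by (cases "x \<in> D") auto
    qed
    also have "\<dots> = (1 / \<nu>\<^sup>2) * IP (R k i) \<alpha>'" by (rule IP_scale_left)
    also have "IP (R k i) \<alpha>' = - IP (\<lambda>x. (h' (w k i x) + penalty' (\<epsilon> k) (w k i x)) * P k i x - P k (Suc i) x / \<tau> - A * (w k i x - z i x)) \<alpha>"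
      using AC_by_parts[OF R al] bc by simp
    also have "IP (\<lambda>x. (h' (w k i x) + penalty' (\<epsilon> k) (w k i x)) * P k i x - P k (Suc i) x / \<tau> - A * (w k i x - z i x)) \<alpha>
       = IP (\<lambda>x. h' (w k i x) * P k i x - (1 / \<tau>) * P k (Suc i) x - A * (w k i x - z i x)) \<alpha>"
    proof (rule IP_cong)
      fix x assume "x \<in> {a<..<b}"
      then show "((h' (w k i x) + penalty' (\<epsilon> k) (w k i x)) * P k i x - P k (Suc i) x / \<tau> - A * (w k i x - z i x)) * \<alpha> x
         = (h' (w k i x) * P k i x - (1 / \<tau>) * P k (Suc i) x - A * (w k i x - z i x)) * \<alpha> x"
        using on(2)[of x] al_out(1)[of x] by (cases "x \<in> D") auto
    qed
    finally show ?case by simp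
  qed
  have "weak_conv (\<lambda>k x. h' (w k i x) * P k i x - (1 / \<tau>) * P k (Suc i) x - A * (w k i x - z i x))
     (\<lambda>x. h' (w1 x) * P1 x - (1 / \<tau>) * P2 x - A * (w1 x - z i x))"
    by (rule weak_conv_diff[OF weak_conv_diff[OF unif_conv_weak_conv[OF unif_conv_mult[OF unif_conv_comp[OF u(1) h'_cont] u(3)]]
         weak_conv_scale[OF unif_conv_weak_conv[OF u(4)]]] weak_conv_scale[OF weak_conv_diff[OF unif_conv_weak_conv[OF u(1)] weak_conv_const[OF z]]]])
  from tendsto_mult_left[OF weak_convD[OF this aL(1)], of "- 1 / \<nu>\<^sup>2"]
  have "(\<lambda>k. IP (\<lambda>x. soft_reg' \<nu> (\<epsilon> k) (\<sigma> k i x) * R k i x) \<alpha>') \<longlonglongrightarrow>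
     (- 1 / \<nu>\<^sup>2) * IP (\<lambda>x. h' (w1 x) * P1 x - (1 / \<tau>) * P2 x - A * (w1 x - z i x)) \<alpha>"
    by (rule Lim_transform_eventually) (use ev in \<open>auto elim: eventually_mono\<close>)
  from LIMSEQ_unique[OF weak_convD[OF dP aL(2)] this]
  have "IP Q \<alpha>' = (- 1 / \<nu>\<^sup>2) * IP (\<lambda>x. h' (w1 x) * P1 x - (1 / \<tau>) * P2 x - A * (w1 x - z i x)) \<alpha>" .
  also have "\<dots> = - IP (\<lambda>x. (h' (w1 x) * P1 x - P2 x / \<tau> - A * (w1 x - z i x)) / \<nu>\<^sup>2) \<alpha>"
    by (simp add: IP_divide_left)
  finally show ?thesis .
qed

text \<open>Backward induction over the time levels, with \<open>l\<close> counting from the end.\<close>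

lemma adjoint_bounds:
  assumes R: "\<And>k::nat. regularisation (S k) (S' k) (K k) (K' k)"
    and ad: "\<And>k. adjoint_system (S' k) (K' k) A z (w k) (\<sigma> k) (P k) (Rr k)" and A: "0 \<le> A"
    and wc: "\<And>k i. i \<in> {1..n} \<Longrightarrow> continuous_on {a..b} (w k i)" and sc: "\<And>k i. i \<in> {1..n} \<Longrightarrow> continuous_on {a..b} (\<sigma> k i)"
    and z: "\<forall>i\<in>{1..n}. z i \<in> LL" and E: "\<And>i. i \<in> {1..n} \<Longrightarrow> \<exists>C. \<forall>k. nrm (w k i) \<le> C"
  shows "l \<le> n \<Longrightarrow> \<exists>C. \<forall>k. nrm (P k (Suc n - l)) \<le> C \<and>
     (1 \<le> l \<longrightarrow> nrm (\<lambda>x. S' k (\<sigma> k (Suc n - l) x) * Rr k (Suc n - l) x) \<le> C)"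
proof (induction l)
  case 0
  have "P k (Suc n) = (\<lambda>x. 0)" for k using ad[of k] unfolding adjoint_system_def by blast
  then show ?case by (intro exI[of _ 0]) (simp add: nrm_const)
next
  case (Suc l)
  define j where "j = n - l"
  have j: "j \<in> {1..n}" "Suc j = Suc n - l" "Suc n - Suc l = j" using Suc.prems by (auto simp: j_def)
  obtain D where D: "\<And>k. nrm (P k (Suc j)) \<le> D" using Suc j(2) by auto
  obtain C where C: "\<And>k. nrm (w k j) \<le> C" using E[OF j(1)] by blast
  have E': "nrm (w k j) + nrm (z j) \<le> C + nrm (z j)" for k using C[of k] by simp
  note en = adjoint_energy[OF R ad j(1) wc[OF j(1)] sc[OF j(1)] z[rule_format, OF j(1)] A E' D]
  define C' where "C' = max ((D / \<tau> + A * (C + nrm (z j))) / m)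
    (sqrt (\<Lambda> * ((D / \<tau> + A * (C + nrm (z j))) / m * (D / \<tau> + A * (C + nrm (z j))))))"
  have "nrm (P k j) \<le> C' \<and> nrm (\<lambda>x. S' k (\<sigma> k j x) * Rr k j x) \<le> C'" for k
    using en[of k] unfolding C'_def by (simp only: le_max_iff_disj) blast
  then show ?case unfolding j(3) by blast
qed

text \<open>The minimisation for the parameter \<open>\<epsilon>\<close> uses the weight \<open>1 / \<mu>\<close> for the forcing, where \<open>\<mu> = Mu + \<epsilon>\<close>, so
  that \<open>e = - \<mu> * P\<close>. Then the forcing term of the minimiser is \<open>\<mu> / 2\<close> times the squared norm of \<open>P\<close>, which
  converges to the cost of the control \<open>- P\<close>. A competing control \<open>v\<close> enters through its forcing \<open>Mu * v\<close>, whose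
  term is \<open>Mu\<^sup>2 / (2 * \<mu>)\<close>, hence at most \<open>Mu / 2\<close>, times the squared norm of \<open>v\<close>. For \<open>Mu = 0\<close> this
  remains meaningful, although the limit forcing vanishes.\<close>

lemma optimality_limit:
  assumes Mu: "0 \<le> Mu" and Mw: "0 \<le> Mw" and z: "\<forall>i\<in>{1..n}. z i \<in> LL"
  shows "\<exists>P P' w \<sigma> \<xi>. feasible (\<lambda>i x. - Mu * P i x) \<xi> w \<sigma> \<and> P (Suc n) = (\<lambda>x. 0) \<and>
    (\<forall>i\<in>{1..n}. AC (P i) (P' i)) \<and>
    (\<forall>i\<in>{1..n}. \<forall>\<alpha> \<alpha>' d. AC \<alpha> \<alpha>' \<longrightarrow> 0 < d \<longrightarrow>
       (\<forall>x\<in>{a..b}. \<bar>\<sigma> i x\<bar> \<le> 1 + d \<longrightarrow> \<alpha> x = 0 \<and> \<alpha>' x = 0) \<longrightarrow>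
       IP (P' i) \<alpha>' = - IP (\<lambda>x. (h' (w i x) * P i x - P (Suc i) x / \<tau> - Mw * (w i x - z i x)) / \<nu>\<^sup>2) \<alpha>) \<and>
    (\<forall>v. (\<forall>i\<in>{1..n}. v i \<in> LL) \<longrightarrow> (\<exists>\<xi>v wv \<sigma>v. feasible (\<lambda>i x. Mu * v i x) \<xi>v wv \<sigma>v \<and>
       Mw / 2 * (\<Sum>i=1..n. IP (\<lambda>x. w i x - z i x) (\<lambda>x. w i x - z i x)) + Mu / 2 * (\<Sum>i=1..n. IP (P i) (P i))
       \<le> Mw / 2 * (\<Sum>i=1..n. IP (\<lambda>x. wv i x - z i x) (\<lambda>x. wv i x - z i x)) + Mu / 2 * (\<Sum>i=1..n. IP (v i) (v i))))"
proof -
  define \<epsilon> where "\<epsilon> k = 1 / real (Suc k)" for k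
  have eps: "\<And>k. 0 < \<epsilon> k" "\<epsilon> \<longlonglongrightarrow> 0" and eps1: "\<And>k. \<epsilon> k \<le> 1"
    unfolding \<epsilon>_def using LIMSEQ_inverse_real_of_nat by (auto simp: inverse_eq_divide)
  define \<mu> where "\<mu> k = Mu + \<epsilon> k" for k
  have mu0: "0 < \<mu> k" "\<mu> k \<le> Mu + 1" for k using Mu eps(1)[of k] eps1[of k] by (auto simp: \<mu>_def)
  have mul: "\<mu> \<longlonglongrightarrow> Mu" unfolding \<mu>_def using tendsto_add[OF tendsto_const eps(2), of Mu] by simp
  note R = soft_reg_regularisation[OF eps(1)]
  define track where "track k = tracking Mw (1 / \<mu> k) z (\<lambda>i x. 0)" for k
  have zero: "\<forall>i\<in>{1..n}. (\<lambda>x::real. 0) \<in> LL" by simp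
  have "\<exists>e w \<sigma>. flux_system (soft_reg \<nu> (\<epsilon> k)) e (\<lambda>i x. penalty (\<epsilon> k) (w i x)) w \<sigma> \<and> minimal (soft_reg \<nu> (\<epsilon> k)) (penalty (\<epsilon> k)) Mw (1 / \<mu> k) z (\<lambda>i x. 0) e w" for k
    using minimiser_exists[OF R Mw _ z zero, of "1 / \<mu> k"] mu0(1) by simp
  then obtain e w \<sigma> where sy: "\<And>k. flux_system (soft_reg \<nu> (\<epsilon> k)) (e k) (\<lambda>i x. penalty (\<epsilon> k) (w k i x)) (w k) (\<sigma> k)"
    and min: "\<And>k. minimal (soft_reg \<nu> (\<epsilon> k)) (penalty (\<epsilon> k)) Mw (1 / \<mu> k) z (\<lambda>i x. 0) (e k) (w k)" by metis
  have "\<forall>k. \<exists>P Rr. adjoint_system (soft_reg' \<nu> (\<epsilon> k)) (penalty' (\<epsilon> k)) Mw z (w k) (\<sigma> k) P Rr \<and> (\<forall>j\<in>{1..n}. AE x in M. P j x = - (1 / \<mu> k) * (e k j x - 0))"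
    using optimality_system[OF R sy min z zero] by blast
  from this[THEN choice] obtain P where "\<forall>k. \<exists>Rr. adjoint_system (soft_reg' \<nu> (\<epsilon> k)) (penalty' (\<epsilon> k)) Mw z (w k) (\<sigma> k) (P k) Rr \<and> (\<forall>j\<in>{1..n}. AE x in M. P k j x = - (1 / \<mu> k) * (e k j x - 0))"
    by blast
  from this[THEN choice] obtain Rr where ad: "\<And>k. adjoint_system (soft_reg' \<nu> (\<epsilon> k)) (penalty' (\<epsilon> k)) Mw z (w k) (\<sigma> k) (P k) (Rr k)"
    and Pe: "\<And>k j. j \<in> {1..n} \<Longrightarrow> AE x in M. P k j x = - (1 / \<mu> k) * (e k j x - 0)" by blast
  have cw: "continuous_on {a..b} (w k i)" and cs: "continuous_on {a..b} (\<sigma> k i)" if "i \<in> {1..n}" for k i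
    using AC_cont flux_systemD(3,4)[OF sy that] by blast+
  \<comment> \<open>Comparison with the states for zero forcing bounds the minimal values, hence the forcings.\<close>
  have "\<exists>w0' \<sigma>0. flux_system (soft_reg \<nu> (\<epsilon> k)) (\<lambda>i x. 0) (\<lambda>i x. penalty (\<epsilon> k) (w0' i x)) w0' \<sigma>0" for k
    using flux_system_exists[OF R zero] by blast
  then obtain wz sz where sz: "\<And>k. flux_system (soft_reg \<nu> (\<epsilon> k)) (\<lambda>i x. 0) (\<lambda>i x. penalty (\<epsilon> k) (wz k i x)) (wz k) (sz k)" by metis
  have "\<exists>C. \<forall>k. nrm (wz k i) \<le> C" if "i \<in> {1..n}" for i
    using flux_system_bounds[of "\<lambda>k. soft_reg \<nu> (\<epsilon> k)" "\<lambda>k. soft_reg' \<nu> (\<epsilon> k)" "\<lambda>k. penalty (\<epsilon> k)" "\<lambda>k. penalty' (\<epsilon> k)" "\<lambda>k i x. 0" wz sz 0 i, OF R sz]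
      that by (auto simp: nrm_const)
  then obtain Cz where Cz: "\<And>k i. i \<in> {1..n} \<Longrightarrow> nrm (wz k i) \<le> Cz i" by metis
  define c where "c = Mw / 2 * (\<Sum>i=1..n. (Cz i + nrm (z i)) * (Cz i + nrm (z i)))"
  have "track k (\<lambda>i x. 0) (wz k) \<le> c" for k
  proof -
    have "IP (\<lambda>x. wz k i x - z i x) (\<lambda>x. wz k i x - z i x) \<le> (Cz i + nrm (z i)) * (Cz i + nrm (z i))" if i: "i \<in> {1..n}" for i
    proof -
      have "nrm (\<lambda>x. wz k i x - z i x) \<le> Cz i + nrm (z i)"
        using nrm_diff_triangle[OF AC_fLL[OF flux_systemD(3)[OF sz i]] z[rule_format, OF i], of k] Cz[OF i, of k] by linarith
      then show ?thesis unfolding nrm_sq'[symmetric] by (intro mult_mono) (auto intro: order_trans[OF nrm_nonneg])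
    qed
    then have "Mw / 2 * (\<Sum>i=1..n. IP (\<lambda>x. wz k i x - z i x) (\<lambda>x. wz k i x - z i x)) \<le> c"
      unfolding c_def using Mw by (intro mult_left_mono sum_mono) auto
    then show ?thesis by (simp add: track_def tracking_def IP_simps)
  qed
  then have Jc: "track k (e k) (w k) \<le> c" for k
    using min[of k] sz[of k] unfolding minimal_def track_def by (blast intro: order_trans)
  define E where "E = sqrt (2 * c * (Mu + 1))"
  have "0 \<le> track 0 (e 0) (w 0)" unfolding track_def using Mw mu0(1)[of 0] by (intro tracking_nonneg) auto
  then have c0: "0 \<le> c" using Jc[of 0] by linarith
  have E: "nrm (e k i) \<le> E" if i: "i \<in> {1..n}" for k i
  proof -
    have "nrm (e k i) \<le> sqrt (2 * c / (1 / \<mu> k)) + nrm (\<lambda>x::real. 0)"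
      using mu0(1)[of k] by (intro tracking_control_bound[OF Mw _ i LL_const flux_systemD(1)[OF sy i] Jc[unfolded track_def]]) auto
    also have "\<dots> \<le> E" unfolding E_def using mu0(2)[of k] c0 by (simp add: nrm_const mult_left_mono)
    finally show ?thesis .
  qed
  obtain r0 e0 \<xi> wl \<sigma>l where r0: "strict_mono (r0::nat\<Rightarrow>nat)" and fl: "feasible e0 \<xi> wl \<sigma>l"
    and lim0: "\<forall>i\<in>{1..n}. weak_conv (\<lambda>k. e (r0 k) i) (e0 i) \<and> unif_conv (\<lambda>k. w (r0 k) i) (wl i) \<and> unif_conv (\<lambda>k. \<sigma> (r0 k) i) (\<sigma>l i)"
    using limit_feasible[OF eps sy E] by blast
  \<comment> \<open>The energy bounds give uniform limits of the adjoint states along a further subsequence.\<close>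
  have wb: "\<exists>C. \<forall>k. nrm (w k i) \<le> C" if "i \<in> {1..n}" for i
    using flux_system_bounds[of "\<lambda>k. soft_reg \<nu> (\<epsilon> k)" "\<lambda>k. soft_reg' \<nu> (\<epsilon> k)" "\<lambda>k. penalty (\<epsilon> k)" "\<lambda>k. penalty' (\<epsilon> k)" e w \<sigma> E i, OF R sy E]
      that by auto
  define Q where "Q i r \<longleftrightarrow> (\<exists>P0 P0'. AC P0 P0' \<and> unif_conv (\<lambda>k. P (r0 (r k)) i) P0 \<and>
     weak_conv (\<lambda>k x. soft_reg' \<nu> (\<epsilon> (r0 (r k))) (\<sigma> (r0 (r k)) i x) * Rr (r0 (r k)) i x) P0')" for i and r :: "nat \<Rightarrow> nat"
  have "\<exists>r. strict_mono r \<and> (\<forall>i\<in>{1..n}. Q i r)"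
  proof (rule finite_subseq)
    fix i and r s :: "nat \<Rightarrow> nat" assume q: "Q i r" "strict_mono s"
    then obtain P0 P0' where p: "AC P0 P0'" "unif_conv (\<lambda>k. P (r0 (r k)) i) P0"
      "weak_conv (\<lambda>k x. soft_reg' \<nu> (\<epsilon> (r0 (r k))) (\<sigma> (r0 (r k)) i x) * Rr (r0 (r k)) i x) P0'" unfolding Q_def by blast
    show "Q i (\<lambda>k. r (s k))" unfolding Q_def
      using p(1) unif_conv_subseq[OF p(2) q(2)] weak_conv_subseq[OF p(3) q(2)] by blast
  next
    fix i and r :: "nat \<Rightarrow> nat" assume i: "i \<in> {1..n}" and r: "strict_mono r"
    define l where "l = Suc n - i"
    have l: "l \<le> n" "1 \<le> l" "Suc n - l = i" using i by (auto simp: l_def)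
    obtain C where C: "\<And>k. nrm (P k i) \<le> C" "\<And>k. nrm (\<lambda>x. soft_reg' \<nu> (\<epsilon> k) (\<sigma> k i x) * Rr k i x) \<le> C"
      using adjoint_bounds[of "\<lambda>k. soft_reg \<nu> (\<epsilon> k)" "\<lambda>k. soft_reg' \<nu> (\<epsilon> k)" "\<lambda>k. penalty (\<epsilon> k)" "\<lambda>k. penalty' (\<epsilon> k)" Mw z w \<sigma> P Rr l,
          OF R ad Mw cw cs z wb l(1)] l(2) unfolding l(3) by blast
    have A: "AC (P k i) (\<lambda>x. soft_reg' \<nu> (\<epsilon> k) (\<sigma> k i x) * Rr k i x)" for k using ad[of k] i unfolding adjoint_system_def by blast
    have la: "\<bar>P k i a\<bar> \<le> C / sqrt (b - a) + C * sqrt (b - a)" for k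
    proof -
      have "nrm (P k i) / sqrt (b - a) \<le> C / sqrt (b - a)"
        "nrm (\<lambda>x. soft_reg' \<nu> (\<epsilon> k) (\<sigma> k i x) * Rr k i x) * sqrt (b - a) \<le> C * sqrt (b - a)"
        using C[of k] ab by (auto intro!: divide_right_mono mult_right_mono)
      then show ?thesis using AC_left_bound[OF A, of k] by linarith
    qed
    obtain s P0 P0' where s: "strict_mono (s::nat\<Rightarrow>nat)" "AC P0 P0'" "uniform_limit {a..b} (\<lambda>k. P (r0 (r (s k))) i) P0 sequentially"
      "weak_conv (\<lambda>k x. soft_reg' \<nu> (\<epsilon> (r0 (r (s k)))) (\<sigma> (r0 (r (s k))) i x) * Rr (r0 (r (s k))) i x) P0'"
      using AC_compact[of "\<lambda>k. P (r0 (r k)) i" "\<lambda>k x. soft_reg' \<nu> (\<epsilon> (r0 (r k))) (\<sigma> (r0 (r k)) i x) * Rr (r0 (r k)) i x" C, OF A C(2) la] by blast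
    have "unif_conv (\<lambda>k. P (r0 (r (s k))) i) P0" using s(3) AC_cont[OF A] by (simp add: unif_conv_def)
    then show "\<exists>s. strict_mono s \<and> Q i (\<lambda>k. r (s k))" unfolding Q_def using s by blast
  qed
  then obtain r1 where r1: "strict_mono r1" "\<And>i. i \<in> {1..n} \<Longrightarrow> Q i r1" by blast
  define r where "r k = r0 (r1 k)" for k
  have r: "strict_mono r" using r0 r1(1) by (simp add: r_def strict_mono_def)
  have "\<forall>i\<in>{1..n}. \<exists>P0 P0'. AC P0 P0' \<and> unif_conv (\<lambda>k. P (r k) i) P0 \<and>
     weak_conv (\<lambda>k x. soft_reg' \<nu> (\<epsilon> (r k)) (\<sigma> (r k) i x) * Rr (r k) i x) P0'" using r1(2) unfolding Q_def r_def by blast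
  from this[THEN bchoice] obtain Pl0 where "\<forall>i\<in>{1..n}. \<exists>P0'. AC (Pl0 i) P0' \<and> unif_conv (\<lambda>k. P (r k) i) (Pl0 i) \<and>
     weak_conv (\<lambda>k x. soft_reg' \<nu> (\<epsilon> (r k)) (\<sigma> (r k) i x) * Rr (r k) i x) P0'" by blast
  from this[THEN bchoice] obtain Pl' where Pl0: "\<And>i. i \<in> {1..n} \<Longrightarrow> AC (Pl0 i) (Pl' i)"
    "\<And>i. i \<in> {1..n} \<Longrightarrow> unif_conv (\<lambda>k. P (r k) i) (Pl0 i)"
    "\<And>i. i \<in> {1..n} \<Longrightarrow> weak_conv (\<lambda>k x. soft_reg' \<nu> (\<epsilon> (r k)) (\<sigma> (r k) i x) * Rr (r k) i x) (Pl' i)" by blast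
  define Pl where "Pl i = (if i = Suc n then (\<lambda>x. 0) else Pl0 i)" for i
  have Plim: "unif_conv (\<lambda>k. P (r k) i) (Pl i)" if "i \<in> {1..Suc n}" for i
  proof (cases "i = Suc n")
    case True
    have "P k (Suc n) = (\<lambda>x. 0)" for k using ad[of k] unfolding adjoint_system_def by blast
    then show ?thesis using True unif_conv_const[of "\<lambda>x. 0"] by (simp add: Pl_def)
  next
    case False
    then show ?thesis using Pl0(2)[of i] that by (simp add: Pl_def)
  qed
  have Pl: "AC (Pl i) (Pl' i)" if "i \<in> {1..n}" for i using Pl0(1)[OF that] that by (simp add: Pl_def)
  have lim: "weak_conv (\<lambda>k. e (r k) i) (e0 i)" "unif_conv (\<lambda>k. w (r k) i) (wl i)" "unif_conv (\<lambda>k. \<sigma> (r k) i) (\<sigma>l i)" if "i \<in> {1..n}" for i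
    using lim0 that weak_conv_subseq[of "\<lambda>k. e (r0 k) i" "e0 i", OF _ r1(1)] unif_conv_subseq[of "\<lambda>k. w (r0 k) i" "wl i", OF _ r1(1)]
      unif_conv_subseq[of "\<lambda>k. \<sigma> (r0 k) i" "\<sigma>l i", OF _ r1(1)] unfolding r_def by blast+
  have eP: "AE x in M. e k i x = - \<mu> k * P k i x" if "i \<in> {1..n}" for k i
    using Pe[OF that, of k] by (rule eventually_mono) (use mu0(1)[of k] in \<open>simp add: field_simps\<close>)
  have PL: "P k i \<in> LL" if "i \<in> {1..n}" for k i using ad[of k] that AC_fLL unfolding adjoint_system_def by blast
  have mur: "(\<lambda>k. \<mu> (r k)) \<longlonglongrightarrow> Mu" using LIMSEQ_subseq_LIMSEQ[OF mul r] by (simp add: o_def)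
  \<comment> \<open>Passing to the limit in \<open>e = - \<mu> * P\<close>.\<close>
  have e0P: "AE x in M. - Mu * Pl i x = e0 i x" if i: "i \<in> {1..n}" for i
  proof (rule weak_conv_unique[OF _ lim(1)[OF i]])
    have i': "i \<in> {1..Suc n}" using i by auto
    have PlL: "Pl i \<in> LL" using Pl[OF i] by (rule AC_fLL)
    show "weak_conv (\<lambda>k. e (r k) i) (\<lambda>x. - Mu * Pl i x)"
      unfolding weak_conv_def
    proof (intro conjI allI ballI LL_scale PlL flux_systemD(1)[OF sy i])
      fix g assume g: "g \<in> LL"
      have "IP (e (r k) i) g = - \<mu> (r k) * IP (P (r k) i) g" for k
        by (subst IP_cong_AE[OF LL_scale[OF PL[OF i]] g eP[OF i], of g]) (simp_all only: IP_scale_left eventually_True simp_thms)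
      moreover have "(\<lambda>k. - \<mu> (r k) * IP (P (r k) i) g) \<longlonglongrightarrow> - Mu * IP (Pl i) g"
        by (intro tendsto_mult tendsto_minus mur weak_convD[OF unif_conv_weak_conv[OF Plim[OF i']] g])
      ultimately show "(\<lambda>k. IP (e (r k) i) g) \<longlonglongrightarrow> IP (\<lambda>x. - Mu * Pl i x) g" by (simp only: IP_scale_left)
    qed
  qed
  have fl': "feasible (\<lambda>i x. - Mu * Pl i x) \<xi> wl \<sigma>l"
    using fl flux_system_cong_AE[of "soft \<nu>" e0 \<xi> wl \<sigma>l \<xi> "\<lambda>i x. - Mu * Pl i x"] e0P unfolding feasible_def by auto
  have sl: "flux_system (soft \<nu>) e0 \<xi> wl \<sigma>l" and wl1: "\<And>i x. i \<in> {1..n} \<Longrightarrow> x \<in> {a..b} \<Longrightarrow> \<bar>wl i x\<bar> \<le> 1"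
    using fl unfolding feasible_def by blast+
  have er: "\<And>k. 0 < \<epsilon> (r k)" "(\<lambda>k. \<epsilon> (r k)) \<longlonglongrightarrow> 0" using eps(1) LIMSEQ_subseq_LIMSEQ[OF eps(2) r] by (auto simp: o_def)
  have loc: "IP (Pl' i) \<alpha>' = - IP (\<lambda>x. (h' (wl i x) * Pl i x - Pl (Suc i) x / \<tau> - Mw * (wl i x - z i x)) / \<nu>\<^sup>2) \<alpha>"
    if i: "i \<in> {1..n}" and al: "AC \<alpha> \<alpha>'" "0 < d" "\<forall>x\<in>{a..b}. \<bar>\<sigma>l i x\<bar> \<le> 1 + d \<longrightarrow> \<alpha> x = 0 \<and> \<alpha>' x = 0" for i \<alpha> \<alpha>' d
  proof -
    have i': "i \<in> {1..Suc n}" "Suc i \<in> {1..Suc n}" using i by auto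
    note s = flux_systemD[OF sl i]
    show ?thesis
      by (rule local_adjoint_limit[OF er i ad lim(2)[OF i] lim(3)[OF i] Plim[OF i'(1)] Plim[OF i'(2)] Pl0(3)[OF i] z[rule_format, OF i]
          s(3) s(5) s(6) wl1[OF i] al(1) al(2)]) (use al(3) in auto)
  qed
  have opt: "\<exists>\<xi>v wv \<sigma>v. feasible (\<lambda>i x. Mu * v i x) \<xi>v wv \<sigma>v \<and>
       Mw / 2 * (\<Sum>i=1..n. IP (\<lambda>x. wl i x - z i x) (\<lambda>x. wl i x - z i x)) + Mu / 2 * (\<Sum>i=1..n. IP (Pl i) (Pl i))
       \<le> Mw / 2 * (\<Sum>i=1..n. IP (\<lambda>x. wv i x - z i x) (\<lambda>x. wv i x - z i x)) + Mu / 2 * (\<Sum>i=1..n. IP (v i) (v i))"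
    if v: "\<forall>i\<in>{1..n}. v i \<in> LL" for v
  proof -
    have vL: "\<forall>i\<in>{1..n}. (\<lambda>x. Mu * v i x) \<in> LL" using v by auto
    have "\<exists>w0' \<sigma>0. flux_system (soft_reg \<nu> (\<epsilon> (r k))) (\<lambda>i x. Mu * v i x) (\<lambda>i x. penalty (\<epsilon> (r k)) (w0' i x)) w0' \<sigma>0" for k
      using flux_system_exists[OF R vL] by blast
    then obtain wk sk where sk: "\<And>k. flux_system (soft_reg \<nu> (\<epsilon> (r k))) (\<lambda>i x. Mu * v i x) (\<lambda>i x. penalty (\<epsilon> (r k)) (wk k i x)) (wk k) (sk k)" by metis
    have vb: "nrm (\<lambda>x. Mu * v i x) \<le> (\<Sum>i=1..n. nrm (\<lambda>x. Mu * v i x))" if "i \<in> {1..n}" for i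
      using that by (intro member_le_sum) auto
    obtain t e1 \<xi>v wv \<sigma>v where t: "strict_mono (t::nat\<Rightarrow>nat)" and fv: "feasible e1 \<xi>v wv \<sigma>v"
      and limv: "\<forall>i\<in>{1..n}. weak_conv (\<lambda>k x. Mu * v i x) (e1 i) \<and> unif_conv (\<lambda>k. wk (t k) i) (wv i) \<and> unif_conv (\<lambda>k. sk (t k) i) (\<sigma>v i)"
      using limit_feasible[OF er sk vb] by blast
    have "AE x in M. Mu * v i x = e1 i x" if i: "i \<in> {1..n}" for i
      using weak_conv_unique[OF weak_conv_const[OF vL[rule_format, OF i]]] limv i by blast
    then have fv': "feasible (\<lambda>i x. Mu * v i x) \<xi>v wv \<sigma>v"
      using fv flux_system_cong_AE[of "soft \<nu>" e1 \<xi>v wv \<sigma>v \<xi>v "\<lambda>i x. Mu * v i x"] unfolding feasible_def by auto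
    have diff: "unif_conv (\<lambda>k. f k) f0 \<Longrightarrow> (\<And>k. f k \<in> LL) \<Longrightarrow> f0 \<in> LL \<Longrightarrow> y \<in> LL \<Longrightarrow>
        (\<lambda>k. IP (\<lambda>x. f k x - y x) (\<lambda>x. f k x - y x)) \<longlonglongrightarrow> IP (\<lambda>x. f0 x - y x) (\<lambda>x. f0 x - y x)" for f f0 y
    proof -
      assume a: "unif_conv (\<lambda>k. f k) f0" "\<And>k. f k \<in> LL" "f0 \<in> LL" "y \<in> LL"
      have "(\<lambda>k. IP (f k) (f k) - IP (f k) y - IP (f k) y + IP y y) \<longlonglongrightarrow> IP f0 f0 - IP f0 y - IP f0 y + IP y y"
        by (intro tendsto_add tendsto_diff tendsto_const unif_conv_IP[OF a(1) a(1)] weak_convD[OF unif_conv_weak_conv[OF a(1)] a(4)])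
      moreover have "IP (\<lambda>x. g x - y x) (\<lambda>x. g x - y x) = IP g g - IP g y - IP g y + IP y y" if "g \<in> LL" for g
        using that a(4) by (simp add: IP_simps IP_commute[of y g])
      ultimately show ?thesis using a(2,3) by simp
    qed
    \<comment> \<open>\<open>X\<close> is the minimal value, written in terms of \<open>P\<close>; \<open>Y\<close> is an upper bound for the value of the competitor.\<close>
    define X where "X k = Mw / 2 * (\<Sum>i=1..n. IP (\<lambda>x. w (r (t k)) i x - z i x) (\<lambda>x. w (r (t k)) i x - z i x))
       + \<mu> (r (t k)) / 2 * (\<Sum>i=1..n. IP (P (r (t k)) i) (P (r (t k)) i))" for k
    define Y where "Y k = Mw / 2 * (\<Sum>i=1..n. IP (\<lambda>x. wk (t k) i x - z i x) (\<lambda>x. wk (t k) i x - z i x))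
       + Mu / 2 * (\<Sum>i=1..n. IP (v i) (v i))" for k
    have "X k \<le> Y k" for k
    proof -
      let ?k = "r (t k)"
      have "track ?k (e ?k) (w ?k) \<le> track ?k (\<lambda>i x. Mu * v i x) (wk (t k))"
        using min[of ?k] sk[of "t k"] unfolding minimal_def track_def by blast
      moreover have "track ?k (e ?k) (w ?k) = X k"
      proof -
        have "IP (e ?k i) (e ?k i) = \<mu> ?k * \<mu> ?k * IP (P ?k i) (P ?k i)" if i: "i \<in> {1..n}" for i
          using IP_cong_AE[OF LL_scale[OF PL[OF i]] LL_scale[OF PL[OF i]] eP[OF i, of ?k] eP[OF i, of ?k]]
          by (simp only: IP_scale_left IP_scale_right)
        then have "(\<Sum>i=1..n. IP (e ?k i) (e ?k i)) = \<mu> ?k * \<mu> ?k * (\<Sum>i=1..n. IP (P ?k i) (P ?k i))"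
          by (simp add: sum_distrib_left)
        then show ?thesis using mu0(1)[of ?k] by (simp add: track_def tracking_def X_def)
      qed
      moreover have "track ?k (\<lambda>i x. Mu * v i x) (wk (t k)) \<le> Y k"
      proof -
        have "Mu * Mu / \<mu> ?k \<le> Mu" using mu0(1)[of ?k] Mu eps(1)[of ?k] by (simp add: divide_le_eq \<mu>_def mult_left_mono)
        then have "Mu * Mu / \<mu> ?k * (\<Sum>i=1..n. IP (v i) (v i)) \<le> Mu * (\<Sum>i=1..n. IP (v i) (v i))"
          by (intro mult_right_mono sum_nonneg) auto
        moreover have "(\<Sum>i=1..n. IP (\<lambda>x. Mu * v i x) (\<lambda>x. Mu * v i x)) = Mu * Mu * (\<Sum>i=1..n. IP (v i) (v i))"
          by (simp add: IP_scale_left IP_scale_right sum_distrib_left mult.assoc)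
        ultimately show ?thesis unfolding track_def tracking_def Y_def by simp
      qed
      ultimately show ?thesis by simp
    qed
    moreover have "X \<longlonglongrightarrow> Mw / 2 * (\<Sum>i=1..n. IP (\<lambda>x. wl i x - z i x) (\<lambda>x. wl i x - z i x)) + Mu / 2 * (\<Sum>i=1..n. IP (Pl i) (Pl i))"
      unfolding X_def
    proof (rule tendsto_add[OF tendsto_mult_left[OF tendsto_sum] tendsto_mult[OF _ tendsto_sum]])
      fix i assume i: "i \<in> {1..n}"
      have i': "i \<in> {1..Suc n}" using i by auto
      have "AC (w k i) (\<lambda>x. soft_reg \<nu> (\<epsilon> k) (\<sigma> k i x))" for k using flux_systemD(3)[OF sy i] .
      then show "(\<lambda>k. IP (\<lambda>x. w (r (t k)) i x - z i x) (\<lambda>x. w (r (t k)) i x - z i x)) \<longlonglongrightarrow> IP (\<lambda>x. wl i x - z i x) (\<lambda>x. wl i x - z i x)"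
        by (intro diff unif_conv_subseq[OF lim(2)[OF i] t] AC_fLL[OF flux_systemD(3)[OF sl i]] z[rule_format, OF i]) (rule AC_fLL)
      show "(\<lambda>k. IP (P (r (t k)) i) (P (r (t k)) i)) \<longlonglongrightarrow> IP (Pl i) (Pl i)"
        by (intro unif_conv_IP unif_conv_subseq[OF Plim[OF i'] t])
    next
      show "(\<lambda>k. \<mu> (r (t k)) / 2) \<longlonglongrightarrow> Mu / 2"
        using LIMSEQ_subseq_LIMSEQ[OF mur t] by (intro tendsto_divide tendsto_const) (auto simp: o_def)
    qed
    moreover have "Y \<longlonglongrightarrow> Mw / 2 * (\<Sum>i=1..n. IP (\<lambda>x. wv i x - z i x) (\<lambda>x. wv i x - z i x)) + Mu / 2 * (\<Sum>i=1..n. IP (v i) (v i))"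
      unfolding Y_def
    proof (rule tendsto_add[OF tendsto_mult_left[OF tendsto_sum] tendsto_const])
      fix i assume i: "i \<in> {1..n}"
      have u: "unif_conv (\<lambda>k. wk (t k) i) (wv i)" using limv i by blast
      show "(\<lambda>k. IP (\<lambda>x. wk (t k) i x - z i x) (\<lambda>x. wk (t k) i x - z i x)) \<longlonglongrightarrow> IP (\<lambda>x. wv i x - z i x) (\<lambda>x. wv i x - z i x)"
        by (rule diff[OF u]) (use unif_conv_cont[OF u] LL_cont z i in auto)
    qed
    ultimately have "Mw / 2 * (\<Sum>i=1..n. IP (\<lambda>x. wl i x - z i x) (\<lambda>x. wl i x - z i x)) + Mu / 2 * (\<Sum>i=1..n. IP (Pl i) (Pl i))
       \<le> Mw / 2 * (\<Sum>i=1..n. IP (\<lambda>x. wv i x - z i x) (\<lambda>x. wv i x - z i x)) + Mu / 2 * (\<Sum>i=1..n. IP (v i) (v i))"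
      using LIMSEQ_le[of X _ Y] by auto
    with fv' show ?thesis by (intro exI conjI)
  qed
  show ?thesis
  proof (rule exI[of _ Pl], rule exI[of _ Pl'], rule exI[of _ wl], rule exI[of _ \<sigma>l], rule exI[of _ \<xi>], intro conjI ballI allI impI)
    show "feasible (\<lambda>i x. - Mu * Pl i x) \<xi> wl \<sigma>l" by (rule fl')
    show "Pl (Suc n) = (\<lambda>x. 0)" by (simp add: Pl_def)
  qed (rule Pl loc opt; assumption)+
qed

end

section \<open>Smooth test functions\<close>

text \<open>The function \<open>x\<^sup>-\<^sup>m exp (- 1 / x)\<close>, extended by \<open>0\<close> to the left. Derivatives of members of this family
  are combinations of members.\<close>

definition flat :: "nat \<Rightarrow> real \<Rightarrow> real" where
  "flat m x = (if x \<le> 0 then 0 else (1 / x) ^ m * exp (- (1 / x)))"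

text \<open>A class of infinitely differentiable functions that is closed under derivatives by construction, so
  that smoothness needs no computation of higher derivatives. Closure under primitives
  turns a bump into a step and a step into a ramp.\<close>

inductive smooth_fun :: "(real \<Rightarrow> real) \<Rightarrow> bool" where
  flat: "smooth_fun (flat m)"
| const: "smooth_fun (\<lambda>x. c)"
| affine: "smooth_fun f \<Longrightarrow> smooth_fun (\<lambda>x. f (c * x + d))"
| add: "smooth_fun f \<Longrightarrow> smooth_fun g \<Longrightarrow> smooth_fun (\<lambda>x. f x + g x)"
| mult: "smooth_fun f \<Longrightarrow> smooth_fun g \<Longrightarrow> smooth_fun (\<lambda>x. f x * g x)"
| primitive: "(\<And>x. (F has_real_derivative f x) (at x)) \<Longrightarrow> smooth_fun f \<Longrightarrow> smooth_fun F"

lemma flat_deriv: "(flat m has_real_derivative - real m * flat (Suc m) x + flat (Suc (Suc m)) x) (at x)"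
proof -
  consider "0 < x" | "x < 0" | "x = 0" by linarith
  then show ?thesis
  proof cases
    case 1
    have D1: "((\<lambda>x. 1 / x) has_real_derivative - (1 / x * (1 / x))) (at x)"
      using 1 by (auto intro!: derivative_eq_intros simp: field_simps power2_eq_square)
    have "((\<lambda>x. (1 / x) ^ m * exp (- (1 / x))) has_real_derivative
        - real m * ((1 / x) ^ Suc m * exp (- (1 / x))) + (1 / x) ^ Suc (Suc m) * exp (- (1 / x))) (at x)"
      by (rule DERIV_cong[OF DERIV_mult[OF DERIV_power[OF D1] DERIV_fun_exp[OF DERIV_minus[OF D1]]]])
        (cases m, simp_all add: algebra_simps add_divide_distrib diff_divide_distrib)
    then have "((\<lambda>x. (1 / x) ^ m * exp (- (1 / x))) has_real_derivative
        - real m * flat (Suc m) x + flat (Suc (Suc m)) x) (at x)" using 1 by (simp add: flat_def)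
    then show ?thesis
      by (rule has_field_derivative_transform_within_open[of _ _ _ "{0<..}"]) (use 1 in \<open>auto simp: flat_def\<close>)
  next
    case 2
    have "((\<lambda>x. 0) has_real_derivative - real m * flat (Suc m) x + flat (Suc (Suc m)) x) (at x)"
      using 2 by (simp add: flat_def)
    then show ?thesis
      by (rule has_field_derivative_transform_within_open[of _ _ _ "{..<0}"]) (use 2 in \<open>auto simp: flat_def\<close>)
  next
    case 3
    have "((\<lambda>t::real. t ^ Suc m / exp t) \<longlongrightarrow> 0) at_top" by (rule tendsto_power_div_exp_0)
    from filterlim_compose[OF this filterlim_inverse_at_top_right]
    have "((\<lambda>u. inverse u ^ Suc m / exp (inverse u :: real)) \<longlongrightarrow> 0) (at_right 0)" .
    then have r: "((\<lambda>u. flat m u / u) \<longlongrightarrow> 0) (at_right 0)"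
      by (rule Lim_transform_eventually)
        (auto simp: eventually_at_right_field flat_def exp_minus field_simps intro!: exI[of _ 1])
    have "((\<lambda>u. 0::real) \<longlongrightarrow> 0) (at_left 0)" by simp
    then have l: "((\<lambda>u. flat m u / u) \<longlongrightarrow> 0) (at_left 0)"
      by (rule Lim_transform_eventually) (auto simp: eventually_at_left_field flat_def intro!: exI[of _ "-1"])
    have "((\<lambda>u. flat m u / u) \<longlongrightarrow> 0) (at 0)" using l r by (simp add: filterlim_at_split)
    then show ?thesis using 3 by (simp add: DERIV_def flat_def)
  qed
qed

lemma smooth_fun_deriv: "smooth_fun f \<Longrightarrow> \<exists>g. smooth_fun g \<and> (\<forall>x. (f has_real_derivative g x) (at x))"
proof (induction rule: smooth_fun.induct)
  case (flat m)
  have "smooth_fun (\<lambda>x. - real m * flat (Suc m) x + flat (Suc (Suc m)) x)" by (intro smooth_fun.intros)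
  then show ?case using flat_deriv by blast
next
  case (const c)
  show ?case by (intro exI[of _ "\<lambda>x. 0"]) (auto intro: smooth_fun.const)
next
  case (affine f c d)
  then obtain g where g: "smooth_fun g" "\<And>x. (f has_real_derivative g x) (at x)" by blast
  have "((\<lambda>x. f (c * x + d)) has_real_derivative g (c * x + d) * c) (at x)" for x
    by (rule DERIV_chain2[OF g(2)]) (auto intro!: derivative_eq_intros)
  moreover have "smooth_fun (\<lambda>x. g (c * x + d) * c)" by (rule smooth_fun.mult[OF smooth_fun.affine[OF g(1)] smooth_fun.const])
  ultimately show ?case by blast
next
  case (add f1 f2)
  then obtain g1 g2 where g: "smooth_fun g1" "\<And>x. (f1 has_real_derivative g1 x) (at x)" "smooth_fun g2" "\<And>x. (f2 has_real_derivative g2 x) (at x)" by blast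
  then show ?case by (intro exI[of _ "\<lambda>x. g1 x + g2 x"]) (auto intro!: smooth_fun.add DERIV_add)
next
  case (mult f1 f2)
  then obtain g1 g2 where g: "smooth_fun g1" "\<And>x. (f1 has_real_derivative g1 x) (at x)" "smooth_fun g2" "\<And>x. (f2 has_real_derivative g2 x) (at x)" by blast
  have "((\<lambda>x. f1 x * f2 x) has_real_derivative g1 x * f2 x + g2 x * f1 x) (at x)" for x
    using DERIV_mult[OF g(2) g(4), of x] .
  moreover have "smooth_fun (\<lambda>x. g1 x * f2 x + g2 x * f1 x)" using g mult by (intro smooth_fun.add smooth_fun.mult)
  ultimately show ?case by blast
next
  case (primitive F f)
  then show ?case by blast
qed

lemma smooth_fun_Ck: assumes "smooth_fun f" shows "Ck k f"
proof -
  have d: "smooth_fun (deriv f) \<and> (\<forall>x. (f has_real_derivative deriv f x) (at x))" if f: "smooth_fun f" for f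
  proof -
    obtain g where g: "smooth_fun g" "\<And>x. (f has_real_derivative g x) (at x)" using smooth_fun_deriv[OF f] by blast
    have "deriv f = g" using DERIV_imp_deriv[OF g(2)] by blast
    then show ?thesis using g by simp
  qed
  have s: "smooth_fun ((deriv ^^ j) f)" for j by (induction j) (use assms d in auto)
  have D: "((deriv ^^ j) f has_real_derivative deriv ((deriv ^^ j) f) x) (at x)" for j x using d[OF s] by blast
  then show ?thesis unfolding Ck_def
    by (auto simp: real_differentiable_def intro!: continuous_at_imp_continuous_on DERIV_isCont)
qed

lemma continuous_primitive_exists:
  fixes f :: "real \<Rightarrow> real"
  assumes "continuous_on UNIV f"
  obtains F where "\<And>x. (F has_real_derivative f x) (at x)"
proof -
  have "\<exists>F. \<forall>x. - \<infinity> < ereal x \<longrightarrow> ereal x < \<infinity> \<longrightarrow> (F has_vector_derivative f x) (at x)"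
    using assms by (intro einterval_antiderivative) (auto simp: continuous_on_eq_continuous_at)
  then show ?thesis using that by (auto simp: has_real_derivative_iff_has_vector_derivative)
qed

lemma smooth_fun_cont: "smooth_fun f \<Longrightarrow> continuous_on UNIV f"
  using smooth_fun_Ck[of f 0] by (simp add: Ck_def)

lemma smooth_step_exists:
  obtains s where "smooth_fun s" "\<And>x. x \<le> 0 \<Longrightarrow> s x = 0" "\<And>x. 1 \<le> x \<Longrightarrow> s x = 1" "\<And>x. 0 \<le> s x" "\<And>x. s x \<le> 1"
proof -
  define \<beta> where "\<beta> x = flat 0 x * flat 0 (- 1 * x + 1)" for x
  have s: "smooth_fun \<beta>" unfolding \<beta>_def by (rule smooth_fun.mult[OF smooth_fun.flat smooth_fun.affine[OF smooth_fun.flat]])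
  have b0: "0 \<le> \<beta> x" for x by (simp add: \<beta>_def flat_def)
  have bz: "\<beta> x = 0" if "x \<le> 0 \<or> 1 \<le> x" for x using that by (auto simp: \<beta>_def flat_def)
  have bp: "0 < \<beta> x" if "0 < x" "x < 1" for x using that by (simp add: \<beta>_def flat_def)
  obtain F where F: "\<And>x. (F has_real_derivative \<beta> x) (at x)" using continuous_primitive_exists[OF smooth_fun_cont[OF s]] by blast
  have mono: "F x \<le> F y" if "x \<le> y" for x y
    using DERIV_nonneg_imp_nondecreasing[OF that, of F] F b0 by blast
  obtain z where z: "0 < z" "z < 1" "F 1 - F 0 = (1 - 0) * \<beta> z" using MVT2[of 0 1 F \<beta>] F by auto
  then have pos: "0 < F 1 - F 0" using bp by simp
  have F0: "F x = F 0" if "x \<le> 0" for x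
  proof (cases "x = 0")
    case False
    with that have "x < 0" by simp
    then obtain z where "x < z" "z < 0" "F 0 - F x = (0 - x) * \<beta> z" using MVT2[of x 0 F \<beta>] F that by auto
    then show ?thesis using bz[of z] by simp
  qed simp
  have F1: "F x = F 1" if "1 \<le> x" for x
  proof (cases "x = 1")
    case False
    with that have "1 < x" by simp
    then obtain z where "1 < z" "z < x" "F x - F 1 = (x - 1) * \<beta> z" using MVT2[of 1 x F \<beta>] F that by auto
    then show ?thesis using bz[of z] by simp
  qed simp
  define s where "s x = (1 / (F 1 - F 0)) * (F x + - F 0)" for x
  have ss: "smooth_fun s" unfolding s_def
    by (rule smooth_fun.mult[OF smooth_fun.const smooth_fun.add[OF smooth_fun.primitive[OF F s] smooth_fun.const]])
  have Fb: "F 0 \<le> F x" "F x \<le> F 1" for x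
    using mono[of 0 x] mono[of x 1] F0[of x] F1[of x] pos by (cases "0 \<le> x"; cases "x \<le> 1"; simp)+
  show ?thesis
  proof (rule that[OF ss])
    show "s x = 0" if "x \<le> 0" for x using F0[OF that] by (simp add: s_def)
    show "s x = 1" if "1 \<le> x" for x using F1[OF that] pos by (simp add: s_def)
    show "0 \<le> s x" "s x \<le> 1" for x using Fb[of x] pos by (simp_all add: s_def divide_le_eq)
  qed
qed

context segment begin

section \<open>Sobolev functions on an interval\<close>

lemma test_function_AC:
  assumes "\<phi> \<in> test_functions {a<..<b}" shows "AC \<phi> (deriv \<phi>)" "\<phi> a = 0" "\<phi> b = 0"
proof -
  have C: "Ck 1 \<phi>" and cl: "closure {x. \<phi> x \<noteq> 0} \<subseteq> {a<..<b}" using assms by (auto simp: test_functions_def)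
  then have d: "(\<phi> has_real_derivative deriv \<phi> x) (at x)" for x
    by (auto simp: Ck_def real_differentiable_def DERIV_deriv_iff_real_differentiable)
  show "AC \<phi> (deriv \<phi>)" using C by (intro AC_C1 d) (auto simp: Ck_def intro: continuous_on_subset)
  show "\<phi> a = 0" "\<phi> b = 0" using cl closure_subset[of "{x. \<phi> x \<noteq> 0}"] by force+
qed

lemma weak_deriv_iff: "weak_deriv {a<..<b} f v \<longleftrightarrow> (\<forall>\<phi>\<in>test_functions {a<..<b}. IP f (deriv \<phi>) = - IP v \<phi>)"
  by (simp add: weak_deriv_def ip_L2_def)

lemma AC_weak_deriv:
  assumes F: "AC F v" and ae: "AE x in M. f x = F x" shows "f \<in> H1 {a<..<b}" "weak_deriv {a<..<b} f v"
proof -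
  show w: "weak_deriv {a<..<b} f v" unfolding weak_deriv_iff
  proof
    fix \<phi> assume "\<phi> \<in> test_functions {a<..<b}"
    note t = test_function_AC[OF this]
    have "IP f (deriv \<phi>) = IP F (deriv \<phi>)" by (rule IP_cong_AE[OF AC_fLL[OF F] AC_LL[OF t(1)] ae]) simp
    then show "IP f (deriv \<phi>) = - IP v \<phi>" using AC_by_parts[OF F t(1)] t by simp
  qed
  then show "f \<in> H1 {a<..<b}" using LL_AE'[OF AC_fLL[OF F] ae] AC_LL[OF F] by (auto simp: H1_def)
qed

text \<open>The difference of two translates of a smooth ramp. Its derivative approximates the indicator of \<open>{p..q}\<close>, and to the
  right it equals \<open>q - p\<close> exactly, independently of \<open>\<delta>\<close>.\<close>

lemma smoothed_indicator:
  assumes s: "smooth_fun s" "\<And>x. x \<le> 0 \<Longrightarrow> s x = 0" "\<And>x. 1 \<le> x \<Longrightarrow> s x = 1"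
    and d: "0 < \<delta>" and pq: "p < q"
  shows "\<exists>\<Phi>. smooth_fun \<Phi> \<and> (\<forall>x. (\<Phi> has_real_derivative (s ((x - p) / \<delta>) - s ((x - q) / \<delta>))) (at x)) \<and>
     (\<forall>x\<le>p. \<Phi> x = 0) \<and> (\<forall>x\<ge>q + \<delta>. \<Phi> x = q - p)"
proof -
  obtain Z0 where Z0: "\<And>x. (Z0 has_real_derivative s x) (at x)" using continuous_primitive_exists[OF smooth_fun_cont[OF s(1)]] by blast
  define Z where "Z x = Z0 x + - Z0 0" for x
  have Z: "(Z has_real_derivative s x) (at x)" for x unfolding Z_def by (auto intro!: derivative_eq_intros Z0)
  have sZ: "smooth_fun Z" using Z s(1) by (rule smooth_fun.primitive)
  have Zneg: "Z x = 0" if "x \<le> 0" for x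
  proof (cases "x = 0")
    case False
    with that have "x < 0" by simp
    then obtain z where "x < z" "z < 0" "Z 0 - Z x = (0 - x) * s z" using MVT2[of x 0 Z s] Z that by auto
    then show ?thesis using s(2)[of z] by (simp add: Z_def)
  qed (simp add: Z_def)
  have Zpos: "Z x = Z 1 + (x - 1)" if "1 \<le> x" for x
  proof (cases "x = 1")
    case False
    with that have "1 < x" by simp
    then obtain z where "1 < z" "z < x" "Z x - Z 1 = (x - 1) * s z" using MVT2[of 1 x Z s] Z that by auto
    then show ?thesis using s(3)[of z] by simp
  qed simp
  define \<Phi> where "\<Phi> x = \<delta> * (Z ((1/\<delta>) * x + - p / \<delta>) + - 1 * Z ((1/\<delta>) * x + - q / \<delta>))" for x
  have e: "(1/\<delta>) * x + - r / \<delta> = (x - r) / \<delta>" for x r by (simp add: diff_divide_distrib)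
  have "smooth_fun \<Phi>" unfolding \<Phi>_def
    by (intro smooth_fun.mult smooth_fun.add smooth_fun.const smooth_fun.affine[OF sZ])
  moreover have "(\<Phi> has_real_derivative (s ((x - p) / \<delta>) - s ((x - q) / \<delta>))) (at x)" for x
  proof -
    have "((\<lambda>x. Z ((1/\<delta>) * x + - r / \<delta>)) has_real_derivative s ((x - r) / \<delta>) * (1/\<delta>)) (at x)" for r
      unfolding e[symmetric] by (rule DERIV_chain2[OF Z]) (use d in \<open>auto intro!: derivative_eq_intros\<close>)
    note D = DERIV_cmult[OF DERIV_add[OF this[of p] DERIV_cmult[OF this[of q], of "-1"]], of \<delta>]
    show ?thesis unfolding \<Phi>_def by (rule DERIV_cong[OF D]) (use d in \<open>simp add: field_simps\<close>)
  qed
  moreover have "\<Phi> x = 0" if "x \<le> p" for x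
    unfolding \<Phi>_def e using Zneg that pq d by (simp add: divide_nonpos_pos)
  moreover have "\<Phi> x = q - p" if "q + \<delta> \<le> x" for x
  proof -
    have "1 \<le> (x - p) / \<delta>" "1 \<le> (x - q) / \<delta>" using that pq d by (auto simp: field_simps)
    then have "Z ((x - p) / \<delta>) = Z 1 + ((x - p) / \<delta> - 1)" "Z ((x - q) / \<delta>) = Z 1 + ((x - q) / \<delta> - 1)"
      by (blast intro: Zpos)+
    then have "\<Phi> x = \<delta> * ((x - p) / \<delta> - (x - q) / \<delta>)" unfolding \<Phi>_def e by simp
    also have "\<dots> = q - p" using d by (simp add: field_simps)
    finally show ?thesis .
  qed
  ultimately show ?thesis by blast
qed

text \<open>Two smoothed indicators, each divided by the length of its interval, have the same final value, so
  their difference is a test function. Hence \<open>k\<close> has the same mean over all intervals.\<close>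

lemma orthogonal_to_test_derivs:
  assumes k: "k \<in> LL" and orth: "\<And>\<phi>. \<phi> \<in> test_functions {a<..<b} \<Longrightarrow> IP k (deriv \<phi>) = 0"
  shows "\<exists>c. AE x in M. k x = c"
proof -
  obtain s where s: "smooth_fun s" "\<And>x. x \<le> 0 \<Longrightarrow> s x = 0" "\<And>x. 1 \<le> x \<Longrightarrow> s x = 1" "\<And>x. 0 \<le> s x" "\<And>x. s x \<le> 1"
    using smooth_step_exists by metis
  define T where "T \<delta> p q x = s ((x - p) / \<delta>) - s ((x - q) / \<delta>)" for \<delta> p q x
  have sc: "continuous_on UNIV s" by (rule smooth_fun_cont[OF s(1)])
  have TL: "T \<delta> p q \<in> LL" if "0 < \<delta>" for \<delta> p q unfolding T_def using that
    by (intro LL_diff LL_cont continuous_on_compose2[OF sc] continuous_intros) auto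
  have lim: "(\<lambda>j. IP (T (1 / real (Suc j)) p q) k) \<longlonglongrightarrow> integral {p..q} k" if "a \<le> p" "p < q" "q \<le> b" for p q
  proof -
    have "(\<lambda>j. IP (T (1 / real (Suc j)) p q) k) \<longlonglongrightarrow> IP (indicator {p<..q}) k"
    proof (rule IP_tendsto_dominated[OF TL _ k LL_const[of 2]])
      show "indicat_real {p<..q} \<in> borel_measurable M" by (intro LL_meas LL_indicator) simp
      have step: "(\<lambda>j. s ((x - p) / (1 / real (Suc j)))) \<longlonglongrightarrow> (if p < x then 1 else 0)" for x p
      proof (cases "p < x")
        case True
        obtain N :: nat where N: "1 / (x - p) < real N" using reals_Archimedean2 by blast
        have "s ((x - p) / (1 / real (Suc j))) = 1" if "N \<le> j" for j
        proof (rule s(3))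
          have "1 / (x - p) \<le> real (Suc j)" using N that by linarith
          then show "1 \<le> (x - p) / (1 / real (Suc j))" using True by (simp add: field_simps)
        qed
        then have "\<forall>\<^sub>F j in sequentially. s ((x - p) / (1 / real (Suc j))) = 1" unfolding eventually_sequentially by blast
        then show ?thesis using True by (simp add: tendsto_eventually)
      next
        case False
        then have "s ((x - p) / (1 / real (Suc j))) = 0" for j by (intro s(2)) (simp add: mult_nonpos_nonneg)
        then show ?thesis using False by simp
      qed
      fix x
      have "(\<lambda>j. T (1 / real (Suc j)) p q x) \<longlonglongrightarrow> (if p < x then 1 else 0) - (if q < x then 1 else 0)"
        unfolding T_def by (intro tendsto_diff step)
      also have "(if p < x then 1 else 0) - (if q < x then 1 else 0) = indicat_real {p<..q} x" using that by (auto simp: indicator_def)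
      finally show "(\<lambda>j. T (1 / real (Suc j)) p q x) \<longlonglongrightarrow> indicat_real {p<..q} x" .
      show "\<bar>T (1 / real (Suc j)) p q x\<bar> \<le> 2" for j
        using s(4,5)[of "(x - p) / (1 / real (Suc j))"] s(4,5)[of "(x - q) / (1 / real (Suc j))"] unfolding T_def by linarith
    qed simp
    also have "IP (indicator {p<..q}) k = IP k (indicator {p..q})"
    proof -
      have "AE x in lborel. x \<noteq> p" by (rule AE_lborel_singleton)
      then have "AE x in lebesgue. x \<noteq> p" by (simp add: AE_completion)
      then have "AE x in M. x \<noteq> p" by (subst AE_restrict_space_iff) auto
      then have "AE x in M. indicat_real {p<..q} x = indicator {p..q} x" by (rule eventually_mono) (auto simp: indicator_def)
      then have "IP (indicator {p<..q}) k = IP (indicator {p..q}) k" using k by (intro IP_cong_AE) auto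
      then show ?thesis by (simp add: IP_commute)
    qed
    also have "\<dots> = integral {p..q} k" using LL_primitive[OF k, of p q] that by simp
    finally show ?thesis .
  qed
  have eq: "integral {p..q} k / (q - p) = integral {p2..q2} k / (q2 - p2)"
    if pq: "a < p" "p < q" "q < b" "a < p2" "p2 < q2" "q2 < b" for p q p2 q2
  proof -
    have "IP (T \<delta> p q) k / (q - p) = IP (T \<delta> p2 q2) k / (q2 - p2)" if d: "0 < \<delta>" "q + \<delta> < b" "q2 + \<delta> < b" for \<delta>
    proof -
      obtain F1 where F1: "smooth_fun F1" "\<And>x. (F1 has_real_derivative T \<delta> p q x) (at x)"
        "\<And>x. x \<le> p \<Longrightarrow> F1 x = 0" "\<And>x. q + \<delta> \<le> x \<Longrightarrow> F1 x = q - p"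
        using smoothed_indicator[OF s(1-3) d(1) pq(2)] unfolding T_def by blast
      obtain F2 where F2: "smooth_fun F2" "\<And>x. (F2 has_real_derivative T \<delta> p2 q2 x) (at x)"
        "\<And>x. x \<le> p2 \<Longrightarrow> F2 x = 0" "\<And>x. q2 + \<delta> \<le> x \<Longrightarrow> F2 x = q2 - p2"
        using smoothed_indicator[OF s(1-3) d(1) pq(5)] unfolding T_def by blast
      define \<phi> where "\<phi> x = (1 / (q - p)) * F1 x + (- 1 / (q2 - p2)) * F2 x" for x
      have sm: "smooth_fun \<phi>" unfolding \<phi>_def using F1 F2 by (intro smooth_fun.add smooth_fun.mult smooth_fun.const)
      have D: "(\<phi> has_real_derivative (1 / (q - p)) * T \<delta> p q x + (- 1 / (q2 - p2)) * T \<delta> p2 q2 x) (at x)" for x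
        unfolding \<phi>_def by (intro DERIV_add DERIV_cmult F1 F2)
      have dphi: "deriv \<phi> = (\<lambda>x. (1 / (q - p)) * T \<delta> p q x + (- 1 / (q2 - p2)) * T \<delta> p2 q2 x)"
        using DERIV_imp_deriv[OF D] by blast
      have "\<phi> x = 0" if "x \<notin> {min p p2..max q q2 + \<delta>}" for x
      proof -
        have "x < min p p2 \<or> max q q2 + \<delta> < x" using that by auto
        then show ?thesis
        proof
          assume "x < min p p2" then show ?thesis using F1(3)[of x] F2(3)[of x] by (simp add: \<phi>_def)
        next
          assume "max q q2 + \<delta> < x" then show ?thesis using F1(4)[of x] F2(4)[of x] pq by (simp add: \<phi>_def)
        qed
      qed
      then have "{x. \<phi> x \<noteq> 0} \<subseteq> {min p p2..max q q2 + \<delta>}" by blast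
      then have cl: "closure {x. \<phi> x \<noteq> 0} \<subseteq> {min p p2..max q q2 + \<delta>}" by (rule closure_minimal) simp
      then have "compact (closure {x. \<phi> x \<noteq> 0})" using compact_Icc bounded_subset compact_eq_bounded_closed by blast
      moreover have "{min p p2..max q q2 + \<delta>} \<subseteq> {a<..<b}" using pq d by auto
      ultimately have "\<phi> \<in> test_functions {a<..<b}" using cl smooth_fun_Ck[OF sm] by (auto simp: test_functions_def)
      from orth[OF this] have "IP k (\<lambda>x. (1 / (q - p)) * T \<delta> p q x + (- 1 / (q2 - p2)) * T \<delta> p2 q2 x) = 0" unfolding dphi .
      then have "(1 / (q - p)) * IP k (T \<delta> p q) + (- 1 / (q2 - p2)) * IP k (T \<delta> p2 q2) = 0"
        using IP_add_right[OF LL_scale[OF TL[OF d(1)]] LL_scale[OF TL[OF d(1)]] k] by (simp only: IP_scale_right)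
      then show ?thesis by (simp add: IP_commute[of k])
    qed
    moreover have "\<forall>\<^sub>F j in sequentially. 1 / real (Suc j) < min (b - q) (b - q2)"
      using LIMSEQ_inverse_real_of_nat pq by (intro order_tendstoD(2)) (auto simp: inverse_eq_divide)
    ultimately have ev: "\<forall>\<^sub>F j in sequentially. IP (T (1 / real (Suc j)) p q) k / (q - p) = IP (T (1 / real (Suc j)) p2 q2) k / (q2 - p2)"
      by (auto elim!: eventually_mono)
    have "(\<lambda>j. IP (T (1 / real (Suc j)) p q) k / (q - p)) \<longlonglongrightarrow> integral {p..q} k / (q - p)"
      using pq by (intro tendsto_divide lim tendsto_const) auto
    then have "(\<lambda>j. IP (T (1 / real (Suc j)) p2 q2) k / (q2 - p2)) \<longlonglongrightarrow> integral {p..q} k / (q - p)"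
      by (rule Lim_transform_eventually) (use ev in auto)
    moreover have "(\<lambda>j. IP (T (1 / real (Suc j)) p2 q2) k / (q2 - p2)) \<longlonglongrightarrow> integral {p2..q2} k / (q2 - p2)"
      using pq by (intro tendsto_divide lim tendsto_const) auto
    ultimately show ?thesis by (rule LIMSEQ_unique)
  qed
  \<comment> \<open>The mean over the middle third serves as the constant.\<close>
  define p0 q0 where "p0 = a + (b - a) / 3" and "q0 = a + 2 * (b - a) / 3"
  have p0: "a < p0" "p0 < q0" "q0 < b" using ab by (auto simp: p0_def q0_def field_simps)
  define c where "c = integral {p0..q0} k / (q0 - p0)"
  have int: "integral {p..q} k = c * (q - p)" if "a < p" "p < q" "q < b" for p q
    using eq[OF that p0] that unfolding c_def by (simp add: field_simps)
  define I where "I x = integral {a..x} k" for x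
  have Ic: "continuous_on {a..b} I" unfolding I_def
    by (rule indefinite_integral_continuous_1) (use LL_integrable_on[OF k, of a b] in simp)
  have I: "I y - I x = c * (y - x)" if "x \<in> {a<..<b}" "y \<in> {a<..<b}" for x y
  proof (cases "x < y")
    case True
    then show ?thesis using int[of x y] LL_primitive_split[OF k, of x y] that by (simp add: I_def)
  next
    case False
    then show ?thesis using int[of y x] LL_primitive_split[OF k, of y x] that
      by (cases "x = y") (auto simp: I_def algebra_simps)
  qed
  define m where "m = (a + b) / 2"
  have m: "m \<in> {a<..<b}" using ab by (auto simp: m_def)
  have all: "I x - I m = c * (x - m)" if "x \<in> {a..b}" for x
  proof -
    have "continuous_on (closure {a<..<b}) (\<lambda>x. I x - I m - c * (x - m))"
      using Ic ab by (auto intro!: continuous_intros)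
    then have "I x - I m - c * (x - m) = 0"
      by (rule continuous_constant_on_closure) (use that ab I[OF m] in auto)
    then show ?thesis by simp
  qed
  have "AE x in M. k x = c"
  proof (rule primitive_eq_imp_AE_eq[OF k LL_const])
    fix x assume x: "x \<in> {a..b}"
    have "I x = c * (x - a)" using all[OF x] all[of a] ab by (simp add: I_def algebra_simps)
    then show "integral {a..x} k = integral {a..x} (\<lambda>x. c)" using x by (simp add: I_def)
  qed
  then show ?thesis by blast
qed

text \<open>Subtract a primitive of \<open>v\<close>; the difference has weak derivative \<open>0\<close>.\<close>

lemma weak_deriv_AC:
  assumes f: "f \<in> LL" and v: "v \<in> LL" and w: "weak_deriv {a<..<b} f v"
  shows "\<exists>F. AC F v \<and> (AE x in M. f x = F x)"
proof -
  define V where "V x = 0 + integral {a..x} v" for x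
  have V: "AC V v" unfolding V_def by (rule AC_prim[OF v])
  have VL: "V \<in> LL" by (rule AC_fLL[OF V])
  have "\<exists>c. AE x in M. f x - V x = c"
  proof (rule orthogonal_to_test_derivs[OF LL_diff[OF f VL]])
    fix \<phi> assume \<phi>: "\<phi> \<in> test_functions {a<..<b}"
    note t = test_function_AC[OF \<phi>]
    have "IP f (deriv \<phi>) = - IP v \<phi>" using w \<phi> by (simp add: weak_deriv_iff)
    moreover have "IP V (deriv \<phi>) = - IP v \<phi>" using AC_by_parts[OF V t(1)] t by simp
    ultimately show "IP (\<lambda>x. f x - V x) (deriv \<phi>) = 0" using IP_diff_left[OF f VL AC_LL[OF t(1)]] by simp
  qed
  then obtain c where c: "AE x in M. f x - V x = c" by blast
  have "AC (\<lambda>x. c + V x) v" using AC_add[OF AC_const V] by simp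
  moreover have "AE x in M. f x = c + V x" using c by (rule eventually_mono) auto
  ultimately show ?thesis by blast
qed

lemma cont_AE_eq:
  fixes f g :: "real \<Rightarrow> real"
  assumes "continuous_on {a..b} f" "continuous_on {a..b} g" "AE x in M. f x = g x" "x \<in> {a..b}"
  shows "f x = g x"
proof -
  have c: "continuous_on {a..b} (\<lambda>x. f x - g x)" using assms by (intro continuous_intros)
  have c2: "continuous_on {a..b} (\<lambda>x. (f x - g x) * (f x - g x))" by (rule continuous_on_mult[OF c c])
  have "IP (\<lambda>x. f x - g x) (\<lambda>x. f x - g x) = IP (\<lambda>x. 0) (\<lambda>x. 0)"
    using assms(3) by (intro IP_cong_AE) auto
  then have "integral {a..b} (\<lambda>x. (f x - g x) * (f x - g x)) = 0" using LINT_M[OF LL_cont[OF c2]] by (simp add: ip_L2_def)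
  then have "\<forall>x\<in>{a..b}. (f x - g x) * (f x - g x) = 0"
    using integral_eq_0_iff[of a b "\<lambda>x. (f x - g x) * (f x - g x)"] c2 ab by auto
  then show ?thesis using assms(4) by auto
qed

lemma H1_dx: assumes "f \<in> H1 {a<..<b}" shows "dx {a<..<b} f \<in> LL" "weak_deriv {a<..<b} f (dx {a<..<b} f)"
proof -
  have "\<exists>v. v \<in> LL \<and> weak_deriv {a<..<b} f v" using assms by (auto simp: H1_def)
  from someI_ex[OF this] show "dx {a<..<b} f \<in> LL" "weak_deriv {a<..<b} f (dx {a<..<b} f)" unfolding dx_def by auto
qed

lemma H1_AC: assumes "f \<in> H1 {a<..<b}" obtains F where "AC F (dx {a<..<b} f)" "AE x in M. f x = F x"
proof -
  have "f \<in> LL" using assms by (simp add: H1_def)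
  from weak_deriv_AC[OF this H1_dx[OF assms]] show ?thesis using that by blast
qed

lemma dx_AC: assumes F: "AC F v" and ae: "AE x in M. f x = F x" shows "AE x in M. dx {a<..<b} f x = v x"
proof -
  obtain F' where F': "AC F' (dx {a<..<b} f)" "AE x in M. f x = F' x" using H1_AC[OF AC_weak_deriv(1)[OF F ae]] .
  have "AE x in M. F' x = F x" using ae F'(2) by eventually_elim simp
  from cont_AE_eq[OF AC_cont[OF F'(1)] AC_cont[OF F] this] show ?thesis by (rule AC_unique[OF F'(1) F])
qed

lemma H1_LL: "f \<in> H1 {a<..<b} \<Longrightarrow> f \<in> LL" by (simp add: H1_def)

lemma dx_add: assumes "f \<in> H1 {a<..<b}" "g \<in> H1 {a<..<b}"
  shows "(\<lambda>x. f x + g x) \<in> H1 {a<..<b}" "AE x in M. dx {a<..<b} (\<lambda>x. f x + g x) x = dx {a<..<b} f x + dx {a<..<b} g x"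
proof -
  obtain F G where F: "AC F (dx {a<..<b} f)" "AE x in M. f x = F x" and G: "AC G (dx {a<..<b} g)" "AE x in M. g x = G x"
    by (rule H1_AC[OF assms(1)], rule H1_AC[OF assms(2)]) blast
  have ae: "AE x in M. f x + g x = F x + G x" using F(2) G(2) by eventually_elim simp
  show "(\<lambda>x. f x + g x) \<in> H1 {a<..<b}" by (rule AC_weak_deriv(1)[OF AC_add[OF F(1) G(1)] ae])
  show "AE x in M. dx {a<..<b} (\<lambda>x. f x + g x) x = dx {a<..<b} f x + dx {a<..<b} g x"
    by (rule dx_AC[OF AC_add[OF F(1) G(1)] ae])
qed

lemma dx_scale: assumes "f \<in> H1 {a<..<b}"
  shows "(\<lambda>x. c * f x) \<in> H1 {a<..<b}" "AE x in M. dx {a<..<b} (\<lambda>x. c * f x) x = c * dx {a<..<b} f x"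
proof -
  obtain F where F: "AC F (dx {a<..<b} f)" "AE x in M. f x = F x" using H1_AC[OF assms(1)] by metis
  have ae: "AE x in M. c * f x = c * F x" using F(2) by eventually_elim simp
  show "(\<lambda>x. c * f x) \<in> H1 {a<..<b}" by (rule AC_weak_deriv(1)[OF AC_scale[OF F(1)] ae])
  show "AE x in M. dx {a<..<b} (\<lambda>x. c * f x) x = c * dx {a<..<b} f x" by (rule dx_AC[OF AC_scale[OF F(1)] ae])
qed

text \<open>The form of the functional \<open>\<zeta>\<close> in the optimality system.\<close>

lemma H1_dual_density:
  assumes A: "A \<in> LL" and B: "B \<in> LL"
  shows "(\<lambda>\<phi>. IP A \<phi> + IP B (dx {a<..<b} \<phi>)) \<in> H1_dual {a<..<b}"
  unfolding H1_dual_def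
proof (intro CollectI conjI ballI allI)
  fix \<phi> \<psi> assume h: "\<phi> \<in> H1 {a<..<b}" "\<psi> \<in> H1 {a<..<b}"
  note L = H1_LL[OF h(1)] H1_LL[OF h(2)] H1_dx(1)[OF h(1)] H1_dx(1)[OF h(2)]
  have "IP B (dx {a<..<b} (\<lambda>x. \<phi> x + \<psi> x)) = IP B (\<lambda>x. dx {a<..<b} \<phi> x + dx {a<..<b} \<psi> x)"
    using L by (intro IP_cong_AE B dx_add(2) h) auto
  then show "IP A (\<lambda>x. \<phi> x + \<psi> x) + IP B (dx {a<..<b} (\<lambda>x. \<phi> x + \<psi> x))
     = IP A \<phi> + IP B (dx {a<..<b} \<phi>) + (IP A \<psi> + IP B (dx {a<..<b} \<psi>))"
    using L A B by (simp add: IP_add_right)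
next
  fix c \<phi> assume h: "\<phi> \<in> H1 {a<..<b}"
  have "IP B (dx {a<..<b} (\<lambda>x. c * \<phi> x)) = IP B (\<lambda>x. c * dx {a<..<b} \<phi> x)"
    using H1_dx(1)[OF h] by (intro IP_cong_AE B dx_scale(2) h) auto
  then show "IP A (\<lambda>x. c * \<phi> x) + IP B (dx {a<..<b} (\<lambda>x. c * \<phi> x)) = c * (IP A \<phi> + IP B (dx {a<..<b} \<phi>))"
    by (simp add: IP_scale_right distrib_left)
next
  show "\<exists>C. \<forall>\<phi>\<in>H1 {a<..<b}. \<bar>IP A \<phi> + IP B (dx {a<..<b} \<phi>)\<bar> \<le> C * sqrt (ip_H1 {a<..<b} \<phi> \<phi>)"
  proof (intro exI ballI)
    fix \<phi> assume h: "\<phi> \<in> H1 {a<..<b}"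
    have s: "nrm \<phi> \<le> sqrt (ip_H1 {a<..<b} \<phi> \<phi>)" "nrm (dx {a<..<b} \<phi>) \<le> sqrt (ip_H1 {a<..<b} \<phi> \<phi>)"
      unfolding nrm_def ip_H1_def by (simp_all add: real_sqrt_le_mono)
    have "\<bar>IP A \<phi>\<bar> \<le> nrm A * nrm \<phi>" "\<bar>IP B (dx {a<..<b} \<phi>)\<bar> \<le> nrm B * nrm (dx {a<..<b} \<phi>)"
      using Cauchy_Schwarz A B H1_LL[OF h] H1_dx(1)[OF h] by auto
    moreover have "nrm A * nrm \<phi> \<le> nrm A * sqrt (ip_H1 {a<..<b} \<phi> \<phi>)"
      "nrm B * nrm (dx {a<..<b} \<phi>) \<le> nrm B * sqrt (ip_H1 {a<..<b} \<phi> \<phi>)" using s by (auto intro!: mult_left_mono)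
    ultimately show "\<bar>IP A \<phi> + IP B (dx {a<..<b} \<phi>)\<bar> \<le> (nrm A + nrm B) * sqrt (ip_H1 {a<..<b} \<phi> \<phi>)"
      unfolding distrib_right by linarith
  qed
qed

section \<open>The energy functional and uniqueness of states\<close>

lemma dom_Psi_iff: "z \<in> dom_Psi {a<..<b} \<nu> \<longleftrightarrow> z \<in> H1 {a<..<b} \<and> (AE x in M. \<bar>z x\<bar> \<le> 1)"
proof
  assume z: "z \<in> dom_Psi {a<..<b} \<nu>"
  then have h: "z \<in> H1 {a<..<b}" by (auto simp: dom_Psi_def Psi_def split: if_splits)
  have [measurable]: "z \<in> borel_measurable M" using LL_meas[OF H1_LL[OF h]] .
  have "(\<integral>\<^sup>+x. indicator_functional (z x) \<partial>M) \<noteq> \<infinity>"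
    using z h by (auto simp: dom_Psi_def Psi_def)
  moreover have "(\<lambda>x. indicator_functional (z x)) \<in> borel_measurable M"
    unfolding indicator_functional_def by measurable
  ultimately have "AE x in M. indicator_functional (z x) \<noteq> \<infinity>" by (intro nn_integral_PInf_AE) auto
  then have "AE x in M. \<bar>z x\<bar> \<le> 1" by (rule eventually_mono) (auto simp: indicator_functional_def split: if_splits)
  with h show "z \<in> H1 {a<..<b} \<and> (AE x in M. \<bar>z x\<bar> \<le> 1)" by simp
next
  assume z: "z \<in> H1 {a<..<b} \<and> (AE x in M. \<bar>z x\<bar> \<le> 1)"
  have "(\<integral>\<^sup>+x. indicator_functional (z x) \<partial>M) = (\<integral>\<^sup>+x. 0 \<partial>M)"
    using z by (intro nn_integral_cong_AE) (auto elim!: eventually_mono simp: indicator_functional_def)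
  then show "z \<in> dom_Psi {a<..<b} \<nu>" using z H1_LL by (auto simp: dom_Psi_def Psi_def)
qed

text \<open>The derivative part of the functional, as a function of the derivative. On the domain of the functional
  it is all that remains.\<close>

definition energy :: "real \<Rightarrow> (real \<Rightarrow> real) \<Rightarrow> real" where
  "energy \<nu> v = (LINT x|M. \<bar>v x\<bar>) + \<nu>\<^sup>2 / 2 * (LINT x|M. \<bar>v x\<bar>\<^sup>2)"

lemma Psi_energy:
  assumes "z \<in> dom_Psi {a<..<b} \<nu>" shows "enn2real (Psi {a<..<b} \<nu> z) = energy \<nu> (dx {a<..<b} z)"
proof -
  have z: "z \<in> H1 {a<..<b}" "AE x in M. \<bar>z x\<bar> \<le> 1" using assms dom_Psi_iff by auto
  have "(\<integral>\<^sup>+x. indicator_functional (z x) \<partial>M) = (\<integral>\<^sup>+x. 0 \<partial>M)"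
    using z by (intro nn_integral_cong_AE) (auto elim!: eventually_mono simp: indicator_functional_def)
  then have "Psi {a<..<b} \<nu> z = ennreal (energy \<nu> (dx {a<..<b} z))"
    unfolding Psi_def energy_def using z(1) by (simp only: if_True nn_integral_const mult_zero_left add_0_right)
  moreover have "0 \<le> energy \<nu> (dx {a<..<b} z)" unfolding energy_def by (intro add_nonneg_nonneg mult_nonneg_nonneg integral_nonneg_AE) auto
  ultimately show ?thesis by simp
qed

lemma energy_cong: assumes "v \<in> LL" "AE x in M. v' x = v x" shows "energy \<nu> v' = energy \<nu> v"
proof -
  have m: "v' \<in> borel_measurable M" "v \<in> borel_measurable M" using LL_meas LL_AE'[OF assms] assms(1) by auto
  have "(LINT x|M. \<bar>v' x\<bar>) = (LINT x|M. \<bar>v x\<bar>)" using assms(2) m by (intro integral_cong_AE) auto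
  moreover have "(LINT x|M. \<bar>v' x\<bar>\<^sup>2) = (LINT x|M. \<bar>v x\<bar>\<^sup>2)" using assms(2) m by (intro integral_cong_AE) auto
  ultimately show ?thesis by (simp add: energy_def)
qed

text \<open>The integrated form of \<open>soft_subgradient\<close>: the flux is a subgradient of the energy at \<open>w'\<close>.\<close>

lemma IP_energy_subgradient:
  assumes nu: "0 < \<nu>" and s: "s \<in> LL" and q: "q \<in> LL" and t: "(\<lambda>x. soft \<nu> (s x)) \<in> LL"
  shows "IP s (\<lambda>x. q x - soft \<nu> (s x)) \<le> energy \<nu> q - energy \<nu> (\<lambda>x. soft \<nu> (s x))"
proof -
  have i: "integrable M (\<lambda>x. \<bar>v x\<bar>)" "integrable M (\<lambda>x. \<bar>v x\<bar>\<^sup>2)" if "v \<in> LL" for v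
    using LL_integrable[OF LL_abs[OF that]] LL_sq[OF that] by (auto simp: power2_eq_square)
  have "IP s (\<lambda>x. q x - soft \<nu> (s x)) \<le> (LINT x|M. (\<bar>q x\<bar> + \<nu>\<^sup>2 / 2 * \<bar>q x\<bar>\<^sup>2) - (\<bar>soft \<nu> (s x)\<bar> + \<nu>\<^sup>2 / 2 * \<bar>soft \<nu> (s x)\<bar>\<^sup>2))"
    unfolding ip_L2_def
  proof (rule integral_mono)
    show "integrable M (\<lambda>x. s x * (q x - soft \<nu> (s x)))" using s q t by (intro LL_mult_integrable LL_diff)
    show "integrable M (\<lambda>x. (\<bar>q x\<bar> + \<nu>\<^sup>2 / 2 * \<bar>q x\<bar>\<^sup>2) - (\<bar>soft \<nu> (s x)\<bar> + \<nu>\<^sup>2 / 2 * \<bar>soft \<nu> (s x)\<bar>\<^sup>2))"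
      using i[OF q] i[OF t] by (intro Bochner_Integration.integrable_diff Bochner_Integration.integrable_add integrable_mult_right)
  qed (rule soft_subgradient[OF nu])
  also have "\<dots> = energy \<nu> q - energy \<nu> (\<lambda>x. soft \<nu> (s x))"
    unfolding energy_def using i[OF q] i[OF t] by (simp del: power2_abs)
  finally show ?thesis .
qed

text \<open>Insert each solution into the inequality of the other and add: the energies cancel, and \<open>1 / \<tau> > Cg\<close> makes
  the remaining quadratic form positive.\<close>

lemma state_solution_unique:
  assumes g: "continuous_on UNIV g" and mono: "mono (\<lambda>r. g r + Cg * r)" and tau: "Cg < 1 / \<tau>"
    and w0: "w0 \<in> LL" and u: "\<forall>i\<in>{1..n}. u i \<in> LL"
    and s: "state_solution {a<..<b} n \<tau> \<nu> Mu g w0 u w" "state_solution {a<..<b} n \<tau> \<nu> Mu g w0 u w'"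
  shows "i \<le> n \<Longrightarrow> w i \<in> LL \<and> (AE x in M. w i x = w' i x)"
proof (induction i)
  case 0
  then show ?case using s w0 unfolding state_solution_def by simp
next
  case (Suc i)
  then have j: "Suc i \<in> {1..n}" and IH: "w i \<in> LL" "AE x in M. w i x = w' i x" by auto
  define W W' where "W = w (Suc i)" and "W' = w' (Suc i)"
  have dom: "W \<in> dom_Psi {a<..<b} \<nu>" "W' \<in> dom_Psi {a<..<b} \<nu>" using s j unfolding state_solution_def W_def W'_def by auto
  have gL: "(\<lambda>x. g (v x)) \<in> LL" "v \<in> LL" if v: "v \<in> dom_Psi {a<..<b} \<nu>" for v
  proof -
    have h: "v \<in> H1 {a<..<b}" using v dom_Psi_iff by auto
    obtain V where V: "AC V (dx {a<..<b} v)" "AE x in M. v x = V x" using H1_AC[OF h] .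
    have "(\<lambda>x. g (V x)) \<in> LL" by (rule LL_cont[OF continuous_on_compose2[OF g AC_cont[OF V(1)]]]) simp
    then show "(\<lambda>x. g (v x)) \<in> LL" by (rule LL_AE') (use V(2) in \<open>auto elim: eventually_mono\<close>)
    show "v \<in> LL" by (rule H1_LL[OF h])
  qed
  note L = gL(2)[OF dom(1)] gL(2)[OF dom(2)] gL(1)[OF dom(1)] gL(1)[OF dom(2)]
  have w'L: "w' i \<in> LL" by (rule LL_AE'[OF IH(1)]) (use IH(2) in \<open>auto elim: eventually_mono\<close>)
  have uL: "(\<lambda>x. Mu * u (Suc i) x) \<in> LL" using u j by auto
  have 1: "1 / \<tau> * IP (\<lambda>x. W x - w i x) (\<lambda>x. W x - W' x) + IP (\<lambda>x. g (W x) - Mu * u (Suc i) x) (\<lambda>x. W x - W' x)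
     + enn2real (Psi {a<..<b} \<nu> W) - enn2real (Psi {a<..<b} \<nu> W') \<le> 0"
    using s(1) j dom(2) unfolding state_solution_def W_def by force
  have 2: "1 / \<tau> * IP (\<lambda>x. W' x - w' i x) (\<lambda>x. W' x - W x) + IP (\<lambda>x. g (W' x) - Mu * u (Suc i) x) (\<lambda>x. W' x - W x)
     + enn2real (Psi {a<..<b} \<nu> W') - enn2real (Psi {a<..<b} \<nu> W) \<le> 0"
    using s(2) j dom(1) unfolding state_solution_def W'_def by force
  define D where "D x = W x - W' x" for x
  have DL: "D \<in> LL" unfolding D_def using L by auto
  have "(\<lambda>x. W' x - W x) = (\<lambda>x. - D x)" by (simp add: D_def)
  with 2 have 2: "- (1 / \<tau> * IP (\<lambda>x. W' x - w' i x) D) - IP (\<lambda>x. g (W' x) - Mu * u (Suc i) x) D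
     + enn2real (Psi {a<..<b} \<nu> W') - enn2real (Psi {a<..<b} \<nu> W) \<le> 0" by (simp add: IP_minus_right)
  have "IP (w' i) D = IP (w i) D" by (rule IP_cong_AE[OF IH(1) DL]) (use IH(2) in \<open>auto elim: eventually_mono\<close>)
  moreover have "IP (\<lambda>x. W x - w i x) D = IP W D - IP (w i) D" "IP (\<lambda>x. W' x - w' i x) D = IP W' D - IP (w' i) D"
    "IP D D = IP W D - IP W' D"
    using L IH(1) w'L DL by (simp_all add: IP_diff_left D_def[abs_def])
  moreover have "IP (\<lambda>x. g (W x) - Mu * u (Suc i) x) D = IP (\<lambda>x. g (W x)) D - IP (\<lambda>x. Mu * u (Suc i) x) D"
    "IP (\<lambda>x. g (W' x) - Mu * u (Suc i) x) D = IP (\<lambda>x. g (W' x)) D - IP (\<lambda>x. Mu * u (Suc i) x) D"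
    using L uL DL by (simp_all add: IP_diff_left)
  ultimately have le: "1 / \<tau> * IP D D + (IP (\<lambda>x. g (W x)) D - IP (\<lambda>x. g (W' x)) D) \<le> 0"
  proof -
    assume h: "IP (w' i) D = IP (w i) D" "IP (\<lambda>x. W x - w i x) D = IP W D - IP (w i) D"
      "IP (\<lambda>x. W' x - w' i x) D = IP W' D - IP (w' i) D" "IP D D = IP W D - IP W' D"
      "IP (\<lambda>x. g (W x) - Mu * u (Suc i) x) D = IP (\<lambda>x. g (W x)) D - IP (\<lambda>x. Mu * u (Suc i) x) D"
      "IP (\<lambda>x. g (W' x) - Mu * u (Suc i) x) D = IP (\<lambda>x. g (W' x)) D - IP (\<lambda>x. Mu * u (Suc i) x) D"
    have "IP D D = IP (\<lambda>x. W x - w i x) D - IP (\<lambda>x. W' x - w' i x) D" using h by simp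
    then have "1 / \<tau> * IP D D = 1 / \<tau> * IP (\<lambda>x. W x - w i x) D - 1 / \<tau> * IP (\<lambda>x. W' x - w' i x) D"
      by (simp only: right_diff_distrib)
    then show ?thesis using 1 2 h(5,6) unfolding D_def[symmetric] by linarith
  qed
  have "- Cg * IP D D \<le> IP (\<lambda>x. g (W x)) D - IP (\<lambda>x. g (W' x)) D"
  proof -
    have "IP (\<lambda>x. - Cg * D x) D \<le> IP (\<lambda>x. g (W x) - g (W' x)) D"
    proof (rule IP_mono[OF LL_scale[OF DL] DL LL_diff[OF L(3,4)] DL])
      fix x
      have "0 \<le> ((g (W x) + Cg * W x) - (g (W' x) + Cg * W' x)) * (W x - W' x)"
        using monoD[OF mono, of "W x" "W' x"] monoD[OF mono, of "W' x" "W x"]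
        by (cases "W x \<le> W' x") (auto intro: mult_nonneg_nonneg mult_nonpos_nonpos)
      then show "- Cg * D x * D x \<le> (g (W x) - g (W' x)) * D x" by (simp add: D_def algebra_simps)
    qed
    then show ?thesis using L DL by (simp add: IP_scale_left IP_minus_left IP_diff_left)
  qed
  then have "(1 / \<tau> - Cg) * IP D D \<le> 0" using le by (simp add: left_diff_distrib)
  then have "IP D D = 0" using tau IP_self_nonneg[of D] by (smt (verit) mult_pos_pos)
  from IP_self_0[OF DL this] show ?case using L(1) unfolding D_def W_def W'_def by simp
qed

section \<open>The adjoint equation where the flux exceeds the threshold\<close>

text \<open>With a threshold \<open>c > 1\<close> in place of \<open>1\<close> the product is an admissible test function of the local equation; let
  \<open>c \<rightarrow> 1\<close> by dominated convergence. The derivative of the product involves \<open>\<sigma>'\<close>, which is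
  square-integrable only, and this suffices because \<open>\<phi>\<close> is bounded.\<close>

lemma multiplier_identity:
  assumes nu: "0 < \<nu>" and s: "AC \<sigma> \<sigma>'" "\<sigma> a = 0" "\<sigma> b = 0"
    and G: "\<And>r. (\<gamma> has_real_derivative \<gamma>' r) (at r)" "continuous_on UNIV \<gamma>'" "\<gamma> 0 = 0" "\<gamma>' 0 = 0"
    and bd: "\<And>r. \<bar>\<gamma> r\<bar> \<le> C" "\<And>r. \<bar>\<gamma>' r\<bar> \<le> C"
    and phi: "AC \<phi> \<phi>'" and Q: "Q \<in> LL" and q: "q \<in> LL"
    and loc: "\<And>\<alpha> \<alpha>' d. AC \<alpha> \<alpha>' \<Longrightarrow> 0 < d \<Longrightarrow> \<forall>x\<in>{a..b}. \<bar>\<sigma> x\<bar> \<le> 1 + d \<longrightarrow> \<alpha> x = 0 \<and> \<alpha>' x = 0 \<Longrightarrow> IP Q \<alpha>' = - IP q \<alpha>"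
  shows "\<exists>\<alpha>'. AC (\<lambda>x. \<gamma> (soft \<nu> (\<sigma> x)) * \<phi> x) \<alpha>' \<and> IP Q \<alpha>' = - IP q (\<lambda>x. \<gamma> (soft \<nu> (\<sigma> x)) * \<phi> x)"
proof -
  have Gc: "continuous_on UNIV \<gamma>" using G(1) by (meson DERIV_isCont continuous_at_imp_continuous_on)
  define al where "al c x = \<gamma> (softc \<nu> c (\<sigma> x)) * \<phi> x" for c x
  define al' where "al' c x = \<gamma> (softc \<nu> c (\<sigma> x)) * \<phi>' x + (\<gamma>' (softc \<nu> c (\<sigma> x)) / \<nu>\<^sup>2 * \<sigma>' x) * \<phi> x" for c x
  have A: "AC (al c) (al' c)" if c: "0 \<le> c" for c
  proof -
    have "continuous_on UNIV (\<lambda>r. \<gamma>' (softc \<nu> c r) / \<nu>\<^sup>2)"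
      using continuous_on_compose2[OF G(2) softc_cont[OF nu]] nu by (intro continuous_on_divide continuous_on_const) auto
    from AC_mult[OF AC_chain[OF s(1) flat_comp_soft_deriv[OF nu c G(1,3,4)] this] phi]
    show ?thesis unfolding al_def al'_def .
  qed
  define c where "c k = 1 + 1 / real (Suc k)" for k
  have c1: "0 \<le> c k" "0 < 1 / real (Suc k)" for k by (auto simp: c_def)
  have cl: "c \<longlonglongrightarrow> 1" unfolding c_def using tendsto_add[OF tendsto_const LIMSEQ_inverse_real_of_nat, of 1] by (simp add: inverse_eq_divide)
  have sl: "(\<lambda>k. softc \<nu> (c k) r) \<longlonglongrightarrow> softc \<nu> 1 r" for r
    unfolding softc_def using nu by (intro tendsto_divide tendsto_diff tendsto_max tendsto_const cl) auto
  have gl: "(\<lambda>k. \<gamma> (softc \<nu> (c k) r)) \<longlonglongrightarrow> \<gamma> (softc \<nu> 1 r)" "(\<lambda>k. \<gamma>' (softc \<nu> (c k) r)) \<longlonglongrightarrow> \<gamma>' (softc \<nu> 1 r)" for r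
    using isCont_tendsto_compose[of "softc \<nu> 1 r" \<gamma>, OF _ sl] isCont_tendsto_compose[of "softc \<nu> 1 r" \<gamma>', OF _ sl] Gc G(2) by (auto simp: continuous_on_eq_continuous_at)
  have C0: "0 \<le> C" using bd(1)[of 0] by linarith
  have pc: "continuous_on {a..b} \<phi>" using phi by (rule AC_cont)
  have pL: "\<phi> \<in> LL" "\<phi>' \<in> LL" "\<sigma>' \<in> LL" using phi s AC_fLL AC_LL by auto
  have spL: "(\<lambda>x. \<phi> x * \<sigma>' x) \<in> LL" by (rule LL_cont_mult[OF pc pL(3)])
  have eqk: "IP Q (al' (c k)) = - IP q (al (c k))" for k
  proof (rule loc[OF A[OF c1(1)] c1(2)])
    show "\<forall>x\<in>{a..b}. \<bar>\<sigma> x\<bar> \<le> 1 + 1 / real (Suc k) \<longrightarrow> al (c k) x = 0 \<and> al' (c k) x = 0"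
      using softc_inside[OF c1(1), of _ k \<nu>] G(3,4) by (auto simp: al_def al'_def c_def)
  qed
  have l1: "(\<lambda>k. IP (al (c k)) q) \<longlonglongrightarrow> IP (al 1) q"
  proof (rule IP_tendsto_dominated[OF AC_fLL[OF A[OF c1(1)]] LL_meas[OF AC_fLL[OF A]] q])
    show "(\<lambda>x. C * \<bar>\<phi> x\<bar>) \<in> LL" using pL by auto
    show "(\<lambda>k. al (c k) x) \<longlonglongrightarrow> al 1 x" for x unfolding al_def by (intro tendsto_mult tendsto_const gl)
    show "\<bar>al (c k) x\<bar> \<le> C * \<bar>\<phi> x\<bar>" for k x unfolding al_def abs_mult by (intro mult_right_mono bd) auto
  qed auto
  have l2: "(\<lambda>k. IP (al' (c k)) Q) \<longlonglongrightarrow> IP (al' 1) Q"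
  proof (rule IP_tendsto_dominated[OF AC_LL[OF A[OF c1(1)]] LL_meas[OF AC_LL[OF A]] Q])
    show "(\<lambda>x. C * \<bar>\<phi>' x\<bar> + (C / \<nu>\<^sup>2) * \<bar>\<phi> x * \<sigma>' x\<bar>) \<in> LL" using pL spL by (intro LL_add LL_scale LL_abs) auto
    show "(\<lambda>k. al' (c k) x) \<longlonglongrightarrow> al' 1 x" for x
      unfolding al'_def using nu by (intro tendsto_add tendsto_mult tendsto_divide tendsto_const gl) auto
    show "\<bar>al' (c k) x\<bar> \<le> C * \<bar>\<phi>' x\<bar> + (C / \<nu>\<^sup>2) * \<bar>\<phi> x * \<sigma>' x\<bar>" for k x
    proof -
      have "\<bar>\<gamma> (softc \<nu> (c k) (\<sigma> x)) * \<phi>' x\<bar> \<le> C * \<bar>\<phi>' x\<bar>" unfolding abs_mult by (intro mult_right_mono bd) auto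
      moreover have "\<bar>\<gamma>' (softc \<nu> (c k) (\<sigma> x))\<bar> / \<nu>\<^sup>2 * \<bar>\<phi> x * \<sigma>' x\<bar> \<le> C / \<nu>\<^sup>2 * \<bar>\<phi> x * \<sigma>' x\<bar>"
        by (intro mult_right_mono divide_right_mono bd) auto
      then have "\<bar>\<gamma>' (softc \<nu> (c k) (\<sigma> x)) / \<nu>\<^sup>2 * \<sigma>' x * \<phi> x\<bar> \<le> C / \<nu>\<^sup>2 * \<bar>\<phi> x * \<sigma>' x\<bar>" by (simp add: abs_mult mult_ac)
      ultimately show ?thesis unfolding al'_def by linarith
    qed
  qed auto
  have "(\<lambda>k. IP (al' (c k)) Q) \<longlonglongrightarrow> - IP (al 1) q"
    using tendsto_minus[OF l1] eqk by (simp add: IP_commute[of _ Q] IP_commute[of _ q])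
  from LIMSEQ_unique[OF l2 this] have "IP Q (al' 1) = - IP q (al 1)" by (simp add: IP_commute)
  moreover have "al 1 = (\<lambda>x. \<gamma> (soft \<nu> (\<sigma> x)) * \<phi> x)" unfolding al_def soft_softc by blast
  ultimately show ?thesis using A[of 1] by auto
qed

lemma LINT_subset:
  assumes U: "U \<subseteq> {a<..<b}" "U \<in> sets lebesgue" and z: "\<And>x. x \<in> {a<..<b} - U \<Longrightarrow> f x = (0::real)"
  shows "integral\<^sup>L (lebesgue_on U) f = integral\<^sup>L M f"
proof -
  have "indicator U x *\<^sub>R f x = indicator {a<..<b} x *\<^sub>R f x" for x using U(1) z by (cases "x \<in> {a<..<b}") (auto simp: indicator_def)
  then have "(LINT x|lebesgue. indicator U x *\<^sub>R f x) = (LINT x|lebesgue. indicator {a<..<b} x *\<^sub>R f x)" by presburger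
  then show ?thesis using U(2) by (simp add: integral_restrict_space)
qed

lemma LL_subset: assumes f: "f \<in> LL" and U: "U \<subseteq> {a<..<b}" "U \<in> sets lebesgue" shows "f \<in> L2 U"
proof -
  have "f \<in> borel_measurable (lebesgue_on U)"
    using measurable_restrict_mono[OF LL_meas[OF f] U(1)] .
  moreover have "set_integrable lebesgue {a<..<b} (\<lambda>x. (f x)\<^sup>2)"
    using f by (simp add: L2_def set_integrable_def integrable_restrict_space)
  then have "set_integrable lebesgue U (\<lambda>x. (f x)\<^sup>2)" by (rule set_integrable_subset) (use U in auto)
  then have "integrable (lebesgue_on U) (\<lambda>x. (f x)\<^sup>2)" using U(2) by (simp add: set_integrable_def integrable_restrict_space)
  ultimately show ?thesis by (simp add: L2_def)
qed

lemma cont_rep_eq: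
  assumes c: "continuous_on {a..b} h" and ae: "AE x in M. h x = f x" and x: "x \<in> {a..b}"
  shows "cont_rep {a<..<b} f x = h x"
proof -
  have cl: "closure {a<..<b} = {a..b}" using ab by simp
  have "continuous_on (closure {a<..<b}) h \<and> (AE x in M. h x = f x)" using c ae cl by simp
  from someI[of "\<lambda>h. continuous_on (closure {a<..<b}) h \<and> (AE x in M. h x = f x)", OF this]
  have "continuous_on (closure {a<..<b}) (cont_rep {a<..<b} f) \<and> (AE x in M. cont_rep {a<..<b} f x = f x)"
    unfolding cont_rep_def .
  then have r: "continuous_on {a..b} (cont_rep {a<..<b} f)" "AE x in M. cont_rep {a<..<b} f x = f x" using cl by auto
  have "AE x in M. cont_rep {a<..<b} f x = h x" using r(2) ae by eventually_elim simp
  then show ?thesis by (rule cont_AE_eq[OF r(1) c _ x])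
qed

text \<open>The support of a test function of \<open>U\<close> is compact, so \<open>\<bar>\<sigma>\<bar> - 1\<close> has a positive minimum on it.\<close>

lemma local_weak_deriv:
  fixes \<sigma> :: "real \<Rightarrow> real"
  assumes sc: "continuous_on {a..b} \<sigma>" and Q: "Q \<in> LL" and q: "q \<in> LL"
    and U: "U = {x \<in> {a<..<b}. 1 < \<bar>\<sigma> x\<bar>}" and p': "AE x in M. p' x = Q x"
    and loc: "\<And>\<alpha> \<alpha>' d. AC \<alpha> \<alpha>' \<Longrightarrow> 0 < d \<Longrightarrow> \<forall>x\<in>{a..b}. \<bar>\<sigma> x\<bar> \<le> 1 + d \<longrightarrow> \<alpha> x = 0 \<and> \<alpha>' x = 0 \<Longrightarrow> IP Q \<alpha>' = - IP q \<alpha>"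
  shows "open U" "q \<in> L2_loc U" "weak_deriv U p' q"
proof -
  show oU: "open U"
  proof -
    have "open ({a<..<b} \<inter> (\<lambda>x. \<bar>\<sigma> x\<bar>) -` {1<..})"
      by (intro continuous_open_preimage continuous_on_rabs continuous_on_subset[OF sc] open_greaterThan) auto
    moreover have "{a<..<b} \<inter> (\<lambda>x. \<bar>\<sigma> x\<bar>) -` {1<..} = U" by (auto simp: U)
    ultimately show ?thesis by simp
  qed
  have UL: "U \<subseteq> {a<..<b}" "U \<in> sets lebesgue" using oU by (auto simp: U)
  show "q \<in> L2_loc U" unfolding L2_loc_def
  proof (intro CollectI allI impI)
    fix K assume "compact K" "K \<subseteq> U"
    then show "q \<in> L2 K" using UL by (intro LL_subset[OF q]) (auto simp: compact_imp_closed)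
  qed
  show "weak_deriv U p' q" unfolding weak_deriv_def
  proof
    fix \<phi> assume \<phi>: "\<phi> \<in> test_functions U"
    define S where "S = closure {x. \<phi> x \<noteq> 0}"
    have S: "compact S" "S \<subseteq> U" using \<phi> by (auto simp: test_functions_def S_def)
    have "\<phi> \<in> test_functions {a<..<b}" using \<phi> UL(1) by (auto simp: test_functions_def)
    note t = test_function_AC[OF this]
    have z: "\<phi> x = 0" if "x \<notin> S" for x using that closure_subset[of "{x. \<phi> x \<noteq> 0}"] by (auto simp: S_def)
    have dz: "deriv \<phi> x = 0" if "x \<notin> S" for x
    proof (rule DERIV_imp_deriv)
      have "((\<lambda>x. 0::real) has_real_derivative 0) (at x)" by simp
      then show "(\<phi> has_real_derivative 0) (at x)"
        by (rule has_field_derivative_transform_within_open[of _ _ _ "- S"]) (use that z S(1) compact_imp_closed in auto)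
    qed
    obtain d where d: "0 < d" "\<And>x. x \<in> S \<Longrightarrow> 1 + d < \<bar>\<sigma> x\<bar>"
    proof (cases "S = {}")
      case True
      then show ?thesis using that[of 1] by simp
    next
      case False
      have "continuous_on S (\<lambda>x. \<bar>\<sigma> x\<bar>)" using S(2) UL(1)
        by (intro continuous_on_rabs continuous_on_subset[OF sc]) auto
      then obtain x0 where x0: "x0 \<in> S" "\<And>x. x \<in> S \<Longrightarrow> \<bar>\<sigma> x0\<bar> \<le> \<bar>\<sigma> x\<bar>"
        using continuous_attains_inf[OF S(1) False] by blast
      have "1 < \<bar>\<sigma> x0\<bar>" using x0(1) S(2) by (auto simp: U)
      then show ?thesis using x0(2) by (intro that[of "(\<bar>\<sigma> x0\<bar> - 1) / 2"]) (force simp: field_simps)+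
    qed
    have "\<forall>x\<in>{a..b}. \<bar>\<sigma> x\<bar> \<le> 1 + d \<longrightarrow> \<phi> x = 0 \<and> deriv \<phi> x = 0" using d(2) z dz by force
    from loc[OF t(1) d(1) this] have "IP Q (deriv \<phi>) = - IP q \<phi>" .
    moreover have "IP p' (deriv \<phi>) = IP Q (deriv \<phi>)" using AC_LL[OF t(1)] by (intro IP_cong_AE Q p') auto
    moreover have "(LINT x|lebesgue_on U. p' x * deriv \<phi> x) = IP p' (deriv \<phi>)"
      unfolding ip_L2_def using dz S(2) by (intro LINT_subset UL) auto
    moreover have "(LINT x|lebesgue_on U. q x * \<phi> x) = IP q \<phi>"
      unfolding ip_L2_def using z S(2) by (intro LINT_subset UL) auto
    ultimately show "(LINT x|lebesgue_on U. p' x * deriv \<phi> x) = - (LINT x|lebesgue_on U. q x * \<phi> x)" by simp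
  qed
qed

end

context tv_evolution begin

section \<open>Necessary optimality conditions\<close>

text \<open>Integrating the flux equation against \<open>w - z\<close> leaves the pairing of the flux with \<open>z' - w'\<close>, bounded by the
  difference of energies, and the pairing of the reaction with \<open>z - w\<close>, which is nonpositive.
  The initial value \<open>w0'\<close> may differ from its continuous representative \<open>w0\<close> on a null set.\<close>

lemma feasible_state_solution:
  assumes f: "feasible (\<lambda>i x. Mu * u i x) \<xi> w \<sigma>" and u: "\<forall>i\<in>{1..n}. u i \<in> LL"
    and g: "continuous_on UNIV g" and hg: "\<And>r. \<bar>r\<bar> \<le> 1 \<Longrightarrow> h r = r / \<tau> + g r"
    and w0': "AE x in M. w0' x = w0 x"
  shows "state_solution {a<..<b} n \<tau> \<nu> Mu g w0' u (\<lambda>i. if i = 0 then w0' else w i)"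
  unfolding state_solution_def
proof (intro conjI ballI)
  have sy: "flux_system (soft \<nu>) (\<lambda>i x. Mu * u i x) \<xi> w \<sigma>" using f by (simp add: feasible_def)
  fix i assume i: "i \<in> {1..n}"
  note s = flux_systemD[OF sy i]
  have w1: "\<And>x. x \<in> {a..b} \<Longrightarrow> \<bar>w i x\<bar> \<le> 1" using f i unfolding feasible_def by blast
  have wi: "(if i = 0 then w0' else w i) = w i" using i by simp
  have wL: "w i \<in> LL" using s(3) by (rule AC_fLL)
  have dom: "w i \<in> dom_Psi {a<..<b} \<nu>" unfolding dom_Psi_iff using AC_weak_deriv(1)[OF s(3), of "w i"] w1 by auto
  then show "(if i = 0 then w0' else w i) \<in> dom_Psi {a<..<b} \<nu>" using wi by simp
  have prev: "AE x in M. (if i - 1 = 0 then w0' else w (i - 1)) x = w (i - 1) x"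
    using w0' flux_system_w0[OF sy] by (cases "i - 1 = 0") auto
  have pL: "w (i - 1) \<in> LL" using flux_system_w_cont[OF sy, of "i - 1"] i by (intro LL_cont) auto
  have p'L: "(if i - 1 = 0 then w0' else w (i - 1)) \<in> LL" by (rule LL_AE'[OF pL prev])
  fix z assume z: "z \<in> dom_Psi {a<..<b} \<nu>"
  then have zh: "z \<in> H1 {a<..<b}" and z1: "AE x in M. \<bar>z x\<bar> \<le> 1" using dom_Psi_iff by auto
  have zL: "z \<in> LL" using zh by (rule H1_LL)
  obtain Z where Z: "AC Z (dx {a<..<b} z)" "AE x in M. z x = Z x" using H1_AC[OF zh] .
  define D where "D x = h (w i x) + \<xi> i x - w (i - 1) x / \<tau> - Mu * u i x" for x
  have DL: "D \<in> LL" using AC_LL[OF s(4)] unfolding D_def .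
  have gL: "(\<lambda>x. g (w i x)) \<in> LL" by (rule LL_cont[OF cont_comp[OF g AC_cont[OF s(3)]]])
  have dL: "(\<lambda>x. w i x - z x) \<in> LL" using wL zL by auto
  define y where "y = (if i - 1 = 0 then w0' else w (i - 1))"
  have yL: "y \<in> LL" and ya: "AE x in M. y x = w (i - 1) x" using p'L prev unfolding y_def by auto
  have "1 / \<tau> * IP (\<lambda>x. w i x - y x) (\<lambda>x. w i x - z x) + IP (\<lambda>x. g (w i x) - Mu * u i x) (\<lambda>x. w i x - z x)
     = IP (\<lambda>x. (1 / \<tau>) * (w i x - y x) + (g (w i x) - Mu * u i x)) (\<lambda>x. w i x - z x)"
    using IP_add_left[OF LL_scale[OF LL_diff[OF wL yL], of "1 / \<tau>"] LL_diff[OF gL s(1)] dL] by (simp only: IP_scale_left)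
  also have "\<dots> = IP (\<lambda>x. D x - \<xi> i x) (\<lambda>x. w i x - z x)"
  proof (rule IP_cong_AE[OF LL_diff[OF DL s(2)] dL])
    have "AE x in M. x \<in> {a<..<b}" by (rule AE_I2) simp
    then show "AE x in M. 1 / \<tau> * (w i x - y x) + (g (w i x) - Mu * u i x) = D x - \<xi> i x"
      using ya
    proof eventually_elim
      case (elim x)
      then have "h (w i x) = w i x / \<tau> + g (w i x)" by (intro hg w1) auto
      then show ?case using elim by (simp add: D_def diff_divide_distrib)
    qed
  qed simp
  also have "\<dots> = IP D (\<lambda>x. w i x - z x) - IP (\<xi> i) (\<lambda>x. w i x - z x)" by (rule IP_diff_left[OF DL s(2) dL])
  also have "IP D (\<lambda>x. w i x - z x) = IP D (\<lambda>x. w i x - Z x)"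
    by (rule IP_cong_AE[OF DL LL_diff[OF wL AC_fLL[OF Z(1)]]]) (use Z(2) in \<open>auto elim: eventually_mono\<close>)
  also have "IP D (\<lambda>x. w i x - Z x) = - IP (\<sigma> i) (\<lambda>x. soft \<nu> (\<sigma> i x) - dx {a<..<b} z x)"
    using AC_by_parts[OF s(4) AC_diff[OF s(3) Z(1)]] s(5,6) unfolding D_def by simp
  also have "\<dots> = IP (\<sigma> i) (\<lambda>x. dx {a<..<b} z x - soft \<nu> (\<sigma> i x))" by (simp flip: IP_minus_right)
  finally have eq: "1 / \<tau> * IP (\<lambda>x. w i x - y x) (\<lambda>x. w i x - z x) + IP (\<lambda>x. g (w i x) - Mu * u i x) (\<lambda>x. w i x - z x)
     = IP (\<sigma> i) (\<lambda>x. dx {a<..<b} z x - soft \<nu> (\<sigma> i x)) + IP (\<xi> i) (\<lambda>x. z x - w i x)"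
    by (simp flip: IP_minus_right)
  have "IP (\<xi> i) (\<lambda>x. z x - w i x) \<le> 0" using f i zL z1 unfolding feasible_def by blast
  moreover have "IP (\<sigma> i) (\<lambda>x. dx {a<..<b} z x - soft \<nu> (\<sigma> i x)) \<le> energy \<nu> (dx {a<..<b} z) - energy \<nu> (\<lambda>x. soft \<nu> (\<sigma> i x))"
    by (rule IP_energy_subgradient[OF nu_pos AC_fLL[OF s(4)] AC_LL[OF Z(1)] AC_LL[OF s(3)]])
  moreover have "energy \<nu> (dx {a<..<b} (w i)) = energy \<nu> (\<lambda>x. soft \<nu> (\<sigma> i x))"
    by (rule energy_cong[OF AC_LL[OF s(3)] dx_AC[OF s(3)]]) simp
  ultimately show "1 / \<tau> * IP (\<lambda>x. (if i = 0 then w0' else w i) x - (if i - 1 = 0 then w0' else w (i - 1)) x) (\<lambda>x. (if i = 0 then w0' else w i) x - z x) +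
      IP (\<lambda>x. g ((if i = 0 then w0' else w i) x) - Mu * u i x) (\<lambda>x. (if i = 0 then w0' else w i) x - z x) +
      enn2real (Psi {a<..<b} \<nu> (if i = 0 then w0' else w i)) - enn2real (Psi {a<..<b} \<nu> z) \<le> 0"
    unfolding wi y_def[symmetric] Psi_energy[OF dom] Psi_energy[OF z] using eq by linarith
qed simp

text \<open>The state chosen in the definition of the cost agrees with \<open>w\<close> almost everywhere by uniqueness.\<close>

lemma cost_eq:
  assumes f: "feasible (\<lambda>i x. Mu * u i x) \<xi> w \<sigma>" and u: "\<forall>i\<in>{1..n}. u i \<in> LL"
    and g: "continuous_on UNIV g" and hg: "\<And>r. \<bar>r\<bar> \<le> 1 \<Longrightarrow> h r = r / \<tau> + g r"
    and w0': "AE x in M. w0' x = w0 x" and z: "\<forall>i\<in>{1..n}. z i \<in> LL"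
    and mono: "mono (\<lambda>r. g r + Cg * r)" and tau: "Cg < 1 / \<tau>"
  shows "cost {a<..<b} n \<tau> \<nu> Mu Mw g z w0' u
     = Mw / 2 * (\<Sum>i=1..n. IP (\<lambda>x. w i x - z i x) (\<lambda>x. w i x - z i x)) + Mu / 2 * (\<Sum>i=1..n. IP (u i) (u i))"
proof -
  define W where "W = (\<lambda>i. if i = 0 then w0' else w i)"
  have s: "state_solution {a<..<b} n \<tau> \<nu> Mu g w0' u W" unfolding W_def by (rule feasible_state_solution[OF f u g hg w0'])
  define V where "V = (SOME w. state_solution {a<..<b} n \<tau> \<nu> Mu g w0' u w)"
  have V: "state_solution {a<..<b} n \<tau> \<nu> Mu g w0' u V"
    unfolding V_def by (rule someI[of "state_solution {a<..<b} n \<tau> \<nu> Mu g w0' u", OF s])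
  have w0L: "w0' \<in> LL" by (rule LL_AE'[OF LL_cont[OF w0_cont] w0'])
  have "IP (\<lambda>x. V i x - z i x) (\<lambda>x. V i x - z i x) = IP (\<lambda>x. w i x - z i x) (\<lambda>x. w i x - z i x)" if i: "i \<in> {1..n}" for i
  proof -
    have Wi: "W i \<in> LL \<and> (AE x in M. W i x = V i x)"
      by (rule state_solution_unique[OF g mono tau w0L u s V]) (use i in auto)
    have WL: "(\<lambda>x. W i x - z i x) \<in> LL" using Wi z i by auto
    have ae: "AE x in M. V i x - z i x = W i x - z i x" using Wi by (auto elim: eventually_mono)
    have "IP (\<lambda>x. V i x - z i x) (\<lambda>x. V i x - z i x) = IP (\<lambda>x. W i x - z i x) (\<lambda>x. W i x - z i x)"
      by (rule IP_cong_AE[OF WL WL ae ae])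
    then show ?thesis using i by (simp add: W_def)
  qed
  then show ?thesis unfolding cost_def V_def[symmetric] Let_def by simp
qed

text \<open>The control is \<open>u = - P\<close>. The function \<open>q\<close> is what the equation predicts for the second derivative of \<open>P\<close> where
  \<open>w' \<noteq> 0\<close>; elsewhere it is a mere definition, and the factor \<open>\<gamma>\<^sub>0(w')\<close> vanishes. The functional \<open>\<zeta>\<close> is
  the residual of the adjoint equation, which has a density against values and derivatives and so lies
  in the dual space.\<close>

lemma necessary_conditions:
  assumes Mu: "0 \<le> Mu" and Mw: "0 \<le> Mw" and z: "\<forall>i\<in>{1..n}. wad i \<in> LL"
    and g: "continuous_on UNIV g" and dg: "continuous_on UNIV (deriv g)"
    and hg: "\<And>r. \<bar>r\<bar> \<le> 1 \<Longrightarrow> h r = r / \<tau> + g r" and h'g: "\<And>r. \<bar>r\<bar> \<le> 1 \<Longrightarrow> h' r = 1 / \<tau> + deriv g r"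
    and w0': "AE x in M. w0' x = w0 x"
    and mono: "mono (\<lambda>r. g r + Cg * r)" and tau: "Cg < 1 / \<tau>" and Om: "\<Omega> = {a<..<b}"
  shows "\<exists>u w p :: nat \<Rightarrow> real \<Rightarrow> real. \<exists>\<zeta> :: nat \<Rightarrow> (real \<Rightarrow> real) \<Rightarrow> real.
    optimal_control \<Omega> n \<tau> \<nu> Mu Mw g wad w0' u \<and>
    state_solution \<Omega> n \<tau> \<nu> Mu g w0' u w \<and>
    (\<forall>i\<in>{1..n}. w i \<in> H2 \<Omega>) \<and>
    (\<forall>i\<in>{1..n}. AE x in lebesgue_on \<Omega>. Mu * (p i x + u i x) = 0) \<and>
    (\<forall>i\<in>{1..n}. p i \<in> H1 \<Omega> \<and> continuous_on (closure \<Omega>) (p i)) \<and>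
    (\<forall>i\<in>{1..n}. \<zeta> i \<in> H1_dual \<Omega>) \<and>
    p (n + 1) = (\<lambda>x. 0) \<and>
    (\<forall>i\<in>{1..n}. \<forall>\<phi>\<in>H1 \<Omega>.
       1 / \<tau> * ip_L2 \<Omega> (\<lambda>x. p i x - p (i + 1) x) \<phi>
       + \<nu>\<^sup>2 * duality_map \<Omega> (p i) \<phi> - \<nu>\<^sup>2 * ip_L2 \<Omega> (p i) \<phi>
       + ip_L2 \<Omega> (\<lambda>x. deriv g (w i x) * p i x) \<phi> + \<zeta> i \<phi>
       = ip_L2 \<Omega> (\<lambda>x. Mw * (w i x - wad i x)) \<phi>) \<and>
    (\<forall>\<gamma>0. Ck 1 \<gamma>0 \<and> bounded (range \<gamma>0) \<and> bounded (range (deriv \<gamma>0)) \<and>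
          \<gamma>0 0 = 0 \<and> deriv \<gamma>0 0 = 0 \<longrightarrow>
       (\<forall>i\<in>{1..n}.
          H1_multiplier \<Omega> (\<lambda>x. \<gamma>0 (dx \<Omega> (w i) x)) \<and>
          (\<exists>h. represented_by \<Omega> (times_dxx \<Omega> (\<lambda>x. \<gamma>0 (dx \<Omega> (w i) x)) (p i)) h \<and>
             (AE x in lebesgue_on \<Omega>.
                \<gamma>0 (dx \<Omega> (w i) x) *
                  (1 / \<tau> * (p i x - p (i + 1) x) + deriv g (w i x) * p i x - Mw * (w i x - wad i x))
                - \<nu>\<^sup>2 * h x = 0)))) \<and>
    (\<forall>i\<in>{1..n}.
       let U = {x \<in> \<Omega>. cont_rep \<Omega> (dx \<Omega> (w i)) x \<noteq> 0} in
       open U \<and>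
       (\<exists>q \<in> L2_loc U. weak_deriv U (dx \<Omega> (p i)) q \<and>
          (AE x in lebesgue_on U.
             1 / \<tau> * (p i x - p (i + 1) x) - \<nu>\<^sup>2 * q x + deriv g (w i x) * p i x
             = Mw * (w i x - wad i x))))"
proof -
  obtain P P' w \<sigma> \<xi> where f: "feasible (\<lambda>i x. - Mu * P i x) \<xi> w \<sigma>" and Pn: "P (Suc n) = (\<lambda>x. 0)"
    and PA: "\<And>i. i \<in> {1..n} \<Longrightarrow> AC (P i) (P' i)"
    and loc: "\<And>i \<alpha> \<alpha>' d. i \<in> {1..n} \<Longrightarrow> AC \<alpha> \<alpha>' \<Longrightarrow> 0 < d \<Longrightarrow>
       \<forall>x\<in>{a..b}. \<bar>\<sigma> i x\<bar> \<le> 1 + d \<longrightarrow> \<alpha> x = 0 \<and> \<alpha>' x = 0 \<Longrightarrow>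
       IP (P' i) \<alpha>' = - IP (\<lambda>x. (h' (w i x) * P i x - P (Suc i) x / \<tau> - Mw * (w i x - wad i x)) / \<nu>\<^sup>2) \<alpha>"
    and opt: "\<And>v. \<forall>i\<in>{1..n}. v i \<in> LL \<Longrightarrow> \<exists>\<xi>v wv \<sigma>v. feasible (\<lambda>i x. Mu * v i x) \<xi>v wv \<sigma>v \<and>
       Mw / 2 * (\<Sum>i=1..n. IP (\<lambda>x. w i x - wad i x) (\<lambda>x. w i x - wad i x)) + Mu / 2 * (\<Sum>i=1..n. IP (P i) (P i))
       \<le> Mw / 2 * (\<Sum>i=1..n. IP (\<lambda>x. wv i x - wad i x) (\<lambda>x. wv i x - wad i x)) + Mu / 2 * (\<Sum>i=1..n. IP (v i) (v i))"
    using optimality_limit[OF Mu Mw z] by blast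
  define u where "u i x = - P i x" for i x
  define W where "W = (\<lambda>i. if i = 0 then w0' else w i)"
  have f': "feasible (\<lambda>i x. Mu * u i x) \<xi> w \<sigma>" using f by (simp add: u_def)
  have PL: "P i \<in> LL" if "i \<in> {1..n}" for i using PA[OF that] by (rule AC_fLL)
  have PSL: "P (Suc i) \<in> LL" if "i \<in> {1..n}" for i
    using PL[of "Suc i"] Pn that by (cases "i = n") auto
  have uL: "\<forall>i\<in>{1..n}. u i \<in> LL" unfolding u_def using PL by auto
  have sy: "flux_system (soft \<nu>) (\<lambda>i x. Mu * u i x) \<xi> w \<sigma>" using f' by (simp add: feasible_def)
  note s = flux_systemD[OF sy]
  have Wi: "W i = w i" if "i \<in> {1..n}" for i using that by (simp add: W_def)
  have w1: "\<bar>w i x\<bar> \<le> 1" if "i \<in> {1..n}" "x \<in> {a..b}" for i x using f that unfolding feasible_def by blast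
  have dxw: "AE x in M. dx {a<..<b} (w i) x = soft \<nu> (\<sigma> i x)" if "i \<in> {1..n}" for i
    by (rule dx_AC[OF s(3)[OF that]]) simp
  have dxP: "AE x in M. dx {a<..<b} (P i) x = P' i x" if "i \<in> {1..n}" for i
    by (rule dx_AC[OF PA[OF that]]) simp
  have PH: "P i \<in> H1 {a<..<b}" if "i \<in> {1..n}" for i by (rule AC_weak_deriv(1)[OF PA[OF that]]) simp
  have cw: "continuous_on {a..b} (w i)" if "i \<in> {1..n}" for i using AC_cont[OF s(3)[OF that]] .
  have wzL: "(\<lambda>x. Mw * (w i x - wad i x)) \<in> LL" if "i \<in> {1..n}" for i
    using LL_cont[OF cw[OF that]] z that by auto
  have dgP: "(\<lambda>x. deriv g (w i x) * P i x) \<in> LL" if "i \<in> {1..n}" for i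
    by (rule LL_cont_mult[OF cont_comp[OF dg cw[OF that]] PL[OF that]])
  define q where "q i x = (1 / \<tau> * (P i x - P (i + 1) x) + deriv g (w i x) * P i x - Mw * (w i x - wad i x)) / \<nu>\<^sup>2" for i x
  have qL: "q i \<in> LL" if "i \<in> {1..n}" for i
    unfolding q_def using PL[OF that] PSL[OF that] dgP[OF that] wzL[OF that]
    by (intro LL_divide LL_diff[OF _ wzL[OF that]] LL_add LL_scale LL_diff) auto
  have loc': "IP (P' i) \<alpha>' = - IP (q i) \<alpha>"
    if i: "i \<in> {1..n}" and A: "AC \<alpha> \<alpha>'" "0 < d" "\<forall>x\<in>{a..b}. \<bar>\<sigma> i x\<bar> \<le> 1 + d \<longrightarrow> \<alpha> x = 0 \<and> \<alpha>' x = 0" for i \<alpha> \<alpha>' d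
  proof -
    have "IP (\<lambda>x. (h' (w i x) * P i x - P (Suc i) x / \<tau> - Mw * (w i x - wad i x)) / \<nu>\<^sup>2) \<alpha> = IP (q i) \<alpha>"
    proof (rule IP_cong)
      fix x assume "x \<in> {a<..<b}"
      then have "h' (w i x) = 1 / \<tau> + deriv g (w i x)" by (intro h'g w1 i) auto
      then show "(h' (w i x) * P i x - P (Suc i) x / \<tau> - Mw * (w i x - wad i x)) / \<nu>\<^sup>2 * \<alpha> x = q i x * \<alpha> x"
        by (simp add: q_def algebra_simps diff_divide_distrib add_divide_distrib)
    qed
    then show ?thesis using loc[OF i A] by simp
  qed
  have sc: "continuous_on {a..b} (\<sigma> i)" if "i \<in> {1..n}" for i using AC_cont[OF s(4)[OF that]] .
  have cs: "continuous_on {a..b} (\<lambda>x. soft \<nu> (\<sigma> i x))" if "i \<in> {1..n}" for i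
    by (rule cont_comp[OF soft_cont sc[OF that]])
  define \<zeta> where "\<zeta> i \<phi> = IP (\<lambda>x. Mw * (w i x - wad i x) - 1 / \<tau> * (P i x - P (i + 1) x) - deriv g (w i x) * P i x) \<phi>
     + IP (\<lambda>x. - \<nu>\<^sup>2 * dx {a<..<b} (P i) x) (dx {a<..<b} \<phi>)" for i \<phi>
  have resL: "(\<lambda>x. Mw * (w i x - wad i x) - 1 / \<tau> * (P i x - P (i + 1) x)) \<in> LL" if "i \<in> {1..n}" for i
    using PL[OF that] PSL[OF that] by (intro LL_diff[OF wzL[OF that]] LL_scale LL_diff) auto
  have "optimal_control {a<..<b} n \<tau> \<nu> Mu Mw g wad w0' u"
    unfolding optimal_control_def
  proof (intro conjI uL allI impI)
    fix v assume v: "\<forall>i\<in>{1..n}. v i \<in> LL"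
    obtain \<xi>v wv \<sigma>v where fv: "feasible (\<lambda>i x. Mu * v i x) \<xi>v wv \<sigma>v" and le:
       "Mw / 2 * (\<Sum>i=1..n. IP (\<lambda>x. w i x - wad i x) (\<lambda>x. w i x - wad i x)) + Mu / 2 * (\<Sum>i=1..n. IP (P i) (P i))
       \<le> Mw / 2 * (\<Sum>i=1..n. IP (\<lambda>x. wv i x - wad i x) (\<lambda>x. wv i x - wad i x)) + Mu / 2 * (\<Sum>i=1..n. IP (v i) (v i))"
      using opt[OF v] by blast
    have "IP (u i) (u i) = IP (P i) (P i)" for i unfolding u_def[abs_def] by (simp add: IP_minus_left IP_minus_right)
    moreover have "cost {a<..<b} n \<tau> \<nu> Mu Mw g wad w0' u
       = Mw / 2 * (\<Sum>i=1..n. IP (\<lambda>x. w i x - wad i x) (\<lambda>x. w i x - wad i x)) + Mu / 2 * (\<Sum>i=1..n. IP (u i) (u i))"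
      by (rule cost_eq[OF f' uL g hg w0' z mono tau])
    moreover have "cost {a<..<b} n \<tau> \<nu> Mu Mw g wad w0' v
       = Mw / 2 * (\<Sum>i=1..n. IP (\<lambda>x. wv i x - wad i x) (\<lambda>x. wv i x - wad i x)) + Mu / 2 * (\<Sum>i=1..n. IP (v i) (v i))"
      by (rule cost_eq[OF fv v g hg w0' z mono tau])
    ultimately show "cost {a<..<b} n \<tau> \<nu> Mu Mw g wad w0' u \<le> cost {a<..<b} n \<tau> \<nu> Mu Mw g wad w0' v"
      using le by simp
  qed
  moreover have "state_solution {a<..<b} n \<tau> \<nu> Mu g w0' u W" unfolding W_def by (rule feasible_state_solution[OF f' uL g hg w0'])
  moreover have "\<forall>i\<in>{1..n}. W i \<in> H2 {a<..<b}"
  proof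
    fix i assume i: "i \<in> {1..n}"
    obtain v' where "AC (\<lambda>x. soft \<nu> (\<sigma> i x)) v'" using soft_AC[OF s(4)[OF i]] by blast
    from AC_weak_deriv(1)[OF this dxw[OF i]] have "dx {a<..<b} (w i) \<in> H1 {a<..<b}" .
    moreover have "w i \<in> H1 {a<..<b}" by (rule AC_weak_deriv(1)[OF s(3)[OF i]]) simp
    ultimately show "W i \<in> H2 {a<..<b}" by (simp add: H2_def Wi[OF i])
  qed
  moreover have "\<forall>i\<in>{1..n}. AE x in M. Mu * (P i x + u i x) = 0" by (simp add: u_def)
  moreover have "\<forall>i\<in>{1..n}. P i \<in> H1 {a<..<b} \<and> continuous_on (closure {a<..<b}) (P i)"
    using PH AC_cont[OF PA] ab by simp
  moreover have "\<forall>i\<in>{1..n}. \<zeta> i \<in> H1_dual {a<..<b}"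
  proof
    fix i assume i: "i \<in> {1..n}"
    show "\<zeta> i \<in> H1_dual {a<..<b}" unfolding \<zeta>_def
      by (rule H1_dual_density[OF LL_diff[OF resL[OF i] dgP[OF i]] LL_scale[OF H1_dx(1)[OF PH[OF i]]]])
  qed
  moreover have "\<forall>i\<in>{1..n}. \<forall>\<phi>\<in>H1 {a<..<b}.
       1 / \<tau> * IP (\<lambda>x. P i x - P (i + 1) x) \<phi>
       + \<nu>\<^sup>2 * duality_map {a<..<b} (P i) \<phi> - \<nu>\<^sup>2 * IP (P i) \<phi>
       + IP (\<lambda>x. deriv g (W i x) * P i x) \<phi> + \<zeta> i \<phi>
       = IP (\<lambda>x. Mw * (W i x - wad i x)) \<phi>"
  proof (intro ballI)
    fix i \<phi> assume i: "i \<in> {1..n}" and phi: "\<phi> \<in> H1 {a<..<b}"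
    have fL: "\<phi> \<in> LL" using phi by (rule H1_LL)
    have dL: "(\<lambda>x. P i x - P (i + 1) x) \<in> LL" using PL[OF i] PSL[OF i] by auto
    show "1 / \<tau> * IP (\<lambda>x. P i x - P (i + 1) x) \<phi>
       + \<nu>\<^sup>2 * duality_map {a<..<b} (P i) \<phi> - \<nu>\<^sup>2 * IP (P i) \<phi>
       + IP (\<lambda>x. deriv g (W i x) * P i x) \<phi> + \<zeta> i \<phi>
       = IP (\<lambda>x. Mw * (W i x - wad i x)) \<phi>"
      unfolding Wi[OF i] \<zeta>_def duality_map_def ip_H1_def IP_diff_left[OF resL[OF i] dgP[OF i] fL]
        IP_diff_left[OF wzL[OF i] LL_scale[OF dL] fL] IP_scale_left
      by (simp add: algebra_simps)
  qed
  moreover have "\<forall>\<gamma>0. Ck 1 \<gamma>0 \<and> bounded (range \<gamma>0) \<and> bounded (range (deriv \<gamma>0)) \<and>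
          \<gamma>0 0 = 0 \<and> deriv \<gamma>0 0 = 0 \<longrightarrow>
       (\<forall>i\<in>{1..n}.
          H1_multiplier {a<..<b} (\<lambda>x. \<gamma>0 (dx {a<..<b} (W i) x)) \<and>
          (\<exists>h. represented_by {a<..<b} (times_dxx {a<..<b} (\<lambda>x. \<gamma>0 (dx {a<..<b} (W i) x)) (P i)) h \<and>
             (AE x in M.
                \<gamma>0 (dx {a<..<b} (W i) x) *
                  (1 / \<tau> * (P i x - P (i + 1) x) + deriv g (W i x) * P i x - Mw * (W i x - wad i x))
                - \<nu>\<^sup>2 * h x = 0)))"
  proof (intro allI impI ballI)
    fix \<gamma>0 i assume G: "Ck 1 \<gamma>0 \<and> bounded (range \<gamma>0) \<and> bounded (range (deriv \<gamma>0)) \<and> \<gamma>0 0 = 0 \<and> deriv \<gamma>0 0 = 0"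
      and i: "i \<in> {1..n}"
    have Gd: "(\<gamma>0 has_real_derivative deriv \<gamma>0 r) (at r)" for r
      using G by (auto simp: Ck_def DERIV_deriv_iff_real_differentiable)
    have Gc: "continuous_on UNIV (deriv \<gamma>0)" using G by (simp add: Ck_def)
    obtain C1 where C1: "\<And>r. \<bar>\<gamma>0 r\<bar> \<le> C1" using G by (auto simp: bounded_iff)
    obtain C2 where C2: "\<And>r. \<bar>deriv \<gamma>0 r\<bar> \<le> C2" using G by (auto simp: bounded_iff)
    have bd: "\<bar>\<gamma>0 r\<bar> \<le> max C1 C2" "\<bar>deriv \<gamma>0 r\<bar> \<le> max C1 C2" for r using C1[of r] C2[of r] by auto
    have g00: "\<gamma>0 0 = 0" "deriv \<gamma>0 0 = 0" using G by auto
    define A where "A x = \<gamma>0 (dx {a<..<b} (w i) x)" for x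
    have Aae: "AE x in M. A x = \<gamma>0 (soft \<nu> (\<sigma> i x))" unfolding A_def using dxw[OF i] by (rule eventually_mono) simp
    have prod: "\<exists>\<alpha>'. (\<lambda>x. A x * \<phi> x) \<in> H1 {a<..<b} \<and> (AE x in M. dx {a<..<b} (\<lambda>x. A x * \<phi> x) x = \<alpha>' x) \<and> \<alpha>' \<in> LL \<and>
        IP (P' i) \<alpha>' = - IP (\<lambda>x. A x * q i x) \<phi>" if phi: "\<phi> \<in> H1 {a<..<b}" for \<phi>
    proof -
      obtain F where F: "AC F (dx {a<..<b} \<phi>)" "AE x in M. \<phi> x = F x" using H1_AC[OF phi] .
      have "\<exists>\<alpha>'. AC (\<lambda>x. \<gamma>0 (soft \<nu> (\<sigma> i x)) * F x) \<alpha>' \<and> IP (P' i) \<alpha>' = - IP (q i) (\<lambda>x. \<gamma>0 (soft \<nu> (\<sigma> i x)) * F x)"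
        by (rule multiplier_identity[OF nu_pos s(4)[OF i] s(5)[OF i] s(6)[OF i] Gd Gc g00 bd F(1) AC_LL[OF PA[OF i]] qL[OF i]])
          (rule loc'[OF i]; assumption)
      then obtain \<alpha>' where al: "AC (\<lambda>x. \<gamma>0 (soft \<nu> (\<sigma> i x)) * F x) \<alpha>'" "IP (P' i) \<alpha>' = - IP (q i) (\<lambda>x. \<gamma>0 (soft \<nu> (\<sigma> i x)) * F x)"
        by (elim exE conjE)
      have ae: "AE x in M. A x * \<phi> x = \<gamma>0 (soft \<nu> (\<sigma> i x)) * F x" using Aae F(2) by eventually_elim simp
      have "IP (q i) (\<lambda>x. \<gamma>0 (soft \<nu> (\<sigma> i x)) * F x) = IP (q i) (\<lambda>x. A x * \<phi> x)"
        by (rule IP_cong_AE[symmetric, OF qL[OF i] AC_fLL[OF al(1)] _ ae]) simp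
      also have "\<dots> = IP (\<lambda>x. A x * q i x) \<phi>" by (rule IP_cong) simp
      finally show ?thesis using al AC_weak_deriv(1)[OF al(1) ae] dx_AC[OF al(1) ae] AC_LL[OF al(1)] by auto
    qed
    have "H1_multiplier {a<..<b} A" unfolding H1_multiplier_def using prod by blast
    moreover have "represented_by {a<..<b} (times_dxx {a<..<b} A (P i)) (\<lambda>x. A x * q i x)"
      unfolding represented_by_def times_dxx_def
    proof (intro conjI ballI)
      have Gs: "continuous_on {a..b} (\<lambda>x. \<gamma>0 (soft \<nu> (\<sigma> i x)))"
        by (rule cont_comp[OF has_deriv_cont[OF Gd] cs[OF i]])
      show "(\<lambda>x. A x * q i x) \<in> LL"
        by (rule LL_AE'[OF LL_cont_mult[OF Gs qL[OF i]]]) (use Aae in \<open>auto elim: eventually_mono\<close>)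
      fix \<phi> assume "\<phi> \<in> H1 {a<..<b}"
      then obtain \<alpha>' where al: "AE x in M. dx {a<..<b} (\<lambda>x. A x * \<phi> x) x = \<alpha>' x" "\<alpha>' \<in> LL" "IP (P' i) \<alpha>' = - IP (\<lambda>x. A x * q i x) \<phi>"
        using prod by blast
      have "IP (dx {a<..<b} (P i)) (dx {a<..<b} (\<lambda>x. A x * \<phi> x)) = IP (P' i) \<alpha>'"
        by (rule IP_cong_AE[OF AC_LL[OF PA[OF i]] al(2) dxP[OF i] al(1)])
      then show "- IP (dx {a<..<b} (P i)) (dx {a<..<b} (\<lambda>x. A x * \<phi> x)) = IP (\<lambda>x. A x * q i x) \<phi>" using al(3) by simp
    qed
    moreover have "A x * (1 / \<tau> * (P i x - P (i + 1) x) + deriv g (w i x) * P i x - Mw * (w i x - wad i x)) - \<nu>\<^sup>2 * (A x * q i x) = 0" for x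
      unfolding q_def using nu_pos by simp
    ultimately show "H1_multiplier {a<..<b} (\<lambda>x. \<gamma>0 (dx {a<..<b} (W i) x)) \<and>
          (\<exists>h. represented_by {a<..<b} (times_dxx {a<..<b} (\<lambda>x. \<gamma>0 (dx {a<..<b} (W i) x)) (P i)) h \<and>
             (AE x in M.
                \<gamma>0 (dx {a<..<b} (W i) x) *
                  (1 / \<tau> * (P i x - P (i + 1) x) + deriv g (W i x) * P i x - Mw * (W i x - wad i x))
                - \<nu>\<^sup>2 * h x = 0))"
      unfolding Wi[OF i] A_def[symmetric] by blast
  qed
  moreover have "\<forall>i\<in>{1..n}.
       let U = {x \<in> {a<..<b}. cont_rep {a<..<b} (dx {a<..<b} (W i)) x \<noteq> 0} in
       open U \<and>
       (\<exists>q \<in> L2_loc U. weak_deriv U (dx {a<..<b} (P i)) q \<and>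
          (AE x in lebesgue_on U.
             1 / \<tau> * (P i x - P (i + 1) x) - \<nu>\<^sup>2 * q x + deriv g (W i x) * P i x
             = Mw * (W i x - wad i x)))"
  proof
    fix i assume i: "i \<in> {1..n}"
    define U where "U = {x \<in> {a<..<b}. cont_rep {a<..<b} (dx {a<..<b} (w i)) x \<noteq> 0}"
    have "AE x in M. soft \<nu> (\<sigma> i x) = dx {a<..<b} (w i) x" using dxw[OF i] by (rule eventually_mono) simp
    from cont_rep_eq[OF cs[OF i] this]
    have U: "U = {x \<in> {a<..<b}. 1 < \<bar>\<sigma> i x\<bar>}" unfolding U_def using soft_zero_iff[OF nu_pos] by (force simp: not_le)
    have l: "open U" "q i \<in> L2_loc U" "weak_deriv U (dx {a<..<b} (P i)) (q i)"
      by (rule local_weak_deriv[OF sc[OF i] AC_LL[OF PA[OF i]] qL[OF i] U dxP[OF i]], rule loc'[OF i]; assumption)+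
    have e: "AE x in lebesgue_on U. 1 / \<tau> * (P i x - P (i + 1) x) - \<nu>\<^sup>2 * q i x + deriv g (w i x) * P i x = Mw * (w i x - wad i x)"
      unfolding q_def using nu_pos by simp
    show "let U = {x \<in> {a<..<b}. cont_rep {a<..<b} (dx {a<..<b} (W i)) x \<noteq> 0} in
       open U \<and>
       (\<exists>q \<in> L2_loc U. weak_deriv U (dx {a<..<b} (P i)) q \<and>
          (AE x in lebesgue_on U.
             1 / \<tau> * (P i x - P (i + 1) x) - \<nu>\<^sup>2 * q x + deriv g (W i x) * P i x
             = Mw * (W i x - wad i x)))"
      unfolding Wi[OF i] Let_def U_def[symmetric] by (intro conjI bexI[of _ "q i"] l e)
  qed
  moreover have "P (n + 1) = (\<lambda>x. 0)" using Pn by simp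
  ultimately show ?thesis unfolding Om by blast
qed

end

text \<open>States take values in \<open>[- 1, 1]\<close>, so the nonlinearity may be continued with constant slope outside this
  interval; this makes its derivative bounded.\<close>

lemma extend_nonlinearity:
  fixes g :: "real \<Rightarrow> real"
  assumes C1: "Ck 1 g" and mono: "mono (\<lambda>r. g r + Cg * r)"
  obtains h h' M where "\<And>r. (h has_real_derivative h' r) (at r)" "continuous_on UNIV h'" "\<And>r. - Cg \<le> h' r" "\<And>r. h' r \<le> M"
    "\<And>r. \<bar>r\<bar> \<le> 1 \<Longrightarrow> h r = g r" "\<And>r. \<bar>r\<bar> \<le> 1 \<Longrightarrow> h' r = deriv g r"
proof -
  have gd: "(g has_real_derivative deriv g r) (at r)" for r
    using C1 by (auto simp: Ck_def DERIV_deriv_iff_real_differentiable)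
  have gc: "continuous_on UNIV (deriv g)" using C1 by (simp add: Ck_def)
  \<comment> \<open>The slope is frozen at the nearest point of \<open>[- 1, 1]\<close>.\<close>
  define h' where "h' r = deriv g (max (- 1) (min 1 r))" for r
  have h'c: "continuous_on UNIV h'" unfolding h'_def
    by (rule continuous_on_compose2[OF gc]) (auto intro!: continuous_intros)
  obtain F where F: "\<And>r. (F has_real_derivative h' r) (at r)" using continuous_primitive_exists[OF h'c] by blast
  define h where "h r = F r - F 0 + g 0" for r
  have h: "(h has_real_derivative h' r) (at r)" for r unfolding h_def by (auto intro!: derivative_eq_intros F)
  have h'in: "h' r = deriv g r" if "\<bar>r\<bar> \<le> 1" for r 
  proof -
    have "max (- 1) (min 1 r) = r" using that by linarith
    then show ?thesis by (simp add: h'_def)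
  qed
  have D: "((\<lambda>r. h r - g r) has_real_derivative h' r - deriv g r) (at r)" for r by (intro DERIV_diff h gd)
  have hin: "h r = g r" if r: "\<bar>r\<bar> \<le> 1" for r
  proof -
    have D0: "h 0 - g 0 = 0" by (simp add: h_def)
    consider "0 < r" | "r < 0" | "r = 0" by linarith
    then show ?thesis
    proof cases
      case 1
      obtain y where "0 < y" "y < r" "(h r - g r) - (h 0 - g 0) = (r - 0) * (h' y - deriv g y)" using MVT2[OF 1, of "\<lambda>r. h r - g r" "\<lambda>y. h' y - deriv g y"] D by blast
      then show ?thesis using h'in[of y] r D0 by simp
    next
      case 2
      obtain y where "r < y" "y < 0" "(h 0 - g 0) - (h r - g r) = (0 - r) * (h' y - deriv g y)" using MVT2[OF 2, of "\<lambda>r. h r - g r" "\<lambda>y. h' y - deriv g y"] D by blast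
      then show ?thesis using h'in[of y] r D0 by simp
    next
      case 3
      then show ?thesis using D0 by simp
    qed
  qed
  have lower: "- Cg \<le> deriv g r" for r
  proof -
    have "((\<lambda>r. g r + Cg * r) has_real_derivative deriv g r + Cg) (at r)"
      by (auto intro!: derivative_eq_intros gd)
    then have "0 \<le> deriv g r + Cg" using mono by (intro mono_on_imp_deriv_nonneg[of UNIV]) (auto simp: mono_on_def mono_def)
    then show ?thesis by simp
  qed
  have "bounded (deriv g ` {-1..1})" using continuous_on_subset[OF gc] by (intro compact_imp_bounded compact_continuous_image) auto
  then obtain M where M: "\<forall>r\<in>{-1..1}. \<bar>deriv g r\<bar> \<le> M" by (auto simp: bounded_iff)
  have "h' r \<le> M" for r
  proof -
    have "max (- 1) (min 1 r) \<in> {-1..1}" by auto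
    then show ?thesis using M unfolding h'_def by fastforce
  qed
  then show ?thesis using that[OF h h'c _ _ hin h'in] lower by (auto simp: h'_def)
qed

text \<open>
  The smallness of \<open>\<tau>\<close> is used in the form \<open>C\<^sub>g < 1 / \<tau>\<close>, which makes \<open>r / \<tau> + g r\<close> strictly increasing with
  slope bounded away from \<open>0\<close>.
\<close>

theorem theorem5:
  fixes L T \<tau> \<nu> Mu Mw Cg :: real
    and n :: nat
    and \<Omega> :: "real set"
    and f Khat K :: "real \<Rightarrow> real \<Rightarrow> real"
    and g G w0 :: "real \<Rightarrow> real"
    and wad :: "nat \<Rightarrow> real \<Rightarrow> real"
  assumes "0 < L" and "0 < T" and "\<Omega> = {-L<..<L}" and "1 \<le> n"
    and "0 < \<nu>" and "0 \<le> Mu" and "0 \<le> Mw"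
    and "\<forall>i\<in>{1..n}. wad i \<in> L2 \<Omega>"
    and "f_approximation f" and "K_approximation Khat K"
    and "Ck 1 g" and "0 < Cg" and "mono (\<lambda>r. g r + Cg * r)"
    and "Ck 2 G" and "\<forall>r. 0 \<le> G r" and "\<forall>r. (G has_real_derivative g r) (at r)"
    and "\<tau> = T / real n" and "\<tau> < 1 / (8 * (Cg + 1))"
    and "w0 \<in> H1 \<Omega>" and "AE x in lebesgue_on \<Omega>. \<bar>w0 x\<bar> \<le> 1"
  shows "\<exists>u w p :: nat \<Rightarrow> real \<Rightarrow> real. \<exists>\<zeta> :: nat \<Rightarrow> (real \<Rightarrow> real) \<Rightarrow> real.
    optimal_control \<Omega> n \<tau> \<nu> Mu Mw g wad w0 u \<and>
    state_solution \<Omega> n \<tau> \<nu> Mu g w0 u w \<and>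
    (\<forall>i\<in>{1..n}. w i \<in> H2 \<Omega>) \<and>
    (\<forall>i\<in>{1..n}. AE x in lebesgue_on \<Omega>. Mu * (p i x + u i x) = 0) \<and>
    (\<forall>i\<in>{1..n}. p i \<in> H1 \<Omega> \<and> continuous_on (closure \<Omega>) (p i)) \<and>
    (\<forall>i\<in>{1..n}. \<zeta> i \<in> H1_dual \<Omega>) \<and>
    p (n + 1) = (\<lambda>x. 0) \<and>
    (\<forall>i\<in>{1..n}. \<forall>\<phi>\<in>H1 \<Omega>.
       1 / \<tau> * ip_L2 \<Omega> (\<lambda>x. p i x - p (i + 1) x) \<phi>
       + \<nu>\<^sup>2 * duality_map \<Omega> (p i) \<phi> - \<nu>\<^sup>2 * ip_L2 \<Omega> (p i) \<phi>
       + ip_L2 \<Omega> (\<lambda>x. deriv g (w i x) * p i x) \<phi> + \<zeta> i \<phi>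
       = ip_L2 \<Omega> (\<lambda>x. Mw * (w i x - wad i x)) \<phi>) \<and>
    (\<forall>\<gamma>0. Ck 1 \<gamma>0 \<and> bounded (range \<gamma>0) \<and> bounded (range (deriv \<gamma>0)) \<and>
          \<gamma>0 0 = 0 \<and> deriv \<gamma>0 0 = 0 \<longrightarrow>
       (\<forall>i\<in>{1..n}.
          H1_multiplier \<Omega> (\<lambda>x. \<gamma>0 (dx \<Omega> (w i) x)) \<and>
          (\<exists>h. represented_by \<Omega> (times_dxx \<Omega> (\<lambda>x. \<gamma>0 (dx \<Omega> (w i) x)) (p i)) h \<and>
             (AE x in lebesgue_on \<Omega>.
                \<gamma>0 (dx \<Omega> (w i) x) *
                  (1 / \<tau> * (p i x - p (i + 1) x) + deriv g (w i x) * p i x - Mw * (w i x - wad i x))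
                - \<nu>\<^sup>2 * h x = 0)))) \<and>
    (\<forall>i\<in>{1..n}.
       let U = {x \<in> \<Omega>. cont_rep \<Omega> (dx \<Omega> (w i)) x \<noteq> 0} in
       open U \<and>
       (\<exists>q \<in> L2_loc U. weak_deriv U (dx \<Omega> (p i)) q \<and>
          (AE x in lebesgue_on U.
             1 / \<tau> * (p i x - p (i + 1) x) - \<nu>\<^sup>2 * q x + deriv g (w i x) * p i x
             = Mw * (w i x - wad i x))))"
proof -
  interpret seg: segment "-L" L by unfold_locales (use assms(1) in simp)
  note Om = \<open>\<Omega> = {-L<..<L}\<close> and C1 = \<open>Ck 1 g\<close> and mono = \<open>mono (\<lambda>r. g r + Cg * r)\<close>
  obtain gt gt' Mg where gt: "\<And>r. (gt has_real_derivative gt' r) (at r)" "continuous_on UNIV gt'" "\<And>r. - Cg \<le> gt' r" "\<And>r. gt' r \<le> Mg"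
    "\<And>r. \<bar>r\<bar> \<le> 1 \<Longrightarrow> gt r = g r" "\<And>r. \<bar>r\<bar> \<le> 1 \<Longrightarrow> gt' r = deriv g r"
    using extend_nonlinearity[OF C1 mono] by blast
  have tau: "0 < \<tau>" using \<open>\<tau> = T / real n\<close> \<open>0 < T\<close> \<open>1 \<le> n\<close> by simp
  have Cgt: "Cg < 1 / \<tau>"
  proof -
    have "\<tau> * (8 * (Cg + 1)) < 1" using \<open>\<tau> < 1 / (8 * (Cg + 1))\<close> \<open>0 < Cg\<close> by (simp add: pos_less_divide_eq)
    moreover have "\<tau> * Cg \<le> \<tau> * (8 * (Cg + 1))" using tau \<open>0 < Cg\<close> by (intro mult_left_mono) auto
    ultimately have "\<tau> * Cg < 1" by linarith
    then show ?thesis using tau by (simp add: pos_less_divide_eq mult.commute)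
  qed
  obtain W0 where W0: "seg.AC W0 (dx {-L<..<L} w0)" "AE x in lebesgue_on {-L<..<L}. w0 x = W0 x"
    using seg.H1_AC[of w0] \<open>w0 \<in> H1 \<Omega>\<close> unfolding Om by metis
  interpret tv: tv_evolution "-L" L "\<lambda>r. r / \<tau> + gt r" "\<lambda>r. 1 / \<tau> + gt' r" "1 / \<tau> - Cg" "1 / \<tau> + Mg" "1 / \<nu>\<^sup>2" \<tau> n W0 \<nu>
  proof unfold_locales
    show "((\<lambda>r. r / \<tau> + gt r) has_real_derivative 1 / \<tau> + gt' r) (at r)" for r
      by (rule DERIV_add[OF DERIV_cdivide[OF DERIV_ident] gt(1)])
    show "continuous_on UNIV (\<lambda>r. 1 / \<tau> + gt' r)" by (intro continuous_on_add continuous_on_const gt(2))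
    show "1 / \<tau> - Cg \<le> 1 / \<tau> + gt' r" for r using gt(3)[of r] by simp
    show "1 / \<tau> + gt' r \<le> 1 / \<tau> + Mg" for r using gt(4)[of r] by simp
    show "continuous_on {- L..L} W0" by (rule seg.AC_cont[OF W0(1)])
  qed (use tau Cgt \<open>0 < \<nu>\<close> in auto)
  have gc: "continuous_on UNIV g" "continuous_on UNIV (deriv g)"
    using C1 by (auto simp: Ck_def continuous_on_eq_continuous_at real_differentiable_def intro: DERIV_isCont)
  show ?thesis
    by (rule tv.necessary_conditions[OF \<open>0 \<le> Mu\<close> \<open>0 \<le> Mw\<close> _ gc _ _ W0(2) mono Cgt Om])
      (use gt(5,6) \<open>\<forall>i\<in>{1..n}. wad i \<in> L2 \<Omega>\<close> Om in auto)
qed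

end
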